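(* Let $1\le p<\infty$, let $Z=(Z,d,\mu)$ be a $p$-PI space and let $\Omega\subset Z$ be a measurable set with $\mu(\overline\Omega\setminus\Omega)=0$. Then the following properties hold. (1) If every $u\in W^{1,p}(\Omega)$ is the restriction of some $h\in W^{1,p}(\overline\Omega)$, then Lipschitz functions with bounded support are norm-dense in $W^{1,p}(\Omega)$. (2) If $\Omega$ is $p$-path almost open in $\overline\Omega$ and Lipschitz functions with bounded support are energy-dense in $W^{1,p}(\Omega)$, then every $u\in W^{1,p}(\Omega)$ is the restriction of some $h\in W^{1,p}(\overline\Omega)$ with $\|h\|_{W^{1,p}(\overline\Omega)}=\|u\|_{W^{1,p}(\Omega)}$.
   Context: Metric measure space: a triple $(Z,d,\mu)$ with $(Z,d)$ a separable metric space and $\mu$ a Borel regular outer measure with $0<\mu(B)<\infty$ for all open balls $B$. $\mu$ is doubling if there is $c_\mu>0$ with $\mu(2B)\le c_\mu\mu(B)$ for every open ball $B$. The following notions are used for $Z$ and for measurable subsets $\Omega$, $\overline\Omega$ with restricted distance and measure; write $X$ for the space. A path is a continuous $\gamma:[a,b]\to X$. For Borel $\rho:X\to[0,\infty]$, $\int_\gamma\rho\,ds$ is the usual integral with respect to the length measure of $\gamma$ if $\gamma$ is rectifiable, and $\infty$ otherwise. A family of paths $\Gamma$ in $X$ is $p$-negligible if there is an $L^p$-integrable Borel $\rho:X\to[0,\infty]$ with $\int_\gamma\rho\,ds=\infty$ for all $\gamma\in\Gamma$. A Borel $\rho:X\to[0,\infty]$ is a $p$-weak upper gradient of $u:X\to\mathbb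 R$ if $|u(\gamma(a))-u(\gamma(b))|\le\int_\gamma\rho\,ds$ for all paths $\gamma:[a,b]\to X$ outside a $p$-negligible family. $W^{1,p}(X)$ is the set of $u\in L^p(X)$ having a representative $\widetilde u$ that admits an $L^p$-integrable $p$-weak upper gradient. Among these there is an a.e.-smallest one; its class in $L^p(X)$ does not depend on $\widetilde u$ and is denoted $\rho_u$. The norm is $\|u\|_{W^{1,p}(X)}=\|u\|_{L^p(X)}+\|\rho_u\|_{L^p(X)}$. $p$-PI space: a complete metric measure space with $\mu$ doubling and supporting a weak $(1,p)$-Poincaré inequality: there are $C>0$, $\lambda\ge1$ such that $\frac1{\mu(B)}\int_B|u-u_B|\,d\mu\le C\operatorname{diam}(B)\big(\frac1{\mu(\lambda B)}\int_{\lambda B}\rho^p\,d\mu\big)^{1/p}$ for every ball $B$, every integrable $u:\lambda B\to\mathbb R$ and every $L^p$-integrable $p$-weak upper gradient $\rho:\lambda B\to[0,\infty]$ of $u$, where $u_B$ is the average of $u$ over $B$. A function has bounded support if $\{f\neq0\}$ is bounded. Lipschitz functions with bounded support are energy-dense in $W^{1,p}(\Omega)$ if for every $u\in W^{1,p}(\Omega)$ there are Lipschitz functions $u_n:\Omega\to\mathbb R$ with bounded support such that $\|u-u_n\|_{L^p(\Omega)}+\|\rho_u-\rho_{u_n}\|_{L^p(\Omega)}\to0$. $\Omega$ is $p$-path almost open in $\overline\Omega$ if, outside a $p$-negligible family of paths in $\overline\Omega$, every nonconstant rectifiable $\gamma:[a,b]\to\overline\Omega$ is such that $\gamma^{-1}(\Omega)$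 is a union of a (relatively) open subset of $[a,b]$ and a set negligible for the length measure of $\gamma$. *)

theory Defs
  imports "HOL-Analysis.Analysis"
begin

text \<open>
  The ambient space is a type. Separable metric spaces are the types of sort
  \<open>{metric_space, second_countable_topology}\<close>, complete separable ones those of sort
  \<open>polish_space\<close>. A subspace is a set \<open>X\<close>, and a function on \<open>X\<close> is a total function whose
  values outside \<open>X\<close> are never used.
\<close>

section \<open>Metric measure spaces\<close>

definition borel_regular_outer_measure :: "('a::topological_space set \<Rightarrow> ennreal) \<Rightarrow> bool" where
  "borel_regular_outer_measure \<mu> \<longleftrightarrow>
     outer_measure_space (Pow UNIV) \<mu> \<and>
     sets borel \<subseteq> lambda_system UNIV (Pow UNIV) \<mu> \<and>
     (\<forall>A. \<exists>B\<in>sets borel. A \<subseteq> B \<and> \<mu> B = \<mu> A)"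

definition metric_measure_space ::
    "('a::{metric_space, second_countable_topology} set \<Rightarrow> ennreal) \<Rightarrow> bool" where
  "metric_measure_space \<mu> \<longleftrightarrow>
     borel_regular_outer_measure \<mu> \<and> (\<forall>x. \<forall>r>0. 0 < \<mu> (ball x r) \<and> \<mu> (ball x r) < \<infinity>)"

text \<open>
  The complete measure given by \<open>\<mu>\<close> on its Caratheodory measurable sets; the measurable sets
  and functions of the theory are those of this measure.
\<close>
definition induced_measure :: "('a set \<Rightarrow> ennreal) \<Rightarrow> 'a measure" where
  "induced_measure \<mu> = measure_of UNIV (lambda_system UNIV (Pow UNIV) \<mu>) \<mu>"

lemma
  assumes "outer_measure_space (Pow UNIV) \<mu>"
  shows sets_induced_measure: "sets (induced_measure \<mu>) = lambda_system UNIV (Pow UNIV) \<mu>"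
    and emeasure_induced_measure:
      "A \<in> lambda_system UNIV (Pow UNIV) \<mu> \<Longrightarrow> emeasure (induced_measure \<mu>) A = \<mu> A"
proof -
  have ms: "measure_space UNIV (lambda_system UNIV (Pow UNIV) \<mu>) \<mu>"
    using sigma_algebra.caratheodory_lemma[OF sigma_algebra_Pow assms] .
  then interpret sigma_algebra UNIV "lambda_system UNIV (Pow UNIV) \<mu>"
    by (simp add: measure_space_def)
  show sets: "sets (induced_measure \<mu>) = lambda_system UNIV (Pow UNIV) \<mu>"
    by (simp add: induced_measure_def sets_measure_of_eq sigma_sets_eq del: Pow_UNIV)
  show "emeasure (induced_measure \<mu>) A = \<mu> A" if "A \<in> lambda_system UNIV (Pow UNIV) \<mu>"
    using ms that sets
    by (intro emeasure_measure_of[OF induced_measure_def]) (auto simp: measure_space_def simp del: Pow_UNIV)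
qed

definition doubling :: "('a::metric_space set \<Rightarrow> ennreal) \<Rightarrow> bool" where
  "doubling \<mu> \<longleftrightarrow> (\<exists>c::real>0. \<forall>x. \<forall>r>0. \<mu> (ball x (2 * r)) \<le> ennreal c * \<mu> (ball x r))"


section \<open>\<open>L\<^sup>p\<close> spaces\<close>

text \<open>Real powers on \<open>[0,\<infinity>]\<close>, used for positive exponents only.\<close>
definition epowr :: "ennreal \<Rightarrow> real \<Rightarrow> ennreal" where
  "epowr x a = (if x = \<infinity> then \<infinity> else ennreal (enn2real x powr a))"

definition Lp_norm ::
    "real \<Rightarrow> ('a set \<Rightarrow> ennreal) \<Rightarrow> 'a set \<Rightarrow> ('a \<Rightarrow> real) \<Rightarrow> ennreal" where
  "Lp_norm p \<mu> X u = epowr (\<integral>\<^sup>+x\<in>X. ennreal (\<bar>u x\<bar> powr p) \<partial>induced_measure \<mu>) (1 / p)"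

definition Lp_space ::
    "real \<Rightarrow> ('a set \<Rightarrow> ennreal) \<Rightarrow> 'a set \<Rightarrow> ('a \<Rightarrow> real) set" where
  "Lp_space p \<mu> X =
     {u \<in> borel_measurable (restrict_space (induced_measure \<mu>) X). Lp_norm p \<mu> X u < \<infinity>}"

definition Lp_integrable_borel ::
    "real \<Rightarrow> ('a::topological_space set \<Rightarrow> ennreal) \<Rightarrow> 'a set \<Rightarrow> ('a \<Rightarrow> ennreal) \<Rightarrow> bool" where
  "Lp_integrable_borel p \<mu> X \<rho> \<longleftrightarrow>
     \<rho> \<in> borel_measurable (restrict_space borel X) \<and>
     (\<integral>\<^sup>+x\<in>X. epowr (\<rho> x) p \<partial>induced_measure \<mu>) < \<infinity>"


section \<open>Paths and path integrals\<close>

text \<open>A path \<open>\<gamma> : [a,b] \<rightarrow> X\<close> is encoded as the triple \<open>(a, b, \<gamma>)\<close>.\<close>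
type_synonym 'a parampath = "real \<times> real \<times> (real \<Rightarrow> 'a)"

definition paths_in :: "'a::topological_space set \<Rightarrow> 'a parampath set" where
  "paths_in X = {(a, b, \<gamma>). a \<le> b \<and> continuous_on {a..b} \<gamma> \<and> \<gamma> ` {a..b} \<subseteq> X}"

definition curve_length :: "real \<Rightarrow> real \<Rightarrow> (real \<Rightarrow> 'a::metric_space) \<Rightarrow> ennreal" where
  "curve_length a b \<gamma> =
     (SUP (n, t) \<in> {(n::nat, t::nat \<Rightarrow> real). mono_on {..n} t \<and> t ` {..n} \<subseteq> {a..b}}.
        \<Sum>i<n. ennreal (dist (\<gamma> (t i)) (\<gamma> (t (Suc i)))))"

definition rectifiable :: "real \<Rightarrow> real \<Rightarrow> (real \<Rightarrow> 'a::metric_space) \<Rightarrow> bool" where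
  "rectifiable a b \<gamma> \<longleftrightarrow> curve_length a b \<gamma> < \<infinity>"

text \<open>
  The length measure of a rectifiable path: the Stieltjes measure on the line of the length
  function \<open>t \<mapsto> length (\<gamma>|[a,t])\<close>, extended to be constant outside \<open>[a,b]\<close>.
\<close>
definition length_measure :: "real \<Rightarrow> real \<Rightarrow> (real \<Rightarrow> 'a::metric_space) \<Rightarrow> real measure" where
  "length_measure a b \<gamma> =
     interval_measure (\<lambda>t. enn2real (curve_length a (max a (min b t)) \<gamma>))"

definition path_int ::
    "('a::metric_space \<Rightarrow> ennreal) \<Rightarrow> real \<Rightarrow> real \<Rightarrow> (real \<Rightarrow> 'a) \<Rightarrow> ennreal" where
  "path_int \<rho> a b \<gamma> =
     (if rectifiable a b \<gamma> then \<integral>\<^sup>+t\<in>{a..b}. \<rho> (\<gamma> t) \<partial>length_measure a b \<gamma> else \<infinity>)"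

definition negligible_paths ::
    "real \<Rightarrow> ('a::metric_space set \<Rightarrow> ennreal) \<Rightarrow> 'a set \<Rightarrow> 'a parampath set \<Rightarrow> bool" where
  "negligible_paths p \<mu> X \<Gamma> \<longleftrightarrow>
     \<Gamma> \<subseteq> paths_in X \<and>
     (\<exists>\<rho>. Lp_integrable_borel p \<mu> X \<rho> \<and> (\<forall>(a, b, \<gamma>)\<in>\<Gamma>. path_int \<rho> a b \<gamma> = \<infinity>))"


section \<open>Weak upper gradients and Sobolev spaces\<close>

definition weak_upper_gradient ::
    "real \<Rightarrow> ('a::metric_space set \<Rightarrow> ennreal) \<Rightarrow> 'a set \<Rightarrow> ('a \<Rightarrow> real) \<Rightarrow> ('a \<Rightarrow> ennreal) \<Rightarrow> bool"
  where
  "weak_upper_gradient p \<mu> X u \<rho> \<longleftrightarrow>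
     \<rho> \<in> borel_measurable (restrict_space borel X) \<and>
     (\<exists>\<Gamma>. negligible_paths p \<mu> X \<Gamma> \<and>
        (\<forall>(a, b, \<gamma>) \<in> paths_in X - \<Gamma>.
           ennreal \<bar>u (\<gamma> a) - u (\<gamma> b)\<bar> \<le> path_int \<rho> a b \<gamma>))"

definition Lp_weak_upper_gradient ::
    "real \<Rightarrow> ('a::metric_space set \<Rightarrow> ennreal) \<Rightarrow> 'a set \<Rightarrow> ('a \<Rightarrow> real) \<Rightarrow> ('a \<Rightarrow> ennreal) \<Rightarrow> bool"
  where
  "Lp_weak_upper_gradient p \<mu> X u \<rho> \<longleftrightarrow>
     weak_upper_gradient p \<mu> X u \<rho> \<and> Lp_integrable_borel p \<mu> X \<rho>"

definition representative ::
    "('a set \<Rightarrow> ennreal) \<Rightarrow> 'a set \<Rightarrow> ('a \<Rightarrow> real) \<Rightarrow> ('a \<Rightarrow> real) \<Rightarrow> bool" where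
  "representative \<mu> X u v \<longleftrightarrow> (AE x\<in>X in induced_measure \<mu>. v x = u x)"

text \<open>
  Elements of \<open>W\<^sup>1\<^sup>,\<^sup>p\<close> are classes of functions modulo a.e. equality; here they are given by
  arbitrary representatives, so the set below is closed under a.e. equality on \<open>X\<close>.
\<close>
definition sobolev ::
    "real \<Rightarrow> ('a::metric_space set \<Rightarrow> ennreal) \<Rightarrow> 'a set \<Rightarrow> ('a \<Rightarrow> real) set" where
  "sobolev p \<mu> X =
     {u \<in> Lp_space p \<mu> X. \<exists>v \<rho>. representative \<mu> X u v \<and> Lp_weak_upper_gradient p \<mu> X v \<rho>}"

definition least_weak_upper_gradient ::
    "real \<Rightarrow> ('a::metric_space set \<Rightarrow> ennreal) \<Rightarrow> 'a set \<Rightarrow> ('a \<Rightarrow> real) \<Rightarrow> ('a \<Rightarrow> ennreal) \<Rightarrow> bool"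
  where
  "least_weak_upper_gradient p \<mu> X v g \<longleftrightarrow>
     Lp_weak_upper_gradient p \<mu> X v g \<and>
     (\<forall>\<rho>. Lp_weak_upper_gradient p \<mu> X v \<rho> \<longrightarrow> (AE x\<in>X in induced_measure \<mu>. g x \<le> \<rho> x))"

text \<open>
  \<open>\<rho>\<^sub>u\<close>, as a real-valued element of \<open>L\<^sup>p(X)\<close>: the chosen extended-valued Borel function is
  finite a.e., and its class depends neither on the representative of \<open>u\<close> nor on the choice.
\<close>
definition min_weak_upper_gradient ::
    "real \<Rightarrow> ('a::metric_space set \<Rightarrow> ennreal) \<Rightarrow> 'a set \<Rightarrow> ('a \<Rightarrow> real) \<Rightarrow> 'a \<Rightarrow> real" where
  "min_weak_upper_gradient p \<mu> X u =
     (let g = (SOME g. \<exists>v. representative \<mu> X u v \<and> least_weak_upper_gradient p \<mu> X v g)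
      in (\<lambda>x. enn2real (g x)))"

definition sobolev_norm ::
    "real \<Rightarrow> ('a::metric_space set \<Rightarrow> ennreal) \<Rightarrow> 'a set \<Rightarrow> ('a \<Rightarrow> real) \<Rightarrow> ennreal" where
  "sobolev_norm p \<mu> X u = Lp_norm p \<mu> X u + Lp_norm p \<mu> X (min_weak_upper_gradient p \<mu> X u)"


section \<open>PI spaces\<close>

definition weak_poincare ::
    "real \<Rightarrow> ('a::metric_space set \<Rightarrow> ennreal) \<Rightarrow> bool" where
  "weak_poincare p \<mu> \<longleftrightarrow>
     (\<exists>(C::real) (l::real). C > 0 \<and> l \<ge> 1 \<and>
       (\<forall>x r u \<rho>. r > 0 \<longrightarrow>
          set_integrable (induced_measure \<mu>) (ball x (l * r)) u \<longrightarrow>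
          Lp_weak_upper_gradient p \<mu> (ball x (l * r)) u \<rho> \<longrightarrow>
          (let M = induced_measure \<mu>; B = ball x r; B' = ball x (l * r);
               uB = (LINT y:B|M. u y) / measure M B
           in (\<integral>\<^sup>+y\<in>B. ennreal \<bar>u y - uB\<bar> \<partial>M) / emeasure M B
                \<le> ennreal (C * diameter B) *
                   epowr ((\<integral>\<^sup>+y\<in>B'. epowr (\<rho> y) p \<partial>M) / emeasure M B') (1 / p))))"

definition PI_space :: "real \<Rightarrow> ('a::polish_space set \<Rightarrow> ennreal) \<Rightarrow> bool" where
  "PI_space p \<mu> \<longleftrightarrow> metric_measure_space \<mu> \<and> doubling \<mu> \<and> weak_poincare p \<mu>"


section \<open>Density, extension and path openness\<close>

definition lipschitz_bounded_support :: "'a::metric_space set \<Rightarrow> ('a \<Rightarrow> real) set" where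
  "lipschitz_bounded_support X = {u. (\<exists>L. L-lipschitz_on X u) \<and> bounded {x\<in>X. u x \<noteq> 0}}"

definition lipschitz_norm_dense ::
    "real \<Rightarrow> ('a::metric_space set \<Rightarrow> ennreal) \<Rightarrow> 'a set \<Rightarrow> bool" where
  "lipschitz_norm_dense p \<mu> X \<longleftrightarrow>
     (\<forall>u\<in>sobolev p \<mu> X. \<exists>v::nat \<Rightarrow> 'a \<Rightarrow> real.
        (\<forall>n. v n \<in> lipschitz_bounded_support X) \<and>
        (\<lambda>n. sobolev_norm p \<mu> X (\<lambda>x. u x - v n x)) \<longlonglongrightarrow> 0)"

definition lipschitz_energy_dense ::
    "real \<Rightarrow> ('a::metric_space set \<Rightarrow> ennreal) \<Rightarrow> 'a set \<Rightarrow> bool" where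
  "lipschitz_energy_dense p \<mu> X \<longleftrightarrow>
     (\<forall>u\<in>sobolev p \<mu> X. \<exists>v::nat \<Rightarrow> 'a \<Rightarrow> real.
        (\<forall>n. v n \<in> lipschitz_bounded_support X) \<and>
        (\<lambda>n. Lp_norm p \<mu> X (\<lambda>x. u x - v n x) +
              Lp_norm p \<mu> X (\<lambda>x. min_weak_upper_gradient p \<mu> X u x -
                                  min_weak_upper_gradient p \<mu> X (v n) x)) \<longlonglongrightarrow> 0)"

text \<open>\<open>u = h|\<^sub>X\<close> as elements of \<open>L\<^sup>p(X)\<close>, that is, modulo a.e. equality.\<close>
definition is_restriction ::
    "('a set \<Rightarrow> ennreal) \<Rightarrow> 'a set \<Rightarrow> ('a \<Rightarrow> real) \<Rightarrow> ('a \<Rightarrow> real) \<Rightarrow> bool" where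
  "is_restriction \<mu> X u h \<longleftrightarrow> (AE x\<in>X in induced_measure \<mu>. u x = h x)"

definition path_almost_open ::
    "real \<Rightarrow> ('a::metric_space set \<Rightarrow> ennreal) \<Rightarrow> 'a set \<Rightarrow> 'a set \<Rightarrow> bool" where
  "path_almost_open p \<mu> \<Omega> X \<longleftrightarrow>
     (\<exists>\<Gamma>. negligible_paths p \<mu> X \<Gamma> \<and>
        (\<forall>(a, b, \<gamma>) \<in> paths_in X - \<Gamma>.
           \<not> \<gamma> constant_on {a..b} \<longrightarrow> rectifiable a b \<gamma> \<longrightarrow>
           (\<exists>U N. openin (top_of_set {a..b}) U \<and>
                  N \<in> null_sets (completion (length_measure a b \<gamma>)) \<and>
                  {t\<in>{a..b}. \<gamma> t \<in> \<Omega>} = U \<union> N)))"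

end

theory Submission
  imports Defs
begin

text \<open>
  The Poincare inequality is not needed. For (2), a typical path in \<open>closure \<Omega>\<close> meets
  \<open>\<Omega>\<close>, up to a set of length zero, in a relatively open set of parameters. Hence a weak upper
  gradient on \<open>\<Omega>\<close> of a Lipschitz function on \<open>closure \<Omega>\<close> is, extended by \<open>0\<close>, a weak upper
  gradient on \<open>closure \<Omega>\<close>, and energy convergence of Lipschitz functions transfers to the closure.

  For (1), let \<open>X = closure \<Omega>\<close>, a closed subset of a proper space. A nonnegative Sobolev function
  on \<open>X\<close> is approximated in \<open>L\<^sup>p\<close> by Lipschitz functions: minimize, over discrete chains ending in
  \<open>x\<close>, the value of a lower semicontinuous majorant at the start plus the cost of the chain with
  respect to a regularized lower semicontinuous upper gradient. Compactness turns cheap chains into paths,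
  so that the minima converge. The local Lipschitz constants of the approximants
  have a common \<open>p\<close>-integrable bound \<open>G\<close>. Strong convergence of the gradients of suitable convex
  combinations is obtained from a quadratic energy, a limit of discrete energies on nets
  weighted so that \<open>G\<^sup>2\<close> is integrable: almost minimizers of this energy form a Cauchy sequence, the energy of the
  difference of two of them yields a small upper gradient, and domination by \<open>G\<close> turns smallness
  in the weighted \<open>L\<^sup>2\<close> into smallness in \<open>L\<^sup>p\<close>. The limit on \<open>X\<close> restricts to \<open>\<Omega>\<close>.
\<close>

section \<open>Length of curves\<close>

text \<open>For p = 1 the space L^p is not reflexive, so convex combinations with norm convergent
  gradients cannot come from weak compactness; moreover, convergence of the minimal gradients
  themselves would not make the gradient of a difference small. Both difficulties are met by an
  energy that is an exact quadratic form in the function: its parallelogram identity bounds the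
  energy of a difference and survives passage to limits of discrete energies. \<open>G\<close> is
  merely p-integrable, which forces the weight.

  The compactness of chains needs a closed set and an upper gradient inequality along every path.
  The first is why (1) is proved on the closure; the second is obtained by adding to the gradient a
  p-integrable function whose integral over each exceptional path is infinite.

  In (2) the minimal gradients satisfy rho_v <= rho_u + |rho_u - rho_v|, so the zero extension of
  rho_u itself is a weak upper gradient of the limit; this gives equality of the norms.\<close>

lemma curve_length_upper:
  assumes "mono_on {..n} t" "t ` {..n} \<subseteq> {a..b}"
  shows "(\<Sum>i<n. ennreal (dist (\<gamma> (t i)) (\<gamma> (t (Suc i))))) \<le> curve_length a b \<gamma>"
  unfolding curve_length_def using assms
  by (intro SUP_upper2[of "(n, t)"]) auto

lemma curve_length_least:
  assumes "\<And>n t. mono_on {..n} t \<Longrightarrow> t ` {..n} \<subseteq> {a..b} \<Longrightarrow>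
      (\<Sum>i<n. ennreal (dist (\<gamma> (t i)) (\<gamma> (t (Suc i))))) \<le> c"
  shows "curve_length a b \<gamma> \<le> c"
  unfolding curve_length_def using assms by (intro SUP_least) auto

lemma curve_length_dist:
  assumes "a \<le> s" "s \<le> t" "t \<le> b"
  shows "ennreal (dist (\<gamma> s) (\<gamma> t)) \<le> curve_length a b \<gamma>"
proof -
  have "(\<Sum>i<1. ennreal (dist (\<gamma> ((\<lambda>i::nat. if i = 0 then s else t) i)) (\<gamma> ((\<lambda>i::nat. if i = 0 then s else t) (Suc i)))))
    \<le> curve_length a b \<gamma>"
    by (rule curve_length_upper) (use assms in \<open>auto simp: mono_on_def\<close>)
  then show ?thesis by simp
qed

lemma curve_length_subinterval:
  assumes "a \<le> c" "d \<le> b"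
  shows "curve_length c d \<gamma> \<le> curve_length a b \<gamma>"
proof (rule curve_length_least)
  fix n :: nat and t :: "nat \<Rightarrow> real"
  assume "mono_on {..n} t" "t ` {..n} \<subseteq> {c..d}"
  then show "(\<Sum>i<n. ennreal (dist (\<gamma> (t i)) (\<gamma> (t (Suc i))))) \<le> curve_length a b \<gamma>"
    using assms by (intro curve_length_upper) force+
qed

lemma curve_length_degenerate: "curve_length a a \<gamma> = 0"
proof -
  have "curve_length a a \<gamma> \<le> 0"
  proof (rule curve_length_least)
    fix n :: nat and t :: "nat \<Rightarrow> real"
    assume *: "t ` {..n} \<subseteq> {a..a}"
    have "t i = a" if "i \<le> n" for i using * that by (auto simp: image_subset_iff)
    then show "(\<Sum>i<n. ennreal (dist (\<gamma> (t i)) (\<gamma> (t (Suc i))))) \<le> 0" by simp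
  qed
  then show ?thesis by simp
qed

text \<open>Clamping keeps the number of points, and the repeated points contribute zero distances.
  It restricts a partition to a subinterval without inserting the cut point, and along a continuous
  curve the clamped sums depend continuously on the cut.\<close>

lemma clamp_partition:
  fixes t :: "nat \<Rightarrow> real"
  assumes "mono_on {..n} t" "t ` {..n} \<subseteq> {a..b}"
  shows "mono_on {..n} (\<lambda>i. min (t i) c)" "mono_on {..n} (\<lambda>i. max (t i) c)"
    and "a \<le> c \<Longrightarrow> (\<lambda>i. min (t i) c) ` {..n} \<subseteq> {a..c}" "c \<le> b \<Longrightarrow> (\<lambda>i. max (t i) c) ` {..n} \<subseteq> {c..b}"
proof -
  show "mono_on {..n} (\<lambda>i. min (t i) c)"
    by (intro mono_onI min.mono mono_onD[OF assms(1)]) auto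
  show "mono_on {..n} (\<lambda>i. max (t i) c)"
    by (intro mono_onI max.mono mono_onD[OF assms(1)]) auto
qed (use assms(2) in \<open>auto simp: image_subset_iff\<close>)

lemma curve_length_split:
  assumes "a \<le> c" "c \<le> b"
  shows "curve_length a b \<gamma> = curve_length a c \<gamma> + curve_length c b \<gamma>"
proof (rule antisym)
  show "curve_length a b \<gamma> \<le> curve_length a c \<gamma> + curve_length c b \<gamma>"
  proof (rule curve_length_least)
    fix n :: nat and t :: "nat \<Rightarrow> real"
    assume t: "mono_on {..n} t" "t ` {..n} \<subseteq> {a..b}"
    let ?l = "\<lambda>i. min (t i) c" and ?r = "\<lambda>i. max (t i) c"
    have tm: "t i \<le> t (Suc i)" if "i < n" for i using t(1) that by (auto simp: mono_on_def)
    have "(\<Sum>i<n. ennreal (dist (\<gamma> (t i)) (\<gamma> (t (Suc i)))))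
      \<le> (\<Sum>i<n. ennreal (dist (\<gamma> (?l i)) (\<gamma> (?l (Suc i)))) + ennreal (dist (\<gamma> (?r i)) (\<gamma> (?r (Suc i)))))"
    proof (rule sum_mono)
      fix i assume "i \<in> {..<n}"
      then have "t i \<le> t (Suc i)" using tm by auto
      then show "ennreal (dist (\<gamma> (t i)) (\<gamma> (t (Suc i)))) \<le>
        ennreal (dist (\<gamma> (?l i)) (\<gamma> (?l (Suc i)))) + ennreal (dist (\<gamma> (?r i)) (\<gamma> (?r (Suc i))))"
        by (auto simp: min_def max_def ennreal_plus[symmetric] dist_triangle simp del: ennreal_plus intro!: ennreal_leI)
    qed
    also have "\<dots> = (\<Sum>i<n. ennreal (dist (\<gamma> (?l i)) (\<gamma> (?l (Suc i))))) +
        (\<Sum>i<n. ennreal (dist (\<gamma> (?r i)) (\<gamma> (?r (Suc i)))))"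
      by (rule sum.distrib)
    also have "\<dots> \<le> curve_length a c \<gamma> + curve_length c b \<gamma>"
    proof (rule add_mono)
      show "(\<Sum>i<n. ennreal (dist (\<gamma> (?l i)) (\<gamma> (?l (Suc i))))) \<le> curve_length a c \<gamma>"
        using clamp_partition[OF t] assms by (intro curve_length_upper)
      show "(\<Sum>i<n. ennreal (dist (\<gamma> (?r i)) (\<gamma> (?r (Suc i))))) \<le> curve_length c b \<gamma>"
        using clamp_partition[OF t] assms by (intro curve_length_upper)
    qed
    finally show "(\<Sum>i<n. ennreal (dist (\<gamma> (t i)) (\<gamma> (t (Suc i))))) \<le> curve_length a c \<gamma> + curve_length c b \<gamma>" .
  qed
  have *: "(\<Sum>i<n. ennreal (dist (\<gamma> (t i)) (\<gamma> (t (Suc i))))) + (\<Sum>i<m. ennreal (dist (\<gamma> (s i)) (\<gamma> (s (Suc i)))))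
      \<le> curve_length a b \<gamma>"
    if t: "mono_on {..n} t" "t ` {..n} \<subseteq> {a..c}" and s: "mono_on {..m} s" "s ` {..m} \<subseteq> {c..b}" for n m t s
  proof -
    \<comment> \<open>The partitions are concatenated; the joint from \<open>t n\<close> to
      \<open>s 0\<close> sits at index \<open>n\<close>, and its nonnegative term is dropped, hence
      the index sets \<open>{..<n}\<close> and \<open>{Suc n..<Suc n + m}\<close>.\<close>
    let ?u = "\<lambda>i. if i \<le> n then t i else s (i - Suc n)"
    let ?d = "\<lambda>i. ennreal (dist (\<gamma> (?u i)) (\<gamma> (?u (Suc i))))"
    have le: "t i \<le> c" "a \<le> t i" if "i \<le> n" for i using t(2) that by (auto simp: image_subset_iff)
    have ge: "c \<le> s i" "s i \<le> b" if "i \<le> m" for i using s(2) that by (auto simp: image_subset_iff)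
    have "(\<Sum>i<n. ennreal (dist (\<gamma> (t i)) (\<gamma> (t (Suc i))))) = (\<Sum>i<n. ?d i)"
      by (intro sum.cong) auto
    moreover have "(\<Sum>i<m. ennreal (dist (\<gamma> (s i)) (\<gamma> (s (Suc i))))) = (\<Sum>i\<in>{Suc n..<Suc n + m}. ?d i)"
      by (rule sum.reindex_bij_witness[of _ "\<lambda>i. i - Suc n" "\<lambda>i. i + Suc n"]) (auto simp: Suc_diff_le)
    moreover have "(\<Sum>i<n. ?d i) + (\<Sum>i\<in>{Suc n..<Suc n + m}. ?d i) = (\<Sum>i\<in>{..<n} \<union> {Suc n..<Suc n + m}. ?d i)"
      by (rule sum.union_disjoint[symmetric]) auto
    moreover have "\<dots> \<le> (\<Sum>i<Suc n + m. ?d i)"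
      by (rule sum_mono2) auto
    moreover have "\<dots> \<le> curve_length a b \<gamma>"
    proof (rule curve_length_upper)
      show "mono_on {..Suc n + m} ?u"
      proof (rule mono_onI)
        fix i j assume ij: "i \<in> {..Suc n + m}" "j \<in> {..Suc n + m}" "i \<le> j"
        consider "j \<le> n" | "i \<le> n" "j > n" | "i > n" by linarith
        then show "?u i \<le> ?u j"
        proof cases
          case 1 then show ?thesis using ij t(1) by (auto simp: mono_on_def)
        next
          case 2
          then have "t i \<le> c" "c \<le> s (j - Suc n)" using le(1)[of i] ge(1)[of "j - Suc n"] ij by auto
          then show ?thesis using 2 by auto
        next
          case 3
          then have "s (i - Suc n) \<le> s (j - Suc n)"
            using ij by (intro mono_onD[OF s(1)]) auto
          then show ?thesis using 3 ij by auto
        qed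
      qed
      show "?u ` {..Suc n + m} \<subseteq> {a..b}"
      proof safe
        fix i assume "i \<le> Suc n + m"
        moreover have "i - Suc n \<le> m" if "\<not> i \<le> n" using \<open>i \<le> Suc n + m\<close> that by linarith
        ultimately show "?u i \<in> {a..b}"
          using le[of i] ge[of "i - Suc n"] assms by (cases "i \<le> n") force+
      qed
    qed
    ultimately show ?thesis by (simp only:)
  qed
  let ?I = "\<lambda>a b. {(n::nat, t::nat \<Rightarrow> real). mono_on {..n} t \<and> t ` {..n} \<subseteq> {a..b}}"
  let ?S = "\<lambda>(n, t). \<Sum>i<n. ennreal (dist (\<gamma> (t i)) (\<gamma> (t (Suc i))))"
  have ne: "?I a c \<noteq> {}" "?I c b \<noteq> {}" using assms
    by (auto intro!: exI[of _ 0] exI[of _ "\<lambda>_. c"] simp: mono_on_def)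
  have "curve_length a c \<gamma> + ?S y \<le> curve_length a b \<gamma>" if y: "y \<in> ?I c b" for y
  proof -
    have "curve_length a c \<gamma> + ?S y = (SUP x\<in>?I a c. ?S x + ?S y)"
      unfolding curve_length_def using ne by (intro ennreal_SUP_add_left[symmetric])
    also have "\<dots> \<le> curve_length a b \<gamma>"
      using y * by (intro SUP_least) auto
    finally show ?thesis .
  qed
  then have "(SUP y\<in>?I c b. curve_length a c \<gamma> + ?S y) \<le> curve_length a b \<gamma>"
    by (intro SUP_least)
  also have "(SUP y\<in>?I c b. curve_length a c \<gamma> + ?S y) = curve_length a c \<gamma> + curve_length c b \<gamma>"
    using ennreal_SUP_add_left[OF ne(2), of ?S "curve_length a c \<gamma>"]
    by (simp add: curve_length_def[of c b] add.commute)
  finally show "curve_length a c \<gamma> + curve_length c b \<gamma> \<le> curve_length a b \<gamma>" .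
qed

section \<open>Length function and length measure of a rectifiable path\<close>

locale rectifiable_path =
  fixes a b :: real and \<gamma> :: "real \<Rightarrow> 'a::metric_space"
  assumes le: "a \<le> b" and cont: "continuous_on {a..b} \<gamma>" and rect: "rectifiable a b \<gamma>"
begin

abbreviation len :: "real \<Rightarrow> real \<Rightarrow> real" where
  "len s t \<equiv> enn2real (curve_length s t \<gamma>)"

lemma subpath: "a \<le> s \<Longrightarrow> s \<le> t \<Longrightarrow> t \<le> b \<Longrightarrow> rectifiable_path s t \<gamma>"
  using cont rect curve_length_subinterval[of a s t b \<gamma>]
  by unfold_locales (auto intro: continuous_on_subset simp: rectifiable_def)

lemma ennreal_len: "a \<le> s \<Longrightarrow> t \<le> b \<Longrightarrow> ennreal (len s t) = curve_length s t \<gamma>"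
  using rect curve_length_subinterval[of a s t b \<gamma>] by (auto simp: rectifiable_def)

lemma len_split: "a \<le> r \<Longrightarrow> r \<le> s \<Longrightarrow> s \<le> t \<Longrightarrow> t \<le> b \<Longrightarrow> len r t = len r s + len s t"
  using curve_length_split[of r s t \<gamma>] rect curve_length_subinterval[of a r s b \<gamma>]
    curve_length_subinterval[of a s t b \<gamma>]
  by (auto simp: rectifiable_def enn2real_plus)

lemma len_nonneg: "0 \<le> len s t" by simp

lemma dist_le_len: "a \<le> s \<Longrightarrow> s \<le> t \<Longrightarrow> t \<le> b \<Longrightarrow> dist (\<gamma> s) (\<gamma> t) \<le> len s t"
  using curve_length_dist[of s s t t \<gamma>] ennreal_len[of s t]
  by (metis ennreal_le_iff enn2real_nonneg order_refl)

lemma approx_sum: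
  assumes "a \<le> s" "s \<le> t" "t \<le> b" "e > 0"
  shows "\<exists>(n::nat) u. mono_on {..n} u \<and> u ` {..n} \<subseteq> {s..t} \<and>
    len s t - e < (\<Sum>i<n. dist (\<gamma> (u i)) (\<gamma> (u (Suc i))))"
proof (rule ccontr)
  assume neg: "\<not> ?thesis"
  have *: "(\<Sum>i<n. dist (\<gamma> (u i)) (\<gamma> (u (Suc i)))) \<le> len s t - e"
    if u: "mono_on {..n} u" "u ` {..n} \<subseteq> {s..t}" for n and u :: "nat \<Rightarrow> real"
    using u neg by (meson not_le)
  have "curve_length s t \<gamma> \<le> ennreal (len s t - e)"
    by (rule curve_length_least) (auto simp: sum_ennreal intro!: ennreal_leI *)
  then have "ennreal (len s t) \<le> ennreal (len s t - e)"
    using ennreal_len assms by simp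
  moreover have "0 \<le> len s t - e"
    using *[of 0 "\<lambda>_. s"] assms by (auto simp: mono_on_def)
  ultimately show False using \<open>e > 0\<close> by (simp add: ennreal_le_iff)
qed

lemma sum_le_len:
  assumes "a \<le> s" "t \<le> b" "mono_on {..n} u" "u ` {..n} \<subseteq> {s..t}"
  shows "(\<Sum>i<n. dist (\<gamma> (u i)) (\<gamma> (u (Suc i)))) \<le> len s t"
  using curve_length_upper[OF assms(3,4), of \<gamma>] ennreal_len[of s t] assms(1,2)
  by (metis (mono_tags, lifting) enn2real_nonneg ennreal_le_iff sum_ennreal zero_le_dist sum.cong)

text \<open>Both \<open>len a r\<close> and \<open>len r b\<close> are suprema of continuous functions of \<open>r\<close> (clamp the
  partition points), hence lower semicontinuous; as their sum is constant they are continuous.\<close>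

lemma continuous_on_len: "continuous_on {a..b} (len a)"
proof -
  have ctn: "continuous_on {a..b} (\<lambda>r. \<Sum>i<n. dist (\<gamma> (m (u i) r)) (\<gamma> (m (u (Suc i)) r)))"
    if "m = min \<or> m = max" "u ` {..n} \<subseteq> {a..b}" for n m and u :: "nat \<Rightarrow> real"
  proof -
    have "continuous_on {a..b} (\<lambda>r. \<gamma> (m (u i) r))" if "i \<le> n" for i
    proof -
      have "u i \<in> {a..b}" using \<open>u ` {..n} \<subseteq> {a..b}\<close> that by auto
      then have "continuous_on {a..b} (m (u i))" "m (u i) ` {a..b} \<subseteq> {a..b}"
        using \<open>m = min \<or> m = max\<close> by (auto intro!: continuous_intros)
      then show ?thesis using continuous_on_compose2[OF cont] by blast
    qed
    then show ?thesis by (intro continuous_intros) auto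
  qed
  have lower: "\<forall>\<^sub>F r in at r0 within {a..b}. len a r0 - e < len a r"
    if r0: "r0 \<in> {a..b}" and "e > 0" for r0 e
  proof -
    obtain n u where u: "mono_on {..n} u" "u ` {..n} \<subseteq> {a..r0}"
      "len a r0 - e < (\<Sum>i<n. dist (\<gamma> (u i)) (\<gamma> (u (Suc i))))"
      using approx_sum[of a r0 e] r0 \<open>e > 0\<close> by auto
    let ?f = "\<lambda>r. \<Sum>i<n. dist (\<gamma> (min (u i) r)) (\<gamma> (min (u (Suc i)) r))"
    have "?f r0 = (\<Sum>i<n. dist (\<gamma> (u i)) (\<gamma> (u (Suc i))))"
      using u(2) by (intro sum.cong) (auto simp: image_subset_iff)
    moreover have "(?f \<longlongrightarrow> ?f r0) (at r0 within {a..b})"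
    proof -
      have "u ` {..n} \<subseteq> {a..b}" using order_trans[OF u(2)] r0 by (meson atLeastAtMost_iff atLeastatMost_subset_iff order_refl)
      then show ?thesis using ctn[of min u n] r0 unfolding continuous_on_def by blast
    qed
    ultimately have "(?f \<longlongrightarrow> (\<Sum>i<n. dist (\<gamma> (u i)) (\<gamma> (u (Suc i))))) (at r0 within {a..b})"
      by (simp only:)
    from order_tendstoD(1)[OF this u(3)]
    have "\<forall>\<^sub>F r in at r0 within {a..b}. len a r0 - e < ?f r" .
    moreover have "?f r \<le> len a r" if "r \<in> {a..b}" for r
      using clamp_partition[OF u(1,2)] r0 that by (intro sum_le_len) auto
    ultimately show ?thesis
      unfolding eventually_at_filter by (elim eventually_mono) (blast intro: less_le_trans)
  qed
  have upper: "\<forall>\<^sub>F r in at r0 within {a..b}. len r0 b - e < len r b"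
    if r0: "r0 \<in> {a..b}" and "e > 0" for r0 e
  proof -
    obtain n u where u: "mono_on {..n} u" "u ` {..n} \<subseteq> {r0..b}"
      "len r0 b - e < (\<Sum>i<n. dist (\<gamma> (u i)) (\<gamma> (u (Suc i))))"
      using approx_sum[of r0 b e] r0 \<open>e > 0\<close> by auto
    let ?f = "\<lambda>r. \<Sum>i<n. dist (\<gamma> (max (u i) r)) (\<gamma> (max (u (Suc i)) r))"
    have "?f r0 = (\<Sum>i<n. dist (\<gamma> (u i)) (\<gamma> (u (Suc i))))"
      using u(2) by (intro sum.cong) (auto simp: image_subset_iff max_absorb1)
    moreover have "(?f \<longlongrightarrow> ?f r0) (at r0 within {a..b})"
    proof -
      have "u ` {..n} \<subseteq> {a..b}" using order_trans[OF u(2)] r0 by (meson atLeastAtMost_iff atLeastatMost_subset_iff order_refl)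
      then show ?thesis using ctn[of max u n] r0 unfolding continuous_on_def by blast
    qed
    ultimately have "(?f \<longlongrightarrow> (\<Sum>i<n. dist (\<gamma> (u i)) (\<gamma> (u (Suc i))))) (at r0 within {a..b})"
      by (simp only:)
    from order_tendstoD(1)[OF this u(3)]
    have "\<forall>\<^sub>F r in at r0 within {a..b}. len r0 b - e < ?f r" .
    moreover have "?f r \<le> len r b" if "r \<in> {a..b}" for r
      using clamp_partition[OF u(1,2)] r0 that by (intro sum_le_len) auto
    ultimately show ?thesis
      unfolding eventually_at_filter by (elim eventually_mono) (blast intro: less_le_trans)
  qed
  show ?thesis
    unfolding continuous_on_def
  proof (intro ballI tendstoI)
    fix r0 e assume r0: "r0 \<in> {a..b}" and "(e::real) > 0"
    have "\<forall>\<^sub>F r in at r0 within {a..b}. r \<in> {a..b}"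
      by (simp add: eventually_at_filter)
    with lower[OF r0 \<open>e > 0\<close>] upper[OF r0 \<open>e > 0\<close>]
    show "\<forall>\<^sub>F r in at r0 within {a..b}. dist (len a r) (len a r0) < e"
    proof eventually_elim
      case (elim r)
      then have "len a r + len r b = len a r0 + len r0 b"
        using len_split[of a r b] len_split[of a r0 b] r0 by auto
      then show ?case using elim by (auto simp: dist_real_def abs_less_iff)
    qed
  qed
qed

definition arclen :: "real \<Rightarrow> real" where
  "arclen t = len a (max a (min b t))"

abbreviation lm :: "real measure" where
  "lm \<equiv> length_measure a b \<gamma>"

lemma lm_eq: "lm = interval_measure arclen"
  by (simp add: length_measure_def arclen_def[abs_def])

lemma arclen_mono: "s \<le> t \<Longrightarrow> arclen s \<le> arclen t"
  unfolding arclen_def using len_split[of a "max a (min b s)" "max a (min b t)"] le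
  by (auto simp: len_nonneg)

lemma continuous_arclen: "continuous_on UNIV arclen"
  unfolding arclen_def using le
  by (intro continuous_on_compose2[OF continuous_on_len]) (auto intro!: continuous_intros)

lemma arclen_right: "continuous (at_right t) arclen"
  using continuous_arclen by (simp add: continuous_on_eq_continuous_at continuous_at_imp_continuous_at_within)

lemma arclen_diff: "a \<le> s \<Longrightarrow> s \<le> t \<Longrightarrow> t \<le> b \<Longrightarrow> arclen t - arclen s = len s t"
  unfolding arclen_def using len_split[of a s t] by auto

lemma sets_lm [simp, measurable_cong]: "sets lm = sets borel" and space_lm [simp]: "space lm = UNIV"
  by (simp_all add: lm_eq)

lemma emeasure_lm_Ioc': "s \<le> t \<Longrightarrow> emeasure lm {s<..t} = ennreal (arclen t - arclen s)"
  unfolding lm_eq by (rule emeasure_interval_measure_Ioc[OF _ arclen_mono arclen_right])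

lemma emeasure_lm_Icc': "s \<le> t \<Longrightarrow> emeasure lm {s..t} = ennreal (arclen t - arclen s)"
  unfolding lm_eq by (rule emeasure_interval_measure_Icc[OF _ arclen_mono continuous_arclen])

lemma emeasure_lm_Ioc: "a \<le> s \<Longrightarrow> s \<le> t \<Longrightarrow> t \<le> b \<Longrightarrow> emeasure lm {s<..t} = ennreal (len s t)"
  using arclen_diff emeasure_lm_Ioc' by simp

lemma emeasure_lm_Icc: "a \<le> s \<Longrightarrow> s \<le> t \<Longrightarrow> t \<le> b \<Longrightarrow> emeasure lm {s..t} = ennreal (len s t)"
  using arclen_diff emeasure_lm_Icc' by simp

lemma emeasure_lm_singleton: "emeasure lm {t} = 0"
  using emeasure_lm_Icc'[of t t] by simp

lemma null_lm_outside: "- {a..b} \<in> null_sets lm"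
proof -
  have "{b<..b + real n} \<in> null_sets lm" for n
    using emeasure_lm_Ioc'[of b "b + real n"] le by (intro null_setsI) (auto simp: arclen_def)
  then have 1: "(\<Union>n. {b<..b + real n}) \<in> null_sets lm" by blast
  have "{a - real n<..a} \<in> null_sets lm" for n
    using emeasure_lm_Ioc'[of "a - real n" a] le by (intro null_setsI) (auto simp: arclen_def)
  then have 2: "(\<Union>n. {a - real n<..a}) \<in> null_sets lm" by blast
  show ?thesis
  proof (rule null_sets_subset[OF null_sets.Un[OF 1 2]])
    show "- {a..b} \<subseteq> (\<Union>n. {b<..b + real n}) \<union> (\<Union>n. {a - real n<..a})"
    proof
      fix t assume "t \<in> - {a..b}"
      moreover obtain n m :: nat where "t - b \<le> real n" "a - t < real m"
        using real_arch_simple reals_Archimedean2 by metis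
      ultimately show "t \<in> (\<Union>n. {b<..b + real n}) \<union> (\<Union>n. {a - real n<..a})"
        by (cases "b < t") (force simp: algebra_simps)+
    qed
  qed simp
qed

lemma AE_lm: "AE t in lm. t \<in> {a..b}"
  using null_lm_outside by (intro AE_I'[where N = "- {a..b}"]) auto

lemma emeasure_lm_UNIV: "emeasure lm UNIV = ennreal (len a b)"
proof -
  have "emeasure lm UNIV = emeasure lm {a..b}"
    using AE_lm by (intro emeasure_eq_AE) auto
  then show ?thesis using emeasure_lm_Icc[of a b] le by simp
qed

lemma finite_lm: "finite_measure lm"
  by (rule finite_measureI) (simp add: emeasure_lm_UNIV)

lemma path_int_eq: "path_int \<rho> a b \<gamma> = (\<integral>\<^sup>+t\<in>{a..b}. \<rho> (\<gamma> t) \<partial>lm)"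
  using rect by (simp add: path_int_def)

text \<open>Finite measures on the line that agree on all half-lines \<open>{x<..}\<close> are
  equal, and there both sides are lengths of subpaths or zero. Integrals over subpaths thereby
  become integrals against the single measure \<open>lm\<close>.\<close>

lemma subpath_measure:
  assumes "a \<le> s" "s \<le> t" "t \<le> b"
  shows "length_measure s t \<gamma> = density lm (indicator {s<..t})"
proof -
  interpret S: rectifiable_path s t \<gamma> using subpath assms by blast
  have lens: "S.arclen r = len s (max s (min t r))" for r by (simp add: S.arclen_def)
  have emD: "emeasure (density lm (indicator {s<..t})) A = emeasure lm (A \<inter> {s<..t})" if "A \<in> sets borel" for A
    using that by (subst emeasure_density) (auto simp: indicator_inter_arith[symmetric] Int_commute simp flip: nn_integral_indicator)
  have "emeasure S.lm {x<..} = emeasure lm ({x<..} \<inter> {s<..t})" for x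
  proof (cases "x < t")
    case True
    have "emeasure S.lm {x<..} = emeasure S.lm {max x s<..t}"
      using S.AE_lm AE_not_in[of "{s}" S.lm] S.emeasure_lm_singleton
      by (intro emeasure_eq_AE) (auto simp: null_setsI elim!: eventually_elim2)
    also have "\<dots> = ennreal (len (max x s) t)"
      using assms True by (intro S.emeasure_lm_Ioc) auto
    also have "\<dots> = emeasure lm {max x s<..t}"
      using assms True by (intro emeasure_lm_Ioc[symmetric]) auto
    also have "{max x s<..t} = {x<..} \<inter> {s<..t}" by auto
    finally show ?thesis .
  next
    case False
    then have "{x<..} \<inter> {s<..t} = {}" by auto
    moreover have "AE r in S.lm. r \<in> {x<..} \<longleftrightarrow> r \<in> {}"
      using S.AE_lm by eventually_elim (use False in auto)
    then have "emeasure S.lm {x<..} = emeasure S.lm {}"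
      by (intro emeasure_eq_AE) auto
    ultimately show ?thesis by simp
  qed
  then show ?thesis
    using finite_measure.emeasure_finite[OF finite_lm]
    by (intro measure_eqI_lessThan) (auto simp: emD less_top[symmetric])
qed

end

section \<open>Powers on \<open>[0,\<infinity>]\<close>\<close>

lemma epowr_ennreal [simp]: "0 \<le> r \<Longrightarrow> epowr (ennreal r) a = ennreal (r powr a)"
  by (simp add: epowr_def)

lemma epowr_top [simp]: "epowr top a = top"
  by (simp add: epowr_def)

lemma epowr_zero [simp]: "epowr 0 a = 0"
  by (simp add: epowr_def)

lemma epowr_mono: "x \<le> y \<Longrightarrow> 0 < a \<Longrightarrow> epowr x a \<le> epowr y a"
  by (cases x rule: ennreal_cases; cases y rule: ennreal_cases)
    (auto simp: powr_mono2 top_unique intro!: ennreal_leI)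

lemma epowr_epowr: "epowr (epowr x a) b = epowr x (a * b)"
  by (cases x rule: ennreal_cases) (auto simp: powr_powr)

lemma epowr_one [simp]: "epowr x 1 = x"
  by (cases x rule: ennreal_cases) auto

lemma epowr_eq_top_iff [simp]: "epowr x a = top \<longleftrightarrow> x = top"
  by (cases x rule: ennreal_cases) auto

lemma epowr_less_top_iff [simp]: "epowr x a < top \<longleftrightarrow> x < top"
  by (cases x rule: ennreal_cases) auto

lemma epowr_eq_0_iff [simp]: "epowr x a = 0 \<longleftrightarrow> x = 0"
  by (cases x rule: ennreal_cases) auto

lemma epowr_mult: "epowr (x * y) a = epowr x a * epowr y a"
proof (cases "x = 0 \<or> y = 0")
  case False
  then show ?thesis
    by (cases x rule: ennreal_cases; cases y rule: ennreal_cases)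
      (auto simp: powr_mult ennreal_mult_top ennreal_top_mult simp flip: ennreal_mult)
qed auto

lemma epowr_max: "0 < a \<Longrightarrow> epowr (max x y) a = max (epowr x a) (epowr y a)"
  using epowr_mono[of x y a] epowr_mono[of y x a] by (auto simp: max_def antisym)

lemma epowr_add_le:
  assumes "0 < a"
  shows "epowr (x + y) a \<le> ennreal (2 powr a) * (epowr x a + epowr y a)"
proof -
  have "x + y \<le> ennreal 2 * max x y"
    by (simp add: mult_2 add_mono)
  then have "epowr (x + y) a \<le> epowr (ennreal 2 * max x y) a"
    using assms by (rule epowr_mono)
  also have "\<dots> = ennreal (2 powr a) * max (epowr x a) (epowr y a)"
    using assms by (simp only: epowr_mult epowr_max) (simp del: ennreal_numeral)
  also have "\<dots> \<le> ennreal (2 powr a) * (epowr x a + epowr y a)"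
    by (intro mult_left_mono) auto
  finally show ?thesis .
qed

text \<open>The inverse power \<open>1 / a\<close> turns the bounds on the powers into one bound for
  all \<open>f i\<close>, hence for their supremum.\<close>

lemma epowr_SUP_le:
  assumes "\<And>i. i \<in> I \<Longrightarrow> epowr (f i) a \<le> C" "0 < a"
  shows "epowr (SUP i\<in>I. f i) a \<le> C"
proof -
  have "f i \<le> epowr C (1 / a)" if "i \<in> I" for i
    using epowr_mono[OF assms(1)[OF that], of "1 / a"] assms(2) by (simp add: epowr_epowr)
  then have "epowr (SUP i\<in>I. f i) a \<le> epowr (epowr C (1 / a)) a"
    by (intro epowr_mono SUP_least assms)
  then show ?thesis using assms(2) by (simp add: epowr_epowr)
qed

lemma borel_measurable_epowr [measurable]:
  assumes [measurable]: "f \<in> borel_measurable N"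
  shows "(\<lambda>x. epowr (f x) a) \<in> borel_measurable N"
  unfolding epowr_def by measurable

section \<open>Sobolev functions on subsets of a metric measure space\<close>

lemma paths_in_mono: "X \<subseteq> Y \<Longrightarrow> paths_in X \<subseteq> paths_in Y"
  by (auto simp: paths_in_def)

lemma paths_in_subpath: "(a, b, \<gamma>) \<in> paths_in X \<Longrightarrow> a \<le> s \<Longrightarrow> s \<le> t \<Longrightarrow> t \<le> b \<Longrightarrow> (s, t, \<gamma>) \<in> paths_in X"
  unfolding paths_in_def by (force intro: continuous_on_subset)

lemma paths_in_rectifiable: "(a, b, \<gamma>) \<in> paths_in X \<Longrightarrow> rectifiable a b \<gamma> \<Longrightarrow> rectifiable_path a b \<gamma>"
  by (simp add: paths_in_def rectifiable_path_def)

lemma path_int_finite_rectifiable: "path_int \<rho> a b \<gamma> < \<infinity> \<Longrightarrow> rectifiable a b \<gamma>"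
  by (auto simp: path_int_def split: if_splits)

lemma path_int_mono:
  assumes "\<And>t. t \<in> {a..b} \<Longrightarrow> \<rho> (\<gamma> t) \<le> \<rho>' (\<gamma> t)"
  shows "path_int \<rho> a b \<gamma> \<le> path_int \<rho>' a b \<gamma>"
  using assms by (auto simp: path_int_def intro!: nn_integral_mono split: split_indicator)

lemma measurable_along_path:
  assumes "(a, b, \<gamma>) \<in> paths_in X" "\<rho> \<in> borel_measurable (restrict_space borel X)"
  shows "(\<lambda>t. (\<rho> (\<gamma> t) :: ennreal) * indicator {a..b} t) \<in> borel_measurable borel"
proof -
  have "\<gamma> \<in> measurable (restrict_space borel {a..b}) (restrict_space borel X)"
    using assms(1)
    by (intro measurable_restrict_space2 borel_measurable_continuous_on_restrict)
      (auto simp: paths_in_def space_restrict_space)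
  from measurable_compose[OF this assms(2)] show ?thesis
    by (subst borel_measurable_restrict_space_iff_ennreal[symmetric]) auto
qed

lemma path_int_cmult:
  assumes "(a, b, \<gamma>) \<in> paths_in X" "\<rho> \<in> borel_measurable (restrict_space borel X)" "0 < c"
  shows "path_int (\<lambda>x. ennreal c * \<rho> x) a b \<gamma> = ennreal c * path_int \<rho> a b \<gamma>"
proof (cases "rectifiable a b \<gamma>")
  case True
  then interpret rectifiable_path a b \<gamma> using assms by (auto intro: paths_in_rectifiable)
  show ?thesis
    using measurable_along_path[OF assms(1,2)] by (simp add: path_int_eq mult.assoc nn_integral_cmult)
qed (use assms in \<open>auto simp: path_int_def ennreal_mult_top\<close>)

lemma path_int_add:
  assumes "(a, b, \<gamma>) \<in> paths_in X"
    "\<rho> \<in> borel_measurable (restrict_space borel X)" "\<rho>' \<in> borel_measurable (restrict_space borel X)"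
  shows "path_int (\<lambda>x. \<rho> x + \<rho>' x) a b \<gamma> = path_int \<rho> a b \<gamma> + path_int \<rho>' a b \<gamma>"
proof (cases "rectifiable a b \<gamma>")
  case True
  then interpret rectifiable_path a b \<gamma> using assms by (auto intro: paths_in_rectifiable)
  show ?thesis
    using measurable_along_path[OF assms(1,2)] measurable_along_path[OF assms(1,3)]
    by (simp add: path_int_eq distrib_right nn_integral_add)
qed (simp add: path_int_def)

text \<open>The factor \<open>indicator {a..b}\<close> keeps the integrand in the globally
  measurable form of \<open>measurable_along_path\<close>; half-open intervals make the integral
  additive over adjacent subpaths.\<close>

lemma (in rectifiable_path) path_int_subpath:
  assumes "(a, b, \<gamma>) \<in> paths_in X" "\<rho> \<in> borel_measurable (restrict_space borel X)"
    and st: "a \<le> s" "s \<le> t" "t \<le> b"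
  shows "path_int \<rho> s t \<gamma> = (\<integral>\<^sup>+r\<in>{s<..t}. \<rho> (\<gamma> r) * indicator {a..b} r \<partial>lm)"
proof -
  interpret S: rectifiable_path s t \<gamma> using subpath st by blast
  note [measurable] = measurable_along_path[OF paths_in_subpath[OF assms(1) st] assms(2)]
  have "path_int \<rho> s t \<gamma> = (\<integral>\<^sup>+r. \<rho> (\<gamma> r) * indicator {s..t} r \<partial>density lm (indicator {s<..t}))"
    by (simp add: S.path_int_eq subpath_measure[OF st])
  also have "\<dots> = (\<integral>\<^sup>+r. indicator {s<..t} r * (\<rho> (\<gamma> r) * indicator {s..t} r) \<partial>lm)"
    by (intro nn_integral_density) auto
  also have "\<dots> = (\<integral>\<^sup>+r\<in>{s<..t}. \<rho> (\<gamma> r) * indicator {a..b} r \<partial>lm)"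
    using st by (intro nn_integral_cong) (auto split: split_indicator)
  finally show ?thesis .
qed

lemma (in rectifiable_path) path_int_subpath_le:
  assumes "(a, b, \<gamma>) \<in> paths_in X" "\<rho> \<in> borel_measurable (restrict_space borel X)"
    and st: "a \<le> s" "s \<le> t" "t \<le> b"
  shows "path_int \<rho> s t \<gamma> \<le> path_int \<rho> a b \<gamma>"
  unfolding path_int_subpath[OF assms] path_int_eq
  by (intro nn_integral_mono) (auto split: split_indicator)

lemma path_int_constant:
  assumes "a \<le> b" "\<And>t. t \<in> {a..b} \<Longrightarrow> \<gamma> t = c"
  shows "path_int \<rho> a b \<gamma> = 0"
proof -
  have "curve_length a b \<gamma> \<le> 0"
  proof (rule curve_length_least)
    fix n :: nat and t :: "nat \<Rightarrow> real"
    assume *: "t ` {..n} \<subseteq> {a..b}"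
    have "\<gamma> (t i) = c" if "i \<le> n" for i using * that by (auto simp: assms image_subset_iff)
    then show "(\<Sum>i<n. ennreal (dist (\<gamma> (t i)) (\<gamma> (t (Suc i))))) \<le> 0" by simp
  qed
  then have z: "curve_length a b \<gamma> = 0" by simp
  have "continuous_on {a..b} \<gamma>"
    using assms(2) continuous_on_cong[of "{a..b}" "{a..b}" \<gamma> "\<lambda>_. c"] by simp
  then interpret rectifiable_path a b \<gamma>
    using assms z by unfold_locales (auto simp: rectifiable_def)
  have "UNIV \<in> null_sets lm" using emeasure_lm_UNIV z by auto
  then have "AE t in lm. False" by (intro AE_I') auto
  then have "AE t in lm. \<rho> (\<gamma> t) * indicator {a..b} t = 0" by (rule eventually_mono) simp
  then have "(\<integral>\<^sup>+t\<in>{a..b}. \<rho> (\<gamma> t) \<partial>lm) = (\<integral>\<^sup>+t. 0 \<partial>lm)"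
    by (intro nn_integral_cong_AE) simp
  then show ?thesis by (simp add: path_int_eq)
qed

section \<open>The complete measure of a Borel regular outer measure\<close>

locale mm_space =
  fixes p :: real and \<mu> :: "'a::{metric_space, second_countable_topology} set \<Rightarrow> ennreal"
  assumes p: "1 \<le> p" and mms: "metric_measure_space \<mu>"
begin

abbreviation M :: "'a measure" where "M \<equiv> induced_measure \<mu>"

lemma p_pos: "0 < p" using p by simp

lemma oms: "outer_measure_space (Pow UNIV) \<mu>"
  using mms by (simp add: metric_measure_space_def borel_regular_outer_measure_def)

lemma sets_M: "sets M = lambda_system UNIV (Pow UNIV) \<mu>"
  by (rule sets_induced_measure[OF oms])

lemma emeasure_M: "A \<in> sets M \<Longrightarrow> emeasure M A = \<mu> A"
  using emeasure_induced_measure[OF oms] sets_M by simp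

lemma space_M [simp]: "space M = UNIV"
  by (simp add: induced_measure_def space_measure_of_conv)

lemma borel_sets_M: "A \<in> sets borel \<Longrightarrow> A \<in> sets M"
  using mms sets_M by (auto simp: metric_measure_space_def borel_regular_outer_measure_def)

lemma null_setsI_M: "\<mu> A = 0 \<Longrightarrow> A \<in> null_sets M"
proof -
  assume A: "\<mu> A = 0"
  have mono: "\<mu> S \<le> \<mu> T" if "S \<subseteq> T" for S T
    using oms that by (auto simp: outer_measure_space_def increasing_def)
  have pos: "\<mu> {} = 0" using oms by (auto simp: outer_measure_space_def positive_def)
  have "\<mu> (A \<inter> S) + \<mu> ((UNIV - A) \<inter> S) = \<mu> S" for S
  proof -
    have "\<mu> (S \<inter> A) = 0" using mono[of "S \<inter> A" A] A by simp
    moreover have "\<mu> S \<le> \<mu> (S \<inter> A) + \<mu> (S - A)"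
    proof -
      have sub: "countably_subadditive (Pow UNIV) \<mu>" using oms by (simp add: outer_measure_space_def)
      let ?B = "\<lambda>n::nat. if n = 0 then S \<inter> A else if n = 1 then S - A else {}"
      have UN: "(\<Union>i. ?B i) = S" by (auto split: if_splits)
      have "\<mu> (\<Union>i. disjointed ?B i) \<le> (\<Sum>i. \<mu> (disjointed ?B i))"
        using sub disjoint_family_disjointed[of ?B] by (auto simp: countably_subadditive_def)
      also have "\<dots> \<le> (\<Sum>i. \<mu> (?B i))"
        by (intro suminf_le mono disjointed_subset) auto
      also have "\<dots> = (\<Sum>i\<in>{0, 1}. \<mu> (?B i))"
        by (rule suminf_finite) (auto simp: pos)
      also have "\<dots> = \<mu> (S \<inter> A) + \<mu> (S - A)" by simp
      finally show ?thesis unfolding UN_disjointed_eq UN .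
    qed
    moreover have "\<mu> (S - A) \<le> \<mu> S" by (rule mono) auto
    ultimately have "\<mu> (S \<inter> A) + \<mu> (S - A) = \<mu> S" by (auto intro: antisym)
    moreover have "(UNIV - A) \<inter> S = S - A" by auto
    ultimately show ?thesis by (simp only: Int_commute)
  qed
  then have "A \<in> lambda_system UNIV (Pow UNIV) \<mu>"
    unfolding lambda_system_def by blast
  then show ?thesis using A emeasure_M sets_M by (intro null_setsI) auto
qed

lemma borel_hull:
  obtains B where "B \<in> sets borel" "A \<subseteq> B" "\<mu> B = \<mu> A"
  using mms that unfolding metric_measure_space_def borel_regular_outer_measure_def by blast

lemma null_sets_borel_hull:
  assumes "A \<in> null_sets M"
  obtains B where "B \<in> sets borel" "A \<subseteq> B" "B \<in> null_sets M"
proof -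
  obtain B where B: "B \<in> sets borel" "A \<subseteq> B" "\<mu> B = \<mu> A" by (rule borel_hull)
  then show ?thesis using assms emeasure_M that null_setsI_M by (metis null_setsD1 null_setsD2)
qed

lemma AE_borel_hull:
  assumes "AE x in M. P x"
  obtains B where "B \<in> sets borel" "B \<in> null_sets M" "\<And>x. x \<notin> B \<Longrightarrow> P x"
proof -
  obtain N where "N \<in> null_sets M" "{x \<in> space M. \<not> P x} \<subseteq> N"
    using assms by (auto simp: eventually_ae_filter)
  moreover from this(1) obtain B where "B \<in> sets borel" "N \<subseteq> B" "B \<in> null_sets M"
    by (rule null_sets_borel_hull)
  ultimately show ?thesis using that by (metis (mono_tags, lifting) UNIV_I mem_Collect_eq space_M subset_iff)
qed

lemma complete_M: "complete_measure M"
proof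
  fix A B assume "B \<subseteq> A" "A \<in> null_sets M"
  then have "\<mu> A = 0" using emeasure_M by (metis null_setsD1 null_setsD2)
  moreover have "\<mu> B \<le> \<mu> A"
    using oms \<open>B \<subseteq> A\<close> by (auto simp: outer_measure_space_def increasing_def)
  ultimately show "B \<in> sets M" using null_setsI_M by (simp add: null_setsD2)
qed

lemma emeasure_ball_finite: "emeasure M (ball x r) < \<infinity>"
proof (cases "r > 0")
  case True
  then show ?thesis using mms emeasure_M[of "ball x r"] borel_sets_M[of "ball x r"]
    by (simp add: metric_measure_space_def)
qed (simp add: ball_empty)

lemma sigma_finite_M: "sigma_finite_measure M"
proof
  let ?x = "undefined :: 'a"
  have "(\<Union>n. ball ?x (real n)) = UNIV"
    by (auto simp: reals_Archimedean2)
  then show "\<exists>A. countable A \<and> A \<subseteq> sets M \<and> \<Union>A = space M \<and> (\<forall>a\<in>A. emeasure M a \<noteq> \<infinity>)"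
    using emeasure_ball_finite borel_sets_M
    by (intro exI[of _ "range (\<lambda>n. ball ?x (real n))"]) (auto simp: less_top[symmetric])
qed

lemma borel_measurable_M: "f \<in> borel_measurable borel \<Longrightarrow> f \<in> measurable M N" if "sets N = sets borel" for N
  using that borel_sets_M by (auto simp: measurable_def sets_eq_imp_space_eq[OF that])

lemma measurable_restrict_M:
  "f \<in> borel_measurable (restrict_space borel X) \<Longrightarrow> f \<in> borel_measurable (restrict_space M X)"
  using borel_sets_M
  by (auto simp: measurable_def space_restrict_space sets_restrict_space)

end

section \<open>Properties of p-almost every path\<close>

locale mm_subspace = mm_space +
  fixes X assumes X: "X \<in> sets M"
begin

abbreviation bm :: "('a \<Rightarrow> ennreal) \<Rightarrow> bool" where
  "bm \<rho> \<equiv> \<rho> \<in> borel_measurable (restrict_space borel X)"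

lemma measurable_on_X:
  assumes "bm \<rho>" shows "(\<lambda>x. \<rho> x * indicator X x) \<in> borel_measurable M"
  using measurable_restrict_M[OF assms] X
  by (subst borel_measurable_restrict_space_iff_ennreal[symmetric]) auto

lemma bm_epowr: "bm \<rho> \<Longrightarrow> bm (\<lambda>x. epowr (\<rho> x) a)"
  by measurable

text \<open>\<open>P\<close> holds outside a p-negligible family. The witness
  \<open>\<sigma>\<close> stands for the family, which turns countable intersections and passage to
  subpaths into operations on functions. Non-rectifiable paths are always exempt, since
  \<open>path_int\<close> is infinite on them.\<close>

definition AE_path :: "(real \<Rightarrow> real \<Rightarrow> (real \<Rightarrow> 'a) \<Rightarrow> bool) \<Rightarrow> bool" where
  "AE_path P \<longleftrightarrow> (\<exists>\<sigma>. Lp_integrable_borel p \<mu> X \<sigma> \<and>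
     (\<forall>a b \<gamma>. (a, b, \<gamma>) \<in> paths_in X \<longrightarrow> path_int \<sigma> a b \<gamma> < \<infinity> \<longrightarrow> P a b \<gamma>))"

lemma negligible_paths_iff:
  "negligible_paths p \<mu> X \<Gamma> \<longleftrightarrow> \<Gamma> \<subseteq> paths_in X \<and> AE_path (\<lambda>a b \<gamma>. (a, b, \<gamma>) \<notin> \<Gamma>)"
  unfolding negligible_paths_def AE_path_def
  by (auto simp: less_top[symmetric]) (rule_tac x = \<sigma> in exI, fastforce)

lemma AE_path_negligible:
  "AE_path P \<longleftrightarrow> (\<exists>\<Gamma>. negligible_paths p \<mu> X \<Gamma> \<and> (\<forall>(a, b, \<gamma>)\<in>paths_in X - \<Gamma>. P a b \<gamma>))"
proof
  assume "AE_path P"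
  then show "\<exists>\<Gamma>. negligible_paths p \<mu> X \<Gamma> \<and> (\<forall>(a, b, \<gamma>)\<in>paths_in X - \<Gamma>. P a b \<gamma>)"
    by (intro exI[of _ "{(a, b, \<gamma>) \<in> paths_in X. \<not> P a b \<gamma>}"])
      (auto simp: negligible_paths_iff AE_path_def)
next
  assume "\<exists>\<Gamma>. negligible_paths p \<mu> X \<Gamma> \<and> (\<forall>(a, b, \<gamma>)\<in>paths_in X - \<Gamma>. P a b \<gamma>)"
  then show "AE_path P"
    unfolding negligible_paths_iff AE_path_def by fast
qed

lemma weak_upper_gradient_iff:
  "weak_upper_gradient p \<mu> X u \<rho> \<longleftrightarrow>
    bm \<rho> \<and> AE_path (\<lambda>a b \<gamma>. ennreal \<bar>u (\<gamma> a) - u (\<gamma> b)\<bar> \<le> path_int \<rho> a b \<gamma>)"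
  unfolding weak_upper_gradient_def AE_path_negligible by simp

lemma AE_path_mono:
  assumes "AE_path P" "\<And>a b \<gamma>. (a, b, \<gamma>) \<in> paths_in X \<Longrightarrow> rectifiable_path a b \<gamma> \<Longrightarrow> P a b \<gamma> \<Longrightarrow> Q a b \<gamma>"
  shows "AE_path Q"
  using assms unfolding AE_path_def
  by (meson path_int_finite_rectifiable paths_in_rectifiable)

text \<open>The p-th power of a supremum is at most the sum of the p-th powers, so a supremum
  combines countably many witnesses at the cost of a series of integrals.\<close>

lemma Lp_SUP:
  fixes \<sigma> :: "nat \<Rightarrow> 'a \<Rightarrow> ennreal"
  assumes "\<And>n. bm (\<sigma> n)" "(\<Sum>n. \<integral>\<^sup>+x\<in>X. epowr (\<sigma> n x) p \<partial>M) < \<infinity>"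
  shows "Lp_integrable_borel p \<mu> X (\<lambda>x. SUP n. \<sigma> n x)"
proof -
  note [measurable] = assms(1)
  have "(\<integral>\<^sup>+x\<in>X. epowr (SUP n. \<sigma> n x) p \<partial>M) \<le> (\<integral>\<^sup>+x. (\<Sum>n. epowr (\<sigma> n x) p * indicator X x) \<partial>M)"
  proof (rule nn_integral_mono)
    fix x
    have "epowr (SUP n. \<sigma> n x) p \<le> (\<Sum>n. epowr (\<sigma> n x) p)"
      using p_pos sum_le_suminf[of "\<lambda>n. epowr (\<sigma> n x) p" "{_}"] by (intro epowr_SUP_le) auto
    then show "epowr (SUP n. \<sigma> n x) p * indicator X x \<le> (\<Sum>n. epowr (\<sigma> n x) p * indicator X x)"
      by (auto split: split_indicator)
  qed
  also have "\<dots> = (\<Sum>n. \<integral>\<^sup>+x\<in>X. epowr (\<sigma> n x) p \<partial>M)"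
    using measurable_on_X[OF bm_epowr[OF assms(1)]] by (intro nn_integral_suminf)
  finally show ?thesis using assms(2) unfolding Lp_integrable_borel_def by (auto intro: le_less_trans)
qed

text \<open>Countable unions of p-negligible families are p-negligible: a path on which the supremum
  of the positive multiples \<open>c n * \<sigma> n\<close> has finite integral has finite integral
  of every \<open>\<sigma> n\<close>.\<close>

lemma AE_path_all_countable:
  assumes "\<And>n::nat. AE_path (P n)"
  shows "AE_path (\<lambda>a b \<gamma>. \<forall>n. P n a b \<gamma>)"
proof -
  obtain \<sigma> where \<sigma>: "\<And>n. Lp_integrable_borel p \<mu> X (\<sigma> n)"
    "\<And>n a b \<gamma>. (a, b, \<gamma>) \<in> paths_in X \<Longrightarrow> path_int (\<sigma> n) a b \<gamma> < \<infinity> \<Longrightarrow> P n a b \<gamma>"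
    using assms unfolding AE_path_def by metis
  have bm: "bm (\<sigma> n)" for n using \<sigma>(1)[of n] by (simp add: Lp_integrable_borel_def)
  define I where "I n = enn2real (\<integral>\<^sup>+x\<in>X. epowr (\<sigma> n x) p \<partial>M)" for n
  have I: "ennreal (I n) = (\<integral>\<^sup>+x\<in>X. epowr (\<sigma> n x) p \<partial>M)" "0 \<le> I n" for n
    using \<sigma>(1)[of n] by (auto simp: I_def Lp_integrable_borel_def)
  \<comment> \<open>Makes the p-integral of \<open>c n * \<sigma> n\<close> at most
    \<open>(1/2) ^ n\<close>; the summand 1 covers \<open>I n = 0\<close>.\<close>
  define c where "c n = ((1/2) ^ n / (1 + I n)) powr (1 / p)" for n
  have c: "0 < c n" "c n powr p = (1/2) ^ n / (1 + I n)" for n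
    using I(2)[of n] p_pos by (auto simp: c_def powr_powr intro!: divide_pos_pos)
  define s where "s n x = ennreal (c n) * \<sigma> n x" for n x
  have bms: "bm (s n)" for n using bm unfolding s_def by measurable
  have "(\<integral>\<^sup>+x\<in>X. epowr (s n x) p \<partial>M) \<le> ennreal ((1/2) ^ n)" for n
  proof -
    have "(\<integral>\<^sup>+x\<in>X. epowr (s n x) p \<partial>M) = (\<integral>\<^sup>+x. ennreal (c n powr p) * (epowr (\<sigma> n x) p * indicator X x) \<partial>M)"
      using c(1)[of n] by (auto simp: s_def epowr_mult mult.assoc less_imp_le)
    also have "\<dots> = ennreal (c n powr p) * ennreal (I n)"
      using measurable_on_X[OF bm_epowr[OF bm]] by (subst nn_integral_cmult) (auto simp: I)
    also have "\<dots> = ennreal ((1/2) ^ n / (1 + I n) * I n)"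
      unfolding c(2) using I(2)[of n] by (intro ennreal_mult[symmetric]) auto
    also have "\<dots> \<le> ennreal ((1/2) ^ n)"
      using I(2)[of n] mult_left_le[of "I n / (1 + I n)" "(1/2) ^ n"] by (intro ennreal_leI) simp
    finally show ?thesis .
  qed
  then have "(\<Sum>n. \<integral>\<^sup>+x\<in>X. epowr (s n x) p \<partial>M) \<le> (\<Sum>n. ennreal ((1/2) ^ n))"
    by (intro suminf_le) auto
  also have "\<dots> = ennreal (\<Sum>n. (1/2) ^ n)"
    by (intro suminf_ennreal2 summable_geometric) auto
  finally have L: "Lp_integrable_borel p \<mu> X (\<lambda>x. SUP n. s n x)"
    by (intro Lp_SUP bms) (auto intro: le_less_trans)
  show ?thesis
    unfolding AE_path_def
  proof (intro exI conjI allI impI, rule L)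
    fix a b \<gamma> n assume *: "(a, b, \<gamma>) \<in> paths_in X" "path_int (\<lambda>x. SUP n. s n x) a b \<gamma> < \<infinity>"
    have "ennreal (c n) * path_int (\<sigma> n) a b \<gamma> \<le> path_int (\<lambda>x. SUP n. s n x) a b \<gamma>"
      unfolding path_int_cmult[OF *(1) bm c(1), symmetric]
      by (intro path_int_mono) (auto simp: s_def[symmetric] intro: SUP_upper)
    then have "ennreal (c n) * path_int (\<sigma> n) a b \<gamma> < \<infinity>" using *(2) by (auto intro: le_less_trans)
    then have "path_int (\<sigma> n) a b \<gamma> < \<infinity>" using c(1)[of n] by (auto simp: ennreal_mult_less_top)
    then show "P n a b \<gamma>" using \<sigma>(2) *(1) by blast
  qed
qed

lemma AE_path_conj:
  assumes "AE_path P" "AE_path Q"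
  shows "AE_path (\<lambda>a b \<gamma>. P a b \<gamma> \<and> Q a b \<gamma>)"
proof -
  have "AE_path (\<lambda>a b \<gamma>. \<forall>n::nat. (if n = 0 then P else Q) a b \<gamma>)"
    by (rule AE_path_all_countable) (use assms in auto)
  then show ?thesis by (rule AE_path_mono) (metis zero_neq_one)
qed

lemma AE_path_finite:
  assumes "Lp_integrable_borel p \<mu> X \<rho>"
  shows "AE_path (\<lambda>a b \<gamma>. path_int \<rho> a b \<gamma> < \<infinity>)"
  using assms unfolding AE_path_def by blast

text \<open>The witness is kept: a subpath has at most the \<open>\<sigma>\<close>-integral of the
  whole path.\<close>

lemma AE_path_subpaths:
  assumes "AE_path P"
  shows "AE_path (\<lambda>a b \<gamma>. \<forall>s t. a \<le> s \<longrightarrow> s \<le> t \<longrightarrow> t \<le> b \<longrightarrow> P s t \<gamma>)"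
proof -
  obtain \<sigma> where \<sigma>: "Lp_integrable_borel p \<mu> X \<sigma>"
    "\<And>a b \<gamma>. (a, b, \<gamma>) \<in> paths_in X \<Longrightarrow> path_int \<sigma> a b \<gamma> < \<infinity> \<Longrightarrow> P a b \<gamma>"
    using assms unfolding AE_path_def by metis
  show ?thesis unfolding AE_path_def
  proof (intro exI conjI allI impI, rule \<sigma>(1))
    fix a b \<gamma> s t assume *: "(a, b, \<gamma>) \<in> paths_in X" "path_int \<sigma> a b \<gamma> < \<infinity>" "a \<le> s" "s \<le> t" "t \<le> b"
    interpret rectifiable_path a b \<gamma>
      using * path_int_finite_rectifiable paths_in_rectifiable by blast
    show "P s t \<gamma>"
      using \<sigma> * path_int_subpath_le[OF *(1) _ *(3-5), of \<sigma>] paths_in_subpath[OF *(1,3-5)]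
      by (auto simp: Lp_integrable_borel_def intro: le_less_trans)
  qed
qed

text \<open>The function \<open>\<infinity> \<cdot> 1\<^sub>N\<close> is \<open>p\<close>-integrable and its integral over a path is \<open>\<infinity>\<close> unless the path
  spends zero length in \<open>N\<close>.\<close>
lemma AE_path_null:
  assumes "N \<in> null_sets M" "N \<in> sets borel"
  shows "AE_path (\<lambda>a b \<gamma>. AE t in length_measure a b \<gamma>. \<gamma> t \<notin> N)"
proof -
  let ?\<sigma> = "\<lambda>x. top * indicator N x :: ennreal"
  have bm: "bm ?\<sigma>"
    using assms(2) by (intro measurable_restrict_space1 borel_measurable_times borel_measurable_indicator) auto
  have "AE x in M. x \<notin> N" using assms by (rule_tac AE_not_in) auto
  then have "(\<integral>\<^sup>+x\<in>X. epowr (?\<sigma> x) p \<partial>M) = (\<integral>\<^sup>+x. 0 \<partial>M)"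
    by (intro nn_integral_cong_AE) (auto elim!: eventually_mono)
  then have L: "Lp_integrable_borel p \<mu> X ?\<sigma>" using bm by (auto simp: Lp_integrable_borel_def)
  show ?thesis
    using AE_path_conj[OF AE_path_finite[OF L] AE_path_finite[OF L]]
  proof (rule AE_path_mono)
    fix a b \<gamma> assume path: "(a, b, \<gamma>) \<in> paths_in X" and "rectifiable_path a b \<gamma>"
      and fin: "path_int ?\<sigma> a b \<gamma> < \<infinity> \<and> path_int ?\<sigma> a b \<gamma> < \<infinity>"
    then interpret rectifiable_path a b \<gamma> by simp
    have "AE t in lm. ?\<sigma> (\<gamma> t) * indicator {a..b} t \<noteq> \<infinity>"
      using fin measurable_along_path[OF path bm] unfolding path_int_eq
      by (intro nn_integral_PInf_AE) auto
    with AE_lm show "AE t in lm. \<gamma> t \<notin> N"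
      by eventually_elim (auto split: split_indicator_asm)
  qed
qed

end

subsection \<open>Interval functions dominated by measures\<close>

text \<open>Approximate \<open>V\<close> from inside by a compact \<open>K\<close> and take a partition finer than the distance
  from \<open>K\<close> to the complement of \<open>V\<close>: the intervals meeting \<open>K\<close> lie in \<open>V\<close>.\<close>
lemma dist_le_measure_open_split:
  fixes f :: "real \<Rightarrow> real" and m1 m2 :: "real measure"
  assumes "a \<le> b" and sets: "sets m1 = sets borel" "sets m2 = sets borel"
    and fin: "emeasure m2 UNIV \<noteq> \<infinity>" and V: "open V"
    and h1: "\<And>s t. a \<le> s \<Longrightarrow> s \<le> t \<Longrightarrow> t \<le> b \<Longrightarrow> {s..t} \<subseteq> V \<Longrightarrow> ennreal \<bar>f s - f t\<bar> \<le> emeasure m1 {s<..t}"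
    and h2: "\<And>s t. a \<le> s \<Longrightarrow> s \<le> t \<Longrightarrow> t \<le> b \<Longrightarrow> ennreal \<bar>f s - f t\<bar> \<le> emeasure m2 {s<..t}"
  shows "ennreal \<bar>f a - f b\<bar> \<le> emeasure m1 (V \<inter> {a<..b}) + emeasure m2 ({a<..b} - V)"
proof (rule ennreal_le_epsilon)
  fix e :: real assume "0 < e"
  have sp: "space m2 = UNIV" using sets(2) by (simp add: sets_eq_imp_space_eq)
  note [measurable_cong] = sets
  define B where "B = V \<inter> {a..b}"
  have [measurable]: "B \<in> sets borel" "V \<in> sets borel" using V by (auto simp: B_def)
  have finB: "emeasure m2 A \<noteq> \<infinity>" for A
    using emeasure_space[of m2 A] fin sp by (auto simp: top_unique)
  have "emeasure m2 B = (SUP K \<in> {K. K \<subseteq> B \<and> compact K}. emeasure m2 K)"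
    by (rule inner_regular) (use sets fin sp in auto)
  then obtain K where K: "K \<subseteq> B" "compact K" "emeasure m2 B \<le> emeasure m2 K + e"
    using SUP_approx_ennreal[of e "{K. K \<subseteq> B \<and> compact K}" "emeasure m2 B" "emeasure m2"] \<open>0 < e\<close> finB[of B]
    by (auto simp: less_imp_le) force
  have [measurable]: "K \<in> sets borel" using K(2) by (simp add: borel_compact)
  have "emeasure m2 (B - K) = emeasure m2 B - emeasure m2 K"
    using K(1) finB by (intro emeasure_Diff) (auto simp: sets)
  also have "\<dots> \<le> e" using K(3) finB[of K] by (simp add: ennreal_minus_le_iff)
  finally have BK: "emeasure m2 (B - K) \<le> e" .
  obtain d where d: "d > 0" "(\<Union>x\<in>K. ball x d) \<subseteq> V"
    using compact_subset_open_imp_ball_epsilon_subset[OF K(2) V] K(1) unfolding B_def by blast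
  obtain n0 :: nat where n0: "(b - a) / d < real n0" using reals_Archimedean2 by blast
  define n where "n = Suc n0"
  have n: "(b - a) / real n < d" "0 < n"
  proof -
    have "(b - a) / d < real n" using n0 by (simp add: n_def)
    then show "(b - a) / real n < d" using d(1) by (simp add: field_simps n_def)
  qed (simp add: n_def)
  define t where "t i = a + real i * ((b - a) / real n)" for i
  have t0: "t 0 = a" "t n = b" using n(2) by (auto simp: t_def)
  have tm: "t i \<le> t j" if "i \<le> j" for i j using that \<open>a \<le> b\<close> by (auto simp: t_def mult_right_mono divide_right_mono)
  have tr: "a \<le> t i" "i \<le> n \<Longrightarrow> t i \<le> b" for i using tm[of 0 i] tm[of i n] t0 by auto
  have ts: "t (Suc i) - t i < d" for i using n(1) by (simp add: t_def algebra_simps add_divide_distrib diff_divide_distrib)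
  define J where "J = {i. i < n \<and> {t i..t (Suc i)} \<inter> K \<noteq> {}}"
  let ?I = "\<lambda>i. {t i<..t (Suc i)}"
  have disj: "disjoint_family_on ?I A" for A
    unfolding disjoint_family_on_def
  proof (intro ballI impI)
    fix i j :: nat assume "i \<noteq> j"
    then consider "Suc i \<le> j" | "Suc j \<le> i" by linarith
    then show "?I i \<inter> ?I j = {}" using tm[of "Suc i" j] tm[of "Suc j" i] by cases auto
  qed
  have inV: "{t i..t (Suc i)} \<subseteq> V" if i: "i \<in> J" for i
  proof
    fix x assume x: "x \<in> {t i..t (Suc i)}"
    obtain y where y: "y \<in> K" "y \<in> {t i..t (Suc i)}" using i unfolding J_def by blast
    have "dist y x < d" using x y ts[of i] by (auto simp: dist_real_def)
    then have "x \<in> (\<Union>x\<in>K. ball x d)" using y(1) by auto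
    then show "x \<in> V" using d(2) by (rule subsetD[rotated])
  qed
  have "\<bar>f a - f b\<bar> = \<bar>\<Sum>i<n. f (t i) - f (t (Suc i))\<bar>"
    using sum_lessThan_telescope'[of "\<lambda>i. f (t i)" n] t0 by simp
  also have "\<dots> \<le> (\<Sum>i<n. \<bar>f (t i) - f (t (Suc i))\<bar>)" by (rule sum_abs)
  finally have "ennreal \<bar>f a - f b\<bar> \<le> (\<Sum>i<n. ennreal \<bar>f (t i) - f (t (Suc i))\<bar>)"
    by (simp add: ennreal_leI)
  also have "\<dots> \<le> (\<Sum>i<n. if i \<in> J then emeasure m1 (?I i) else emeasure m2 (?I i))"
  proof (rule sum_mono)
    fix i assume "i \<in> {..<n}"
    then have "a \<le> t i" "t i \<le> t (Suc i)" "t (Suc i) \<le> b" using tr tm by auto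
    then show "ennreal \<bar>f (t i) - f (t (Suc i))\<bar> \<le> (if i \<in> J then emeasure m1 (?I i) else emeasure m2 (?I i))"
      using h1 h2 inV by auto
  qed
  also have "\<dots> = (\<Sum>i\<in>J. emeasure m1 (?I i)) + (\<Sum>i\<in>{..<n} - J. emeasure m2 (?I i))"
  proof -
    have "J \<subseteq> {..<n}" by (auto simp: J_def)
    then show ?thesis
      by (subst sum.subset_diff[of J]) (auto simp: add.commute intro!: arg_cong2[where f="(+)"] sum.cong)
  qed
  also have "(\<Sum>i\<in>J. emeasure m1 (?I i)) = emeasure m1 (\<Union>i\<in>J. ?I i)"
    using disj by (intro sum_emeasure) (auto simp: J_def sets)
  also have "\<dots> \<le> emeasure m1 (V \<inter> {a<..b})"
  proof (rule emeasure_mono)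
    show "(\<Union>i\<in>J. ?I i) \<subseteq> V \<inter> {a<..b}"
    proof (rule UN_least)
      fix i assume "i \<in> J"
      then show "?I i \<subseteq> V \<inter> {a<..b}" using inV[of i] tr(1)[of i] tr(2)[of "Suc i"]
        by (auto simp: J_def)
    qed
  qed (simp add: sets)
  also have "(\<Sum>i\<in>{..<n} - J. emeasure m2 (?I i)) = emeasure m2 (\<Union>i\<in>{..<n} - J. ?I i)"
    using disj by (intro sum_emeasure) (auto simp: sets)
  also have "\<dots> \<le> emeasure m2 (({a<..b} - V) \<union> (B - K))"
  proof (rule emeasure_mono)
    show "(\<Union>i\<in>{..<n} - J. ?I i) \<subseteq> ({a<..b} - V) \<union> (B - K)"
    proof (rule UN_least)
      fix i assume "i \<in> {..<n} - J"
      then have i: "i < n" "{t i..t (Suc i)} \<inter> K = {}" by (auto simp: J_def)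
      show "?I i \<subseteq> ({a<..b} - V) \<union> (B - K)"
      proof
        fix x assume x: "x \<in> ?I i"
        then have "x \<in> {t i..t (Suc i)}" by auto
        then have "x \<notin> K" using i(2) by blast
        moreover have "a < x" "x \<le> b" using x tr(1)[of i] tr(2)[of "Suc i"] i(1) by auto
        ultimately show "x \<in> ({a<..b} - V) \<union> (B - K)" by (simp add: B_def)
      qed
    qed
  qed (simp add: sets)
  also have "\<dots> \<le> emeasure m2 ({a<..b} - V) + emeasure m2 (B - K)"
    by (intro emeasure_subadditive) (auto simp: sets)
  also have "\<dots> \<le> emeasure m2 ({a<..b} - V) + e" using BK by (rule add_left_mono)
  finally show "ennreal \<bar>f a - f b\<bar> \<le> emeasure m1 (V \<inter> {a<..b}) + emeasure m2 ({a<..b} - V) + e"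
    by (simp add: add_left_mono add_right_mono add.assoc)
qed

section \<open>Measures with a density along a path\<close>

context rectifiable_path begin

text \<open>Integrals over subpaths are the values of this measure on half-open intervals, so that
  regularity of finite Borel measures on the line becomes available for sets of parameters.\<close>

definition dm :: "('a \<Rightarrow> ennreal) \<Rightarrow> real measure" where
  "dm \<rho> = density lm (\<lambda>t. \<rho> (\<gamma> t) * indicator {a..b} t)"

lemma sets_dm [simp, measurable_cong]: "sets (dm \<rho>) = sets borel" and space_dm [simp]: "space (dm \<rho>) = UNIV"
  by (simp_all add: dm_def)

context
  fixes X and \<rho> :: "'a \<Rightarrow> ennreal"
  assumes path: "(a, b, \<gamma>) \<in> paths_in X" and \<rho>: "\<rho> \<in> borel_measurable (restrict_space borel X)"
begin

lemma emeasure_dm: "A \<in> sets borel \<Longrightarrow> emeasure (dm \<rho>) A = (\<integral>\<^sup>+t\<in>A. \<rho> (\<gamma> t) * indicator {a..b} t \<partial>lm)"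
  unfolding dm_def using measurable_along_path[OF path \<rho>] by (intro emeasure_density) auto

lemma emeasure_dm_Ioc: "a \<le> s \<Longrightarrow> s \<le> t \<Longrightarrow> t \<le> b \<Longrightarrow> emeasure (dm \<rho>) {s<..t} = path_int \<rho> s t \<gamma>"
  by (simp add: emeasure_dm path_int_subpath[OF path \<rho>])

lemma emeasure_dm_UNIV: "emeasure (dm \<rho>) UNIV = path_int \<rho> a b \<gamma>"
  by (simp add: emeasure_dm path_int_eq)

lemma null_dm: "N \<in> null_sets lm \<Longrightarrow> N \<in> null_sets (dm \<rho>)"
  using absolutely_continuousI_density[of "\<lambda>t. \<rho> (\<gamma> t) * indicator {a..b} t" lm]
    measurable_along_path[OF path \<rho>]
  by (auto simp: dm_def absolutely_continuous_def)

text \<open>Otherwise the \<open>\<rho>\<close>-mass of the largest \<open>lm\<close>-null interval centred at \<open>t\<^sub>0\<close> would be positive.\<close>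
lemma exists_close_typical:
  fixes e :: real
  assumes Q: "AE t in lm. Q t" and len: "0 < len a b" and fin: "path_int \<rho> a b \<gamma> < \<infinity>"
    and t0: "t0 \<in> {a..b}" and "0 < e"
  shows "\<exists>t\<in>{a..b}. Q t \<and> path_int \<rho> (min t0 t) (max t0 t) \<gamma> < e"
proof -
  let ?I = "\<lambda>r. {t0 - r..t0 + r}"
  have F0: "{t} \<in> null_sets lm" for t using emeasure_lm_singleton by (auto intro!: null_setsI)
  note D0 = null_dm[OF F0]
  have finD: "emeasure (dm \<rho>) A \<noteq> \<infinity>" for A
    using emeasure_space[of "dm \<rho>" A] fin by (auto simp: emeasure_dm_UNIV top_unique less_top[symmetric])
  have "\<exists>r\<ge>0. 0 < emeasure lm (?I r) \<and> emeasure (dm \<rho>) (?I r) < e"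
  proof (rule ccontr)
    assume "\<not> ?thesis"
    then have neg: "e \<le> emeasure (dm \<rho>) (?I r)" if "0 \<le> r" "0 < emeasure lm (?I r)" for r
      using that by (force simp: not_less)
    define S where "S = {r. 0 \<le> r \<and> 0 < emeasure lm (?I r)}"
    have "AE t in lm. t \<in> ?I (b - a) \<longleftrightarrow> t \<in> UNIV"
      using AE_lm by eventually_elim (use t0 in auto)
    then have "emeasure lm (?I (b - a)) = emeasure lm UNIV"
      by (intro emeasure_eq_AE) auto
    then have "b - a \<in> S" using len le by (auto simp: S_def emeasure_lm_UNIV)
    have bdd: "bdd_below S" by (auto simp: S_def)
    \<comment> \<open>The closed interval of radius \<open>s\<close> contains a decreasing limit of
      intervals of positive length measure, so its \<open>\<rho>\<close>-mass would be at least
      \<open>e\<close>; yet up to its two endpoints it is a union of \<open>lm\<close>-null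
      intervals.\<close>
    define s where "s = Inf S"
    have "0 \<le> s" unfolding s_def
    proof (rule cInf_greatest)
      show "S \<noteq> {}" using \<open>b - a \<in> S\<close> by blast
    qed (simp add: S_def)
    have above: "s + 1 / real (Suc n) \<in> S" for n
    proof -
      obtain r where r: "r \<in> S" "r < s + 1 / real (Suc n)"
        using cInf_less_iff[OF _ bdd, of "s + 1 / real (Suc n)"] \<open>b - a \<in> S\<close> unfolding s_def[symmetric] by fastforce
      have "emeasure lm (?I r) \<le> emeasure lm (?I (s + 1 / real (Suc n)))"
        using r(2) by (intro emeasure_mono) auto
      then show ?thesis using r(1) \<open>0 \<le> s\<close> by (auto simp: S_def intro: less_le_trans)
    qed
    have "(\<lambda>n. emeasure (dm \<rho>) (?I (s + 1 / real (Suc n)))) \<longlonglongrightarrow> emeasure (dm \<rho>) (\<Inter>n. ?I (s + 1 / real (Suc n)))"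
    proof (rule Lim_emeasure_decseq)
      show "decseq (\<lambda>n. ?I (s + 1 / real (Suc n)))"
      proof (rule decseq_SucI)
        fix n
        have "1 / real (Suc (Suc n)) \<le> 1 / real (Suc n)" by (simp add: field_simps)
        then show "?I (s + 1 / real (Suc (Suc n))) \<subseteq> ?I (s + 1 / real (Suc n))" by auto
      qed
    qed (use finD in auto)
    moreover have "(\<Inter>n. ?I (s + 1 / real (Suc n))) \<subseteq> ?I s"
    proof
      fix x assume x: "x \<in> (\<Inter>n. ?I (s + 1 / real (Suc n)))"
      have "\<bar>x - t0\<bar> \<le> s + 1 / real (Suc n)" for n
      proof -
        have "x \<in> ?I (s + 1 / real (Suc n))" using x by blast
        then show ?thesis unfolding atLeastAtMost_iff by linarith
      qed
      then have "\<bar>x - t0\<bar> \<le> s"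
        using LIMSEQ_inverse_real_of_nat_add[of s]
        by (intro LIMSEQ_le_const) (auto simp: divide_inverse)
      then show "x \<in> ?I s" by (auto simp: abs_le_iff)
    qed
    ultimately have "ennreal e \<le> emeasure (dm \<rho>) (\<Inter>n. ?I (s + 1 / real (Suc n)))"
      using above neg by (intro LIMSEQ_le_const) (auto simp: S_def)
    also have "\<dots> \<le> emeasure (dm \<rho>) (?I s)"
      using \<open>_ \<subseteq> ?I s\<close> by (intro emeasure_mono) auto
    finally have pos: "ennreal e \<le> emeasure (dm \<rho>) (?I s)" .
    have "?I (s - 1 / real (Suc n)) \<in> null_sets (dm \<rho>)" for n
    proof (cases "0 \<le> s - 1 / real (Suc n)")
      case True
      have "s - 1 / real (Suc n) \<notin> S"
        using cInf_lower[OF _ bdd, of "s - 1 / real (Suc n)"] by (auto simp: s_def)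
      then show ?thesis using True by (intro null_dm null_setsI) (auto simp: S_def)
    qed auto
    then have "(\<Union>n. ?I (s - 1 / real (Suc n))) \<union> ({t0 - s} \<union> {t0 + s}) \<in> null_sets (dm \<rho>)"
      using D0 by (intro null_sets.Un null_sets_UN) auto
    moreover have "?I s \<subseteq> (\<Union>n. ?I (s - 1 / real (Suc n))) \<union> ({t0 - s} \<union> {t0 + s})"
    proof
      fix x assume x: "x \<in> ?I s"
      show "x \<in> (\<Union>n. ?I (s - 1 / real (Suc n))) \<union> ({t0 - s} \<union> {t0 + s})"
      proof (cases "\<bar>x - t0\<bar> < s")
        case True
        then obtain n where "1 / real (Suc n) < s - \<bar>x - t0\<bar>"
          using nat_approx_posE[of "s - \<bar>x - t0\<bar>"] by auto
        then have "x \<in> ?I (s - 1 / real (Suc n))" by (auto simp: abs_if split: if_splits)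
        then show ?thesis by blast
      qed (use x in \<open>auto simp: abs_if split: if_splits\<close>)
    qed
    ultimately have "?I s \<in> null_sets (dm \<rho>)" by (intro null_sets_subset[of _ _ "?I s"]) auto
    then have "emeasure (dm \<rho>) (?I s) = 0" by (rule null_setsD1)
    then show False using pos \<open>0 < e\<close> by simp
  qed
  then obtain r where r: "0 \<le> r" "0 < emeasure lm (?I r)" "emeasure (dm \<rho>) (?I r) < e" by blast
  have "\<exists>t\<in>?I r \<inter> {a..b}. Q t"
  proof (rule ccontr)
    assume "\<not> ?thesis"
    then have "AE t in lm. t \<notin> ?I r" using Q AE_lm by (auto elim!: eventually_elim2)
    then have "emeasure lm (?I r) = 0" by (subst AE_iff_measurable[symmetric, of _ _ "\<lambda>t. t \<notin> ?I r"]) auto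
    then show False using r(2) by simp
  qed
  then obtain t where t: "t \<in> ?I r" "t \<in> {a..b}" "Q t" by blast
  have "path_int \<rho> (min t0 t) (max t0 t) \<gamma> = emeasure (dm \<rho>) {min t0 t<..max t0 t}"
    using t t0 by (intro emeasure_dm_Ioc[symmetric]) auto
  also have "\<dots> \<le> emeasure (dm \<rho>) (?I r)"
    using t r(1) by (intro emeasure_mono) (auto simp: min_def max_def)
  finally show ?thesis using t r(3) by (auto intro: le_less_trans)
qed

end

end

subsection \<open>Weak upper gradients\<close>

context mm_subspace begin

abbreviation Lwug :: "('a \<Rightarrow> real) \<Rightarrow> ('a \<Rightarrow> ennreal) \<Rightarrow> bool" where
  "Lwug \<equiv> Lp_weak_upper_gradient p \<mu> X"

lemma Lp_bm: "Lp_integrable_borel p \<mu> X \<rho> \<Longrightarrow> bm \<rho>"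
  by (simp add: Lp_integrable_borel_def)

lemma Lwug_bm: "Lwug u \<rho> \<Longrightarrow> bm \<rho>"
  by (auto simp: Lp_weak_upper_gradient_def weak_upper_gradient_def)

lemma Lwug_Lp: "Lwug u \<rho> \<Longrightarrow> Lp_integrable_borel p \<mu> X \<rho>"
  by (auto simp: Lp_weak_upper_gradient_def)

lemma Lwug_AE_path:
  assumes "Lwug u \<rho>"
  shows "AE_path (\<lambda>a b \<gamma>. path_int \<rho> a b \<gamma> < \<infinity> \<and>
    (\<forall>s t. a \<le> s \<longrightarrow> s \<le> t \<longrightarrow> t \<le> b \<longrightarrow> ennreal \<bar>u (\<gamma> s) - u (\<gamma> t)\<bar> \<le> path_int \<rho> s t \<gamma>))"
proof (rule AE_path_conj[OF AE_path_finite AE_path_subpaths])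
  show "Lp_integrable_borel p \<mu> X \<rho>" using assms by (rule Lwug_Lp)
  show "AE_path (\<lambda>a b \<gamma>. ennreal \<bar>u (\<gamma> a) - u (\<gamma> b)\<bar> \<le> path_int \<rho> a b \<gamma>)"
    using assms by (simp add: Lp_weak_upper_gradient_def weak_upper_gradient_iff)
qed

lemma LwugI:
  assumes "Lp_integrable_borel p \<mu> X \<rho>" "AE_path (\<lambda>a b \<gamma>. ennreal \<bar>u (\<gamma> a) - u (\<gamma> b)\<bar> \<le> path_int \<rho> a b \<gamma>)"
  shows "Lwug u \<rho>"
  using assms by (simp add: Lp_weak_upper_gradient_def weak_upper_gradient_iff Lp_integrable_borel_def)

lemma Lp_mono:
  assumes "Lp_integrable_borel p \<mu> X \<rho>'" "bm \<rho>" "AE x\<in>X in M. \<rho> x \<le> \<rho>' x"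
  shows "Lp_integrable_borel p \<mu> X \<rho>"
proof -
  have "(\<integral>\<^sup>+x\<in>X. epowr (\<rho> x) p \<partial>M) \<le> (\<integral>\<^sup>+x\<in>X. epowr (\<rho>' x) p \<partial>M)"
    using assms(3) by (intro nn_integral_mono_AE, eventually_elim) (auto split: split_indicator intro: epowr_mono p_pos)
  then show ?thesis using assms unfolding Lp_integrable_borel_def by (auto intro: le_less_trans)
qed

lemma Lp_add:
  assumes "Lp_integrable_borel p \<mu> X \<rho>" "Lp_integrable_borel p \<mu> X \<rho>'"
  shows "Lp_integrable_borel p \<mu> X (\<lambda>x. \<rho> x + \<rho>' x)"
proof -
  note bm = assms[THEN Lp_bm]
  note [measurable] = bm measurable_on_X[OF bm_epowr[OF bm(1)]] measurable_on_X[OF bm_epowr[OF bm(2)]]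
  have "(\<integral>\<^sup>+x\<in>X. epowr (\<rho> x + \<rho>' x) p \<partial>M) \<le>
    (\<integral>\<^sup>+x. ennreal (2 powr p) * (epowr (\<rho> x) p * indicator X x + epowr (\<rho>' x) p * indicator X x) \<partial>M)"
    using epowr_add_le[OF p_pos] by (intro nn_integral_mono) (auto split: split_indicator)
  also have "\<dots> = ennreal (2 powr p) * ((\<integral>\<^sup>+x\<in>X. epowr (\<rho> x) p \<partial>M) + (\<integral>\<^sup>+x\<in>X. epowr (\<rho>' x) p \<partial>M))"
    by (simp add: nn_integral_cmult nn_integral_add)
  also have "\<dots> < \<infinity>" using assms by (auto simp: Lp_integrable_borel_def ennreal_mult_less_top)
  finally show ?thesis using bm by (auto simp: Lp_integrable_borel_def)
qed

text \<open>Almost every path spends zero length in a Borel null set containing the points of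
  \<open>X\<close> where the inequality fails.\<close>

lemma AE_path_mono_AE:
  assumes "AE x\<in>X in M. \<rho> x \<le> \<rho>' x"
  shows "AE_path (\<lambda>a b \<gamma>. path_int \<rho> a b \<gamma> \<le> path_int \<rho>' a b \<gamma>)"
proof -
  obtain N where N: "N \<in> sets borel" "N \<in> null_sets M" "\<And>x. x \<notin> N \<Longrightarrow> x \<in> X \<longrightarrow> \<rho> x \<le> \<rho>' x"
    using AE_borel_hull[OF assms] by metis
  show ?thesis
    using AE_path_null[OF N(2,1)]
  proof (rule AE_path_mono)
    fix a b \<gamma> assume path: "(a, b, \<gamma>) \<in> paths_in X" and "rectifiable_path a b \<gamma>"
      and AE: "AE t in length_measure a b \<gamma>. \<gamma> t \<notin> N"
    then interpret rectifiable_path a b \<gamma> by simp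
    show "path_int \<rho> a b \<gamma> \<le> path_int \<rho>' a b \<gamma>"
      unfolding path_int_eq using AE
    proof (intro nn_integral_mono_AE, eventually_elim)
      case (elim t)
      then show ?case using N(3)[of "\<gamma> t"] path by (auto simp: paths_in_def image_subset_iff split: split_indicator)
    qed
  qed
qed

lemma Lwug_mono_AE:
  assumes "Lwug u \<rho>" "Lp_integrable_borel p \<mu> X \<rho>'" "AE x\<in>X in M. \<rho> x \<le> \<rho>' x"
  shows "Lwug u \<rho>'"
proof (rule LwugI[OF assms(2)])
  show "AE_path (\<lambda>a b \<gamma>. ennreal \<bar>u (\<gamma> a) - u (\<gamma> b)\<bar> \<le> path_int \<rho>' a b \<gamma>)"
    using AE_path_conj[OF Lwug_AE_path[OF assms(1)] AE_path_mono_AE[OF assms(3)]]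
    by (rule AE_path_mono) (meson order_trans order_refl rectifiable_path.le)
qed

text \<open>Along a path, the set \<open>E\<close> of parameters where \<open>\<rho>1\<close> is the
  smaller one is enclosed in an open set \<open>V\<close> of almost the same
  \<open>\<rho>1\<close>-mass; increments of \<open>u\<close> are then estimated by
  \<open>\<rho>1\<close> on \<open>V\<close> and by \<open>\<rho>2\<close> off
  \<open>V\<close>.\<close>

lemma Lwug_min:
  assumes 1: "Lwug u \<rho>1" and 2: "Lwug u \<rho>2"
  shows "Lwug u (\<lambda>x. min (\<rho>1 x) (\<rho>2 x))"
proof (rule LwugI)
  note bm1 = Lwug_bm[OF 1] and bm2 = Lwug_bm[OF 2]
  have bmm: "bm (\<lambda>x. min (\<rho>1 x) (\<rho>2 x))" using bm1 bm2 by measurable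
  then show "Lp_integrable_borel p \<mu> X (\<lambda>x. min (\<rho>1 x) (\<rho>2 x))"
    by (rule Lp_mono[OF Lwug_Lp[OF 1]]) auto
  show "AE_path (\<lambda>a b \<gamma>. ennreal \<bar>u (\<gamma> a) - u (\<gamma> b)\<bar> \<le> path_int (\<lambda>x. min (\<rho>1 x) (\<rho>2 x)) a b \<gamma>)"
    using AE_path_conj[OF Lwug_AE_path[OF 1] Lwug_AE_path[OF 2]]
  proof (rule AE_path_mono)
    fix a b \<gamma> assume path: "(a, b, \<gamma>) \<in> paths_in X" and "rectifiable_path a b \<gamma>"
      and *: "(path_int \<rho>1 a b \<gamma> < \<infinity> \<and>
        (\<forall>s t. a \<le> s \<longrightarrow> s \<le> t \<longrightarrow> t \<le> b \<longrightarrow> ennreal \<bar>u (\<gamma> s) - u (\<gamma> t)\<bar> \<le> path_int \<rho>1 s t \<gamma>)) \<and>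
       path_int \<rho>2 a b \<gamma> < \<infinity> \<and>
        (\<forall>s t. a \<le> s \<longrightarrow> s \<le> t \<longrightarrow> t \<le> b \<longrightarrow> ennreal \<bar>u (\<gamma> s) - u (\<gamma> t)\<bar> \<le> path_int \<rho>2 s t \<gamma>)"
    then interpret rectifiable_path a b \<gamma> by simp
    let ?r = "\<lambda>\<rho> t. \<rho> (\<gamma> t) * indicator {a..b} t"
    note [measurable] = measurable_along_path[OF path bm1] measurable_along_path[OF path bm2]
    define E where "E = {t. ?r \<rho>1 t \<le> ?r \<rho>2 t}"
    have E [measurable]: "E \<in> sets borel" unfolding E_def by measurable
    have fin: "emeasure (dm \<rho>1) UNIV \<noteq> \<infinity>" "emeasure (dm \<rho>2) UNIV \<noteq> \<infinity>"
      using * emeasure_dm_UNIV[OF path bm1] emeasure_dm_UNIV[OF path bm2] by auto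
    have outer: "emeasure (dm \<rho>1) E = (INF V \<in> {V. E \<subseteq> V \<and> open V}. emeasure (dm \<rho>1) V)"
      by (rule outer_regular) (use E fin in auto)
    have "ennreal \<bar>u (\<gamma> a) - u (\<gamma> b)\<bar> \<le> emeasure (dm \<rho>1) E + emeasure (dm \<rho>2) (- E)"
    proof (rule ennreal_le_epsilon)
      fix e :: real assume "0 < e"
      have "emeasure (dm \<rho>1) E < emeasure (dm \<rho>1) E + e"
        using fin \<open>0 < e\<close> emeasure_space[of "dm \<rho>1" E] by (auto simp: ennreal_add_left_cancel_less[of _ 0, simplified] less_top[symmetric] top_unique)
      then obtain V where V: "E \<subseteq> V" "open V" "emeasure (dm \<rho>1) V < emeasure (dm \<rho>1) E + e"
        unfolding outer INF_less_iff by auto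
      have "ennreal \<bar>(u \<circ> \<gamma>) a - (u \<circ> \<gamma>) b\<bar> \<le> emeasure (dm \<rho>1) (V \<inter> {a<..b}) + emeasure (dm \<rho>2) ({a<..b} - V)"
        using le * V(2) fin
        by (intro dist_le_measure_open_split) (auto simp: emeasure_dm_Ioc[OF path bm1] emeasure_dm_Ioc[OF path bm2])
      also have "\<dots> \<le> emeasure (dm \<rho>1) V + emeasure (dm \<rho>2) (- E)"
        using V by (intro add_mono emeasure_mono) auto
      also have "\<dots> \<le> (emeasure (dm \<rho>1) E + e) + emeasure (dm \<rho>2) (- E)"
        using V(3) by (intro add_right_mono) auto
      finally show "ennreal \<bar>u (\<gamma> a) - u (\<gamma> b)\<bar> \<le> emeasure (dm \<rho>1) E + emeasure (dm \<rho>2) (- E) + e"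
        by (simp add: ac_simps)
    qed
    also have "\<dots> = (\<integral>\<^sup>+t. ?r \<rho>1 t * indicator E t + ?r \<rho>2 t * indicator (- E) t \<partial>lm)"
      by (simp add: emeasure_dm[OF path bm1] emeasure_dm[OF path bm2] nn_integral_add)
    also have "\<dots> = path_int (\<lambda>x. min (\<rho>1 x) (\<rho>2 x)) a b \<gamma>"
      unfolding path_int_eq by (intro nn_integral_cong) (auto simp: E_def min_def split: split_indicator)
    finally show "ennreal \<bar>u (\<gamma> a) - u (\<gamma> b)\<bar> \<le> path_int (\<lambda>x. min (\<rho>1 x) (\<rho>2 x)) a b \<gamma>" .
  qed
qed

text \<open>Monotone convergence from above along each path, started from a finite integral.\<close>

lemma Lwug_INF:
  assumes "\<And>n::nat. Lwug u (g n)" "decseq g"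
  shows "Lwug u (\<lambda>x. INF n. g n x)"
proof (rule LwugI)
  note bm = Lwug_bm[OF assms(1)]
  note [measurable] = bm
  have bmI: "bm (\<lambda>x. INF n. g n x)" by measurable
  then show "Lp_integrable_borel p \<mu> X (\<lambda>x. INF n. g n x)"
    by (rule Lp_mono[OF Lwug_Lp[OF assms(1)[of 0]]]) (auto intro: INF_lower)
  show "AE_path (\<lambda>a b \<gamma>. ennreal \<bar>u (\<gamma> a) - u (\<gamma> b)\<bar> \<le> path_int (\<lambda>x. INF n. g n x) a b \<gamma>)"
    using AE_path_all_countable[OF Lwug_AE_path[OF assms(1)]]
  proof (rule AE_path_mono)
    fix a b \<gamma> assume path: "(a, b, \<gamma>) \<in> paths_in X" and "rectifiable_path a b \<gamma>"
      and *: "\<forall>n. path_int (g n) a b \<gamma> < \<infinity> \<and>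
        (\<forall>s t. a \<le> s \<longrightarrow> s \<le> t \<longrightarrow> t \<le> b \<longrightarrow> ennreal \<bar>u (\<gamma> s) - u (\<gamma> t)\<bar> \<le> path_int (g n) s t \<gamma>)"
    then interpret rectifiable_path a b \<gamma> by simp
    have "path_int (\<lambda>x. INF n. g n x) a b \<gamma> = (\<integral>\<^sup>+t. (INF n. g n (\<gamma> t) * indicator {a..b} t) \<partial>lm)"
      unfolding path_int_eq by (intro nn_integral_cong) (auto split: split_indicator)
    also have "\<dots> = (INF n. path_int (g n) a b \<gamma>)"
      unfolding path_int_eq
    proof (rule nn_integral_monotone_convergence_INF_decseq)
      show "decseq (\<lambda>n t. g n (\<gamma> t) * indicator {a..b} t)"
        using decseq_SucD[OF \<open>decseq g\<close>]
        by (intro decseq_SucI le_funI) (auto simp: le_fun_def split: split_indicator)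
      show "(\<integral>\<^sup>+t. g 0 (\<gamma> t) * indicator {a..b} t \<partial>lm) < \<infinity>" using * path_int_eq by metis
    qed (use measurable_along_path[OF path bm] in auto)
    finally show "ennreal \<bar>u (\<gamma> a) - u (\<gamma> b)\<bar> \<le> path_int (\<lambda>x. INF n. g n x) a b \<gamma>"
      using * le by (auto intro!: INF_greatest)
  qed
qed

end

lemma paths_in_mem: "(a, b, \<gamma>) \<in> paths_in X \<Longrightarrow> t \<in> {a..b} \<Longrightarrow> \<gamma> t \<in> X"
  by (auto simp: paths_in_def image_subset_iff)

lemma AE_ennreal_eq_of_nn_integral_le:
  fixes f g :: "'a \<Rightarrow> ennreal"
  assumes [measurable]: "f \<in> borel_measurable N" "g \<in> borel_measurable N"
    and le: "\<And>x. f x \<le> g x" and "integral\<^sup>N N g \<le> integral\<^sup>N N f" "integral\<^sup>N N g < \<infinity>"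
  shows "AE x in N. f x = g x"
proof -
  have "integral\<^sup>N N f \<noteq> \<infinity>" using nn_integral_mono[of N f g] le assms(5) by (auto simp: top_unique)
  then have "(\<integral>\<^sup>+x. g x - f x \<partial>N) = integral\<^sup>N N g - integral\<^sup>N N f"
    using le by (intro nn_integral_diff) auto
  also have "\<dots> = 0" using assms(4,5) by (simp add: diff_eq_0_iff_ennreal)
  finally have "AE x in N. g x - f x = 0" by (subst (asm) nn_integral_0_iff_AE) auto
  moreover have "AE x in N. g x \<noteq> \<infinity>" using assms(5) by (intro nn_integral_noteq_infinite) auto
  ultimately show ?thesis
    by eventually_elim (metis le antisym ennreal_minus_eq_0 diff_eq_0_iff_ennreal less_top infinity_ennreal_def)
qed

section \<open>Representatives and minimal weak upper gradients\<close>

context mm_subspace begin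

definition pint :: "('a \<Rightarrow> ennreal) \<Rightarrow> ennreal" where
  "pint \<rho> = (\<integral>\<^sup>+x\<in>X. epowr (\<rho> x) p \<partial>M)"

lemma Lp_iff: "Lp_integrable_borel p \<mu> X \<rho> \<longleftrightarrow> bm \<rho> \<and> pint \<rho> < \<infinity>"
  by (simp add: Lp_integrable_borel_def pint_def)

lemma pint_mono_AE: "AE x\<in>X in M. \<rho> x \<le> \<rho>' x \<Longrightarrow> pint \<rho> \<le> pint \<rho>'"
  unfolding pint_def
  by (intro nn_integral_mono_AE, elim eventually_mono)
    (auto split: split_indicator intro: epowr_mono p_pos)

lemma pint_mono: "(\<And>x. x \<in> X \<Longrightarrow> \<rho> x \<le> \<rho>' x) \<Longrightarrow> pint \<rho> \<le> pint \<rho>'"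
  by (intro pint_mono_AE) auto

lemma pint_cmult:
  assumes "bm \<rho>" "0 \<le> c"
  shows "pint (\<lambda>x. ennreal c * \<rho> x) = ennreal (c powr p) * pint \<rho>"
proof -
  have "epowr (ennreal c * \<rho> x) p * indicator X x = ennreal (c powr p) * (epowr (\<rho> x) p * indicator X x)" for x
    using assms(2) by (simp only: epowr_mult epowr_ennreal mult.assoc)
  then show ?thesis
    unfolding pint_def by (simp only: nn_integral_cmult[OF measurable_on_X[OF bm_epowr[OF assms(1)]]])
qed

text \<open>Two functions that agree a.e. and are absolutely continuous along almost every path agree at
  the endpoints of almost every path of positive length.\<close>
lemma Lwug_representative:
  assumes u: "Lwug u \<rho>" and v: "Lwug v \<rho>'" and rep: "representative \<mu> X u v"
  shows "Lwug v \<rho>"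
proof (rule LwugI[OF Lwug_Lp[OF u]])
  from AE_borel_hull[OF rep[unfolded representative_def]]
  obtain N where N: "N \<in> sets borel" "N \<in> null_sets M" "\<And>x. x \<notin> N \<Longrightarrow> x \<in> X \<longrightarrow> v x = u x"
    by blast
  note bm = Lwug_bm[OF u] Lwug_bm[OF v]
  have bm2: "bm (\<lambda>x. \<rho> x + \<rho>' x)" using bm by measurable
  show "AE_path (\<lambda>a b \<gamma>. ennreal \<bar>v (\<gamma> a) - v (\<gamma> b)\<bar> \<le> path_int \<rho> a b \<gamma>)"
    using AE_path_conj[OF AE_path_null[OF N(2,1)] AE_path_conj[OF Lwug_AE_path[OF u] Lwug_AE_path[OF v]]]
  proof (rule AE_path_mono)
    fix a b \<gamma> assume path: "(a, b, \<gamma>) \<in> paths_in X" and "rectifiable_path a b \<gamma>"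
      and *: "(AE t in length_measure a b \<gamma>. \<gamma> t \<notin> N) \<and>
        (path_int \<rho> a b \<gamma> < \<infinity> \<and> (\<forall>s t. a \<le> s \<longrightarrow> s \<le> t \<longrightarrow> t \<le> b \<longrightarrow>
            ennreal \<bar>u (\<gamma> s) - u (\<gamma> t)\<bar> \<le> path_int \<rho> s t \<gamma>)) \<and>
        path_int \<rho>' a b \<gamma> < \<infinity> \<and> (\<forall>s t. a \<le> s \<longrightarrow> s \<le> t \<longrightarrow> t \<le> b \<longrightarrow>
            ennreal \<bar>v (\<gamma> s) - v (\<gamma> t)\<bar> \<le> path_int \<rho>' s t \<gamma>)"
    then interpret rectifiable_path a b \<gamma> by simp
    show "ennreal \<bar>v (\<gamma> a) - v (\<gamma> b)\<bar> \<le> path_int \<rho> a b \<gamma>"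
    proof (cases "len a b = 0")
      case True
      then have "\<gamma> a = \<gamma> b" using dist_le_len[of a b] le by simp
      then show ?thesis by simp
    next
      case False
      then have pos: "0 < len a b" using len_nonneg[of a b] by linarith
      have eq: "v (\<gamma> t0) = u (\<gamma> t0)" if t0: "t0 \<in> {a..b}" for t0
      proof -
        have "\<bar>v (\<gamma> t0) - u (\<gamma> t0)\<bar> \<le> e" if "0 < e" for e
        proof -
          have fin: "path_int (\<lambda>x. \<rho> x + \<rho>' x) a b \<gamma> < \<infinity>"
            using * by (simp add: path_int_add[OF path bm])
          obtain t where t: "t \<in> {a..b}" "\<gamma> t \<notin> N"
              "path_int (\<lambda>x. \<rho> x + \<rho>' x) (min t0 t) (max t0 t) \<gamma> < e"
            using exists_close_typical[OF path bm2 conjunct1[OF *] pos fin t0 \<open>0 < e\<close>] by blast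
          let ?s = "min t0 t" and ?t = "max t0 t"
          have st: "a \<le> ?s" "?s \<le> ?t" "?t \<le> b" using t t0 by auto
          have "ennreal (\<bar>u (\<gamma> ?s) - u (\<gamma> ?t)\<bar> + \<bar>v (\<gamma> ?s) - v (\<gamma> ?t)\<bar>)
            \<le> path_int \<rho> ?s ?t \<gamma> + path_int \<rho>' ?s ?t \<gamma>"
            using * st by (auto simp: ennreal_plus intro!: add_mono)
          also have "\<dots> < e"
            using t(3) by (simp add: path_int_add[OF paths_in_subpath[OF path st] bm])
          finally have "\<bar>u (\<gamma> ?s) - u (\<gamma> ?t)\<bar> + \<bar>v (\<gamma> ?s) - v (\<gamma> ?t)\<bar> < e"
            by (subst (asm) ennreal_less_iff) auto
          moreover have "v (\<gamma> t) = u (\<gamma> t)"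
            using N(3)[OF t(2)] paths_in_mem[OF path t(1)] by simp
          ultimately show ?thesis by (cases "t0 \<le> t") auto
        qed
        then have "\<bar>v (\<gamma> t0) - u (\<gamma> t0)\<bar> \<le> 0" by (rule_tac field_le_epsilon) simp
        then show ?thesis by simp
      qed
      show ?thesis using * le eq[of a] eq[of b] by auto
    qed
  qed
qed

text \<open>\<open>pint\<close> is minimized: \<open>Lwug_min\<close> makes a minimizing sequence
  decreasing and \<open>Lwug_INF\<close> gives a minimizer \<open>h\<close>. For any competitor
  \<open>\<rho>\<close> the minimum of \<open>h\<close> and \<open>\<rho>\<close> has no smaller
  \<open>pint\<close> than \<open>h\<close>, hence equals \<open>h\<close> a.e.\<close>

lemma least_wug_exists:
  assumes "Lwug u \<rho>0"
  shows "\<exists>g. least_weak_upper_gradient p \<mu> X u g"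
proof -
  define m where "m = (INF \<rho>\<in>Collect (Lwug u). pint \<rho>)"
  have mle: "m \<le> pint \<rho>" if "Lwug u \<rho>" for \<rho> unfolding m_def using that by (intro INF_lower) simp
  have "m < \<infinity>" using mle[OF assms] Lwug_Lp[OF assms] by (auto simp: Lp_iff intro: le_less_trans)
  have "\<exists>\<rho>. Lwug u \<rho> \<and> pint \<rho> < m + ennreal (1 / real (Suc n))" for n
  proof -
    have "m < m + ennreal (1 / real (Suc n))"
      using \<open>m < \<infinity>\<close> by (cases m) (auto simp flip: ennreal_plus simp: ennreal_less_iff)
    then show ?thesis unfolding m_def INF_less_iff by simp
  qed
  then obtain r where r: "\<And>n. Lwug u (r n)" "\<And>n. pint (r n) < m + ennreal (1 / real (Suc n))"
    by metis
  define g where "g n x = rec_nat (r 0 x) (\<lambda>k y. min y (r (Suc k) x)) n" for n x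
  have gS: "g 0 = r 0" "g (Suc n) = (\<lambda>x. min (g n x) (r (Suc n) x))" for n by (auto simp: g_def)
  have gL: "Lwug u (g n)" for n
    by (induction n) (simp_all only: gS r(1) Lwug_min)
  have gr: "g n x \<le> r n x" for n x by (cases n) (simp_all add: gS)
  have dec: "decseq g" by (intro decseq_SucI) (auto simp: gS le_fun_def)
  define h where "h x = (INF n. g n x)" for x
  have hL: "Lwug u h" unfolding h_def by (rule Lwug_INF[OF gL dec])
  have hm: "pint h \<le> m"
  proof (rule ennreal_le_epsilon)
    fix e :: real assume "0 < e"
    then obtain n where n: "1 / real (Suc n) < e" using nat_approx_posE by blast
    have "pint h \<le> pint (r n)"
      by (intro pint_mono) (auto simp: h_def intro: INF_lower2[of n] gr)
    also have "\<dots> \<le> m + ennreal (1 / real (Suc n))" using r(2) by (simp add: less_imp_le)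
    also have "\<dots> \<le> m + ennreal e" using n by (intro add_left_mono ennreal_leI) auto
    finally show "pint h \<le> m + ennreal e" .
  qed
  have "AE x\<in>X in M. h x \<le> \<rho> x" if \<rho>: "Lwug u \<rho>" for \<rho>
  proof -
    note L = Lwug_min[OF hL \<rho>]
    let ?f = "\<lambda>x. epowr (min (h x) (\<rho> x)) p * indicator X x" and ?g = "\<lambda>x. epowr (h x) p * indicator X x"
    have "AE x in M. ?f x = ?g x"
    proof (rule AE_ennreal_eq_of_nn_integral_le)
      show "?f \<in> borel_measurable M" "?g \<in> borel_measurable M"
        using L hL by (auto intro!: measurable_on_X bm_epowr dest: Lwug_bm)
      show "?f x \<le> ?g x" for x by (auto split: split_indicator intro!: epowr_mono p_pos)
      show "integral\<^sup>N M ?g \<le> integral\<^sup>N M ?f" using order_trans[OF hm mle[OF L]] by (simp add: pint_def)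
      show "integral\<^sup>N M ?g < \<infinity>" using Lwug_Lp[OF hL] by (simp add: Lp_iff pint_def)
    qed
    then show ?thesis
    proof eventually_elim
      case (elim x)
      then show ?case
      proof (intro impI)
        assume "x \<in> X"
        then have "epowr (epowr (min (h x) (\<rho> x)) p) (1/p) = epowr (epowr (h x) p) (1/p)" using elim by simp
        then have "min (h x) (\<rho> x) = h x" using p_pos by (simp add: epowr_epowr)
        then show "h x \<le> \<rho> x" by (simp add: min_def split: if_splits)
      qed
    qed
  qed
  then show ?thesis using hL by (auto simp: least_weak_upper_gradient_def)
qed

lemma representative_trans:
  "representative \<mu> X u v \<Longrightarrow> representative \<mu> X u w \<Longrightarrow> representative \<mu> X v w"
  unfolding representative_def
proof -
  assume "AE x\<in>X in M. v x = u x" "AE x\<in>X in M. w x = u x"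
  then show "AE x\<in>X in M. w x = v x" by eventually_elim simp
qed

text \<open>Independence of choices: by \<open>Lwug_representative\<close> all representatives of
  \<open>u\<close> that have integrable weak upper gradients have the same ones, so the function
  picked by \<open>SOME\<close> is least for each of them.\<close>

lemma min_wug_char:
  assumes "representative \<mu> X u w" "Lwug w \<rho>"
  obtains g where "min_weak_upper_gradient p \<mu> X u = (\<lambda>x. enn2real (g x))"
    "\<And>v \<rho>'. representative \<mu> X u v \<Longrightarrow> Lwug v \<rho>' \<Longrightarrow> Lwug v g \<and> (AE x\<in>X in M. g x \<le> \<rho>' x)"
proof -
  let ?P = "\<lambda>g. \<exists>v. representative \<mu> X u v \<and> least_weak_upper_gradient p \<mu> X v g"
  define g where "g = (SOME g. ?P g)"
  have "\<exists>g. ?P g" using least_wug_exists[OF assms(2)] assms(1) by blast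
  then have "?P g" unfolding g_def by (rule someI_ex)
  then obtain w' where w': "representative \<mu> X u w'" "Lwug w' g"
      "\<And>\<rho>. Lwug w' \<rho> \<Longrightarrow> AE x\<in>X in M. g x \<le> \<rho> x"
    by (auto simp: least_weak_upper_gradient_def)
  show ?thesis
  proof (rule that)
    show "min_weak_upper_gradient p \<mu> X u = (\<lambda>x. enn2real (g x))"
      by (simp add: min_weak_upper_gradient_def g_def Let_def)
    show "Lwug v g \<and> (AE x\<in>X in M. g x \<le> \<rho>' x)" if "representative \<mu> X u v" "Lwug v \<rho>'" for v \<rho>'
      using Lwug_representative[OF w'(2) that(2) representative_trans[OF w'(1) that(1)]]
        Lwug_representative[OF that(2) w'(2) representative_trans[OF that(1) w'(1)]] w'(3) by blast
  qed
qed

subsection \<open>Limits of Sobolev functions\<close>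

lemma pint_subseq:
  assumes "(\<lambda>n. q n) \<longlonglongrightarrow> (0::ennreal)" "\<And>k. (0::real) < e k"
  obtains r :: "nat \<Rightarrow> nat" where "strict_mono r" "\<And>k. q (r k) \<le> ennreal (e k)"
proof -
  have "\<exists>n. \<forall>m\<ge>n. q m \<le> ennreal (e k)" for k
    using order_tendstoD(2)[OF assms(1), of "ennreal (e k)"] assms(2)[of k]
    unfolding eventually_sequentially by (auto intro: less_imp_le)
  then obtain n where n: "\<And>k m. n k \<le> m \<Longrightarrow> q m \<le> ennreal (e k)" by metis
  define r where "r = rec_nat (n 0) (\<lambda>k y. max (Suc y) (n (Suc k)))"
  have "r k < r (Suc k)" "n k \<le> r k" for k by (auto simp: r_def) (cases k; simp)
  then show ?thesis using n that[of r] by (auto simp: strict_mono_Suc_iff)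
qed

text \<open>If \<open>\<Sum>\<^sub>k \<parallel>2\<^sup>k d\<^sub>k\<parallel>\<^sub>p\<^sup>p < \<infinity>\<close> then \<open>sup\<^sub>k 2\<^sup>k d\<^sub>k\<close> is \<open>p\<close>-integrable, so the integrals of \<open>d\<^sub>k\<close>
  along almost every path decay like \<open>2\<^sup>-\<^sup>k\<close>.\<close>
lemma AE_path_fast_decay:
  fixes d :: "nat \<Rightarrow> 'a \<Rightarrow> ennreal"
  assumes bm: "\<And>k. bm (d k)" and small: "\<And>k. pint (d k) \<le> ennreal ((1/2) ^ k / (2 ^ k) powr p)"
  obtains \<sigma> where "Lp_integrable_borel p \<mu> X \<sigma>" "\<And>k x. d k x \<le> ennreal ((1/2) ^ k) * \<sigma> x"
proof -
  let ?s = "\<lambda>k x. ennreal (2 ^ k) * d k x"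
  have "pint (?s k) \<le> ennreal ((1/2) ^ k)" for k
  proof -
    have "pint (?s k) = ennreal ((2 ^ k) powr p) * pint (d k)" by (rule pint_cmult[OF bm]) simp
    also have "\<dots> \<le> ennreal ((2 ^ k) powr p) * ennreal ((1/2) ^ k / (2 ^ k) powr p)"
      by (intro mult_left_mono small) simp
    also have "\<dots> = ennreal ((1/2) ^ k)" by (simp flip: ennreal_mult)
    finally show ?thesis .
  qed
  then have "(\<Sum>k. pint (?s k)) \<le> (\<Sum>k. ennreal ((1/2) ^ k))"
    by (intro suminf_le) auto
  also have "\<dots> = ennreal (\<Sum>k. (1/2) ^ k)"
    by (intro suminf_ennreal2 summable_geometric) auto
  finally have "(\<Sum>k. pint (?s k)) < \<infinity>" by (auto intro: le_less_trans)
  then have L: "Lp_integrable_borel p \<mu> X (\<lambda>x. SUP k. ?s k x)"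
    using bm by (intro Lp_SUP) (auto simp: pint_def)
  show ?thesis
  proof (rule that[OF L])
    fix k x
    have "d k x = ennreal ((1/2) ^ k) * ?s k x"
      by (simp add: mult.assoc[symmetric] ennreal_mult[symmetric] power_mult_distrib[symmetric] del: ennreal_power)
    also have "\<dots> \<le> ennreal ((1/2) ^ k) * (SUP k. ?s k x)" by (intro mult_left_mono SUP_upper) auto
    finally show "d k x \<le> ennreal ((1/2) ^ k) * (SUP k. ?s k x)" .
  qed
qed

lemma AE_subseq_limit:
  fixes f :: "nat \<Rightarrow> 'a \<Rightarrow> real"
  assumes [measurable]: "\<And>n. f n \<in> borel_measurable (restrict_space M X)" "g \<in> borel_measurable (restrict_space M X)"
    and small: "\<And>k. (\<integral>\<^sup>+x\<in>X. ennreal (\<bar>f k x - g x\<bar> powr p) \<partial>M) \<le> ennreal ((1/2) ^ k)"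
  shows "AE x\<in>X in M. (\<lambda>k. f k x) \<longlonglongrightarrow> g x"
proof -
  let ?h = "\<lambda>k x. ennreal (\<bar>f k x - g x\<bar> powr p) * indicator X x"
  have hm: "?h k \<in> borel_measurable M" for k
    using X by (subst borel_measurable_restrict_space_iff_ennreal[symmetric]) auto
  have "(\<integral>\<^sup>+x. (\<Sum>k. ?h k x) \<partial>M) = (\<Sum>k. \<integral>\<^sup>+x. ?h k x \<partial>M)" using hm by (rule nn_integral_suminf)
  also have "\<dots> \<le> (\<Sum>k. ennreal ((1/2) ^ k))" using small by (intro suminf_le) auto
  also have "\<dots> = ennreal (\<Sum>k. (1/2) ^ k)"
    by (intro suminf_ennreal2 summable_geometric) auto
  finally have "(\<integral>\<^sup>+x. (\<Sum>k. ?h k x) \<partial>M) \<noteq> \<infinity>" by (auto simp: top_unique)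
  then have "AE x in M. (\<Sum>k. ?h k x) \<noteq> \<infinity>"
    by (intro nn_integral_noteq_infinite borel_measurable_suminf_order hm)
  then show ?thesis
  proof (rule eventually_mono, intro impI)
    fix x assume "(\<Sum>k. ?h k x) \<noteq> \<infinity>" "x \<in> X"
    then have "(\<Sum>k. ennreal (\<bar>f k x - g x\<bar> powr p)) \<noteq> top" by simp
    then have "summable (\<lambda>k. \<bar>f k x - g x\<bar> powr p)" by (intro summable_suminf_not_top) auto
    then have "(\<lambda>k. \<bar>f k x - g x\<bar> powr p) \<longlonglongrightarrow> 0" by (rule summable_LIMSEQ_zero)
    then have "(\<lambda>k. (\<bar>f k x - g x\<bar> powr p) powr (1 / p)) \<longlonglongrightarrow> 0 powr (1 / p)"
      by (rule tendsto_powr'[OF _ tendsto_const]) (use p_pos in simp)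
    moreover have "(\<bar>y\<bar> powr p) powr (1 / p) = \<bar>y\<bar>" for y using p_pos by (simp add: powr_powr)
    ultimately have "(\<lambda>k. \<bar>f k x - g x\<bar>) \<longlonglongrightarrow> 0" by (simp only: powr_0)
    then show "(\<lambda>k. f k x) \<longlonglongrightarrow> g x" by (rule LIM_zero_cancel[OF tendsto_rabs_zero_cancel])
  qed
qed

text \<open>A closure theorem of Fuglede type. Along almost every path of positive length the
  increments of \<open>f (s k)\<close> are controlled by \<open>r + (1/2) ^ k * \<sigma>\<close>, so
  convergence at one typical parameter nearby forces the Cauchy property at every parameter. The
  gradients \<open>\<rho> n\<close> themselves may fail to converge; what matters is their
  asymptotic bound by \<open>r\<close>.\<close>

lemma Lwug_limit:
  fixes f :: "nat \<Rightarrow> 'a \<Rightarrow> real"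
  assumes fm: "\<And>n. f n \<in> borel_measurable (restrict_space M X)" and gm: "g \<in> borel_measurable (restrict_space M X)"
    and conv: "(\<lambda>n. \<integral>\<^sup>+x\<in>X. ennreal (\<bar>f n x - g x\<bar> powr p) \<partial>M) \<longlonglongrightarrow> 0"
    and wug: "\<And>n. Lwug (f n) (\<rho> n)" and r: "Lp_integrable_borel p \<mu> X r"
    and d: "\<And>n. bm (d n)" "(\<lambda>n. pint (d n)) \<longlonglongrightarrow> 0"
    and le: "\<And>n. AE x\<in>X in M. \<rho> n x \<le> r x + d n x"
  shows "\<exists>v. representative \<mu> X g v \<and> Lwug v r"
proof -
  \<comment> \<open>Small enough for a.e. convergence of \<open>f (s k)\<close>, being at most
    \<open>(1/2) ^ k\<close>, and exactly the bound that \<open>AE_path_fast_decay\<close> asks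
    for.\<close>
  let ?e = "\<lambda>k::nat. (1/2) ^ k / (2 ^ k) powr p"
  have half_nn: "0 \<le> (1/2 :: real)" by simp
  have epos: "0 < ?e k" and ele: "?e k \<le> (1/2) ^ k" for k
  proof -
    have "1 \<le> (2::real) ^ k" by simp
    then have "1 \<le> ((2::real) ^ k) powr p" using p by (intro ge_one_powr_ge_zero) auto
    then show "?e k \<le> (1/2) ^ k" by (simp add: divide_le_eq mult_le_cancel_left1)
  qed simp
  have "(\<lambda>n. (\<integral>\<^sup>+x\<in>X. ennreal (\<bar>f n x - g x\<bar> powr p) \<partial>M) + pint (d n)) \<longlonglongrightarrow> 0 + 0"
    by (intro tendsto_add conv d)
  then have lim0: "(\<lambda>n. (\<integral>\<^sup>+x\<in>X. ennreal (\<bar>f n x - g x\<bar> powr p) \<partial>M) + pint (d n)) \<longlonglongrightarrow> 0"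
    by simp
  obtain s :: "nat \<Rightarrow> nat" where s: "strict_mono s"
      "\<And>k. (\<integral>\<^sup>+x\<in>X. ennreal (\<bar>f (s k) x - g x\<bar> powr p) \<partial>M) + pint (d (s k)) \<le> ennreal (?e k)"
    using pint_subseq[OF lim0, of ?e] epos by blast
  have s1: "(\<integral>\<^sup>+x\<in>X. ennreal (\<bar>f (s k) x - g x\<bar> powr p) \<partial>M) \<le> ennreal ((1/2) ^ k)" for k
    by (rule order_trans[OF order_trans[OF add_increasing2[OF zero_le order_refl] s(2)] ennreal_leI[OF ele]])
  have s2: "pint (d (s k)) \<le> ennreal (?e k)" for k
    by (rule order_trans[OF add_increasing[OF zero_le order_refl] s(2)])
  obtain \<sigma> where \<sigma>: "Lp_integrable_borel p \<mu> X \<sigma>" "\<And>k x. d (s k) x \<le> ennreal ((1/2) ^ k) * \<sigma> x"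
    using AE_path_fast_decay[of "\<lambda>k. d (s k)"] d(1) s2 by blast
  have AEc: "AE x\<in>X in M. (\<lambda>k. f (s k) x) \<longlonglongrightarrow> g x"
    by (rule AE_subseq_limit[OF fm gm s1])
  from AE_borel_hull[OF this] obtain N where N: "N \<in> sets borel" "N \<in> null_sets M"
      "\<And>x. x \<notin> N \<Longrightarrow> x \<in> X \<longrightarrow> (\<lambda>k. f (s k) x) \<longlonglongrightarrow> g x"
    by blast
  \<comment> \<open>\<open>lim\<close> has an arbitrary value at points of divergence; almost every
    path of positive length meets none of them.\<close>
  define v where "v x = lim (\<lambda>k. f (s k) x)" for x
  have rep: "representative \<mu> X g v"
    unfolding representative_def
  proof (rule eventually_mono[OF AEc], intro impI)
    fix x assume "x \<in> X \<longrightarrow> (\<lambda>k. f (s k) x) \<longlonglongrightarrow> g x" "x \<in> X"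
    then have "(\<lambda>k. f (s k) x) \<longlonglongrightarrow> g x" by (rule mp)
    then show "v x = g x" unfolding v_def by (rule limI)
  qed
  define q where "q k x = r x + ennreal ((1/2) ^ k) * \<sigma> x" for k x
  have L\<sigma>: "Lp_integrable_borel p \<mu> X (\<lambda>x. ennreal ((1/2) ^ k) * \<sigma> x)" for k
  proof -
    have "bm (\<lambda>x. ennreal ((1/2) ^ k) * \<sigma> x)"
      using Lp_bm[OF \<sigma>(1)] by measurable
    moreover have "pint (\<lambda>x. ennreal ((1/2) ^ k) * \<sigma> x) < \<infinity>"
      using \<sigma>(1) unfolding pint_cmult[OF Lp_bm[OF \<sigma>(1)] zero_le_power[OF half_nn]]
      by (simp add: Lp_iff ennreal_mult_less_top)
    ultimately show ?thesis by (simp only: Lp_iff)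
  qed
  have Lq: "Lp_integrable_borel p \<mu> X (q k)" for k
    unfolding q_def by (rule Lp_add[OF r L\<sigma>])
  have wq: "Lwug (f (s k)) (q k)" for k
  proof (rule Lwug_mono_AE[OF wug Lq])
    show "AE x\<in>X in M. \<rho> (s k) x \<le> q k x"
      using le[of "s k"]
    proof (rule eventually_mono, intro impI)
      fix x assume "x \<in> X \<longrightarrow> \<rho> (s k) x \<le> r x + d (s k) x" "x \<in> X"
      then show "\<rho> (s k) x \<le> q k x"
        using add_left_mono[OF \<sigma>(2)[of k x], of "r x"] unfolding q_def by (blast intro: order_trans)
    qed
  qed
  note bmr = Lp_bm[OF r] and bms = Lp_bm[OF \<sigma>(1)]
  have "Lwug v r"
  proof (rule LwugI[OF r])
    show "AE_path (\<lambda>a b \<gamma>. ennreal \<bar>v (\<gamma> a) - v (\<gamma> b)\<bar> \<le> path_int r a b \<gamma>)"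
      using AE_path_conj[OF AE_path_null[OF N(2,1)] AE_path_conj[OF AE_path_finite[OF r]
        AE_path_conj[OF AE_path_finite[OF \<sigma>(1)] AE_path_all_countable[OF Lwug_AE_path[OF wq]]]]]
    proof (rule AE_path_mono)
      fix a b \<gamma> assume path: "(a, b, \<gamma>) \<in> paths_in X" and "rectifiable_path a b \<gamma>"
        and *: "(AE t in length_measure a b \<gamma>. \<gamma> t \<notin> N) \<and> path_int r a b \<gamma> < \<infinity> \<and> path_int \<sigma> a b \<gamma> < \<infinity> \<and>
          (\<forall>k. path_int (q k) a b \<gamma> < \<infinity> \<and> (\<forall>s' t. a \<le> s' \<longrightarrow> s' \<le> t \<longrightarrow> t \<le> b \<longrightarrow>
            ennreal \<bar>f (s k) (\<gamma> s') - f (s k) (\<gamma> t)\<bar> \<le> path_int (q k) s' t \<gamma>))"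
      then interpret rectifiable_path a b \<gamma> by simp
      define P where "P = enn2real (path_int \<sigma> a b \<gamma>)"
      have P: "ennreal P = path_int \<sigma> a b \<gamma>" "0 \<le> P" using * by (auto simp: P_def)
      have qle: "path_int (q k) s' t \<gamma> \<le> path_int r s' t \<gamma> + ennreal ((1/2) ^ k * P)"
        if st: "a \<le> s'" "s' \<le> t" "t \<le> b" for k s' t
      proof -
        note path' = paths_in_subpath[OF path st]
        have "path_int (q k) s' t \<gamma> = path_int r s' t \<gamma> + ennreal ((1/2) ^ k) * path_int \<sigma> s' t \<gamma>"
          unfolding q_def using path_int_add[OF path' bmr, of "\<lambda>x. ennreal ((1/2) ^ k) * \<sigma> x"]
            path_int_cmult[OF path' bms, of "(1/2)^k"] bms by simp
        also have "\<dots> \<le> path_int r s' t \<gamma> + ennreal ((1/2) ^ k) * path_int \<sigma> a b \<gamma>"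
          by (intro add_left_mono mult_left_mono path_int_subpath_le[OF path bms st]) simp
        also have "\<dots> = path_int r s' t \<gamma> + ennreal ((1/2) ^ k * P)" using P by (simp add: ennreal_mult)
        finally show ?thesis .
      qed
      have Pk: "(\<lambda>k. (1/2) ^ k * P) \<longlonglongrightarrow> 0"
        by (intro tendsto_mult_left_zero LIMSEQ_power_zero) simp
      show "ennreal \<bar>v (\<gamma> a) - v (\<gamma> b)\<bar> \<le> path_int r a b \<gamma>"
      proof (cases "len a b = 0")
        case True
        then have "\<gamma> a = \<gamma> b" using dist_le_len[of a b] le by simp
        then show ?thesis by simp
      next
        case False
        then have pos: "0 < len a b" using len_nonneg[of a b] by linarith
        have lim: "(\<lambda>k. f (s k) (\<gamma> t0)) \<longlonglongrightarrow> v (\<gamma> t0)" if t0: "t0 \<in> {a..b}" for t0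
        proof -
          have "Cauchy (\<lambda>k. f (s k) (\<gamma> t0))"
          proof (rule CauchyI)
            fix e :: real assume "0 < e"
            then have e6: "0 < e / 6" by simp
            obtain t where t: "t \<in> {a..b}" "\<gamma> t \<notin> N" "path_int r (min t0 t) (max t0 t) \<gamma> < e / 6"
              using exists_close_typical[OF path bmr conjunct1[OF *] pos _ t0 e6] * by blast
            let ?s = "min t0 t" and ?t = "max t0 t"
            have st: "a \<le> ?s" "?s \<le> ?t" "?t \<le> b" using t t0 by auto
            have ct: "(\<lambda>k. f (s k) (\<gamma> t)) \<longlonglongrightarrow> g (\<gamma> t)"
              using N(3)[OF t(2)] paths_in_mem[OF path t(1)] by simp
            have "\<forall>\<^sub>F k in sequentially. (1/2) ^ k * P < e / 6 \<and> \<bar>f (s k) (\<gamma> t) - g (\<gamma> t)\<bar> < e / 6"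
              using order_tendstoD(2)[OF Pk e6] tendstoD[OF ct e6]
              by eventually_elim (auto simp: dist_real_def)
            then obtain K where K: "\<And>k. k \<ge> K \<Longrightarrow> (1/2) ^ k * P < e / 6 \<and> \<bar>f (s k) (\<gamma> t) - g (\<gamma> t)\<bar> < e / 6"
              by (auto simp: eventually_sequentially)
            have near: "\<bar>f (s k) (\<gamma> t0) - g (\<gamma> t)\<bar> < e / 2" if "k \<ge> K" for k
            proof -
              have "ennreal \<bar>f (s k) (\<gamma> ?s) - f (s k) (\<gamma> ?t)\<bar> \<le> path_int r ?s ?t \<gamma> + ennreal ((1/2) ^ k * P)"
                using * st qle[OF st, of k] by (blast intro: order_trans)
              also have "\<dots> \<le> ennreal (e / 6) + ennreal ((1/2) ^ k * P)"
                using t(3) by (intro add_right_mono) auto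
              also have "\<dots> = ennreal (e / 6 + (1/2) ^ k * P)" using \<open>0 < e\<close> P by (intro ennreal_plus[symmetric]) auto
              finally have "\<bar>f (s k) (\<gamma> ?s) - f (s k) (\<gamma> ?t)\<bar> \<le> e / 6 + (1/2) ^ k * P"
                using \<open>0 < e\<close> P by (subst (asm) ennreal_le_iff) auto
              then have "\<bar>f (s k) (\<gamma> t0) - f (s k) (\<gamma> t)\<bar> \<le> e / 6 + (1/2) ^ k * P"
                by (cases "t0 \<le> t") (auto simp: abs_minus_commute)
              then show ?thesis using K[OF that] by linarith
            qed
            show "\<exists>K. \<forall>m\<ge>K. \<forall>n\<ge>K. norm (f (s m) (\<gamma> t0) - f (s n) (\<gamma> t0)) < e"
            proof (intro exI allI impI)
              fix m n assume "m \<ge> K" "n \<ge> K"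
              then show "norm (f (s m) (\<gamma> t0) - f (s n) (\<gamma> t0)) < e"
                using near[of m] near[of n] unfolding real_norm_def by linarith
            qed
          qed
          then show ?thesis unfolding v_def
            by (simp add: Cauchy_convergent_iff convergent_LIMSEQ_iff)
        qed
        have A: "(\<lambda>k. ennreal \<bar>f (s k) (\<gamma> a) - f (s k) (\<gamma> b)\<bar>) \<longlonglongrightarrow> ennreal \<bar>v (\<gamma> a) - v (\<gamma> b)\<bar>"
          using le by (intro tendsto_ennrealI tendsto_rabs tendsto_diff lim) auto
        have B: "(\<lambda>k. path_int r a b \<gamma> + ennreal ((1/2) ^ k * P)) \<longlonglongrightarrow> path_int r a b \<gamma> + ennreal 0"
          by (intro tendsto_add tendsto_const tendsto_ennrealI Pk)
        have C: "ennreal \<bar>f (s k) (\<gamma> a) - f (s k) (\<gamma> b)\<bar> \<le> path_int r a b \<gamma> + ennreal ((1/2) ^ k * P)" for k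
          using * le qle[of a b k] by (blast intro: order_trans order_refl)
        have "ennreal \<bar>v (\<gamma> a) - v (\<gamma> b)\<bar> \<le> path_int r a b \<gamma> + ennreal 0"
          by (rule LIMSEQ_le[OF A B]) (use C in blast)
        then show ?thesis by simp
      qed
    qed
  qed
  with rep show ?thesis by blast
qed

end

section \<open>Extension from an almost open set to its closure\<close>

lemma (in rectifiable_path) path_int_const:
  assumes "0 \<le> c" shows "path_int (\<lambda>_. ennreal c) a b \<gamma> = ennreal (c * len a b)"
  using emeasure_lm_Icc[of a b] le assms
  by (simp add: path_int_eq nn_integral_cmult_indicator ennreal_mult)

lemma (in rectifiable_path) lipschitz_along_path:
  assumes "L-lipschitz_on X v" "(a, b, \<gamma>) \<in> paths_in X" "a \<le> s" "s \<le> t" "t \<le> b"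
  shows "ennreal \<bar>v (\<gamma> s) - v (\<gamma> t)\<bar> \<le> path_int (\<lambda>_. ennreal L) s t \<gamma>"
proof -
  interpret S: rectifiable_path s t \<gamma> by (rule subpath[OF assms(3-5)])
  have L: "0 \<le> L" using assms(1) by (rule lipschitz_on_nonneg)
  have "dist (v (\<gamma> s)) (v (\<gamma> t)) \<le> L * dist (\<gamma> s) (\<gamma> t)"
    using assms by (intro lipschitz_onD[OF assms(1)] paths_in_mem[OF assms(2)]) auto
  also have "\<dots> \<le> L * len s t"
    using L dist_le_len[OF assms(3-5)] by (intro mult_left_mono)
  finally show ?thesis unfolding S.path_int_const[OF L] by (simp add: dist_real_def ennreal_leI)
qed

lemma epowr_tendsto_0:
  assumes "(q \<longlongrightarrow> 0) F" "0 < a"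
  shows "((\<lambda>n. epowr (q n) a) \<longlongrightarrow> 0) F"
proof (rule order_tendstoI)
  fix e :: ennreal assume "0 < e"
  then obtain e' where e': "0 < e'" "e' < e" using dense by blast
  then have "0 < epowr e' (1 / a)" by (metis epowr_eq_0_iff not_gr_zero)
  from order_tendstoD(2)[OF assms(1) this] show "\<forall>\<^sub>F n in F. epowr (q n) a < e"
  proof eventually_elim
    case (elim n)
    then have "epowr (q n) a \<le> epowr (epowr e' (1 / a)) a" using assms(2) by (intro epowr_mono) auto
    then show ?case using e' assms(2) by (auto simp: epowr_epowr)
  qed
qed simp

context mm_subspace begin

lemma Lwug_cong:
  assumes "Lwug u \<rho>" "\<And>x. x \<in> X \<Longrightarrow> u x = v x"
  shows "Lwug v \<rho>"
proof (rule LwugI[OF Lwug_Lp[OF assms(1)]])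
  show "AE_path (\<lambda>a b \<gamma>. ennreal \<bar>v (\<gamma> a) - v (\<gamma> b)\<bar> \<le> path_int \<rho> a b \<gamma>)"
    using Lwug_AE_path[OF assms(1)]
  proof (rule AE_path_mono)
    fix a b \<gamma> assume *: "(a, b, \<gamma>) \<in> paths_in X" "rectifiable_path a b \<gamma>"
      "path_int \<rho> a b \<gamma> < \<infinity> \<and> (\<forall>s t. a \<le> s \<longrightarrow> s \<le> t \<longrightarrow> t \<le> b \<longrightarrow>
         ennreal \<bar>u (\<gamma> s) - u (\<gamma> t)\<bar> \<le> path_int \<rho> s t \<gamma>)"
    then have "a \<le> b" by (simp add: rectifiable_path_def)
    then have "ennreal \<bar>u (\<gamma> a) - u (\<gamma> b)\<bar> \<le> path_int \<rho> a b \<gamma>" using *(3) by simp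
    moreover have "\<gamma> a \<in> X" "\<gamma> b \<in> X" using paths_in_mem[OF *(1)] \<open>a \<le> b\<close> by auto
    ultimately show "ennreal \<bar>v (\<gamma> a) - v (\<gamma> b)\<bar> \<le> path_int \<rho> a b \<gamma>" by (simp add: assms(2))
  qed
qed

lemma Lp_AE_finite:
  assumes "Lp_integrable_borel p \<mu> X \<rho>"
  shows "AE x\<in>X in M. \<rho> x < \<infinity>"
proof -
  have "AE x in M. epowr (\<rho> x) p * indicator X x \<noteq> \<infinity>"
    using assms by (intro nn_integral_noteq_infinite measurable_on_X bm_epowr) (auto simp: Lp_integrable_borel_def)
  then show ?thesis by eventually_elim (auto simp: less_top)
qed

text \<open>Outside the ball containing the support the function is locally constant along the path.\<close>
lemma lipschitz_bounded_support_Lwug: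
  assumes "v \<in> lipschitz_bounded_support X"
  shows "\<exists>\<rho>. Lwug v \<rho>"
proof -
  obtain L where L: "L-lipschitz_on X v" using assms by (auto simp: lipschitz_bounded_support_def)
  then have L0: "0 \<le> L" by (rule lipschitz_on_nonneg)
  have "bounded {x \<in> X. v x \<noteq> 0}" using assms by (auto simp: lipschitz_bounded_support_def)
  then obtain x0 R where R: "{x \<in> X. v x \<noteq> 0} \<subseteq> cball x0 R" by (auto simp: bounded_subset_cball)
  let ?\<rho> = "\<lambda>x. ennreal L * indicator (cball x0 R) x"
  have [measurable]: "cball x0 R \<in> sets borel" by simp
  have bm: "bm ?\<rho>" by (intro measurable_restrict_space1) measurable
  have "(\<integral>\<^sup>+x\<in>X. epowr (?\<rho> x) p \<partial>M) \<le> (\<integral>\<^sup>+x. ennreal (L powr p) * indicator (ball x0 (R + 1)) x \<partial>M)"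
    using L0 by (intro nn_integral_mono) (auto split: split_indicator)
  also have "\<dots> < \<infinity>"
    using emeasure_ball_finite[of x0 "R + 1"] borel_sets_M[of "ball x0 (R + 1)"]
    by (simp add: nn_integral_cmult_indicator ennreal_mult_less_top)
  finally have Lp: "Lp_integrable_borel p \<mu> X ?\<rho>" using bm by (simp add: Lp_integrable_borel_def)
  have "Lwug v ?\<rho>"
  proof (rule LwugI[OF Lp])
    show "AE_path (\<lambda>a b \<gamma>. ennreal \<bar>v (\<gamma> a) - v (\<gamma> b)\<bar> \<le> path_int ?\<rho> a b \<gamma>)"
      using AE_path_finite[OF Lp]
    proof (rule AE_path_mono)
      fix a b \<gamma> assume path: "(a, b, \<gamma>) \<in> paths_in X" and "rectifiable_path a b \<gamma>"
      then interpret rectifiable_path a b \<gamma> by simp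
      let ?K = "{a..b} \<inter> \<gamma> -` cball x0 R"
      have cl: "closed ?K" by (rule continuous_closed_preimage[OF cont]) auto
      have cb: "(\<lambda>_. ennreal L) \<in> borel_measurable (restrict_space borel X)" by simp
      \<comment> \<open>The zero measure dominates on the open complement of \<open>?K\<close>: on
        intervals of \<open>{a..b}\<close> that miss \<open>?K\<close>, \<open>v\<close> vanishes
        along the path.\<close>
      have "ennreal \<bar>(v \<circ> \<gamma>) a - (v \<circ> \<gamma>) b\<bar>
        \<le> emeasure (null_measure borel) (- ?K \<inter> {a<..b}) + emeasure (dm (\<lambda>_. ennreal L)) ({a<..b} - - ?K)"
      proof (rule dist_le_measure_open_split)
        show "open (- ?K)" using cl by (rule open_Compl)
        show "emeasure (dm (\<lambda>_. ennreal L)) UNIV \<noteq> \<infinity>"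
          by (simp add: emeasure_dm_UNIV[OF path cb] path_int_const[OF L0])
        fix s t assume st: "a \<le> s" "s \<le> t" "t \<le> b"
        show "ennreal \<bar>(v \<circ> \<gamma>) s - (v \<circ> \<gamma>) t\<bar> \<le> emeasure (dm (\<lambda>_. ennreal L)) {s<..t}"
          using lipschitz_along_path[OF L path st] by (simp add: emeasure_dm_Ioc[OF path cb st])
        assume K: "{s..t} \<subseteq> - ?K"
        have "v (\<gamma> r) = 0" if "r \<in> {s..t}" for r
        proof -
          have "r \<in> {a..b}" "\<gamma> r \<notin> cball x0 R" using K that st by auto
          then show ?thesis using R paths_in_mem[OF path] by blast
        qed
        then show "ennreal \<bar>(v \<circ> \<gamma>) s - (v \<circ> \<gamma>) t\<bar> \<le> emeasure (null_measure borel) {s<..t}"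
          using st by simp
      qed (use le in auto)
      also have "\<dots> = emeasure (dm (\<lambda>_. ennreal L)) ({a<..b} - - ?K)" by simp
      also have "\<dots> = (\<integral>\<^sup>+t\<in>({a<..b} - - ?K). ennreal L * indicator {a..b} t \<partial>lm)"
      proof (rule emeasure_dm[OF path cb])
        have "?K \<in> sets borel" using cl by (rule borel_closed)
        then have "{a<..b} \<inter> ?K \<in> sets borel" by (rule sets.Int[rotated]) simp
        moreover have "{a<..b} - - ?K = {a<..b} \<inter> ?K" by blast
        ultimately show "{a<..b} - - ?K \<in> sets borel" by (simp only:)
      qed
      also have "\<dots> \<le> path_int ?\<rho> a b \<gamma>"
        unfolding path_int_eq by (intro nn_integral_mono) (auto split: split_indicator)
      finally show "ennreal \<bar>v (\<gamma> a) - v (\<gamma> b)\<bar> \<le> path_int ?\<rho> a b \<gamma>" by simp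
    qed
  qed
  then show ?thesis by blast
qed

end

section \<open>Passage to measurable subsets\<close>

context mm_space begin

lemma mm_subspaceI: "X \<in> sets M \<Longrightarrow> mm_subspace p \<mu> X"
  by (simp add: mm_subspace_def mm_subspace_axioms_def mm_space_axioms)

lemma Lp_integrable_borel_subset:
  assumes "Lp_integrable_borel p \<mu> X \<rho>" "Y \<subseteq> X"
  shows "Lp_integrable_borel p \<mu> Y \<rho>"
proof -
  have "(\<integral>\<^sup>+x\<in>Y. epowr (\<rho> x) p \<partial>M) \<le> (\<integral>\<^sup>+x\<in>X. epowr (\<rho> x) p \<partial>M)"
    using assms(2) by (intro nn_integral_mono) (auto split: split_indicator)
  moreover have "\<rho> \<in> borel_measurable (restrict_space borel Y)"
    using assms by (auto simp: Lp_integrable_borel_def intro: measurable_restrict_mono)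
  ultimately show ?thesis using assms(1) unfolding Lp_integrable_borel_def by (auto intro: le_less_trans)
qed

lemma Lwug_subset:
  assumes "Lp_weak_upper_gradient p \<mu> X u \<rho>" "Y \<subseteq> X" "X \<in> sets M" "Y \<in> sets M"
  shows "Lp_weak_upper_gradient p \<mu> Y u \<rho>"
proof -
  interpret X: mm_subspace p \<mu> X by (rule mm_subspaceI[OF assms(3)])
  interpret Y: mm_subspace p \<mu> Y by (rule mm_subspaceI[OF assms(4)])
  have "X.AE_path (\<lambda>a b \<gamma>. ennreal \<bar>u (\<gamma> a) - u (\<gamma> b)\<bar> \<le> path_int \<rho> a b \<gamma>)"
    using assms(1) by (simp add: Lp_weak_upper_gradient_def X.weak_upper_gradient_iff)
  then have "Y.AE_path (\<lambda>a b \<gamma>. ennreal \<bar>u (\<gamma> a) - u (\<gamma> b)\<bar> \<le> path_int \<rho> a b \<gamma>)"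
    unfolding X.AE_path_def Y.AE_path_def
    using Lp_integrable_borel_subset[OF _ assms(2)] paths_in_mono[OF assms(2)] by blast
  then show ?thesis
    by (rule Y.LwugI[OF Lp_integrable_borel_subset[OF X.Lwug_Lp[OF assms(1)] assms(2)]])
qed

end

section \<open>Zero extension across a null boundary\<close>

locale mm_closure = mm_space +
  fixes \<Omega> assumes \<Omega>: "\<Omega> \<in> sets M" and null_boundary: "\<mu> (closure \<Omega> - \<Omega>) = 0"
begin

sublocale O: mm_subspace p \<mu> \<Omega>
  by (rule mm_subspaceI[OF \<Omega>])

sublocale C: mm_subspace p \<mu> "closure \<Omega>"
  by (rule mm_subspaceI) (simp add: borel_sets_M)

text \<open>\<open>\<Omega>\<close> is only Caratheodory measurable, whereas gradients are Borel;
  extending them by zero off a Borel subset of full measure keeps them Borel.\<close>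

lemma borel_kernel:
  obtains B where "B \<in> sets borel" "B \<subseteq> \<Omega>" "closure \<Omega> - B \<in> null_sets M"
proof -
  obtain H where H: "H \<in> sets borel" "closure \<Omega> - \<Omega> \<subseteq> H" "H \<in> null_sets M"
    using null_sets_borel_hull[OF null_setsI_M[OF null_boundary]] by metis
  show ?thesis
  proof (rule that)
    show "closure \<Omega> - H \<in> sets borel" using H by auto
    show "closure \<Omega> - H \<subseteq> \<Omega>" using H(2) by auto
    show "closure \<Omega> - (closure \<Omega> - H) \<in> null_sets M"
      by (rule null_sets_subset[OF H(3)]) (use H in \<open>auto simp: borel_sets_M\<close>)
  qed
qed

lemma extend_by_zero:
  assumes B: "B \<in> sets borel" "B \<subseteq> \<Omega>" and \<rho>: "Lp_integrable_borel p \<mu> \<Omega> \<rho>"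
  shows "Lp_integrable_borel p \<mu> (closure \<Omega>) (\<lambda>x. \<rho> x * indicator B x)"
proof -
  have "\<rho> \<in> borel_measurable (restrict_space borel B)"
    using \<rho> B(2) by (auto simp: Lp_integrable_borel_def intro: measurable_restrict_mono)
  then have "(\<lambda>x. \<rho> x * indicator B x) \<in> borel_measurable borel"
    using B(1) by (subst borel_measurable_restrict_space_iff_ennreal[symmetric]) auto
  then have "C.bm (\<lambda>x. \<rho> x * indicator B x)" by (rule measurable_restrict_space1)
  moreover have "(\<integral>\<^sup>+x\<in>closure \<Omega>. epowr (\<rho> x * indicator B x) p \<partial>M) \<le> (\<integral>\<^sup>+x\<in>\<Omega>. epowr (\<rho> x) p \<partial>M)"
    using B(2) by (intro nn_integral_mono) (auto split: split_indicator)
  ultimately show ?thesis using \<rho> by (auto simp: Lp_integrable_borel_def intro: le_less_trans)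
qed

text \<open>Up to a null set of parameters, a typical path in \<open>closure \<Omega>\<close> runs in \<open>\<Omega>\<close> on a relatively open
  set; the Lipschitz bound takes care of the null rest.\<close>
lemma extend_Lwug:
  assumes B: "B \<in> sets borel" "B \<subseteq> \<Omega>" "closure \<Omega> - B \<in> null_sets M"
    and f: "L-lipschitz_on (closure \<Omega>) f" and g: "O.Lwug f g"
    and pao: "path_almost_open p \<mu> \<Omega> (closure \<Omega>)"
  shows "C.Lwug f (\<lambda>x. g x * indicator B x)"
proof -
  let ?X = "closure \<Omega>" and ?E = "\<lambda>h x. h x * indicator B x :: ennreal"
  obtain \<sigma> where \<sigma>: "Lp_integrable_borel p \<mu> \<Omega> \<sigma>"
    "\<And>a b \<gamma>. (a, b, \<gamma>) \<in> paths_in \<Omega> \<Longrightarrow> path_int \<sigma> a b \<gamma> < \<infinity> \<Longrightarrow>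
       ennreal \<bar>f (\<gamma> a) - f (\<gamma> b)\<bar> \<le> path_int g a b \<gamma>"
    using g by (auto simp: Lp_weak_upper_gradient_def O.weak_upper_gradient_iff O.AE_path_def)
  note Lg = extend_by_zero[OF B(1,2) O.Lwug_Lp[OF g]] and L\<sigma> = extend_by_zero[OF B(1,2) \<sigma>(1)]
  note bg = C.Lp_bm[OF Lg] and b\<sigma> = C.Lp_bm[OF L\<sigma>]
  have L0: "0 \<le> L" using f by (rule lipschitz_on_nonneg)
  have cb: "C.bm (\<lambda>_. ennreal L)" by simp
  have open_path: "C.AE_path (\<lambda>a b \<gamma>. \<not> \<gamma> constant_on {a..b} \<longrightarrow> rectifiable a b \<gamma> \<longrightarrow>
    (\<exists>U N. openin (top_of_set {a..b}) U \<and> N \<in> null_sets (completion (length_measure a b \<gamma>)) \<and>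
       {t\<in>{a..b}. \<gamma> t \<in> \<Omega>} = U \<union> N))"
    using pao unfolding path_almost_open_def C.AE_path_negligible .
  have "?X - B \<in> sets borel" using B(1) by auto
  note null = C.AE_path_null[OF B(3) this]
  show ?thesis
  proof (rule C.LwugI[OF Lg])
    show "C.AE_path (\<lambda>a b \<gamma>. ennreal \<bar>f (\<gamma> a) - f (\<gamma> b)\<bar> \<le> path_int (?E g) a b \<gamma>)"
      using C.AE_path_conj[OF open_path C.AE_path_conj[OF C.AE_path_subpaths[OF null] C.AE_path_finite[OF L\<sigma>]]]
    proof (rule C.AE_path_mono)
      fix a b \<gamma> assume path: "(a, b, \<gamma>) \<in> paths_in ?X" and "rectifiable_path a b \<gamma>"
        and *: "(\<not> \<gamma> constant_on {a..b} \<longrightarrow> rectifiable a b \<gamma> \<longrightarrow>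
          (\<exists>U N. openin (top_of_set {a..b}) U \<and> N \<in> null_sets (completion (length_measure a b \<gamma>)) \<and>
             {t\<in>{a..b}. \<gamma> t \<in> \<Omega>} = U \<union> N)) \<and>
          (\<forall>s t. a \<le> s \<longrightarrow> s \<le> t \<longrightarrow> t \<le> b \<longrightarrow> (AE r in length_measure s t \<gamma>. \<gamma> r \<notin> ?X - B)) \<and>
          path_int (?E \<sigma>) a b \<gamma> < \<infinity>"
      then interpret rectifiable_path a b \<gamma> by simp
      show "ennreal \<bar>f (\<gamma> a) - f (\<gamma> b)\<bar> \<le> path_int (?E g) a b \<gamma>"
      proof (cases "\<gamma> constant_on {a..b}")
        case True
        then have "\<gamma> a = \<gamma> b" using le unfolding constant_on_def by fastforce
        then show ?thesis by simp
      next
        case False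
        then obtain U N where UN: "openin (top_of_set {a..b}) U" "N \<in> null_sets (completion lm)"
            "{t\<in>{a..b}. \<gamma> t \<in> \<Omega>} = U \<union> N"
          using * rect by blast
        obtain V where V: "open V" "U = {a..b} \<inter> V" using UN(1) by (auto simp: openin_open)
        have "ennreal \<bar>(f \<circ> \<gamma>) a - (f \<circ> \<gamma>) b\<bar>
          \<le> emeasure (dm (?E g)) (V \<inter> {a<..b}) + emeasure (dm (\<lambda>_. ennreal L)) ({a<..b} - V)"
        proof (rule dist_le_measure_open_split)
          show "emeasure (dm (\<lambda>_. ennreal L)) UNIV \<noteq> \<infinity>"
            by (simp add: emeasure_dm_UNIV[OF path cb] path_int_const[OF L0])
          fix s t assume st: "a \<le> s" "s \<le> t" "t \<le> b"
          show "ennreal \<bar>(f \<circ> \<gamma>) s - (f \<circ> \<gamma>) t\<bar> \<le> emeasure (dm (\<lambda>_. ennreal L)) {s<..t}"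
            using lipschitz_along_path[OF f path st] by (simp add: emeasure_dm_Ioc[OF path cb st])
          assume sub: "{s..t} \<subseteq> V"
          interpret S: rectifiable_path s t \<gamma> by (rule subpath[OF st])
          have in\<Omega>: "\<gamma> r \<in> \<Omega>" if "r \<in> {s..t}" for r
          proof -
            have "r \<in> U" using that sub st V(2) by auto
            then show ?thesis using UN(3) by blast
          qed
          have path\<Omega>: "(s, t, \<gamma>) \<in> paths_in \<Omega>"
            using paths_in_subpath[OF path st] in\<Omega> by (auto simp: paths_in_def)
          \<comment> \<open>Almost every parameter of the subpath is mapped into \<open>B\<close>,
            where the zero extension agrees with the original function.\<close>
          have eq: "path_int (?E h) s t \<gamma> = path_int h s t \<gamma>" for h
          proof -
            have AE: "AE r in S.lm. \<gamma> r \<notin> ?X - B" using * st by blast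
            show ?thesis unfolding S.path_int_eq
            proof (rule nn_integral_cong_AE, use AE in eventually_elim)
              case (elim r)
              then show ?case using in\<Omega>[of r] closure_subset[of \<Omega>] by (auto split: split_indicator)
            qed
          qed
          have "path_int \<sigma> s t \<gamma> < \<infinity>"
            using path_int_subpath_le[OF path b\<sigma> st] * unfolding eq by (auto intro: le_less_trans)
          from \<sigma>(2)[OF path\<Omega> this]
          show "ennreal \<bar>(f \<circ> \<gamma>) s - (f \<circ> \<gamma>) t\<bar> \<le> emeasure (dm (?E g)) {s<..t}"
            by (simp add: emeasure_dm_Ioc[OF path bg st] eq)
        qed (use le V in auto)
        \<comment> \<open>A parameter outside \<open>V\<close> is either mapped into
          \<open>closure \<Omega> - B\<close> or lies in \<open>N\<close>, and both happen only on a
          set of length zero.\<close>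
        also have "emeasure (dm (\<lambda>_. ennreal L)) ({a<..b} - V) = 0"
        proof -
          obtain N' where N': "N' \<in> null_sets lm" "N \<subseteq> N'"
            using UN(2) by (auto simp: null_sets_completion_iff2)
          have "AE r in lm. \<gamma> r \<notin> ?X - B" using * le by blast
          moreover have "AE r in lm. r \<notin> N'" using N'(1) by (rule AE_not_in)
          ultimately have "AE r in lm. r \<notin> {a<..b} - V"
          proof eventually_elim
            case (elim r)
            show ?case
            proof
              assume r: "r \<in> {a<..b} - V"
              then have "\<gamma> r \<in> \<Omega>" using elim(1) B(2) paths_in_mem[OF path, of r] by auto
              then have "r \<in> U \<union> N" using r UN(3) by fastforce
              then show False using r V(2) elim(2) N'(2) by auto
            qed
          qed
          then have "{a<..b} - V \<in> null_sets lm"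
            using V(1) by (subst AE_iff_null_sets) auto
          then show ?thesis using null_dm[OF path cb] by (auto dest: null_setsD1)
        qed
        also have "emeasure (dm (?E g)) (V \<inter> {a<..b}) \<le> emeasure (dm (?E g)) UNIV"
          by (intro emeasure_mono) auto
        finally show ?thesis by (simp add: emeasure_dm_UNIV[OF path bg] add_mono)
      qed
    qed
  qed
qed

lemma Lp_norm_tendsto_0_iff:
  "(\<lambda>n. Lp_norm p \<mu> X (w n)) \<longlonglongrightarrow> 0 \<longleftrightarrow> (\<lambda>n. \<integral>\<^sup>+x\<in>X. ennreal (\<bar>w n x\<bar> powr p) \<partial>M) \<longlonglongrightarrow> 0"
proof -
  have "epowr (Lp_norm p \<mu> X (w n)) p = (\<integral>\<^sup>+x\<in>X. ennreal (\<bar>w n x\<bar> powr p) \<partial>M)" for n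
    using p_pos by (simp add: Lp_norm_def epowr_epowr)
  then show ?thesis
    using epowr_tendsto_0[of "\<lambda>n. Lp_norm p \<mu> X (w n)" sequentially p] p_pos
      epowr_tendsto_0[of "\<lambda>n. \<integral>\<^sup>+x\<in>X. ennreal (\<bar>w n x\<bar> powr p) \<partial>M" sequentially "1/p"]
    by (auto simp: Lp_norm_def)
qed

text \<open>The Lipschitz approximants extend to the closure with the zero extensions of their
  minimal gradients. \<open>Lwug_limit\<close> then makes the zero extension \<open>r\<close> of the
  minimal gradient of \<open>u\<close> a weak upper gradient of the limit; it is minimal because
  every weak upper gradient on the closure restricts to one on \<open>\<Omega>\<close>.\<close>

theorem extension_of_energy_density:
  assumes pao: "path_almost_open p \<mu> \<Omega> (closure \<Omega>)" and dens: "lipschitz_energy_dense p \<mu> \<Omega>"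
    and u: "u \<in> sobolev p \<mu> \<Omega>"
  shows "\<exists>h\<in>sobolev p \<mu> (closure \<Omega>). is_restriction \<mu> \<Omega> u h \<and>
    sobolev_norm p \<mu> (closure \<Omega>) h = sobolev_norm p \<mu> \<Omega> u"
proof -
  let ?X = "closure \<Omega>" and ?mw = "min_weak_upper_gradient p \<mu> \<Omega>"
  obtain B where B: "B \<in> sets borel" "B \<subseteq> \<Omega>" "?X - B \<in> null_sets M" by (rule borel_kernel)
  have \<Omega>X: "\<Omega> \<subseteq> ?X" by (rule closure_subset)
  obtain v0 \<rho>0 where v0: "representative \<mu> \<Omega> u v0" "O.Lwug v0 \<rho>0" and uLp: "u \<in> Lp_space p \<mu> \<Omega>"
    using u by (auto simp: sobolev_def)
  obtain gu where gu: "?mw u = (\<lambda>x. enn2real (gu x))"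
    "\<And>v \<rho>'. representative \<mu> \<Omega> u v \<Longrightarrow> O.Lwug v \<rho>' \<Longrightarrow> O.Lwug v gu \<and> (AE x\<in>\<Omega> in M. gu x \<le> \<rho>' x)"
    by (rule O.min_wug_char[OF v0]) blast
  have Lgu: "Lp_integrable_borel p \<mu> \<Omega> gu" using gu(2)[OF v0] O.Lwug_Lp by blast
  obtain v where v: "\<And>n. v n \<in> lipschitz_bounded_support \<Omega>"
    "(\<lambda>n. Lp_norm p \<mu> \<Omega> (\<lambda>x. u x - v n x) + Lp_norm p \<mu> \<Omega> (\<lambda>x. ?mw u x - ?mw (v n) x)) \<longlonglongrightarrow> 0"
    using dens u unfolding lipschitz_energy_dense_def by blast
  have lim1: "(\<lambda>n. Lp_norm p \<mu> \<Omega> (\<lambda>x. u x - v n x)) \<longlonglongrightarrow> 0"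
    by (rule tendsto_sandwich[OF _ _ tendsto_const v(2)]) (auto intro: add_increasing2)
  have lim2: "(\<lambda>n. Lp_norm p \<mu> \<Omega> (\<lambda>x. ?mw u x - ?mw (v n) x)) \<longlonglongrightarrow> 0"
    by (rule tendsto_sandwich[OF _ _ tendsto_const v(2)]) (auto intro: add_increasing)
  have "\<exists>g. ?mw (v n) = (\<lambda>x. enn2real (g x)) \<and> O.Lwug (v n) g" for n
  proof -
    have r: "representative \<mu> \<Omega> (v n) (v n)" by (simp add: representative_def)
    obtain \<rho> where \<rho>: "O.Lwug (v n) \<rho>" using O.lipschitz_bounded_support_Lwug[OF v(1)] by blast
    show ?thesis by (rule O.min_wug_char[OF r \<rho>]) (use r \<rho> in blast)
  qed
  then obtain g where g: "\<And>n. ?mw (v n) = (\<lambda>x. enn2real (g n x))" "\<And>n. O.Lwug (v n) (g n)" by metis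
  have "\<exists>f L. L-lipschitz_on ?X f \<and> (\<forall>x\<in>\<Omega>. f x = v n x)" for n
    using v(1)[of n] lipschitz_extend_closure by (auto simp: lipschitz_bounded_support_def) blast
  then obtain f L where f: "\<And>n. (L n)-lipschitz_on ?X (f n)" "\<And>n x. x \<in> \<Omega> \<Longrightarrow> f n x = v n x" by metis
  have fW: "C.Lwug (f n) (\<lambda>x. g n x * indicator B x)" for n
    by (rule extend_Lwug[OF B f(1) O.Lwug_cong[OF g(2)] pao]) (simp add: f(2))
  define h where "h x = indicator \<Omega> x * u x" for x
  define r where "r x = gu x * indicator B x" for x
  \<comment> \<open>\<open>enn2real\<close> sends infinity to 0, which is harmless:
    \<open>gu\<close> and \<open>g n\<close> are finite a.e., so \<open>g n \<le> gu + d n\<close>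
    still holds a.e. on \<open>B\<close>.\<close>
  define d where "d n x = ennreal \<bar>enn2real (gu x) - enn2real (g n x)\<bar> * indicator B x" for n x
  have hm: "h \<in> borel_measurable M"
    using uLp \<Omega> unfolding h_def Lp_space_def
    by (auto simp: borel_measurable_restrict_space_iff)
  have Lr: "Lp_integrable_borel p \<mu> ?X r" unfolding r_def by (rule extend_by_zero[OF B(1,2) Lgu])
  have "\<exists>w. representative \<mu> ?X h w \<and> C.Lwug w r"
  proof (rule C.Lwug_limit[OF _ _ _ fW Lr])
    show "f n \<in> borel_measurable (restrict_space M ?X)" for n
      using lipschitz_on_continuous_on[OF f(1)] by (intro measurable_restrict_M borel_measurable_continuous_on_restrict)
    show "h \<in> borel_measurable (restrict_space M ?X)" using hm by (rule measurable_restrict_space1)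
    have AE\<Omega>: "AE x in M. x \<in> ?X \<longrightarrow> x \<in> B" using AE_not_in[OF B(3)] by eventually_elim auto
    have "(\<integral>\<^sup>+x\<in>?X. ennreal (\<bar>f n x - h x\<bar> powr p) \<partial>M) = (\<integral>\<^sup>+x\<in>\<Omega>. ennreal (\<bar>u x - v n x\<bar> powr p) \<partial>M)" for n
    proof (rule nn_integral_cong_AE, use AE\<Omega> in eventually_elim)
      case (elim x)
      then show ?case using B(2) \<Omega>X by (auto simp: h_def f(2) abs_minus_commute split: split_indicator)
    qed
    then show "(\<lambda>n. \<integral>\<^sup>+x\<in>?X. ennreal (\<bar>f n x - h x\<bar> powr p) \<partial>M) \<longlonglongrightarrow> 0"
      using lim1 unfolding Lp_norm_tendsto_0_iff by simp
    show "C.bm (d n)" for n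
    proof -
      have "gu \<in> borel_measurable (restrict_space borel B)" "g n \<in> borel_measurable (restrict_space borel B)"
        using O.Lp_bm[OF Lgu] O.Lwug_bm[OF g(2)] B(2) by (auto intro: measurable_restrict_mono)
      then have "(\<lambda>x. ennreal \<bar>enn2real (gu x) - enn2real (g n x)\<bar>) \<in> borel_measurable (restrict_space borel B)"
        by measurable
      then have "d n \<in> borel_measurable borel"
        unfolding d_def using B(1) by (subst borel_measurable_restrict_space_iff_ennreal[symmetric]) auto
      then show ?thesis by (rule measurable_restrict_space1)
    qed
    have ple: "C.pint (d n) \<le> (\<integral>\<^sup>+x\<in>\<Omega>. ennreal (\<bar>?mw u x - ?mw (v n) x\<bar> powr p) \<partial>M)" for n
      unfolding C.pint_def gu(1) g(1)
      using B(2) by (intro nn_integral_mono) (auto simp: d_def split: split_indicator)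
    show "(\<lambda>n. C.pint (d n)) \<longlonglongrightarrow> 0"
    proof (rule tendsto_sandwich[OF _ _ tendsto_const lim2[unfolded Lp_norm_tendsto_0_iff]])
      show "\<forall>\<^sub>F n in sequentially. 0 \<le> C.pint (d n)" by simp
      show "\<forall>\<^sub>F n in sequentially. C.pint (d n) \<le> (\<integral>\<^sup>+x\<in>\<Omega>. ennreal (\<bar>?mw u x - ?mw (v n) x\<bar> powr p) \<partial>M)"
        using ple by (intro always_eventually allI)
    qed
    show "AE x\<in>?X in M. g n x * indicator B x \<le> r x + d n x" for n
      using O.Lp_AE_finite[OF Lgu] O.Lp_AE_finite[OF O.Lwug_Lp[OF g(2)[of n]]]
    proof eventually_elim
      case (elim x)
      show ?case
      proof (cases "x \<in> B")
        case True
        then have "gu x < \<infinity>" "g n x < \<infinity>" using elim B(2) by auto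
        then obtain c c' where c: "gu x = ennreal c" "g n x = ennreal c'" "0 \<le> c" "0 \<le> c'"
          by (cases "gu x"; cases "g n x") auto
        then show ?thesis using True by (auto simp: r_def d_def simp flip: ennreal_plus intro!: ennreal_leI)
      qed simp
    qed
  qed
  then obtain w where w: "representative \<mu> ?X h w" "C.Lwug w r" by blast
  obtain gh where gh: "min_weak_upper_gradient p \<mu> ?X h = (\<lambda>x. enn2real (gh x))"
    "\<And>v \<rho>'. representative \<mu> ?X h v \<Longrightarrow> C.Lwug v \<rho>' \<Longrightarrow> C.Lwug v gh \<and> (AE x\<in>?X in M. gh x \<le> \<rho>' x)"
    by (rule C.min_wug_char[OF w]) blast
  have hu: "h x = u x" if "x \<in> \<Omega>" for x using that by (simp add: h_def)
  have "representative \<mu> \<Omega> u w"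
    using w(1) unfolding representative_def
  proof eventually_elim
    case (elim x)
    then show ?case using \<Omega>X hu[of x] by auto
  qed
  moreover have "O.Lwug w gh"
    by (rule Lwug_subset[OF conjunct1[OF gh(2)[OF w]] \<Omega>X C.X \<Omega>])
  \<comment> \<open>With \<open>le2\<close> this squeezes \<open>gh\<close> between
    \<open>gu\<close> and \<open>r\<close>, which equals \<open>gu\<close> on
    \<open>B\<close>.\<close>
  ultimately have le1: "AE x\<in>\<Omega> in M. gu x \<le> gh x" using gu(2) by blast
  have le2: "AE x\<in>?X in M. gh x \<le> r x" using gh(2)[OF w] by blast
  have AE\<Omega>: "AE x in M. x \<in> ?X \<longrightarrow> x \<in> B" using AE_not_in[OF B(3)] by eventually_elim auto
  have n1: "Lp_norm p \<mu> ?X h = Lp_norm p \<mu> \<Omega> u"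
    unfolding Lp_norm_def using \<Omega>X p_pos
    by (intro arg_cong2[where f = epowr] nn_integral_cong) (auto simp: h_def split: split_indicator)
  have n2: "Lp_norm p \<mu> ?X (min_weak_upper_gradient p \<mu> ?X h) = Lp_norm p \<mu> \<Omega> (?mw u)"
    unfolding Lp_norm_def gh(1) gu(1)
  proof (intro arg_cong2[where f = epowr] nn_integral_cong_AE refl)
    show "AE x in M. ennreal (\<bar>enn2real (gh x)\<bar> powr p) * indicator ?X x =
      ennreal (\<bar>enn2real (gu x)\<bar> powr p) * indicator \<Omega> x"
      using le1 le2 AE\<Omega>
    proof eventually_elim
      case (elim x)
      show ?case
      proof (cases "x \<in> ?X")
        case True
        then have x: "x \<in> B" "x \<in> \<Omega>" using elim B(2) by auto
        then have "gh x = gu x" using elim True by (intro antisym) (auto simp: r_def)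
        then show ?thesis using True x by simp
      next
        case False
        then have "x \<notin> \<Omega>" using \<Omega>X by blast
        then show ?thesis using False by simp
      qed
    qed
  qed
  have "h \<in> Lp_space p \<mu> ?X"
    using uLp n1 measurable_restrict_space1[OF hm] by (simp add: Lp_space_def)
  then have "h \<in> sobolev p \<mu> ?X" using w unfolding sobolev_def by blast
  moreover have "is_restriction \<mu> \<Omega> u h" by (simp add: is_restriction_def hu)
  moreover have "sobolev_norm p \<mu> ?X h = sobolev_norm p \<mu> \<Omega> u" using n1 n2 by (simp add: sobolev_norm_def)
  ultimately show ?thesis by blast
qed

end

section \<open>Lower semicontinuous majorants\<close>

definition lsc :: "('a::topological_space \<Rightarrow> ennreal) \<Rightarrow> bool" where
  "lsc f \<longleftrightarrow> (\<forall>c. open {x. c < f x})"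

lemma lsc_SUP: "(\<And>i. i \<in> I \<Longrightarrow> lsc (f i)) \<Longrightarrow> lsc (\<lambda>x. SUP i\<in>I. f i x)"
  unfolding lsc_def less_SUP_iff by (auto simp: Collect_bex_eq)

lemma lsc_max: "lsc f \<Longrightarrow> lsc g \<Longrightarrow> lsc (\<lambda>x. max (f x) (g x))"
  unfolding lsc_def less_max_iff_disj by (auto simp: Collect_disj_eq)

lemma lsc_min: "lsc f \<Longrightarrow> lsc g \<Longrightarrow> lsc (\<lambda>x. min (f x) (g x))"
  unfolding lsc_def min_less_iff_conj by (auto simp: Collect_conj_eq)

lemma lsc_indicator: "open U \<Longrightarrow> lsc (indicator U)"
proof -
  assume "open U"
  have "{x. c < indicator U x} = (if c < 1 then U else {})" for c :: ennreal
    by (auto split: split_indicator)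
  then show ?thesis using \<open>open U\<close> by (simp add: lsc_def)
qed

lemma ennreal_less_cmult_iff: "0 < c \<Longrightarrow> c < \<infinity> \<Longrightarrow> k < c * w \<longleftrightarrow> k / c < (w::ennreal)"
  by (cases c; cases k; cases w)
    (auto simp: ennreal_mult_top divide_ennreal ennreal_less_iff ennreal_top_divide top_unique field_simps
      simp flip: ennreal_mult)

lemma lsc_cmult: "lsc f \<Longrightarrow> 0 < c \<Longrightarrow> c < \<infinity> \<Longrightarrow> lsc (\<lambda>x. c * f x)"
  unfolding lsc_def by (simp add: ennreal_less_cmult_iff)

lemma lsc_epowr:
  assumes "lsc f" "0 < a" shows "lsc (\<lambda>x. epowr (f x) a)"
proof -
  have "c < epowr y a \<longleftrightarrow> epowr c (1 / a) < y" for c y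
  proof -
    have "epowr y a \<le> c \<longleftrightarrow> y \<le> epowr c (1 / a)"
      using epowr_mono[of y "epowr c (1 / a)" a] epowr_mono[of "epowr y a" c "1 / a"] \<open>0 < a\<close>
      by (auto simp: epowr_epowr)
    then show ?thesis by (simp flip: not_le)
  qed
  then show ?thesis using assms(1) by (simp add: lsc_def)
qed

lemma lsc_borel_measurable: "lsc f \<Longrightarrow> f \<in> borel_measurable borel"
  unfolding lsc_def by (intro borel_measurableI_greater) auto

section \<open>Outer regularity and the Vitali-Caratheodory theorem\<close>

locale polish_mm_space = mm_space p \<mu> for p :: real and \<mu> :: "'a::polish_space set \<Rightarrow> ennreal"
begin

text \<open>Regularity of finite Borel measures is applied to the restrictions \<open>m n\<close> of
  \<open>M\<close> to an exhausting sequence of balls, with errors \<open>e / 2 ^ Suc n\<close> that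
  sum to \<open>e\<close>. The set \<open>A\<close> is first replaced by a Borel hull of the same
  measure.\<close>

lemma outer_open:
  assumes A: "A \<in> sets M" and "0 < e"
  shows "\<exists>U. open U \<and> A \<subseteq> U \<and> emeasure M U \<le> emeasure M A + ennreal e"
proof -
  obtain B where B: "B \<in> sets borel" "A \<subseteq> B" "\<mu> B = \<mu> A" by (rule borel_hull)
  then have MB: "emeasure M B = emeasure M A" using A by (simp add: emeasure_M borel_sets_M)
  define x0 :: 'a where "x0 = undefined"
  let ?b = "\<lambda>n::nat. ball x0 (real n)"
  define m where "m n = density (distr M borel (\<lambda>x. x)) (indicator (?b n))" for n
  have id: "(\<lambda>x. x) \<in> measurable M borel" using borel_sets_M by (auto simp: measurable_def)
  have em: "emeasure (m n) S = emeasure M (S \<inter> ?b n)" if S: "S \<in> sets borel" for S n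
  proof -
    have [measurable]: "?b n \<in> sets borel" by simp
    have "emeasure (m n) S = (\<integral>\<^sup>+x. indicator (?b n) x * indicator S x \<partial>distr M borel (\<lambda>x. x))"
      using S unfolding m_def by (intro emeasure_density) auto
    also have "\<dots> = (\<integral>\<^sup>+x. indicator (S \<inter> ?b n) x \<partial>distr M borel (\<lambda>x. x))"
      by (intro nn_integral_cong) (simp add: indicator_inter_arith mult.commute)
    also have "\<dots> = emeasure M (S \<inter> ?b n)"
      using S id by (subst nn_integral_indicator) (auto simp: emeasure_distr)
    finally show ?thesis .
  qed
  have "\<exists>U. open U \<and> B \<inter> ?b n \<subseteq> U \<and> emeasure M (U \<inter> ?b n - B) \<le> ennreal (e / 2 ^ Suc n)" for n
  proof -
    let ?B = "B \<inter> ?b n" and ?e = "e / 2 ^ Suc n"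
    have sB: "?B \<in> sets borel" using B(1) by auto
    have "emeasure M (?B \<inter> ?b n) \<le> emeasure M (?b n)"
      by (intro emeasure_mono) (auto simp: borel_sets_M)
    then have fin: "emeasure (m n) ?B < \<infinity>"
      using emeasure_ball_finite[of x0 n] em[OF sB, of n] by (auto intro: le_less_trans)
    have "emeasure (m n) ?B = (INF U \<in> {U. ?B \<subseteq> U \<and> open U}. emeasure (m n) U)"
      by (rule outer_regular) (use sB em[of UNIV n] emeasure_ball_finite[of x0 n] in \<open>auto simp: m_def\<close>)
    moreover have "emeasure (m n) ?B < emeasure (m n) ?B + ennreal ?e"
      using fin \<open>0 < e\<close> by (cases "emeasure (m n) ?B") (auto simp: ennreal_less_iff simp flip: ennreal_plus)
    ultimately have "(INF U \<in> {U. ?B \<subseteq> U \<and> open U}. emeasure (m n) U) < emeasure (m n) ?B + ennreal ?e"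
      by (simp only:)
    then obtain U where U: "?B \<subseteq> U" "open U" "emeasure (m n) U < emeasure (m n) ?B + ennreal ?e"
      unfolding INF_less_iff by blast
    have "emeasure M (U \<inter> ?b n - ?B) = emeasure M (U \<inter> ?b n) - emeasure M ?B"
      using U B(1) fin em[OF sB, of n] by (intro emeasure_Diff) (auto simp: borel_sets_M less_top)
    also have "\<dots> \<le> ennreal ?e"
      using U(3) em[OF sB, of n] em[of U n] U(2) fin by (auto simp: ennreal_minus_le_iff less_imp_le)
    also have "U \<inter> ?b n - ?B = U \<inter> ?b n - B" by auto
    finally show ?thesis using U by blast
  qed
  then obtain U where U: "\<And>n. open (U n)" "\<And>n. B \<inter> ?b n \<subseteq> U n"
      "\<And>n. emeasure M (U n \<inter> ?b n - B) \<le> ennreal (e / 2 ^ Suc n)" by metis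
  define V where "V = (\<Union>n. U n \<inter> ?b n)"
  have oV: "open V" using U(1) by (auto simp: V_def)
  have "B \<subseteq> V"
  proof
    fix x assume "x \<in> B"
    moreover obtain n where "x \<in> ?b n" using reals_Archimedean2[of "dist x0 x"] by auto
    ultimately show "x \<in> V" using U(2)[of n] by (auto simp: V_def)
  qed
  have sums: "(\<Sum>n. ennreal (e / 2 ^ Suc n)) = ennreal e"
  proof -
    have "(\<lambda>n. e * (1/2) ^ Suc n) sums (e * 1)" by (intro sums_mult power_half_series)
    then have s: "(\<lambda>n. e / 2 ^ Suc n) sums e" by (simp add: power_divide)
    have "(\<Sum>n. ennreal (e / 2 ^ Suc n)) = ennreal (\<Sum>n. e / 2 ^ Suc n)"
      using \<open>0 < e\<close> sums_summable[OF s] by (intro suminf_ennreal2) auto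
    then show ?thesis using sums_unique[OF s] by simp
  qed
  have "emeasure M V \<le> emeasure M (B \<union> (V - B))" using oV B by (intro emeasure_mono) (auto simp: borel_sets_M)
  also have "\<dots> \<le> emeasure M B + emeasure M (V - B)"
    using oV B by (intro emeasure_subadditive) (auto simp: borel_sets_M)
  also have "emeasure M (V - B) = emeasure M (\<Union>n. U n \<inter> ?b n - B)"
    by (rule arg_cong[where f = "emeasure M"]) (auto simp: V_def)
  also have "\<dots> \<le> (\<Sum>n. emeasure M (U n \<inter> ?b n - B))"
    using U(1) B(1) by (intro emeasure_subadditive_countably) (auto simp: borel_sets_M)
  also have "\<dots> \<le> (\<Sum>n. ennreal (e / 2 ^ Suc n))" using U(3) by (intro suminf_le) auto
  finally have "emeasure M V \<le> emeasure M A + ennreal e" unfolding sums MB by (simp add: add_left_mono)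
  then show ?thesis using oV \<open>B \<subseteq> V\<close> B(2) by blast
qed

text \<open>Induction over the construction of measurable functions from indicators; the case of an
  indicator is \<open>outer_open\<close>.\<close>

theorem Vitali_Caratheodory:
  assumes "f \<in> borel_measurable M" "0 < e"
  shows "\<exists>W. lsc W \<and> (\<forall>x. f x \<le> W x) \<and> integral\<^sup>N M W \<le> integral\<^sup>N M f + ennreal e"
  using assms
proof (induction arbitrary: e rule: borel_measurable_induct)
  case (cong f g)
  then have "f = g" by (auto simp: fun_eq_iff)
  then show ?case using cong by simp
next
  case (set A)
  obtain U where U: "open U" "A \<subseteq> U" "emeasure M U \<le> emeasure M A + ennreal e"
    using outer_open[OF set(1,2)] by blast
  then show ?case using set(1)
    by (intro exI[of _ "indicator U"]) (auto simp: lsc_indicator borel_sets_M split: split_indicator)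
next
  case (mult u c)
  show ?case
  proof (cases "c = 0")
    case True
    then show ?thesis by (intro exI[of _ "\<lambda>_. 0"]) (auto simp: lsc_def)
  next
    case False
    obtain c' where c: "c = ennreal c'" "0 < c'" using mult False by (cases c) (auto simp: less_le)
    then obtain W where W: "lsc W" "\<And>x. u x \<le> W x" "integral\<^sup>N M W \<le> integral\<^sup>N M u + ennreal (e / c')"
      using mult.IH[of "e / c'"] mult.prems by auto
    have "(\<integral>\<^sup>+x. c * W x \<partial>M) = c * integral\<^sup>N M W"
      by (intro nn_integral_cmult borel_measurable_M lsc_borel_measurable W) simp
    also have "\<dots> \<le> c * (integral\<^sup>N M u + ennreal (e / c'))" using W(3) by (rule mult_left_mono) simp
    also have "\<dots> = (\<integral>\<^sup>+x. c * u x \<partial>M) + ennreal e"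
      using c mult.hyps mult.prems by (simp add: nn_integral_cmult distrib_left flip: ennreal_mult)
    finally show ?thesis using c W(1,2)
      by (intro exI[of _ "\<lambda>x. c * W x"]) (auto intro!: lsc_cmult mult_left_mono)
  qed
next
  case (add u v)
  from add.IH(1)[of "e/2"] add.prems obtain W1 where W1: "lsc W1" "\<And>x. u x \<le> W1 x"
    "integral\<^sup>N M W1 \<le> integral\<^sup>N M u + ennreal (e / 2)" by auto
  from add.IH(2)[of "e/2"] add.prems obtain W2 where W2: "lsc W2" "\<And>x. v x \<le> W2 x"
    "integral\<^sup>N M W2 \<le> integral\<^sup>N M v + ennreal (e / 2)" by auto
  have [measurable]: "W1 \<in> borel_measurable M" "W2 \<in> borel_measurable M"
    by (auto intro!: borel_measurable_M lsc_borel_measurable W1 W2)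
  note [measurable] = add.hyps(1,3)
  have "(\<integral>\<^sup>+x. max (W1 x) (W2 x) \<partial>M) \<le> (\<integral>\<^sup>+x. W1 x + W2 x \<partial>M)"
    by (intro nn_integral_mono) (auto simp: max_def intro: add_increasing add_increasing2)
  also have "\<dots> = integral\<^sup>N M W1 + integral\<^sup>N M W2" by (rule nn_integral_add) auto
  also have "\<dots> \<le> (integral\<^sup>N M u + ennreal (e / 2)) + (integral\<^sup>N M v + ennreal (e / 2))"
    by (intro add_mono W1 W2)
  also have "\<dots> = (\<integral>\<^sup>+x. v x + u x \<partial>M) + (ennreal (e / 2) + ennreal (e / 2))"
    by (simp add: nn_integral_add ac_simps)
  also have "ennreal (e / 2) + ennreal (e / 2) = ennreal e"
    using add.prems by (subst ennreal_plus[symmetric]) auto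
  finally have int: "(\<integral>\<^sup>+x. max (W1 x) (W2 x) \<partial>M) \<le> (\<integral>\<^sup>+x. v x + u x \<partial>M) + ennreal e" .
  \<comment> \<open>\<open>u\<close> and \<open>v\<close> have disjoint supports by
    \<open>add.hyps(5)\<close>, so the maximum of the majorants dominates the sum.\<close>
  have "v x + u x \<le> max (W1 x) (W2 x)" for x
    using add.hyps(5)[of x] W1(2)[of x] W2(2)[of x] by (auto simp: le_max_iff_disj)
  then show ?case using int W1 W2 by (intro exI[of _ "\<lambda>x. max (W1 x) (W2 x)"]) (auto intro: lsc_max)
next
  case (seq U)
  have "\<exists>W. lsc W \<and> (\<forall>x. U i x \<le> W x) \<and> integral\<^sup>N M W \<le> integral\<^sup>N M (U i) + ennreal (e / 2 ^ Suc i)" for i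
    by (rule seq.IH) (use seq.prems in simp)
  then obtain W where W: "\<And>i. lsc (W i)" "\<And>i x. U i x \<le> W i x"
    "\<And>i. integral\<^sup>N M (W i) \<le> integral\<^sup>N M (U i) + ennreal (e / 2 ^ Suc i)" by metis
  note [measurable] = seq.hyps(1)
  have [measurable]: "W i \<in> borel_measurable M" for i
    by (intro borel_measurable_M lsc_borel_measurable W) simp
  have sums: "(\<Sum>n. ennreal (e / 2 ^ Suc n)) = ennreal e"
  proof -
    have "(\<lambda>n. e * (1/2) ^ Suc n) sums (e * 1)" by (intro sums_mult power_half_series)
    then have s: "(\<lambda>n. e / 2 ^ Suc n) sums e" by (simp add: power_divide)
    have "(\<Sum>n. ennreal (e / 2 ^ Suc n)) = ennreal (\<Sum>n. e / 2 ^ Suc n)"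
      using seq.prems sums_summable[OF s] by (intro suminf_ennreal2) auto
    then show ?thesis using sums_unique[OF s] by simp
  qed
  let ?u = "\<lambda>x. SUP i. U i x"
  show ?case
  proof (cases "integral\<^sup>N M ?u = \<infinity>")
    case True
    then show ?thesis
      by (intro exI[of _ "\<lambda>_. top"]) (auto simp: lsc_def SUP_apply[abs_def])
  next
    case False
    have Ufin: "integral\<^sup>N M (U i) \<noteq> \<infinity>" for i
    proof -
      have "integral\<^sup>N M (U i) \<le> integral\<^sup>N M ?u" by (intro nn_integral_mono SUP_upper) simp
      then show ?thesis using False by (auto simp: top_unique)
    qed
    have diff: "(\<integral>\<^sup>+x. W i x - U i x \<partial>M) \<le> ennreal (e / 2 ^ Suc i)" for i
    proof -
      have "(\<integral>\<^sup>+x. W i x - U i x \<partial>M) = integral\<^sup>N M (W i) - integral\<^sup>N M (U i)"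
        using W(2) Ufin by (intro nn_integral_diff) auto
      then show ?thesis using W(3)[of i] Ufin[of i] by (simp add: ennreal_minus_le_iff)
    qed
    \<comment> \<open>The majorants \<open>W i\<close> may fail to increase; each exceeds
      \<open>U i\<close> by \<open>W i - U i\<close>, so their supremum exceeds \<open>?u\<close> by
      at most the sum of these excesses.\<close>
    have "(\<integral>\<^sup>+x. (SUP i. W i x) \<partial>M) \<le> (\<integral>\<^sup>+x. ?u x + (\<Sum>i. W i x - U i x) \<partial>M)"
    proof (intro nn_integral_mono SUP_least)
      fix x i
      have "W i x \<le> U i x + (W i x - U i x)" using W(2)[of i x] by (simp add: add_diff_self_ennreal)
      also have "\<dots> \<le> ?u x + (\<Sum>i. W i x - U i x)"
        using sum_le_suminf[of "\<lambda>i. W i x - U i x" "{i}"] by (intro add_mono SUP_upper) auto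
      finally show "W i x \<le> ?u x + (\<Sum>i. W i x - U i x)" .
    qed
    also have "\<dots> = integral\<^sup>N M ?u + (\<Sum>i. \<integral>\<^sup>+x. W i x - U i x \<partial>M)"
      by (subst nn_integral_add) (auto simp: nn_integral_suminf)
    also have "\<dots> \<le> integral\<^sup>N M ?u + (\<Sum>n. ennreal (e / 2 ^ Suc n))"
      using diff by (intro add_left_mono suminf_le) auto
    finally have "(\<integral>\<^sup>+x. (SUP i. W i x) \<partial>M) \<le> integral\<^sup>N M ?u + ennreal e" by (simp only: sums)
    then show ?thesis using W
      by (intro exI[of _ "\<lambda>x. SUP i. W i x"]) (auto simp: SUP_apply[abs_def] intro!: lsc_SUP SUP_mono)
  qed
qed

end

section \<open>Doubling spaces\<close>

definition separated :: "real \<Rightarrow> 'a::metric_space set \<Rightarrow> bool" where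
  "separated r S \<longleftrightarrow> (\<forall>x\<in>S. \<forall>y\<in>S. x \<noteq> y \<longrightarrow> r \<le> dist x y)"

lemma maximal_separated_subset:
  assumes "0 < r"
  obtains N where "N \<subseteq> X" "separated r N" "\<And>x. x \<in> X \<Longrightarrow> \<exists>y\<in>N. dist x y < r"
proof -
  have "\<exists>N\<in>{N. N \<subseteq> X \<and> separated r N}. \<forall>N'\<in>{N. N \<subseteq> X \<and> separated r N}. N \<subseteq> N' \<longrightarrow> N' = N"
  proof (rule subset_Zorn')
    fix C assume C: "subset.chain {N. N \<subseteq> X \<and> separated r N} C"
    have "separated r (\<Union>C)"
      unfolding separated_def
    proof (intro ballI impI)
      fix x y assume "x \<in> \<Union>C" "y \<in> \<Union>C" "x \<noteq> y"
      then obtain A B where AB: "A \<in> C" "B \<in> C" "x \<in> A" "y \<in> B" by blast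
      then have "A \<subseteq> B \<or> B \<subseteq> A" "separated r A" "separated r B"
        using C by (auto simp: subset_chain_def)
      then show "r \<le> dist x y" using AB \<open>x \<noteq> y\<close> unfolding separated_def by blast
    qed
    then show "\<Union>C \<in> {N. N \<subseteq> X \<and> separated r N}" using C by (auto simp: subset_chain_def)
  qed
  then obtain N where N0: "N \<in> {N. N \<subseteq> X \<and> separated r N}"
    and m: "\<forall>N'\<in>{N. N \<subseteq> X \<and> separated r N}. N \<subseteq> N' \<longrightarrow> N' = N"
    by (rule bexE)
  have N: "N \<subseteq> X" "separated r N" using N0 by simp_all
  have max: "N' = N" if "N' \<subseteq> X" "separated r N'" "N \<subseteq> N'" for N'
    using bspec[OF m, of N'] that by simp
  show ?thesis
  proof (rule that[OF N])
    fix x assume x: "x \<in> X"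
    show "\<exists>y\<in>N. dist x y < r"
    proof (rule ccontr)
      assume neg: "\<not> ?thesis"
      then have "separated r (insert x N)"
        using N(2) by (auto simp: separated_def not_less dist_commute)
      then have "x \<in> N" using max[of "insert x N"] x N(1) by auto
      then show False using neg \<open>0 < r\<close> by force
    qed
  qed
qed

locale doubling_space = polish_mm_space p \<mu> for p :: real and \<mu> :: "'a::polish_space set \<Rightarrow> ennreal" +
  assumes dbl: "doubling \<mu>"
begin

text \<open>Volume counting. The balls of radius \<open>r / 2\<close> about the points are disjoint
  and lie in \<open>ball x (2 ^ Suc k * r)\<close>. Doubling the radius of one of them
  \<open>k + 3\<close> times gives \<open>4 * 2 ^ k * r\<close>, enough to cover that ball; hence
  there are at most \<open>c ^ (k + 3)\<close> points.\<close>

lemma separated_card_bound: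
  obtains K :: nat where "\<And>(x::'a) r S. 0 < r \<Longrightarrow> separated r S \<Longrightarrow> S \<subseteq> ball x (2 ^ k * r) \<Longrightarrow> finite S \<and> card S \<le> K"
proof -
  obtain c :: real where c: "0 < c" "\<And>x r. 0 < r \<Longrightarrow> \<mu> (ball x (2 * r)) \<le> ennreal c * \<mu> (ball x r)"
    using dbl by (auto simp: doubling_def)
  have c': "emeasure M (ball x (2 * r)) \<le> ennreal c * emeasure M (ball x r)" if "0 < r" for x :: 'a and r
    using c(2)[OF that] by (simp add: emeasure_M borel_sets_M)
  have iter: "emeasure M (ball x (2 ^ n * r)) \<le> ennreal (c ^ n) * emeasure M (ball x r)" if "0 < r" for x :: 'a and r n
  proof (induction n)
    case (Suc n)
    have "emeasure M (ball x (2 ^ Suc n * r)) = emeasure M (ball x (2 * (2 ^ n * r)))" by (simp add: mult.assoc)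
    also have "\<dots> \<le> ennreal c * emeasure M (ball x (2 ^ n * r))" using that by (intro c') simp
    also have "\<dots> \<le> ennreal c * (ennreal (c ^ n) * emeasure M (ball x r))" using Suc by (rule mult_left_mono) simp
    also have "\<dots> = ennreal (c ^ Suc n) * emeasure M (ball x r)"
      using c(1) by (simp add: ennreal_mult mult.assoc del: ennreal_power)
    finally show ?case .
  qed simp
  define K where "K = nat \<lceil>c ^ (k + 3)\<rceil>"
  have fin: "card F \<le> K" if r: "0 < r" "separated r F" "F \<subseteq> ball x (2 ^ k * r)" "finite F" for x :: 'a and r F
  proof -
    let ?V = "emeasure M (ball x (2 ^ Suc k * r))"
    have V: "0 < ?V" "?V < \<infinity>"
    proof -
      have "0 < 2 ^ Suc k * r" using r(1) by simp
      then show "0 < ?V" using mms unfolding metric_measure_space_def by (simp add: emeasure_M borel_sets_M)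
    qed (rule emeasure_ball_finite)
    have one: "1 \<le> (2::real) ^ k" by simp
    have rk: "r \<le> 2 ^ k * r" using r(1) one by simp
    have VB: "?V \<le> ennreal (c ^ (k + 3)) * emeasure M (ball y (r / 2))" if "y \<in> F" for y
    proof -
      have "dist x y < 2 ^ k * r" using that r(3) by auto
      have "ball x (2 ^ Suc k * r) \<subseteq> ball y (2 ^ (k + 3) * (r / 2))"
      proof
        fix z assume "z \<in> ball x (2 ^ Suc k * r)"
        then have "dist y z < 3 * (2 ^ k * r)"
          using \<open>dist x y < 2 ^ k * r\<close> dist_triangle[of y z x] by (simp add: dist_commute)
        also have "\<dots> \<le> 2 ^ (k + 3) * (r / 2)" using r(1) by (simp add: power_add)
        finally show "z \<in> ball y (2 ^ (k + 3) * (r / 2))" by simp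
      qed
      then have "?V \<le> emeasure M (ball y (2 ^ (k + 3) * (r / 2)))" by (intro emeasure_mono) (auto simp: borel_sets_M)
      also have "\<dots> \<le> ennreal (c ^ (k + 3)) * emeasure M (ball y (r / 2))" using r(1) by (intro iter) simp
      finally show ?thesis .
    qed
    have "of_nat (card F) * ?V = (\<Sum>y\<in>F. ?V)" by simp
    also have "\<dots> \<le> (\<Sum>y\<in>F. ennreal (c ^ (k + 3)) * emeasure M (ball y (r / 2)))" by (intro sum_mono VB)
    also have "\<dots> = ennreal (c ^ (k + 3)) * (\<Sum>y\<in>F. emeasure M (ball y (r / 2)))" by (simp add: sum_distrib_left)
    also have "(\<Sum>y\<in>F. emeasure M (ball y (r / 2))) = emeasure M (\<Union>y\<in>F. ball y (r / 2))"
    proof (rule sum_emeasure)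
      show "disjoint_family_on (\<lambda>y. ball y (r / 2)) F"
        unfolding disjoint_family_on_def
      proof (intro ballI impI)
        fix y z assume "y \<in> F" "z \<in> F" "y \<noteq> z"
        then have "r \<le> dist y z" using r(2) by (auto simp: separated_def)
        then show "ball y (r / 2) \<inter> ball z (r / 2) = {}" by (intro disjoint_ballI) simp
      qed
    qed (use r(4) in \<open>auto simp: borel_sets_M\<close>)
    also have "\<dots> \<le> ?V"
    proof (rule emeasure_mono)
      show "(\<Union>y\<in>F. ball y (r / 2)) \<subseteq> ball x (2 ^ Suc k * r)"
      proof safe
        fix y z assume "y \<in> F" "z \<in> ball y (r / 2)"
        then have "dist x y < 2 ^ k * r" "dist y z < r / 2" using r(3) by auto
        then have "dist x z < 2 ^ k * r + r / 2" using dist_triangle[of x z y] by linarith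
        moreover have "2 ^ Suc k * r = 2 ^ k * r + 2 ^ k * r" by simp
        ultimately have "dist x z < 2 ^ Suc k * r" using rk r(1) by linarith
        then show "z \<in> ball x (2 ^ Suc k * r)" unfolding mem_ball .
      qed
    qed (simp add: borel_sets_M)
    finally have *: "of_nat (card F) * ?V \<le> ennreal (c ^ (k + 3)) * ?V" by (simp add: mult_left_mono)
    obtain v where v: "?V = ennreal v" "0 < v" using V by (cases ?V) auto
    have "ennreal (real (card F) * v) \<le> ennreal (c ^ (k + 3) * v)"
      using * v c(1) by (simp add: ennreal_mult ennreal_of_nat_eq_real_of_nat del: ennreal_power)
    then have "real (card F) * v \<le> c ^ (k + 3) * v" using c(1) v(2) by (subst (asm) ennreal_le_iff) auto
    then have "real (card F) \<le> c ^ (k + 3)" using v(2) by simp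
    then show "card F \<le> K" unfolding K_def by linarith
  qed
  show ?thesis
  proof (rule that[of K])
    fix x :: 'a and r S assume r: "0 < r" "separated r S" "S \<subseteq> ball x (2 ^ k * r)"
    have "finite S"
    proof (rule ccontr)
      assume "infinite S"
      then obtain F where F: "finite F" "card F = Suc K" "F \<subseteq> S" using infinite_arbitrarily_large by blast
      then have "card F \<le> K" using r by (intro fin[of r F x]) (auto simp: separated_def)
      then show False using F by simp
    qed
    then show "finite S \<and> card S \<le> K" using fin r by blast
  qed
qed

text \<open>Separated subsets of a ball are finite by doubling, so a maximal
  \<open>e\<close>-separated subset is a finite \<open>e\<close>-net; completeness does the
  rest.\<close>

lemma compact_cball: "compact (cball x R :: 'a set)"
  unfolding compact_eq_totally_bounded
proof (intro conjI allI impI)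
  show "complete (cball x R)" by (simp add: complete_eq_closed)
  fix e :: real assume "0 < e"
  obtain N where N: "N \<subseteq> cball x R" "separated e N" "\<And>y. y \<in> cball x R \<Longrightarrow> \<exists>z\<in>N. dist y z < e"
    using maximal_separated_subset[OF \<open>0 < e\<close>] by blast
  obtain k :: nat where "R / e < 2 ^ k" using real_arch_pow[of 2 "R / e"] by auto
  then have "R < 2 ^ k * e" using \<open>0 < e\<close> by (simp add: pos_divide_less_eq)
  then have "N \<subseteq> ball x (2 ^ k * e)" using N(1) by auto
  moreover obtain K :: nat where "\<And>(x::'a) r S. 0 < r \<Longrightarrow> separated r S \<Longrightarrow> S \<subseteq> ball x (2 ^ k * r) \<Longrightarrow> finite S \<and> card S \<le> K"
    using separated_card_bound by blast
  ultimately have "finite N" using \<open>0 < e\<close> N(2) by meson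
  moreover have "cball x R \<subseteq> (\<Union>z\<in>N. ball z e)"
    using N(3) by (fastforce simp: dist_commute)
  ultimately show "\<exists>k. finite k \<and> cball x R \<subseteq> (\<Union>x\<in>k. ball x e)" by blast
qed

end

section \<open>Lipschitz regularization\<close>

text \<open>Pasch-Hausdorff envelope: the largest \<open>n\<close>-Lipschitz function below the
  truncation \<open>min n g\<close>. The truncation keeps \<open>enn2real\<close> faithful where
  \<open>g\<close> is infinite.\<close>

definition lip_reg :: "('a::metric_space \<Rightarrow> ennreal) \<Rightarrow> nat \<Rightarrow> 'a \<Rightarrow> real" where
  "lip_reg g n x = (INF y. enn2real (min (of_nat n) (g y)) + real n * dist x y)"

lemma lip_reg_bdd: "bdd_below (range (\<lambda>y. enn2real (min (of_nat n) (g y)) + real n * dist x y))"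
  by (intro bdd_belowI[of _ 0]) auto

lemma lip_reg_nonneg: "0 \<le> lip_reg g n x"
  unfolding lip_reg_def by (intro cINF_greatest) auto

lemma lip_reg_le: "lip_reg g n x \<le> enn2real (min (of_nat n) (g x))"
  using cINF_lower[OF lip_reg_bdd, of x n g x] by (simp add: lip_reg_def)

lemma lip_reg_le_n: "lip_reg g n x \<le> real n"
proof -
  have "enn2real (min (of_nat n) (g x)) \<le> enn2real (of_nat n)"
    by (intro enn2real_mono) (auto simp: of_nat_less_top)
  then show ?thesis using lip_reg_le[of g n x] by simp
qed

lemma lip_reg_le_self: "ennreal (lip_reg g n x) \<le> g x"
proof -
  have "ennreal (lip_reg g n x) \<le> ennreal (enn2real (min (of_nat n) (g x)))"
    by (intro ennreal_leI lip_reg_le)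
  also have "\<dots> = min (of_nat n) (g x)" by (intro ennreal_enn2real) (auto simp: of_nat_less_top min_less_iff_disj)
  finally show ?thesis by simp
qed

lemma lip_reg_lipschitz: "\<bar>lip_reg g n x - lip_reg g n y\<bar> \<le> real n * dist x y"
proof -
  have "lip_reg g n x \<le> lip_reg g n y + real n * dist x y" for x y
  proof -
    have "lip_reg g n x - real n * dist x y \<le> lip_reg g n y"
      unfolding lip_reg_def[of g n y]
    proof (rule cINF_greatest)
      fix z
      have "lip_reg g n x \<le> enn2real (min (of_nat n) (g z)) + real n * dist x z"
        unfolding lip_reg_def by (rule cINF_lower[OF lip_reg_bdd]) simp
      also have "\<dots> \<le> enn2real (min (of_nat n) (g z)) + real n * (dist x y + dist y z)"
        by (intro add_left_mono mult_left_mono dist_triangle) auto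
      finally show "lip_reg g n x - real n * dist x y \<le> enn2real (min (of_nat n) (g z)) + real n * dist y z"
        by (simp add: algebra_simps)
    qed simp
    then show ?thesis by simp
  qed
  from this[of x y] this[of y x] show ?thesis by (auto simp: dist_commute abs_le_iff)
qed

lemma lip_reg_mono: "m \<le> n \<Longrightarrow> lip_reg g m x \<le> lip_reg g n x"
  unfolding lip_reg_def
proof (intro cINF_mono)
  fix y assume "m \<le> n"
  then have "enn2real (min (of_nat m) (g y)) \<le> enn2real (min (of_nat n) (g y))"
    by (intro enn2real_mono min.mono) (auto simp: of_nat_less_top min_less_iff_disj)
  moreover have "real m * dist x y \<le> real n * dist x y" using \<open>m \<le> n\<close> by (intro mult_right_mono) auto
  ultimately show "\<exists>z\<in>UNIV. enn2real (min (of_nat m) (g z)) + real m * dist x z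
      \<le> enn2real (min (of_nat n) (g y)) + real n * dist x y"
    by (intro bexI[of _ y]) auto
qed (auto simp: lip_reg_bdd)

lemma lip_reg_SUP:
  assumes "lsc g" shows "(SUP n. ennreal (lip_reg g n x)) = g x"
proof (rule antisym)
  show "(SUP n. ennreal (lip_reg g n x)) \<le> g x" by (intro SUP_least lip_reg_le_self)
  show "g x \<le> (SUP n. ennreal (lip_reg g n x))"
  proof (rule dense_le)
    fix c assume "c < g x"
    then obtain c' where c: "c = ennreal c'" "0 \<le> c'" by (cases c) auto
    have "open {y. c < g y}" using assms by (simp add: lsc_def)
    then obtain r where r: "r > 0" "ball x r \<subseteq> {y. c < g y}"
      using \<open>c < g x\<close> openE[of "{y. c < g y}" x] by auto
    \<comment> \<open>Near \<open>x\<close>, \<open>c' < n\<close> keeps the truncation of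
      \<open>g\<close> at least \<open>c'\<close>; at distance at least \<open>r\<close> the penalty
      is at least \<open>n * r\<close>, which exceeds \<open>c'\<close>.\<close>
    obtain n :: nat where n: "max c' (c' / r) < real n" using reals_Archimedean2 by blast
    have "c' \<le> lip_reg g n x"
      unfolding lip_reg_def
    proof (rule cINF_greatest)
      fix y
      show "c' \<le> enn2real (min (of_nat n) (g y)) + real n * dist x y"
      proof (cases "dist x y < r")
        case True
        then have "c < g y" using r(2) by auto
        moreover have "c \<le> of_nat n"
          using n c by (simp add: ennreal_leI flip: ennreal_of_nat_eq_real_of_nat)
        ultimately have "enn2real c \<le> enn2real (min (of_nat n) (g y))"
          by (intro enn2real_mono) (auto simp: of_nat_less_top min_less_iff_disj)
        then show ?thesis using c by (simp add: add_increasing2)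
      next
        case False
        then have "c' \<le> real n * dist x y"
          using n r(1) mult_mono[of "c' / r" "real n" r "dist x y"] c(2) by auto
        then show ?thesis by (simp add: add_increasing)
      qed
    qed simp
    then have "c \<le> ennreal (lip_reg g n x)" using c by (simp add: ennreal_leI)
    then show "c \<le> (SUP n. ennreal (lip_reg g n x))" by (rule order_trans) (auto intro: SUP_upper)
  qed
qed

section \<open>Limits of discrete chains\<close>

text \<open>Tychonoff's theorem in filter form: one refinement of \<open>F\<close> yields limits at
  all indices at once. The index sets in use, the parameters of a path and the functions on the
  space, are too large for a diagonal subsequence.\<close>

lemma cluster_point_product:
  fixes f :: "nat \<Rightarrow> 'i \<Rightarrow> 'b::topological_space"
  assumes F: "F \<noteq> bot" and S: "\<And>i. compact (S i)" and f: "\<And>n i. f n i \<in> S i"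
  shows "\<exists>F' g. F' \<le> F \<and> F' \<noteq> bot \<and> (\<forall>i. g i \<in> S i) \<and> (\<forall>i. ((\<lambda>n. f n i) \<longlongrightarrow> g i) F')"
proof -
  have "compactin (product_topology (\<lambda>_. euclidean) UNIV) (PiE UNIV S)"
    using S by (simp add: compactin_PiE)
  then have c: "compact (PiE UNIV S)" by (simp add: euclidean_product_topology)
  have "filtermap f F \<noteq> bot" using F by (simp add: filtermap_bot_iff)
  moreover have "\<forall>\<^sub>F x in filtermap f F. x \<in> PiE UNIV S"
    using f by (simp add: eventually_filtermap PiE_UNIV_domain)
  ultimately obtain g where g: "g \<in> PiE UNIV S" "inf (nhds g) (filtermap f F) \<noteq> bot"
    using c[unfolded compact_filter, rule_format, of "filtermap f F"] by blast
  define F' where "F' = inf (filtercomap f (nhds g)) F"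
  have "F' \<noteq> bot"
  proof
    assume "F' = bot"
    then have "eventually (\<lambda>_. False) F'" by simp
    then obtain Q R where QR: "eventually Q (filtercomap f (nhds g))" "eventually R F" "\<And>n. Q n \<Longrightarrow> R n \<Longrightarrow> False"
      unfolding F'_def eventually_inf by blast
    obtain P where P: "eventually P (nhds g)" "\<And>n. P (f n) \<Longrightarrow> Q n"
      using QR(1) unfolding eventually_filtercomap by blast
    have "eventually (\<lambda>y. \<exists>n. R n \<and> y = f n) (filtermap f F)"
      unfolding eventually_filtermap using QR(2) by (rule eventually_mono) blast
    then have "eventually (\<lambda>_. False) (inf (nhds g) (filtermap f F))"
      unfolding eventually_inf using P QR(3) by blast
    then show False using g(2) by (simp add: eventually_False)
  qed
  moreover have "F' \<le> F" by (simp add: F'_def)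
  moreover have lim: "(f \<longlongrightarrow> g) F'"
    unfolding filterlim_iff_le_filtercomap F'_def by simp
  have "((\<lambda>n. f n i) \<longlongrightarrow> g i) F'" for i
  proof (rule topological_tendstoI)
    fix T assume T: "open T" "g i \<in> T"
    have "open ((\<lambda>h. h i) -` T)" using T(1) continuous_on_product_coordinates by (rule open_vimage)
    then have "\<forall>\<^sub>F n in F'. f n \<in> (\<lambda>h. h i) -` T" using T(2) by (intro topological_tendstoD[OF lim]) auto
    then show "\<forall>\<^sub>F n in F'. f n i \<in> T" by simp
  qed
  moreover have "g i \<in> S i" for i using g(1) by auto
  ultimately show ?thesis by blast
qed

lemma rectifiable_lipschitz_path:
  assumes "0 \<le> \<Lambda>" "\<And>s t. 0 \<le> s \<Longrightarrow> s \<le> t \<Longrightarrow> t \<le> 1 \<Longrightarrow> dist (\<gamma> s) (\<gamma> t) \<le> \<Lambda> * (t - s)"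
  shows "rectifiable_path 0 1 \<gamma>"
proof
  have "\<Lambda>-lipschitz_on {0..1} \<gamma>"
  proof (rule lipschitz_onI[OF _ assms(1)])
    fix s t :: real assume "s \<in> {0..1}" "t \<in> {0..1}"
    then show "dist (\<gamma> s) (\<gamma> t) \<le> \<Lambda> * dist s t"
      using assms(2)[of s t] assms(2)[of t s] by (cases "s \<le> t") (auto simp: dist_real_def dist_commute)
  qed
  then show "continuous_on {0..1} \<gamma>" by (rule lipschitz_on_continuous_on)
  have "curve_length 0 1 \<gamma> \<le> ennreal \<Lambda>"
  proof (rule curve_length_least)
    fix n :: nat and t :: "nat \<Rightarrow> real"
    assume t: "mono_on {..n} t" "t ` {..n} \<subseteq> {0..1}"
    have tI: "0 \<le> t i" "t i \<le> 1" if "i \<le> n" for i using t(2) that by (auto simp: image_subset_iff)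
    have "(\<Sum>i<n. dist (\<gamma> (t i)) (\<gamma> (t (Suc i)))) \<le> (\<Sum>i<n. \<Lambda> * (t (Suc i) - t i))"
      using tI by (intro sum_mono assms(2)) (auto intro: mono_onD[OF t(1)])
    also have "\<dots> = \<Lambda> * (t n - t 0)" by (simp add: sum_lessThan_telescope flip: sum_distrib_left)
    also have "\<dots> \<le> \<Lambda>" using tI[of 0] tI[of n] assms(1) by (intro mult_left_le) auto
    finally show "(\<Sum>i<n. ennreal (dist (\<gamma> (t i)) (\<gamma> (t (Suc i))))) \<le> ennreal \<Lambda>"
      by (simp add: sum_ennreal ennreal_leI)
  qed
  then show "rectifiable 0 1 \<gamma>" unfolding rectifiable_def by (rule le_less_trans) simp
qed simp

lemma (in rectifiable_path) path_int_split:
  assumes "(a, b, \<gamma>) \<in> paths_in X" "\<rho> \<in> borel_measurable (restrict_space borel X)"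
    and "a \<le> r" "r \<le> s" "s \<le> t" "t \<le> b"
  shows "path_int \<rho> r t \<gamma> = path_int \<rho> r s \<gamma> + path_int \<rho> s t \<gamma>"
proof -
  have "{r<..t} = {r<..s} \<union> {s<..t}" using assms by auto
  then have "emeasure (dm \<rho>) {r<..t} = emeasure (dm \<rho>) {r<..s} + emeasure (dm \<rho>) {s<..t}"
    by (subst plus_emeasure) auto
  then show ?thesis using assms by (simp add: emeasure_dm_Ioc[OF assms(1,2)])
qed

text \<open>\<open>C\<close> plays the role of the limiting cumulative cost.\<close>
lemma (in rectifiable_path) path_int_le_cumulative_cost:
  fixes k :: "'a \<Rightarrow> real" and C :: "real \<Rightarrow> real"
  assumes k: "\<And>x y. k x - k y \<le> \<kappa> * dist x y" "\<And>x. 0 \<le> k x" "0 \<le> \<kappa>"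
    and \<Lambda>: "0 \<le> \<Lambda>" "\<And>s t. a \<le> s \<Longrightarrow> s \<le> t \<Longrightarrow> t \<le> b \<Longrightarrow> dist (\<gamma> s) (\<gamma> t) \<le> \<Lambda> * (t - s)"
    and C: "\<And>s t. a \<le> s \<Longrightarrow> s \<le> t \<Longrightarrow> t \<le> b \<Longrightarrow> C s \<le> C t"
      "\<And>s t. a \<le> s \<Longrightarrow> s \<le> t \<Longrightarrow> t \<le> b \<Longrightarrow> (k (\<gamma> s) - \<kappa> * (\<Lambda> * (t - s))) * dist (\<gamma> s) (\<gamma> t) \<le> C t - C s"
  shows "path_int (\<lambda>x. ennreal (k x)) a b \<gamma> \<le> ennreal (C b - C a)"
proof -
  have path: "(a, b, \<gamma>) \<in> paths_in UNIV" using le cont by (simp add: paths_in_def)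
  have "continuous_on UNIV k"
    unfolding continuous_on_iff
  proof (intro ballI allI impI)
    fix x :: 'a and e :: real assume "0 < e"
    show "\<exists>d>0. \<forall>x'\<in>UNIV. dist x' x < d \<longrightarrow> dist (k x') (k x) < e"
    proof (intro exI conjI ballI impI)
      show "0 < e / (\<kappa> + 1)" using \<open>0 < e\<close> k(3) by simp
      fix y assume d: "dist y x < e / (\<kappa> + 1)"
      have "\<bar>k y - k x\<bar> \<le> \<kappa> * dist y x" using k(1)[of y x] k(1)[of x y] by (auto simp: dist_commute abs_le_iff)
      also have "\<dots> \<le> (\<kappa> + 1) * dist y x" by (intro mult_right_mono) auto
      also have "\<dots> < e" using d k(3) by (simp add: pos_less_divide_eq mult.commute)
      finally show "dist (k y) (k x) < e" by (simp add: dist_real_def)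
    qed
  qed
  then have bm: "(\<lambda>x. ennreal (k x)) \<in> borel_measurable (restrict_space borel UNIV)"
    by (intro measurable_restrict_space1 measurable_compose[OF _ measurable_ennreal] borel_measurable_continuous_onI)
  have cell: "path_int (\<lambda>x. ennreal (k x)) s t \<gamma> \<le> ennreal (C t - C s + 3 * (\<kappa> * \<Lambda> * (t - s)) * len s t)"
    if st: "a \<le> s" "s \<le> t" "t \<le> b" for s t
  proof -
    interpret S: rectifiable_path s t \<gamma> by (rule subpath[OF st])
    define D where "D = \<kappa> * \<Lambda> * (t - s)"
    have D0: "0 \<le> D" using k(3) \<Lambda>(1) st by (simp add: D_def)
    \<comment> \<open>One \<open>D\<close> pays for the oscillation of \<open>k\<close> on the
      piece, the other for the defect allowed in \<open>C(2)\<close>. The upper bound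
      \<open>k (\<gamma> s) + D\<close> is then \<open>A + 3 * D\<close>, whence the factor 3 in
      \<open>cell\<close>.\<close>
    define A where "A = k (\<gamma> s) - 2 * D"
    have near: "\<bar>k (\<gamma> r) - k (\<gamma> s)\<bar> \<le> D" if r: "s \<le> r" "r \<le> t" for r
    proof -
      have "\<kappa> * dist (\<gamma> s) (\<gamma> r) \<le> \<kappa> * (\<Lambda> * (r - s))" using k(3) r st by (intro mult_left_mono \<Lambda>(2)) auto
      also have "\<dots> \<le> \<kappa> * (\<Lambda> * (t - s))" using k(3) \<Lambda>(1) r by (intro mult_left_mono) auto
      finally have "\<kappa> * dist (\<gamma> s) (\<gamma> r) \<le> D" by (simp add: D_def mult.assoc)
      then show ?thesis using k(1)[of "\<gamma> r" "\<gamma> s"] k(1)[of "\<gamma> s" "\<gamma> r"] by (auto simp: dist_commute abs_le_iff)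
    qed
    have AC: "A * len s t \<le> C t - C s"
    proof (cases "0 < A")
      case False
      then have "A * len s t \<le> 0" by (intro mult_nonpos_nonneg) auto
      then show ?thesis using C(1)[OF st] by linarith
    next
      case True
      show ?thesis
      proof (rule field_le_epsilon)
        fix e :: real assume "0 < e"
        then have "0 < e / A" using True by simp
        then obtain n u where u: "mono_on {..n} u" "u ` {..n} \<subseteq> {s..t}"
            "len s t - e / A < (\<Sum>i<n. dist (\<gamma> (u i)) (\<gamma> (u (Suc i))))"
          using approx_sum[OF st] by blast
        have uI: "s \<le> u i" "u i \<le> t" if "i \<le> n" for i using u(2) that by (auto simp: image_subset_iff)
        have um: "u i \<le> u (Suc i)" if "i < n" for i using that by (intro mono_onD[OF u(1)]) auto
        have "A * (\<Sum>i<n. dist (\<gamma> (u i)) (\<gamma> (u (Suc i)))) = (\<Sum>i<n. A * dist (\<gamma> (u i)) (\<gamma> (u (Suc i))))"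
          by (simp add: sum_distrib_left)
        also have "\<dots> \<le> (\<Sum>i<n. C (u (Suc i)) - C (u i))"
        proof (rule sum_mono)
          fix i assume "i \<in> {..<n}"
          then have i: "i < n" "s \<le> u i" "u i \<le> u (Suc i)" "u (Suc i) \<le> t" using uI um by auto
          have "\<kappa> * (\<Lambda> * (u (Suc i) - u i)) \<le> D"
            using i k(3) \<Lambda>(1) unfolding D_def mult.assoc by (intro mult_left_mono) auto
          then have "A \<le> k (\<gamma> (u i)) - \<kappa> * (\<Lambda> * (u (Suc i) - u i))"
            using near[of "u i"] i unfolding A_def by linarith
          then have "A * dist (\<gamma> (u i)) (\<gamma> (u (Suc i)))
            \<le> (k (\<gamma> (u i)) - \<kappa> * (\<Lambda> * (u (Suc i) - u i))) * dist (\<gamma> (u i)) (\<gamma> (u (Suc i)))"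
            by (intro mult_right_mono) auto
          also have "\<dots> \<le> C (u (Suc i)) - C (u i)" using i st by (intro C(2)) auto
          finally show "A * dist (\<gamma> (u i)) (\<gamma> (u (Suc i))) \<le> C (u (Suc i)) - C (u i)" .
        qed
        also have "\<dots> = C (u n) - C (u 0)" by (rule sum_lessThan_telescope)
        also have "\<dots> \<le> C t - C s"
          using C(1)[of s "u 0"] C(1)[of "u n" t] uI[of 0] uI[of n] st by simp
        finally have "A * (\<Sum>i<n. dist (\<gamma> (u i)) (\<gamma> (u (Suc i)))) \<le> C t - C s" .
        moreover have "A * (len s t - e / A) \<le> A * (\<Sum>i<n. dist (\<gamma> (u i)) (\<gamma> (u (Suc i))))"
          using u(3) True by (intro mult_left_mono) auto
        moreover have "A * (len s t - e / A) = A * len s t - e" using True by (simp add: right_diff_distrib)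
        ultimately show "A * len s t \<le> C t - C s + e" by linarith
      qed
    qed
    have "path_int (\<lambda>x. ennreal (k x)) s t \<gamma> \<le> path_int (\<lambda>_. ennreal (k (\<gamma> s) + D)) s t \<gamma>"
    proof (intro path_int_mono ennreal_leI)
      fix r assume "r \<in> {s..t}"
      then show "k (\<gamma> r) \<le> k (\<gamma> s) + D" using near[of r] by (auto simp: abs_le_iff)
    qed
    also have "\<dots> = ennreal ((k (\<gamma> s) + D) * len s t)"
      using k(2)[of "\<gamma> s"] D0 by (intro S.path_int_const) simp
    also have "\<dots> \<le> ennreal (C t - C s + 3 * D * len s t)"
      using AC by (intro ennreal_leI) (simp add: A_def algebra_simps)
    finally show ?thesis by (simp add: D_def)
  qed
  show ?thesis
  proof (rule ennreal_le_epsilon)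
    fix e :: real assume "0 < e"
    \<comment> \<open>The error terms of \<open>m\<close> equal pieces add up to
      \<open>c / m\<close>.\<close>
    define c where "c = 3 * (\<kappa> * \<Lambda> * (b - a)) * len a b"
    have c0: "0 \<le> c" using k(3) \<Lambda>(1) le by (simp add: c_def)
    obtain m0 :: nat where m0: "c / e < real m0" using reals_Archimedean2 by blast
    define m where "m = Suc m0"
    have m: "0 < m" "c / real m \<le> e"
    proof -
      have "c < real m * e" using m0 \<open>0 < e\<close> by (simp add: m_def pos_divide_less_eq algebra_simps)
      then show "c / real m \<le> e" by (simp add: m_def pos_divide_le_eq mult.commute)
    qed (simp add: m_def)
    define h where "h = (b - a) / real m"
    have h0: "0 \<le> h" using le by (simp add: h_def)
    define t where "t j = a + real j * h" for j
    have tm: "t m = b" using m(1) by (simp add: t_def h_def)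
    have tr: "a \<le> t j" "t j \<le> t (Suc j)" "t (Suc j) - t j = h" for j
      using h0 by (auto simp: t_def algebra_simps)
    have tb: "t j \<le> b" if "j \<le> m" for j
    proof -
      have "real j * h \<le> real m * h" using that h0 by (intro mult_right_mono) auto
      then show ?thesis using tm by (simp add: t_def)
    qed
    have "path_int (\<lambda>x. ennreal (k x)) a (t j) \<gamma> \<le> ennreal (C (t j) - C a + 3 * (\<kappa> * \<Lambda> * h) * len a (t j))"
      if "j \<le> m" for j
      using that
    proof (induction j)
      case 0
      have "path_int (\<lambda>x. ennreal (k x)) a a \<gamma> = 0" by (rule path_int_constant[of _ _ _ "\<gamma> a"]) auto
      then show ?case by (simp add: t_def)
    next
      case (Suc j)
      let ?E = "\<lambda>s t. C t - C s + 3 * (\<kappa> * \<Lambda> * h) * len s t"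
      have pos: "0 \<le> 3 * (\<kappa> * \<Lambda> * h) * len s t" for s t using k(3) \<Lambda>(1) h0 by simp
      have "path_int (\<lambda>x. ennreal (k x)) a (t (Suc j)) \<gamma>
        = path_int (\<lambda>x. ennreal (k x)) a (t j) \<gamma> + path_int (\<lambda>x. ennreal (k x)) (t j) (t (Suc j)) \<gamma>"
        using tr tb[OF Suc.prems] by (intro path_int_split[OF path bm]) auto
      also have "\<dots> \<le> ennreal (?E a (t j)) + ennreal (?E (t j) (t (Suc j)))"
        using Suc cell[of "t j" "t (Suc j)"] tr tb[OF Suc.prems] by (intro add_mono) auto
      also have "\<dots> = ennreal (?E a (t j) + ?E (t j) (t (Suc j)))"
        using C(1)[of a "t j"] C(1)[of "t j" "t (Suc j)"] tr tb[OF Suc.prems] pos tb[of j] Suc.prems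
        by (intro ennreal_plus[symmetric]) (auto intro!: add_nonneg_nonneg)
      also have "?E a (t j) + ?E (t j) (t (Suc j)) = ?E a (t (Suc j))"
        using len_split[of a "t j" "t (Suc j)"] tr tb[OF Suc.prems] by (simp add: algebra_simps)
      finally show ?case .
    qed
    from this[of m] have "path_int (\<lambda>x. ennreal (k x)) a b \<gamma> \<le> ennreal (C b - C a + 3 * (\<kappa> * \<Lambda> * h) * len a b)"
      by (simp add: tm)
    also have "3 * (\<kappa> * \<Lambda> * h) * len a b = c / real m" by (simp add: h_def c_def)
    also have "ennreal (C b - C a + c / real m) \<le> ennreal (C b - C a + e)" using m(2) by (intro ennreal_leI) simp
    also have "\<dots> = ennreal (C b - C a) + ennreal e"
      using C(1)[of a b] le \<open>0 < e\<close> by (intro ennreal_plus) auto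
    finally show "path_int (\<lambda>x. ennreal (k x)) a b \<gamma> \<le> ennreal (C b - C a) + ennreal e" .
  qed
qed

text \<open>A discrete chain as a step path on \<open>[0,1]\<close> parametrized by relative length, together with the
  accumulated cost of its steps.\<close>
lemma chain_param:
  fixes q :: "nat \<Rightarrow> 'a::metric_space" and h :: "'a \<Rightarrow> real"
  assumes step: "\<And>i. i < N \<Longrightarrow> dist (q i) (q (Suc i)) \<le> r" and "0 \<le> r"
    and len: "(\<Sum>i<N. dist (q i) (q (Suc i))) \<le> \<Lambda>" and h: "\<And>x. 0 \<le> h x"
  obtains \<gamma> C where "\<And>t. \<gamma> t \<in> q ` {..N}" "\<gamma> 0 = q 0" "\<gamma> 1 = q N" "C 0 = s0"
    "C 1 = s0 + (\<Sum>i<N. h (q i) * dist (q i) (q (Suc i)))"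
    "\<And>s t. 0 \<le> s \<Longrightarrow> s \<le> t \<Longrightarrow> t \<le> 1 \<Longrightarrow> C s \<le> C t"
    "\<And>s t. 0 \<le> s \<Longrightarrow> s \<le> t \<Longrightarrow> t \<le> 1 \<Longrightarrow> dist (\<gamma> s) (\<gamma> t) \<le> \<Lambda> * (t - s) + r"
    "\<And>k \<kappa> s t. 0 \<le> \<kappa> \<Longrightarrow> (\<And>x y. k x - k y \<le> \<kappa> * dist x y) \<Longrightarrow> (\<And>x. k x \<le> h x) \<Longrightarrow>
       0 \<le> s \<Longrightarrow> s \<le> t \<Longrightarrow> t \<le> 1 \<Longrightarrow>
       (k (\<gamma> s) - \<kappa> * (\<Lambda> * (t - s) + r)) * dist (\<gamma> s) (\<gamma> t) \<le> C t - C s"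
proof -
  define S where "S i = (\<Sum>j<i. dist (q j) (q (Suc j)))" for i
  have S0: "S 0 = 0" and SS: "S (Suc i) = S i + dist (q i) (q (Suc i))" for i by (simp_all add: S_def)
  have Sm: "i \<le> j \<Longrightarrow> S i \<le> S j" for i j by (rule lift_Suc_mono_le[of S]) (simp_all add: SS)
  have S_nonneg: "0 \<le> S i" for i using Sm[of 0 i] S0 by simp
  have dS: "dist (q i) (q j) \<le> S j - S i" if "i \<le> j" for i j
    using that
  proof (induction j rule: dec_induct)
    case (step j)
    then show ?case using dist_triangle[of "q i" "q (Suc j)" "q j"] by (simp add: SS)
  qed simp
  define I where "I t = {i. i \<le> N \<and> S i \<le> t * S N}" for t
  \<comment> \<open>The last vertex reached at time \<open>t\<close> when the chain is traversed in
    proportion to length.\<close>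
  define idx where "idx t = Max (I t)" for t
  have fI: "finite (I t)" for t by (simp add: I_def)
  have neI: "I t \<noteq> {}" if "0 \<le> t" for t
    using that S_nonneg[of N] by (auto simp: I_def S0 intro!: exI[of _ 0])
  have idx: "idx t \<le> N" "S (idx t) \<le> t * S N" if "0 \<le> t" for t
    using Max_in[OF fI neI[OF that]] by (auto simp: idx_def I_def)
  have idx_ge: "i \<le> idx t" if "i \<le> N" "S i \<le> t * S N" for i t
    unfolding idx_def by (rule Max_ge[OF fI]) (use that in \<open>simp add: I_def\<close>)
  have idx_mono: "idx s \<le> idx t" if "0 \<le> s" "s \<le> t" for s t
  proof (rule idx_ge)
    show "idx s \<le> N" using idx that by simp
    have "S (idx s) \<le> s * S N" using idx that by simp
    also have "\<dots> \<le> t * S N" using that S_nonneg by (intro mult_right_mono)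
    finally show "S (idx s) \<le> t * S N" .
  qed
  have idx1: "idx 1 = N" using idx[of 1] idx_ge[of N 1] by simp
  have Sd: "S (idx t) - S (idx s) \<le> \<Lambda> * (t - s) + r" if st: "0 \<le> s" "s \<le> t" "t \<le> 1" for s t
  proof (cases "idx s = N")
    case True
    then have "idx t = N" using idx_mono[OF st(1,2)] idx[of t] st by simp
    moreover have "0 \<le> \<Lambda>" using len S_nonneg[of N] by (simp add: S_def)
    ultimately show ?thesis using True st \<open>0 \<le> r\<close> by simp
  next
    case False
    then have lt: "idx s < N" using idx[of s] st by simp
    have "s * S N < S (Suc (idx s))"
    proof (rule ccontr)
      assume "\<not> ?thesis"
      then have "Suc (idx s) \<le> idx s" using lt by (intro idx_ge) auto
      then show False by simp
    qed
    \<comment> \<open>The next vertex lies beyond \<open>s * S N\<close>, so the step path lags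
      behind by less than \<open>r\<close>, the bound on one step.\<close>
    then have "s * S N - r < S (idx s)" using step[OF lt] by (simp add: SS)
    moreover have "S (idx t) \<le> t * S N" using idx[of t] st by simp
    moreover have "(t - s) * S N \<le> (t - s) * \<Lambda>" using len st by (intro mult_left_mono) (simp_all add: S_def)
    ultimately show ?thesis by (simp add: algebra_simps)
  qed
  define \<gamma> where "\<gamma> t = q (if 0 \<le> t then idx t else 0)" for t
  define C where "C t = s0 + (\<Sum>i<idx t. h (q i) * dist (q i) (q (Suc i)))" for t
  \<comment> \<open>If the chain begins with repeated points, \<open>idx 0\<close> is positive;
    those steps have length 0 and carry no cost.\<close>
  have z: "dist (q i) (q (Suc i)) = 0" if "i < idx 0" for i
  proof -
    have "S (Suc i) \<le> S (idx 0)" using that by (intro Sm) simp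
    also have "\<dots> \<le> 0" using idx(2)[of 0] by simp
    finally have "S i + dist (q i) (q (Suc i)) \<le> 0" by (simp only: SS)
    then show ?thesis using S_nonneg[of i] zero_le_dist[of "q i" "q (Suc i)"] by linarith
  qed
  have Cd: "C t - C s = (\<Sum>i=idx s..<idx t. h (q i) * dist (q i) (q (Suc i)))" if "0 \<le> s" "s \<le> t" for s t
    using sum_diff_nat_ivl[of 0 "idx s" "idx t" "\<lambda>i. h (q i) * dist (q i) (q (Suc i))"] idx_mono[OF that]
    by (simp add: C_def lessThan_atLeast0)
  have Cm: "C s \<le> C t" if "0 \<le> s" "s \<le> t" for s t
  proof -
    have "0 \<le> (\<Sum>i=idx s..<idx t. h (q i) * dist (q i) (q (Suc i)))" using h by (intro sum_nonneg) simp
    then show ?thesis using Cd[OF that] by simp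
  qed
  have d\<gamma>: "dist (\<gamma> s) (\<gamma> t) \<le> S (idx t) - S (idx s)" if "0 \<le> s" "s \<le> t" for s t
    using dS[OF idx_mono[OF that]] that by (simp add: \<gamma>_def)
  show ?thesis
  proof (rule that[of \<gamma> C])
    show "\<gamma> t \<in> q ` {..N}" for t using idx by (auto simp: \<gamma>_def)
    have "S (idx 0) \<le> 0" using idx(2)[of 0] by simp
    then have "dist (q 0) (q (idx 0)) \<le> 0" using dS[of 0 "idx 0"] unfolding S0 by linarith
    then show "\<gamma> 0 = q 0" by (simp add: \<gamma>_def)
    show "\<gamma> 1 = q N" by (simp add: \<gamma>_def idx1)
    show "C 0 = s0" by (simp add: C_def z)
    show "C 1 = s0 + (\<Sum>i<N. h (q i) * dist (q i) (q (Suc i)))" by (simp add: C_def idx1)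
    fix s t :: real assume st: "0 \<le> s" "s \<le> t" "t \<le> 1"
    show "C s \<le> C t" using Cm st by blast
    show "dist (\<gamma> s) (\<gamma> t) \<le> \<Lambda> * (t - s) + r" using d\<gamma>[OF st(1,2)] Sd[OF st] by linarith
    fix k :: "'a \<Rightarrow> real" and \<kappa> assume k: "0 \<le> \<kappa>" "\<And>x y. k x - k y \<le> \<kappa> * dist x y" "\<And>x. k x \<le> h x"
    let ?A = "k (\<gamma> s) - \<kappa> * (\<Lambda> * (t - s) + r)"
    show "?A * dist (\<gamma> s) (\<gamma> t) \<le> C t - C s"
    proof (cases "0 \<le> ?A")
      case False
      then have "?A * dist (\<gamma> s) (\<gamma> t) \<le> 0" by (intro mult_nonpos_nonneg) auto
      then show ?thesis using Cm[OF st(1,2)] by linarith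
    next
      case True
      have "?A * dist (\<gamma> s) (\<gamma> t) \<le> ?A * (S (idx t) - S (idx s))"
        using True d\<gamma>[OF st(1,2)] by (rule mult_left_mono[rotated])
      also have "S (idx t) - S (idx s) = (\<Sum>i=idx s..<idx t. dist (q i) (q (Suc i)))"
        using sum_diff_nat_ivl[of 0 "idx s" "idx t" "\<lambda>i. dist (q i) (q (Suc i))"] idx_mono[OF st(1,2)]
        by (simp add: S_def lessThan_atLeast0)
      also have "?A * (\<Sum>i=idx s..<idx t. dist (q i) (q (Suc i))) = (\<Sum>i=idx s..<idx t. ?A * dist (q i) (q (Suc i)))"
        by (rule sum_distrib_left)
      also have "\<dots> \<le> (\<Sum>i=idx s..<idx t. h (q i) * dist (q i) (q (Suc i)))"
      proof (intro sum_mono mult_right_mono)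
        fix i assume i: "i \<in> {idx s..<idx t}"
        have "dist (q (idx s)) (q i) \<le> S i - S (idx s)" using i by (intro dS) simp
        also have "\<dots> \<le> S (idx t) - S (idx s)" using i Sm[of i "idx t"] by simp
        also have "\<dots> \<le> \<Lambda> * (t - s) + r" by (rule Sd[OF st])
        finally have "\<kappa> * dist (q (idx s)) (q i) \<le> \<kappa> * (\<Lambda> * (t - s) + r)" using k(1) by (rule mult_left_mono)
        then show "?A \<le> h (q i)"
          using k(2)[of "q (idx s)" "q i"] k(3)[of "q i"] st by (simp add: \<gamma>_def)
      qed simp
      finally show ?thesis by (simp only: Cd[OF st(1,2)])
    qed
  qed
qed

section \<open>Discrete approximation from below\<close>

text \<open>A Riemann sum of the regularized \<open>g\<close> along the chain. The summand
  \<open>\<delta>\<close> makes the cost control the length, so that cheap chains cannot be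
  long.\<close>

definition chain_cost :: "('a::metric_space \<Rightarrow> ennreal) \<Rightarrow> real \<Rightarrow> nat \<Rightarrow> nat \<Rightarrow> (nat \<Rightarrow> 'a) \<Rightarrow> real" where
  "chain_cost g \<delta> n N q = (\<Sum>i<N. (lip_reg g n (q i) + \<delta>) * dist (q i) (q (Suc i)))"

definition is_chain :: "'a::metric_space set \<Rightarrow> nat \<Rightarrow> nat \<Rightarrow> (nat \<Rightarrow> 'a) \<Rightarrow> bool" where
  "is_chain X n N q \<longleftrightarrow> (\<forall>i\<le>N. q i \<in> X) \<and> (\<forall>i<N. dist (q i) (q (Suc i)) \<le> 1 / real (Suc n))"

text \<open>The real \<open>s\<close> stands for the initial cost \<open>w (q 0)\<close>, so that no
  chain starts where \<open>w\<close> is infinite.\<close>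

definition chain_values ::
    "'a::metric_space set \<Rightarrow> ('a \<Rightarrow> ennreal) \<Rightarrow> ('a \<Rightarrow> ennreal) \<Rightarrow> real \<Rightarrow> nat \<Rightarrow> 'a \<Rightarrow> real set" where
  "chain_values X g w \<delta> n x =
     {s + chain_cost g \<delta> n N q | s N q. 0 \<le> s \<and> w (q 0) \<le> ennreal s \<and> is_chain X n N q \<and> q N = x}"

text \<open>The cheapest chain with steps at most \<open>1/(n+1)\<close> ending in \<open>x\<close>, where a chain starting in \<open>y\<close>
  has initial cost \<open>w y\<close>; capped at \<open>n\<close>, as there may be no chain of finite cost.\<close>
definition chain_inf ::
    "'a::metric_space set \<Rightarrow> ('a \<Rightarrow> ennreal) \<Rightarrow> ('a \<Rightarrow> ennreal) \<Rightarrow> real \<Rightarrow> nat \<Rightarrow> 'a \<Rightarrow> real" where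
  "chain_inf X g w \<delta> n x = Inf (insert (real n) (chain_values X g w \<delta> n x))"

context
  fixes X :: "'a::metric_space set" and g w :: "'a \<Rightarrow> ennreal" and \<delta> :: real
  assumes \<delta>: "0 < \<delta>"
begin

lemma chain_cost_nonneg: "0 \<le> chain_cost g \<delta> n N q"
  unfolding chain_cost_def using \<delta> by (intro sum_nonneg mult_nonneg_nonneg add_nonneg_nonneg lip_reg_nonneg) auto

lemma chain_values_nonneg: "v \<in> chain_values X g w \<delta> n x \<Longrightarrow> 0 \<le> v"
  using chain_cost_nonneg by (fastforce simp: chain_values_def)

lemma chain_inf_bdd: "bdd_below (insert (real n) (chain_values X g w \<delta> n x))"
  by (intro bdd_belowI[of _ 0]) (auto dest: chain_values_nonneg)

lemma chain_inf_nonneg: "0 \<le> chain_inf X g w \<delta> n x"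
  unfolding chain_inf_def by (intro cInf_greatest) (auto dest: chain_values_nonneg)

lemma chain_inf_le_n: "chain_inf X g w \<delta> n x \<le> real n"
  unfolding chain_inf_def by (intro cInf_lower chain_inf_bdd) simp

lemma chain_inf_le_value: "v \<in> chain_values X g w \<delta> n x \<Longrightarrow> chain_inf X g w \<delta> n x \<le> v"
  unfolding chain_inf_def by (intro cInf_lower chain_inf_bdd) simp

lemma chain_inf_le: "x \<in> X \<Longrightarrow> ennreal (chain_inf X g w \<delta> n x) \<le> w x"
proof (cases "w x")
  case (real s)
  moreover assume "x \<in> X"
  ultimately have "s + chain_cost g \<delta> n 0 (\<lambda>_. x) \<in> chain_values X g w \<delta> n x"
    unfolding chain_values_def by (fastforce simp: is_chain_def)
  then have "chain_inf X g w \<delta> n x \<le> s" using chain_inf_le_value by (fastforce simp: chain_cost_def)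
  then show ?thesis using real by (simp add: ennreal_leI)
qed simp

text \<open>A chain to \<open>x\<close> is prolonged by the step to \<open>y\<close>. The one-step
  slope \<open>lip_reg g n x + \<delta>\<close> is the source of the pointwise Lipschitz bounds on
  the approximants.\<close>

lemma chain_inf_step:
  assumes xy: "x \<in> X" "y \<in> X" "dist x y \<le> 1 / real (Suc n)"
  shows "chain_inf X g w \<delta> n y \<le> chain_inf X g w \<delta> n x + (lip_reg g n x + \<delta>) * dist x y"
proof -
  let ?c = "(lip_reg g n x + \<delta>) * dist x y"
  have c0: "0 \<le> ?c" using \<delta> lip_reg_nonneg[of g n x] by simp
  have "chain_inf X g w \<delta> n y - ?c \<le> chain_inf X g w \<delta> n x"
    unfolding chain_inf_def[of X g w \<delta> n x]
  proof (rule cInf_greatest)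
    fix v assume "v \<in> insert (real n) (chain_values X g w \<delta> n x)"
    then consider "v = real n" | "v \<in> chain_values X g w \<delta> n x" by blast
    then show "chain_inf X g w \<delta> n y - ?c \<le> v"
    proof cases
      case 1 then show ?thesis using chain_inf_le_n[of n y] c0 by linarith
    next
      case 2
      then obtain s N q where q: "v = s + chain_cost g \<delta> n N q" "0 \<le> s" "w (q 0) \<le> ennreal s" "is_chain X n N q" "q N = x"
        by (auto simp: chain_values_def)
      let ?q = "\<lambda>i. if i \<le> N then q i else y"
      have "chain_cost g \<delta> n (Suc N) ?q = chain_cost g \<delta> n N q + ?c"
        using q(5) by (simp add: chain_cost_def)
      moreover have "is_chain X n (Suc N) ?q"
        using q(4,5) xy unfolding is_chain_def by (auto simp: less_Suc_eq)
      ultimately have "s + (chain_cost g \<delta> n N q + ?c) \<in> chain_values X g w \<delta> n y"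
        unfolding chain_values_def mem_Collect_eq using q(2,3)
        by (intro exI[of _ s] exI[of _ "Suc N"] exI[of _ ?q]) simp
      then show ?thesis using chain_inf_le_value q(1) by fastforce
    qed
  qed simp
  then show ?thesis by simp
qed

text \<open>At distances up to \<open>1 / (n + 1)\<close> the slope is at most
  \<open>n + \<delta>\<close> by \<open>chain_inf_step\<close>; at larger distances the cap
  \<open>n\<close> bounds the difference by \<open>n * (n + 1)\<close> times the distance.\<close>

lemma chain_inf_lipschitz: "((real n + \<delta> + real n * real (Suc n)))-lipschitz_on X (chain_inf X g w \<delta> n)"
proof (rule lipschitz_onI)
  let ?K = "real n + \<delta> + real n * real (Suc n)"
  have one: "chain_inf X g w \<delta> n y - chain_inf X g w \<delta> n x \<le> ?K * dist x y" if "x \<in> X" "y \<in> X" for x y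
  proof (cases "dist x y \<le> 1 / real (Suc n)")
    case True
    have "(lip_reg g n x + \<delta>) * dist x y \<le> ?K * dist x y"
      using lip_reg_le_n[of g n x] by (intro mult_right_mono) (auto intro: add_increasing2)
    then show ?thesis using chain_inf_step[OF that True] by linarith
  next
    case False
    then have "1 \<le> real (Suc n) * dist x y" by (simp add: field_simps)
    then have "real n * 1 \<le> real n * (real (Suc n) * dist x y)" by (intro mult_left_mono) auto
    also have "\<dots> \<le> ?K * dist x y" using \<delta> by (simp add: algebra_simps)
    finally show ?thesis using chain_inf_le_n[of n y] chain_inf_nonneg[of n x] by simp
  qed
  show "dist (chain_inf X g w \<delta> n x) (chain_inf X g w \<delta> n y) \<le> ?K * dist x y" if "x \<in> X" "y \<in> X" for x y
    using one[OF that] one[OF that(2,1)] by (auto simp: dist_real_def dist_commute abs_le_iff)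
qed (use \<delta> in simp)

text \<open>Otherwise chains of uniformly bounded cost, hence of bounded length, ending in \<open>x\<close> would
  subconverge to a path in \<open>X\<close> violating the upper gradient inequality.\<close>
theorem chain_inf_eventually_gt:
  assumes proper: "\<And>R. compact (cball x R :: 'a set)" and "closed X" and lsc: "lsc g" "lsc w"
    and uw: "\<And>y. y \<in> X \<Longrightarrow> ennreal (u y) \<le> w y"
    and ug: "\<And>a b \<gamma>. (a, b, \<gamma>) \<in> paths_in X \<Longrightarrow> ennreal \<bar>u (\<gamma> a) - u (\<gamma> b)\<bar> \<le> path_int g a b \<gamma>"
    and x: "x \<in> X" and c: "c < u x"
  shows "\<forall>\<^sub>F n in sequentially. c < chain_inf X g w \<delta> n x"
proof (rule ccontr)
  assume neg: "\<not> ?thesis"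
  have "0 \<le> c"
  proof (rule ccontr)
    assume "\<not> 0 \<le> c"
    then have "\<forall>\<^sub>F n in sequentially. c < chain_inf X g w \<delta> n x"
      using chain_inf_nonneg by (intro always_eventually allI) (meson less_le_trans not_le)
    then show False using neg by blast
  qed
  obtain c1 where c1: "c < c1" "c1 < u x" using dense[OF c] by blast
  define P where "P n s N q \<longleftrightarrow> 0 \<le> s \<and> w (q 0) \<le> ennreal s \<and> is_chain X n N q \<and> q N = x \<and>
    s + chain_cost g \<delta> n N q < c1" for n s N q
  define A where "A = {n. \<exists>s N q. P n s N q}"
  have "\<exists>\<^sub>F n in sequentially. n \<in> A"
  proof -
    have fr: "\<exists>\<^sub>F n in sequentially. chain_inf X g w \<delta> n x \<le> c"
      using neg by (simp add: not_eventually not_less)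
    obtain n0 :: nat where "c1 < real n0" using reals_Archimedean2 by blast
    then have ev: "\<forall>\<^sub>F n in sequentially. c1 < real n"
      by (intro eventually_mono[OF eventually_ge_at_top[of n0]]) (meson less_le_trans of_nat_le_iff)
    have "\<forall>\<^sub>F n in sequentially. chain_inf X g w \<delta> n x \<le> c \<longrightarrow> n \<in> A"
      using ev
    proof (rule eventually_mono, intro impI)
      fix n assume n: "c1 < real n" and "chain_inf X g w \<delta> n x \<le> c"
      then have "Inf (insert (real n) (chain_values X g w \<delta> n x)) < c1" using c1 by (simp add: chain_inf_def)
      then obtain v where "v \<in> insert (real n) (chain_values X g w \<delta> n x)" "v < c1"
        using cInf_lessD[of "insert (real n) (chain_values X g w \<delta> n x)" c1] by blast
      then show "n \<in> A" using n by (auto simp: A_def P_def chain_values_def)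
    qed
    with fr show ?thesis by (rule frequently_rev_mp)
  qed
  then have F: "inf sequentially (principal A) \<noteq> bot"
    unfolding frequently_def trivial_limit_def[symmetric] eventually_inf_principal by (simp add: trivial_limit_def eventually_inf_principal)
  have "\<exists>s N q. n \<in> A \<longrightarrow> P n s N q" for n by (auto simp: A_def)
  then obtain s N q where P: "\<And>n. n \<in> A \<Longrightarrow> P n (s n) (N n) (q n)" by metis
  \<comment> \<open>A chain of cost below \<open>c1\<close> has length at most
    \<open>c1 / \<delta>\<close>.\<close>
  define \<Lambda> where "\<Lambda> = c1 / \<delta>"
  have c10: "0 \<le> c1" using \<open>0 \<le> c\<close> c1 by linarith
  then have \<Lambda>0: "0 \<le> \<Lambda>" using \<delta> by (simp add: \<Lambda>_def)
  define r where "r n = 1 / real (Suc n)" for n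
  have r: "0 \<le> r n" "r n \<le> 1" for n by (simp_all add: r_def)
  define ok where "ok n \<gamma> C \<longleftrightarrow> (\<forall>t. \<gamma> t \<in> q n ` {..N n}) \<and> \<gamma> 0 = q n 0 \<and> \<gamma> 1 = x \<and> C 0 = s n \<and> C 1 \<le> c1 \<and>
    (\<forall>s t. 0 \<le> s \<longrightarrow> s \<le> t \<longrightarrow> t \<le> 1 \<longrightarrow> C s \<le> C t) \<and>
    (\<forall>s t. 0 \<le> s \<longrightarrow> s \<le> t \<longrightarrow> t \<le> 1 \<longrightarrow> dist (\<gamma> s) (\<gamma> t) \<le> \<Lambda> * (t - s) + r n) \<and>
    (\<forall>m\<le>n. \<forall>s t. 0 \<le> s \<longrightarrow> s \<le> t \<longrightarrow> t \<le> 1 \<longrightarrow>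
      (lip_reg g m (\<gamma> s) - real m * (\<Lambda> * (t - s) + r n)) * dist (\<gamma> s) (\<gamma> t) \<le> C t - C s)"
    for n and \<gamma> :: "real \<Rightarrow> 'a" and C :: "real \<Rightarrow> real"
  have "\<exists>\<gamma> C. ok n \<gamma> C" if "n \<in> A" for n
  proof -
    note Pn = P[OF that, unfolded P_def]
    let ?d = "\<lambda>i. dist (q n i) (q n (Suc i))"
    have "\<delta> * (\<Sum>i<N n. ?d i) \<le> chain_cost g \<delta> n (N n) (q n)"
      unfolding chain_cost_def sum_distrib_left using lip_reg_nonneg[of g n] by (intro sum_mono mult_right_mono) auto
    then have "\<delta> * (\<Sum>i<N n. ?d i) \<le> c1" using Pn by linarith
    then have len: "(\<Sum>i<N n. ?d i) \<le> \<Lambda>" using \<delta> by (simp add: \<Lambda>_def pos_le_divide_eq mult.commute)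
    have "(\<Sum>i<N n. lip_reg g n (q n i) * ?d i) \<le> chain_cost g \<delta> n (N n) (q n)"
      unfolding chain_cost_def using \<delta> by (intro sum_mono mult_right_mono) auto
    then have cost: "s n + (\<Sum>i<N n. lip_reg g n (q n i) * ?d i) \<le> c1" using Pn by linarith
    have st: "?d i \<le> r n" if "i < N n" for i using Pn that by (simp add: is_chain_def r_def)
    obtain \<gamma> C where \<gamma>: "\<And>t. \<gamma> t \<in> q n ` {..N n}" "\<gamma> 0 = q n 0" "\<gamma> 1 = q n (N n)" "C 0 = s n"
      "C 1 = s n + (\<Sum>i<N n. lip_reg g n (q n i) * ?d i)"
      "\<And>s t. 0 \<le> s \<Longrightarrow> s \<le> t \<Longrightarrow> t \<le> 1 \<Longrightarrow> C s \<le> C t"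
      "\<And>s t. 0 \<le> s \<Longrightarrow> s \<le> t \<Longrightarrow> t \<le> 1 \<Longrightarrow> dist (\<gamma> s) (\<gamma> t) \<le> \<Lambda> * (t - s) + r n"
      "\<And>k \<kappa> s t. 0 \<le> \<kappa> \<Longrightarrow> (\<And>x y. k x - k y \<le> \<kappa> * dist x y) \<Longrightarrow> (\<And>x. k x \<le> lip_reg g n x) \<Longrightarrow>
         0 \<le> s \<Longrightarrow> s \<le> t \<Longrightarrow> t \<le> 1 \<Longrightarrow>
         (k (\<gamma> s) - \<kappa> * (\<Lambda> * (t - s) + r n)) * dist (\<gamma> s) (\<gamma> t) \<le> C t - C s"
      using chain_param[where N = "N n" and q = "q n" and r = "r n" and \<Lambda> = \<Lambda> and h = "lip_reg g n" and ?s0.0 = "s n",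
          OF st r(1) len lip_reg_nonneg] by blast
    have lr: "lip_reg g m y - lip_reg g m z \<le> real m * dist y z" for m y z
      using lip_reg_lipschitz[of g m y z] by (simp add: abs_le_iff)
    have "(lip_reg g m (\<gamma> s) - real m * (\<Lambda> * (t - s) + r n)) * dist (\<gamma> s) (\<gamma> t) \<le> C t - C s"
      if "m \<le> n" "0 \<le> s" "s \<le> t" "t \<le> 1" for m s t
      by (rule \<gamma>(8)[of "real m" "lip_reg g m"]) (use that lr lip_reg_mono in auto)
    then have "ok n \<gamma> C" unfolding ok_def using \<gamma>(1-7) Pn cost by auto
    then show ?thesis by blast
  qed
  then obtain \<Gamma> K where ok: "\<And>n. n \<in> A \<Longrightarrow> ok n (\<Gamma> n) (K n)" by metis
  have okK: "K n s \<le> K n t" if "n \<in> A" "0 \<le> s" "s \<le> t" "t \<le> 1" for n s t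
    using ok[OF that(1)] that(2-4) unfolding ok_def by blast
  have okd: "dist (\<Gamma> n s) (\<Gamma> n t) \<le> \<Lambda> * (t - s) + r n" if "n \<in> A" "0 \<le> s" "s \<le> t" "t \<le> 1" for n s t
    using ok[OF that(1)] that(2-4) unfolding ok_def by blast
  have okc: "(lip_reg g m (\<Gamma> n s) - real m * (\<Lambda> * (t - s) + r n)) * dist (\<Gamma> n s) (\<Gamma> n t) \<le> K n t - K n s"
    if "n \<in> A" "m \<le> n" "0 \<le> s" "s \<le> t" "t \<le> 1" for n m s t
    using ok[OF that(1)] that(2-5) unfolding ok_def by blast
  have oke: "\<Gamma> n 0 = q n 0" "\<Gamma> n 1 = x" "K n 0 = s n" "K n 1 \<le> c1" "\<Gamma> n t \<in> q n ` {..N n}" if "n \<in> A" for n t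
    using ok[OF that] unfolding ok_def by blast+
  \<comment> \<open>The default \<open>(x, 0)\<close> keeps the values in one compact set for every
    \<open>n\<close> and \<open>t\<close>, as \<open>cluster_point_product\<close> demands; the
    limit is taken along \<open>A\<close>.\<close>
  define f where "f n t = (if n \<in> A \<and> t \<in> {0..1} then (\<Gamma> n t, K n t) else (x, 0))" for n and t :: real
  \<comment> \<open>The step paths end in \<open>x\<close> and move by at most
    \<open>\<Lambda> + r n\<close>, where \<open>r n \<le> 1\<close>.\<close>
  have cpt: "compact ((X \<inter> cball x (\<Lambda> + 1)) \<times> {0..c1})"
    using proper \<open>closed X\<close> by (intro compact_Times) (auto intro: closed_Int_compact)
  have mem: "f n t \<in> (X \<inter> cball x (\<Lambda> + 1)) \<times> {0..c1}" for n t
  proof (cases "n \<in> A \<and> t \<in> {0..1}")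
    case True
    then have t: "0 \<le> t" "t \<le> 1" by auto
    have nA: "n \<in> A" using True by simp
    have "\<Gamma> n t \<in> q n ` {..N n}" using nA by (rule oke)
    then obtain i where i: "i \<le> N n" "\<Gamma> n t = q n i" by auto
    moreover have "is_chain X n (N n) (q n)" using P[OF nA] unfolding P_def by blast
    ultimately have "\<Gamma> n t \<in> X" unfolding is_chain_def by simp
    moreover have "dist (\<Gamma> n t) (\<Gamma> n 1) \<le> \<Lambda> * (1 - t) + r n" "\<Gamma> n 1 = x" using okd[OF nA, of t 1] oke[OF nA] t by auto
    then have "dist x (\<Gamma> n t) \<le> \<Lambda> + 1"
      using r(2)[of n] \<Lambda>0 t mult_left_le[of "1 - t" \<Lambda>] by (simp add: dist_commute)
    moreover have "0 \<le> K n 0" using P[OF nA] oke[OF nA] by (simp add: P_def)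
    moreover have "K n 0 \<le> K n t" "K n t \<le> K n 1" "K n 1 \<le> c1" using okK[OF nA, of 0 t] okK[OF nA, of t 1] oke[OF nA] t by auto
    ultimately have "\<Gamma> n t \<in> X" "dist x (\<Gamma> n t) \<le> \<Lambda> + 1" "0 \<le> K n t" "K n t \<le> c1" by (blast intro: order_trans)+
    then show ?thesis using True unfolding f_def by simp
  next
    case False
    then show ?thesis using x c10 \<Lambda>0 by (simp only: f_def if_False) auto
  qed
  obtain F' G where F': "F' \<le> inf sequentially (principal A)" "F' \<noteq> bot"
    "\<And>t. G t \<in> (X \<inter> cball x (\<Lambda> + 1)) \<times> {0..c1}" "\<And>t. ((\<lambda>n. f n t) \<longlongrightarrow> G t) F'"
    using cluster_point_product[where f = f and S = "\<lambda>_. (X \<inter> cball x (\<Lambda> + 1)) \<times> {0..c1}", OF F cpt mem]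
    by blast
  define \<gamma> where "\<gamma> t = fst (G t)" for t
  define C where "C t = snd (G t)" for t
  have evA: "eventually (\<lambda>n. n \<in> A) F'"
    by (rule filter_leD[OF order_trans[OF F'(1) inf_le2]]) (simp add: eventually_principal)
  have seqF: "F' \<le> sequentially" using F'(1) by simp
  have lim\<gamma>: "((\<lambda>n. \<Gamma> n t) \<longlongrightarrow> \<gamma> t) F'" and limC: "((\<lambda>n. K n t) \<longlongrightarrow> C t) F'" if "0 \<le> t" "t \<le> 1" for t
  proof -
    have "eventually (\<lambda>n. fst (f n t) = \<Gamma> n t) F'" "eventually (\<lambda>n. snd (f n t) = K n t) F'"
      using evA that by (auto elim!: eventually_mono simp: f_def)
    then show "((\<lambda>n. \<Gamma> n t) \<longlongrightarrow> \<gamma> t) F'" "((\<lambda>n. K n t) \<longlongrightarrow> C t) F'"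
      using tendsto_fst[OF F'(4)[of t]] tendsto_snd[OF F'(4)[of t]]
      by (auto simp: \<gamma>_def C_def intro: Lim_transform_eventually)
  qed
  have limr: "(r \<longlongrightarrow> 0) F'"
    using LIMSEQ_inverse_real_of_nat by (intro tendsto_mono[OF seqF]) (simp add: r_def[abs_def] inverse_eq_divide)
  have d\<gamma>: "dist (\<gamma> s) (\<gamma> t) \<le> \<Lambda> * (t - s)" if st: "0 \<le> s" "s \<le> t" "t \<le> 1" for s t
  proof -
    have "((\<lambda>n. \<Lambda> * (t - s) + r n) \<longlongrightarrow> \<Lambda> * (t - s) + 0) F'" by (intro tendsto_intros limr)
    moreover have "((\<lambda>n. dist (\<Gamma> n s) (\<Gamma> n t)) \<longlongrightarrow> dist (\<gamma> s) (\<gamma> t)) F'" using st by (intro tendsto_dist lim\<gamma>) auto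
    moreover have "\<forall>\<^sub>F n in F'. dist (\<Gamma> n s) (\<Gamma> n t) \<le> \<Lambda> * (t - s) + r n"
      using evA by (rule eventually_mono) (rule okd[OF _ st])
    ultimately have "dist (\<gamma> s) (\<gamma> t) \<le> \<Lambda> * (t - s) + 0" by (rule tendsto_le[OF F'(2)])
    then show ?thesis by simp
  qed
  have Cm: "C s \<le> C t" if st: "0 \<le> s" "s \<le> t" "t \<le> 1" for s t
  proof (rule tendsto_le[OF F'(2)])
    show "((\<lambda>n. K n t) \<longlongrightarrow> C t) F'" "((\<lambda>n. K n s) \<longlongrightarrow> C s) F'" using st by (auto intro: limC)
    show "\<forall>\<^sub>F n in F'. K n s \<le> K n t"
      using evA by (rule eventually_mono) (rule okK[OF _ st])
  qed
  have cost: "(lip_reg g m (\<gamma> s) - real m * (\<Lambda> * (t - s))) * dist (\<gamma> s) (\<gamma> t) \<le> C t - C s"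
    if st: "0 \<le> s" "s \<le> t" "t \<le> 1" for m s t
  proof -
    have "((\<lambda>n. lip_reg g m (\<Gamma> n s)) \<longlongrightarrow> lip_reg g m (\<gamma> s)) F'"
    proof (rule Lim_null[THEN iffD2], rule Lim_null_comparison)
      show "\<forall>\<^sub>F n in F'. norm (lip_reg g m (\<Gamma> n s) - lip_reg g m (\<gamma> s)) \<le> real m * dist (\<Gamma> n s) (\<gamma> s)"
        by (intro always_eventually allI) (simp add: lip_reg_lipschitz)
      have "((\<lambda>n. real m * dist (\<Gamma> n s) (\<gamma> s)) \<longlongrightarrow> real m * dist (\<gamma> s) (\<gamma> s)) F'"
        using st by (intro tendsto_intros lim\<gamma>) auto
      then show "((\<lambda>n. real m * dist (\<Gamma> n s) (\<gamma> s)) \<longlongrightarrow> 0) F'" by simp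
    qed
    then have "((\<lambda>n. (lip_reg g m (\<Gamma> n s) - real m * (\<Lambda> * (t - s) + r n)) * dist (\<Gamma> n s) (\<Gamma> n t)) \<longlongrightarrow>
        (lip_reg g m (\<gamma> s) - real m * (\<Lambda> * (t - s) + 0)) * dist (\<gamma> s) (\<gamma> t)) F'"
      using st by (intro tendsto_intros limr lim\<gamma>) auto
    moreover have "((\<lambda>n. K n t - K n s) \<longlongrightarrow> C t - C s) F'" using st by (intro tendsto_diff limC) auto
    moreover have "\<forall>\<^sub>F n in F'. m \<le> n" using filter_leD[OF seqF eventually_ge_at_top] .
    then have "\<forall>\<^sub>F n in F'. (lip_reg g m (\<Gamma> n s) - real m * (\<Lambda> * (t - s) + r n)) * dist (\<Gamma> n s) (\<Gamma> n t) \<le> K n t - K n s"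
      using evA by eventually_elim (rule okc[OF _ _ st])
    ultimately have "(lip_reg g m (\<gamma> s) - real m * (\<Lambda> * (t - s) + 0)) * dist (\<gamma> s) (\<gamma> t) \<le> C t - C s"
      by (intro tendsto_le[OF F'(2)])
    then show ?thesis by simp
  qed
  interpret rectifiable_path 0 1 \<gamma> by (rule rectifiable_lipschitz_path[OF \<Lambda>0 d\<gamma>])
  have inX: "\<gamma> t \<in> X" for t using F'(3)[of t] by (auto simp: \<gamma>_def)
  have C01: "0 \<le> C t" "C t \<le> c1" for t using F'(3)[of t] by (auto simp: C_def)
  have path: "(0, 1, \<gamma>) \<in> paths_in X" using inX cont by (auto simp: paths_in_def)
  have km: "path_int (\<lambda>y. ennreal (lip_reg g m y)) 0 1 \<gamma> \<le> ennreal (C 1 - C 0)" for m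
  proof (rule path_int_le_cumulative_cost)
    show "lip_reg g m y - lip_reg g m z \<le> real m * dist y z" for y z
      using lip_reg_lipschitz[of g m y z] by (simp add: abs_le_iff)
  qed (use \<Lambda>0 d\<gamma> Cm cost lip_reg_nonneg in auto)
  have "path_int g 0 1 \<gamma> \<le> ennreal (C 1 - C 0)"
  proof -
    let ?h = "\<lambda>m t. ennreal (lip_reg g m (\<gamma> t)) * indicator {0..1} t"
    have "path_int g 0 1 \<gamma> = (\<integral>\<^sup>+t. (SUP m. ?h m t) \<partial>lm)"
      unfolding path_int_eq by (intro nn_integral_cong) (auto simp: lip_reg_SUP[OF lsc(1)] split: split_indicator)
    also have "\<dots> = (SUP m. \<integral>\<^sup>+t. ?h m t \<partial>lm)"
    proof (rule nn_integral_monotone_convergence_SUP)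
      show "incseq ?h" by (auto simp: incseq_def le_fun_def intro!: mult_right_mono ennreal_leI lip_reg_mono)
      show "?h m \<in> borel_measurable lm" for m
      proof -
        have "(real m)-lipschitz_on UNIV (lip_reg g m)"
          by (intro lipschitz_onI) (auto simp: dist_real_def lip_reg_lipschitz)
        then have "continuous_on UNIV (lip_reg g m)" by (rule lipschitz_on_continuous_on)
        then have "(\<lambda>y. ennreal (lip_reg g m y)) \<in> borel_measurable (restrict_space borel X)"
          by (intro measurable_restrict_space1 measurable_compose[OF _ measurable_ennreal] borel_measurable_continuous_onI)
        from measurable_along_path[OF path this] show ?thesis by simp
      qed
    qed
    also have "\<dots> \<le> ennreal (C 1 - C 0)" using km unfolding path_int_eq by (intro SUP_least)
    finally show ?thesis .
  qed
  with ug[OF path] have "ennreal \<bar>u (\<gamma> 0) - u (\<gamma> 1)\<bar> \<le> ennreal (C 1 - C 0)" by (rule order_trans)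
  then have u1: "\<bar>u (\<gamma> 0) - u (\<gamma> 1)\<bar> \<le> C 1 - C 0" using Cm[of 0 1] by (subst (asm) ennreal_le_iff) auto
  have \<gamma>1: "\<gamma> 1 = x"
  proof (rule tendsto_unique[OF F'(2) lim\<gamma>])
    have "eventually (\<lambda>n. x = \<Gamma> n 1) F'" using evA by (rule eventually_mono) (simp add: oke)
    then show "((\<lambda>n. \<Gamma> n 1) \<longlongrightarrow> x) F'" by (rule Lim_transform_eventually[OF tendsto_const])
  qed auto
  \<comment> \<open>Lower semicontinuity of \<open>w\<close> carries the bound by the initial costs
    to the limit.\<close>
  have w0: "w (\<gamma> 0) \<le> ennreal (C 0)"
  proof (rule ccontr)
    assume "\<not> ?thesis"
    then obtain e where e: "ennreal (C 0) < e" "e < w (\<gamma> 0)" using dense by (metis not_le)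
    then obtain c2 where c2: "e = ennreal c2" "0 \<le> c2" by (cases e) auto
    have "\<forall>\<^sub>F n in F'. e < w (\<Gamma> n 0)"
      using topological_tendstoD[OF lim\<gamma>[of 0], of "{y. e < w y}"] lsc(2) e(2) by (auto simp: lsc_def)
    moreover have "C 0 < c2" using e(1) c2 C01(1)[of 0] by (simp add: ennreal_less_iff)
    then have "\<forall>\<^sub>F n in F'. K n 0 < c2" by (intro order_tendstoD(2)[OF limC]) auto
    ultimately have "\<forall>\<^sub>F n in F'. False"
      using evA
    proof eventually_elim
      case (elim n)
      have "w (\<Gamma> n 0) \<le> ennreal (K n 0)" using oke[OF elim(3)] P[OF elim(3)] by (simp add: P_def)
      also have "\<dots> \<le> e" unfolding c2(1) using elim(2) by (intro ennreal_leI) simp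
      finally show False using elim(1) by simp
    qed
    then show False using F'(2) by (simp add: eventually_False)
  qed
  have "ennreal (u (\<gamma> 0)) \<le> ennreal (C 0)" using uw[OF inX] w0 by (rule order_trans)
  then have "u (\<gamma> 0) \<le> C 0" using C01(1)[of 0] by (simp add: ennreal_le_iff2) linarith
  \<comment> \<open>The contradiction is \<open>u x \<le> u (\<gamma> 0) + (C 1 - C 0) \<le> C 1
    \<le> c1 < u x\<close>.\<close>
  then show False using u1 \<gamma>1 C01(2)[of 1] c1(2) by (auto simp: abs_le_iff)
qed

end

section \<open>Midpoint hulls and energy minimization\<close>

text \<open>Dyadic convex combinations, generated by midpoints because the parallelogram identity
  and the convexity estimates act on midpoints.\<close>

inductive_set mhull :: "('a \<Rightarrow> real) set \<Rightarrow> ('a \<Rightarrow> real) set" for S where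
  base: "f \<in> S \<Longrightarrow> f \<in> mhull S"
| mid: "f \<in> mhull S \<Longrightarrow> g \<in> mhull S \<Longrightarrow> (\<lambda>x. (f x + g x) / 2) \<in> mhull S"

lemma mhull_mono: "S \<subseteq> T \<Longrightarrow> mhull S \<subseteq> mhull T"
proof
  fix f assume "S \<subseteq> T" "f \<in> mhull S"
  from this(2,1) show "f \<in> mhull T" by induction (auto intro: mhull.intros)
qed

lemma mhull_le:
  assumes "f \<in> mhull S" "\<And>g. g \<in> S \<Longrightarrow> g x \<le> b"
  shows "f x \<le> (b::real)"
  using assms(1) by induction (auto intro: assms(2))

lemma mhull_ge:
  assumes "f \<in> mhull S" "\<And>g. g \<in> S \<Longrightarrow> b \<le> g x"
  shows "(b::real) \<le> f x"
  using assms(1) by induction (auto intro: assms(2))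

lemma mhull_measurable:
  assumes "f \<in> mhull S" "\<And>g. g \<in> S \<Longrightarrow> g \<in> borel_measurable N"
  shows "f \<in> borel_measurable N"
  using assms(1) by induction (auto intro: assms(2))

text \<open>The minimization argument of the Hilbert space projection theorem.\<close>
lemma min_energy_Cauchy:
  fixes q :: "('a \<Rightarrow> real) \<Rightarrow> real" and S :: "nat \<Rightarrow> ('a \<Rightarrow> real) set"
  assumes ne: "\<And>n. S n \<noteq> {}" and dec: "\<And>m n. m \<le> n \<Longrightarrow> S n \<subseteq> S m"
    and mid: "\<And>n f g. f \<in> S n \<Longrightarrow> g \<in> S n \<Longrightarrow> (\<lambda>x. (f x + g x) / 2) \<in> S n"
    and q0: "\<And>f. f \<in> S 0 \<Longrightarrow> 0 \<le> q f" and bdd: "\<And>n. \<exists>f\<in>S n. q f \<le> B"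
    and par: "\<And>f g. f \<in> S 0 \<Longrightarrow> g \<in> S 0 \<Longrightarrow>
      q (\<lambda>x. (f x + g x) / 2) + q (\<lambda>x. (f x - g x) / 2) = (q f + q g) / 2"
  shows "\<exists>y. (\<forall>n. y n \<in> S n) \<and> (\<forall>e>0. \<exists>N. \<forall>n\<ge>N. \<forall>m\<ge>n. q (\<lambda>x. (y n x - y m x) / 2) < e)"
proof -
  define I where "I n = (INF f\<in>S n. q f)" for n
  have S0: "S n \<subseteq> S 0" for n using dec by simp
  have bb: "bdd_below (q ` S n)" for n using q0 S0 by (intro bdd_belowI[of _ 0]) auto
  have Ile: "I n \<le> q f" if "f \<in> S n" for n f unfolding I_def using that by (intro cINF_lower bb)
  have IB: "I n \<le> B" for n using bdd[of n] Ile by (meson order_trans)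
  have inc: "incseq I" unfolding incseq_def I_def using ne bb dec by (intro allI impI cINF_superset_mono) auto
  have ex: "\<exists>f\<in>S n. q f < I n + 1 / real (Suc n)" for n
  proof -
    have "I n < I n + 1 / real (Suc n)" by simp
    then show ?thesis using cInf_lessD[of "q ` S n" "I n + 1 / real (Suc n)"] ne[of n] unfolding I_def by auto
  qed
  then obtain y where y: "\<And>n. y n \<in> S n" "\<And>n. q (y n) < I n + 1 / real (Suc n)" by metis
  have conv: "I \<longlonglongrightarrow> (SUP n. I n)" using inc IB by (intro LIMSEQ_incseq_SUP) (auto intro!: bdd_aboveI)
  \<comment> \<open>\<open>y m\<close> also lies in \<open>S n\<close>, so the midpoint has energy
    at least \<open>I n\<close>; the parallelogram identity leaves at most
    \<open>(q (y n) + q (y m)) / 2 - I n\<close> for the half difference.\<close>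
  have key: "q (\<lambda>x. (y n x - y m x) / 2) \<le> ((SUP n. I n) - I n) / 2 + 1 / real (Suc n)" if "n \<le> m" for n m
  proof -
    have ym: "y m \<in> S n" using y(1)[of m] dec[OF that] by blast
    have "q (\<lambda>x. (y n x + y m x) / 2) + q (\<lambda>x. (y n x - y m x) / 2) = (q (y n) + q (y m)) / 2"
      using y(1)[of n] ym S0 by (intro par) auto
    moreover have "I n \<le> q (\<lambda>x. (y n x + y m x) / 2)" by (intro Ile mid y ym)
    moreover have "I m \<le> (SUP n. I n)" using IB by (intro cSUP_upper) (auto intro!: bdd_aboveI)
    moreover have "1 / real (Suc m) \<le> 1 / real (Suc n)" using that by (simp add: frac_le)
    ultimately show ?thesis using y(2)[of n] y(2)[of m] by argo
  qed
  show ?thesis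
  proof (intro exI[of _ y] conjI allI impI y(1))
    fix e :: real assume "0 < e"
    have "(\<lambda>n. ((SUP n. I n) - I n) / 2 + 1 / real (Suc n)) \<longlonglongrightarrow> ((SUP n. I n) - (SUP n. I n)) / 2 + 0"
      by (intro tendsto_intros conv LIMSEQ_inverse_real_of_nat[unfolded inverse_eq_divide]) simp
    then have "\<forall>\<^sub>F n in sequentially. ((SUP n. I n) - I n) / 2 + 1 / real (Suc n) < e"
      using \<open>0 < e\<close> by (intro order_tendstoD(2)) auto
    then obtain N where "\<And>n. N \<le> n \<Longrightarrow> ((SUP n. I n) - I n) / 2 + 1 / real (Suc n) < e"
      by (auto simp: eventually_sequentially)
    then show "\<exists>N. \<forall>n\<ge>N. \<forall>m\<ge>n. q (\<lambda>x. (y n x - y m x) / 2) < e" using key by (meson le_less_trans)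
  qed
qed

section \<open>Discrete energies\<close>

text \<open>\<open>G x\<close> bounds the asymptotic Lipschitz constant of \<open>v\<close> at \<open>x\<close> within \<open>X\<close>.\<close>
definition alip_le :: "'a::metric_space set \<Rightarrow> ('a \<Rightarrow> real) \<Rightarrow> 'a \<Rightarrow> ennreal \<Rightarrow> bool" where
  "alip_le X v x G \<longleftrightarrow> (\<forall>c. G < ennreal c \<longrightarrow>
     (\<exists>r>0. \<forall>y\<in>X \<inter> ball x r. \<forall>z\<in>X \<inter> ball x r. \<bar>v y - v z\<bar> \<le> c * dist y z))"

text \<open>The hypothesis on \<open>h\<close> covers half sums and half differences of
  \<open>f\<close> and \<open>g\<close> alike.\<close>

lemma alip_le_combine:
  assumes "alip_le X f x G" "alip_le X g x G"
    and h: "\<And>y z. \<bar>h y - h z\<bar> \<le> (\<bar>f y - f z\<bar> + \<bar>g y - g z\<bar>) / 2"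
  shows "alip_le X h x G"
  unfolding alip_le_def
proof (intro allI impI)
  fix c assume c: "G < ennreal c"
  obtain r s where r: "r > 0" "\<forall>y\<in>X \<inter> ball x r. \<forall>z\<in>X \<inter> ball x r. \<bar>f y - f z\<bar> \<le> c * dist y z"
    and s: "s > 0" "\<forall>y\<in>X \<inter> ball x s. \<forall>z\<in>X \<inter> ball x s. \<bar>g y - g z\<bar> \<le> c * dist y z"
    using assms(1,2) c unfolding alip_le_def by blast
  show "\<exists>r>0. \<forall>y\<in>X \<inter> ball x r. \<forall>z\<in>X \<inter> ball x r. \<bar>h y - h z\<bar> \<le> c * dist y z"
  proof (intro exI[of _ "min r s"] conjI ballI)
    fix y z assume "y \<in> X \<inter> ball x (min r s)" "z \<in> X \<inter> ball x (min r s)"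
    then have "\<bar>f y - f z\<bar> \<le> c * dist y z" "\<bar>g y - g z\<bar> \<le> c * dist y z" using r(2) s(2) by auto
    then show "\<bar>h y - h z\<bar> \<le> c * dist y z" using h[of y z] by simp
  qed (use r s in simp)
qed

lemma mhull_alip_le:
  assumes "f \<in> mhull S" "\<And>g. g \<in> S \<Longrightarrow> alip_le X g x G"
  shows "alip_le X f x G"
  using assms(1)
proof induction
  case (mid f g)
  show ?case
  proof (rule alip_le_combine[OF mid.IH])
    fix y z
    have e: "(f y + g y) / 2 - (f z + g z) / 2 = ((f y - f z) + (g y - g z)) / 2"
      unfolding add_divide_distrib diff_divide_distrib by (simp only: algebra_simps)
    show "\<bar>(f y + g y) / 2 - (f z + g z) / 2\<bar> \<le> (\<bar>f y - f z\<bar> + \<bar>g y - g z\<bar>) / 2"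
      unfolding e using abs_triangle_ineq[of "f y - f z" "g y - g z"] by simp
  qed
qed (rule assms(2))

definition lipschitz_fun :: "'a::metric_space set \<Rightarrow> ('a \<Rightarrow> real) \<Rightarrow> bool" where
  "lipschitz_fun X v \<longleftrightarrow> (\<exists>L. L-lipschitz_on X v)"

lemma lipschitz_fun_half:
  assumes "lipschitz_fun X f" "lipschitz_fun X g"
  shows "lipschitz_fun X (\<lambda>x. (f x + g x) / 2)" "lipschitz_fun X (\<lambda>x. (f x - g x) / 2)"
proof -
  obtain L L' where L: "L-lipschitz_on X f" "L'-lipschitz_on X g" using assms by (auto simp: lipschitz_fun_def)
  have "(\<bar>1/2\<bar> * (L + L'))-lipschitz_on X (\<lambda>x. (1/2) * (f x + g x))"
    by (intro lipschitz_on_cmult_real lipschitz_on_add L)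
  then show "lipschitz_fun X (\<lambda>x. (f x + g x) / 2)" by (auto simp: lipschitz_fun_def)
  have "(\<bar>1/2\<bar> * (L + L'))-lipschitz_on X (\<lambda>x. (1/2) * (f x - g x))"
    by (intro lipschitz_on_cmult_real lipschitz_on_diff L)
  then show "lipschitz_fun X (\<lambda>x. (f x - g x) / 2)" by (auto simp: lipschitz_fun_def)
qed

lemma mhull_lipschitz_fun:
  assumes "f \<in> mhull S" "\<And>g. g \<in> S \<Longrightarrow> lipschitz_fun X g"
  shows "lipschitz_fun X f"
  using assms(1) by induction (auto intro: assms(2) lipschitz_fun_half)

section \<open>Nets and discrete quadratic energies\<close>

locale closed_doubling = doubling_space p \<mu> for p :: real and \<mu> :: "'a::polish_space set \<Rightarrow> ennreal" +
  fixes X :: "'a set"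
  assumes closed_X: "closed X"
begin

sublocale mm_subspace p \<mu> X
  by (rule mm_subspaceI) (simp add: borel_sets_M closed_X)

definition scale :: "nat \<Rightarrow> real" where "scale k = 1 / real (Suc k)"

lemma scale_pos: "0 < scale k" and scale_antimono: "i \<le> j \<Longrightarrow> scale j \<le> scale i"
  by (auto simp: scale_def frac_le)

lemma scale_tendsto: "scale \<longlonglongrightarrow> 0"
  unfolding scale_def[abs_def] by (rule LIMSEQ_inverse_real_of_nat[unfolded inverse_eq_divide])

definition net :: "nat \<Rightarrow> 'a set" where
  "net k = (SOME N. N \<subseteq> X \<and> separated (scale k) N \<and> (\<forall>x\<in>X. \<exists>y\<in>N. dist x y < scale k))"

lemma net: "net k \<subseteq> X" "separated (scale k) (net k)" "x \<in> X \<Longrightarrow> \<exists>y\<in>net k. dist x y < scale k"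
proof -
  have "\<exists>N. N \<subseteq> X \<and> separated (scale k) N \<and> (\<forall>x\<in>X. \<exists>y\<in>N. dist x y < scale k)"
    by (rule maximal_separated_subset[OF scale_pos[of k], of X]) blast
  from someI_ex[OF this] show "net k \<subseteq> X" "separated (scale k) (net k)" "x \<in> X \<Longrightarrow> \<exists>y\<in>net k. dist x y < scale k"
    unfolding net_def by blast+
qed

lemma separated_subset: "separated r S \<Longrightarrow> T \<subseteq> S \<Longrightarrow> separated r T"
  by (auto simp: separated_def)

text \<open>Contains all net points within \<open>scale k\<close> of a point at distance at most
  \<open>scale k\<close> from \<open>x\<close>, as is required when \<open>x\<close> lies on a piece
  of path of length at most \<open>scale k\<close>.\<close>

definition nb :: "nat \<Rightarrow> 'a \<Rightarrow> 'a set" where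
  "nb k x = net k \<inter> ball x (3 * scale k)"

text \<open>The radius \<open>2 ^ 2 * r\<close> with \<open>r = scale k\<close> encloses the radius
  \<open>3 * scale k\<close> of \<open>nb\<close>; the bound is the same at all scales.\<close>

definition Kd :: nat where
  "Kd = (SOME K. \<forall>(x::'a) r S. 0 < r \<longrightarrow> separated r S \<longrightarrow> S \<subseteq> ball x (2 ^ 2 * r) \<longrightarrow> finite S \<and> card S \<le> K)"

lemma nb_card: "finite (nb k x) \<and> card (nb k x) \<le> Kd"
proof -
  have "\<exists>K. \<forall>(x::'a) r S. 0 < r \<longrightarrow> separated r S \<longrightarrow> S \<subseteq> ball x (2 ^ 2 * r) \<longrightarrow> finite S \<and> card S \<le> K"
    by (rule separated_card_bound[of 2]) blast
  then have *: "\<forall>(x::'a) r S. 0 < r \<longrightarrow> separated r S \<longrightarrow> S \<subseteq> ball x (2 ^ 2 * r) \<longrightarrow> finite S \<and> card S \<le> Kd"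
    unfolding Kd_def by (rule someI_ex)
  have "separated (scale k) (nb k x)" by (rule separated_subset[OF net(2)]) (auto simp: nb_def)
  moreover have "nb k x \<subseteq> ball x (2 ^ 2 * scale k)" using scale_pos[of k] by (auto simp: nb_def)
  ultimately show ?thesis using * scale_pos by blast
qed

text \<open>Built from squared difference quotients so that, for fixed \<open>x\<close>, it is an
  exact quadratic form in \<open>v\<close>, unlike the square of a local Lipschitz constant.\<close>

definition En :: "nat \<Rightarrow> ('a \<Rightarrow> real) \<Rightarrow> 'a \<Rightarrow> real" where
  "En k v x = (\<Sum>y\<in>nb k x. \<Sum>z\<in>nb k x. ((v y - v z) / scale k)\<^sup>2)"

lemma En_nonneg: "0 \<le> En k v x"
  unfolding En_def by (intro sum_nonneg) auto

lemma En_parallelogram: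
  "En k (\<lambda>x. (f x + g x) / 2) x + En k (\<lambda>x. (f x - g x) / 2) x = (En k f x + En k g x) / 2"
proof -
  have "(((f y + g y) / 2 - (f z + g z) / 2) / s)\<^sup>2 + (((f y - g y) / 2 - (f z - g z) / 2) / s)\<^sup>2
    = (((f y - f z) / s)\<^sup>2 + ((g y - g z) / s)\<^sup>2) / 2" for y z and s :: real
    unfolding power_divide by (simp add: power2_eq_square divide_simps) (simp add: algebra_simps)
  then show ?thesis
    unfolding En_def by (simp only: sum.distrib[symmetric] sum_divide_distrib)
qed

lemma En_term_le: "y \<in> nb k x \<Longrightarrow> z \<in> nb k x \<Longrightarrow> ((v y - v z) / scale k)\<^sup>2 \<le> En k v x"
proof -
  assume yz: "y \<in> nb k x" "z \<in> nb k x"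
  have "((v y - v z) / scale k)\<^sup>2 \<le> (\<Sum>z\<in>nb k x. ((v y - v z) / scale k)\<^sup>2)"
    using yz nb_card by (intro member_le_sum) auto
  also have "\<dots> \<le> En k v x"
    unfolding En_def using yz nb_card by (intro member_le_sum[where f = "\<lambda>y. \<Sum>z\<in>nb k x. ((v y - v z) / scale k)\<^sup>2"] sum_nonneg) auto
  finally show ?thesis .
qed

text \<open>Points of \<open>nb k x\<close> are at most \<open>6 * scale k\<close> apart, so each
  quotient is at most \<open>6 * L\<close> in absolute value, and there are at most
  \<open>Kd\<^sup>2\<close> pairs.\<close>

lemma En_le_local:
  assumes "0 \<le> L" "\<And>y z. y \<in> X \<inter> ball x (3 * scale k) \<Longrightarrow> z \<in> X \<inter> ball x (3 * scale k) \<Longrightarrow> \<bar>v y - v z\<bar> \<le> L * dist y z"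
  shows "En k v x \<le> (6 * real Kd * L)\<^sup>2"
proof -
  have t: "((v y - v z) / scale k)\<^sup>2 \<le> (6 * L)\<^sup>2" if "y \<in> nb k x" "z \<in> nb k x" for y z
  proof (rule power2_le_iff_abs_le[THEN iffD2])
    have yz: "y \<in> X \<inter> ball x (3 * scale k)" "z \<in> X \<inter> ball x (3 * scale k)" using that net(1) by (auto simp: nb_def)
    have "dist y z \<le> 6 * scale k" using yz dist_triangle[of y z x] by (auto simp: dist_commute)
    then have "L * dist y z \<le> L * (6 * scale k)" using assms(1) by (rule mult_left_mono)
    then have "\<bar>v y - v z\<bar> \<le> 6 * L * scale k" using assms(2)[OF yz] by simp
    then show "\<bar>(v y - v z) / scale k\<bar> \<le> 6 * L" using scale_pos[of k] by (simp add: pos_divide_le_eq)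
  qed (use assms(1) in simp)
  have "En k v x \<le> (\<Sum>y\<in>nb k x. \<Sum>z\<in>nb k x. (6 * L)\<^sup>2)"
    unfolding En_def by (intro sum_mono t)
  also have "\<dots> = (real (card (nb k x)))\<^sup>2 * (6 * L)\<^sup>2" by (simp add: power2_eq_square)
  also have "\<dots> \<le> (real Kd)\<^sup>2 * (6 * L)\<^sup>2" using nb_card by (intro mult_right_mono power_mono) auto
  finally show ?thesis by (simp add: power_mult_distrib mult.commute mult.left_commute)
qed

lemma En_le: "L-lipschitz_on X v \<Longrightarrow> En k v x \<le> (6 * real Kd * L)\<^sup>2"
  by (intro En_le_local) (auto simp: lipschitz_on_def dist_real_def)

lemma En_eventually_le:
  assumes "alip_le X v x G" "G < ennreal c"
  shows "\<forall>\<^sub>F k in sequentially. En k v x \<le> (6 * real Kd * c)\<^sup>2"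
proof -
  have c: "0 \<le> c" using assms(2) by (metis ennreal_neg less_le_not_le linear not_less_zero)
  obtain r where r: "r > 0" "\<forall>y\<in>X \<inter> ball x r. \<forall>z\<in>X \<inter> ball x r. \<bar>v y - v z\<bar> \<le> c * dist y z"
    using assms unfolding alip_le_def by blast
  have "\<forall>\<^sub>F k in sequentially. scale k < r / 3" by (rule order_tendstoD(2)[OF scale_tendsto]) (use r(1) in simp)
  then show ?thesis
  proof eventually_elim
    case (elim k)
    then show ?case using r(2) by (intro En_le_local[OF c]) auto
  qed
qed

text \<open>The net may be infinite, so the sums run over its finite parts \<open>N j\<close> in
  growing balls, with indicators selecting the neighbours of \<open>x\<close>; for each
  \<open>x\<close> these sums are eventually constant.\<close>

lemma En_measurable [measurable]: "En k v \<in> borel_measurable borel"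
proof -
  define x0 :: 'a where "x0 = undefined"
  define N where "N j = net k \<inter> ball x0 (2 ^ j * scale k)" for j
  have fN: "finite (N j)" for j
  proof -
    obtain K :: nat where "\<And>(x::'a) r S. 0 < r \<Longrightarrow> separated r S \<Longrightarrow> S \<subseteq> ball x (2 ^ j * r) \<Longrightarrow> finite S \<and> card S \<le> K"
      by (rule separated_card_bound[of j]) blast
    from this[OF scale_pos separated_subset[OF net(2)], of "N j" k x0] show ?thesis by (auto simp: N_def)
  qed
  let ?i = "\<lambda>y x. indicator (ball y (3 * scale k)) x :: real"
  define e where "e j x = (\<Sum>y\<in>N j. \<Sum>z\<in>N j. ?i y x * (?i z x * ((v y - v z) / scale k)\<^sup>2))" for j x
  show ?thesis
  proof (rule borel_measurable_LIMSEQ_real)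
    have [measurable]: "ball y r \<in> sets borel" for y :: 'a and r by simp
    show "e j \<in> borel_measurable borel" for j
      unfolding e_def by (intro borel_measurable_sum borel_measurable_times borel_measurable_indicator) auto
    fix x
    obtain j0 :: nat where j0: "(dist x0 x + 3 * scale k) / scale k < 2 ^ j0" using real_arch_pow[of 2] by auto
    have "e j x = En k v x" if "j0 \<le> j" for j
    proof -
      have "(2::real) ^ j0 \<le> 2 ^ j" using that by simp
      then have "(dist x0 x + 3 * scale k) / scale k < 2 ^ j" using j0 by linarith
      then have b: "dist x0 x + 3 * scale k < 2 ^ j * scale k" using scale_pos[of k] by (simp add: pos_divide_less_eq)
      have sub: "nb k x \<subseteq> N j"
      proof
        fix y assume y: "y \<in> nb k x"
        then have "dist x0 y < 2 ^ j * scale k" using dist_triangle[of x0 y x] b by (auto simp: nb_def)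
        then show "y \<in> N j" using y by (simp add: N_def nb_def)
      qed
      have eq: "(\<Sum>y\<in>N j. ?i y x * h y) = (\<Sum>y\<in>nb k x. h y)" for h
      proof -
        have "(\<Sum>y\<in>N j. ?i y x * h y) = (\<Sum>y\<in>nb k x. ?i y x * h y)"
          using fN sub by (intro sum.mono_neutral_right) (auto simp: nb_def N_def dist_commute split: split_indicator)
        also have "\<dots> = (\<Sum>y\<in>nb k x. h y)" by (intro sum.cong) (auto simp: nb_def dist_commute)
        finally show ?thesis .
      qed
      show ?thesis unfolding e_def En_def sum_distrib_left[symmetric] eq ..
    qed
    then show "(\<lambda>j. e j x) \<longlonglongrightarrow> En k v x" by (intro tendsto_eventually) (auto simp: eventually_sequentially)
  qed
qed

text \<open>Cut the path into pieces of length between \<open>scale k / 2\<close> and \<open>scale k\<close> and compare with net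
  points near the endpoints of the pieces.\<close>
lemma discrete_upper_gradient:
  assumes v: "L-lipschitz_on X v" and path: "(a, b, \<gamma>) \<in> paths_in X" and "rectifiable_path a b \<gamma>"
    and long: "scale k \<le> enn2real (curve_length a b \<gamma>)"
  shows "ennreal \<bar>v (\<gamma> a) - v (\<gamma> b)\<bar> \<le> path_int (\<lambda>x. ennreal (2 * sqrt (En k v x))) a b \<gamma> + ennreal (2 * L * scale k)"
proof -
  interpret rectifiable_path a b \<gamma> by fact
  let ?d = "scale k" and ?T = "len a b"
  have L0: "0 \<le> L" using v by (rule lipschitz_on_nonneg)
  have T: "0 < ?T" using long scale_pos[of k] by linarith
  define m where "m = nat \<lceil>?T / ?d\<rceil>"
  have mr: "?T / ?d \<le> real m" "real m < ?T / ?d + 1"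
    using T scale_pos[of k] unfolding m_def by (auto simp: of_nat_nat) linarith+
  have T1: "1 \<le> ?T / ?d" using long scale_pos[of k] by simp
  have m0: "0 < m" using mr T1 by (cases m) auto
  define l where "l = ?T / real m"
  have l: "l \<le> ?d" "?d \<le> 2 * l" "0 < l"
  proof -
    show "l \<le> ?d" using mr(1) m0 scale_pos[of k] by (simp add: l_def field_simps)
    have "real m \<le> 2 * (?T / ?d)" using mr(2) T1 by linarith
    then show "?d \<le> 2 * l" using m0 scale_pos[of k] by (simp add: l_def field_simps)
    show "0 < l" using T m0 by (simp add: l_def)
  qed
  have "\<exists>t. a \<le> t \<and> t \<le> b \<and> len a t = real i * l" if "i \<le> m" for i
  proof (rule IVT')
    show "len a a \<le> real i * l" using l by (simp add: curve_length_degenerate)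
    have "real i * l \<le> real m * l" using that l by (intro mult_right_mono) auto
    then show "real i * l \<le> len a b" using m0 by (simp add: l_def)
  qed (use le continuous_on_len in auto)
  then obtain t' where t': "\<And>i. i \<le> m \<Longrightarrow> a \<le> t' i \<and> t' i \<le> b \<and> len a (t' i) = real i * l" by metis
  \<comment> \<open>The length determines a parameter only up to intervals on which
    \<open>\<gamma>\<close> is constant; the first and the last parameter are therefore set to
    \<open>a\<close> and \<open>b\<close>.\<close>
  define t where "t i = (if i = 0 then a else if i = m then b else t' i)" for i
  have t: "a \<le> t i" "t i \<le> b" "len a (t i) = real i * l" if "i \<le> m" for i
    using t'[OF that] le m0 by (auto simp: t_def curve_length_degenerate l_def)
  have tS: "t i \<le> t (Suc i)" "len (t i) (t (Suc i)) = l" if "i < m" for i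
  proof -
    have ti: "a \<le> t i" "t i \<le> b" "len a (t i) = real i * l" "a \<le> t (Suc i)" "t (Suc i) \<le> b" "len a (t (Suc i)) = real (Suc i) * l"
      using t[of i] t[of "Suc i"] that by auto
    show le': "t i \<le> t (Suc i)"
    proof (rule ccontr)
      assume "\<not> ?thesis"
      then have "len a (t i) = len a (t (Suc i)) + len (t (Suc i)) (t i)" using ti by (intro len_split) auto
      then have "real (Suc i) * l \<le> real i * l" using ti(3,6) len_nonneg[of "t (Suc i)" "t i"] by linarith
      then show False using l(3) by (simp add: algebra_simps)
    qed
    show "len (t i) (t (Suc i)) = l" using len_split[OF _ _ le' ti(5), of a] ti by (simp add: algebra_simps)
  qed
  have inX: "\<gamma> r \<in> X" if "r \<in> {a..b}" for r using paths_in_mem[OF path that] .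
  have "\<exists>y\<in>net k. dist (\<gamma> (t i)) y < ?d" if "i \<le> m" for i using net(3)[OF inX] t[OF that] by auto
  then obtain y where y: "\<And>i. i \<le> m \<Longrightarrow> y i \<in> net k" "\<And>i. i \<le> m \<Longrightarrow> dist (\<gamma> (t i)) (y i) < ?d" by metis
  let ?f = "\<lambda>x. ennreal (2 * sqrt (En k v x))"
  have bmf: "bm ?f" by (intro measurable_restrict_space1) measurable
  have piece: "ennreal \<bar>v (y i) - v (y (Suc i))\<bar> \<le> path_int ?f (t i) (t (Suc i)) \<gamma>" if i: "i < m" for i
  proof -
    have ti: "a \<le> t i" "t i \<le> t (Suc i)" "t (Suc i) \<le> b" using t[of i] t[of "Suc i"] tS[OF i] i by auto
    interpret S: rectifiable_path "t i" "t (Suc i)" \<gamma> by (rule subpath[OF ti])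
    let ?D = "\<bar>v (y i) - v (y (Suc i))\<bar>"
    \<comment> \<open>Since \<open>?d \<le> 2 * l\<close>, the quotient \<open>?D / ?d\<close>
      integrated over a piece of length \<open>l\<close> recovers at least half of the increment;
      this is the origin of the factor 2.\<close>
    have "?D * ?d \<le> ?D * (2 * l)" using l by (intro mult_left_mono) auto
    then have "?D \<le> 2 * (?D / ?d) * l" using scale_pos[of k] by (simp add: field_simps)
    then have "ennreal ?D \<le> path_int (\<lambda>_. ennreal (2 * (?D / ?d))) (t i) (t (Suc i)) \<gamma>"
      using tS(2)[OF i] scale_pos[of k] by (subst S.path_int_const) (auto intro!: ennreal_leI)
    also have "\<dots> \<le> path_int ?f (t i) (t (Suc i)) \<gamma>"
    proof (intro path_int_mono ennreal_leI)
      fix r assume r: "r \<in> {t i..t (Suc i)}"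
      have "len (t i) r + len r (t (Suc i)) = l"
        using len_split[of "t i" r "t (Suc i)"] ti r tS(2)[OF i] by simp
      moreover have "dist (\<gamma> (t i)) (\<gamma> r) \<le> len (t i) r" "dist (\<gamma> r) (\<gamma> (t (Suc i))) \<le> len r (t (Suc i))"
        using ti r by (auto intro!: dist_le_len)
      ultimately have "dist (\<gamma> (t i)) (\<gamma> r) \<le> l" "dist (\<gamma> r) (\<gamma> (t (Suc i))) \<le> l"
        using len_nonneg[of "t i" r] len_nonneg[of r "t (Suc i)"] by linarith+
      then have "dist (\<gamma> r) (y i) < 3 * ?d" "dist (\<gamma> r) (y (Suc i)) < 3 * ?d"
        using y(2)[of i] y(2)[of "Suc i"] i l(1) dist_triangle[of "\<gamma> r" "y i" "\<gamma> (t i)"]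
          dist_triangle[of "\<gamma> r" "y (Suc i)" "\<gamma> (t (Suc i))"] scale_pos[of k]
        by (auto simp: dist_commute)
      then have "y i \<in> nb k (\<gamma> r)" "y (Suc i) \<in> nb k (\<gamma> r)" using y(1)[of i] y(1)[of "Suc i"] i by (auto simp: nb_def)
      then have "sqrt (((v (y i) - v (y (Suc i))) / ?d)\<^sup>2) \<le> sqrt (En k v (\<gamma> r))"
        by (intro real_sqrt_le_mono En_term_le)
      then show "2 * (?D / ?d) \<le> 2 * sqrt (En k v (\<gamma> r))" using scale_pos[of k] by simp
    qed
    finally show ?thesis .
  qed
  have sum: "(\<Sum>j<i. ennreal \<bar>v (y j) - v (y (Suc j))\<bar>) \<le> path_int ?f a (t i) \<gamma>" if "i \<le> m" for i
    using that
  proof (induction i)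
    case (Suc i)
    have "path_int ?f a (t (Suc i)) \<gamma> = path_int ?f a (t i) \<gamma> + path_int ?f (t i) (t (Suc i)) \<gamma>"
      using t[of i] t[of "Suc i"] tS[of i] Suc.prems by (intro path_int_split[OF path bmf]) auto
    then show ?case using Suc piece[of i] by (simp add: add_mono)
  qed simp
  have tm: "t m = b" "t 0 = a" using m0 by (auto simp: t_def)
  \<comment> \<open>Replacing each endpoint of the path by its net point costs
    \<open>L * ?d\<close>, whence the additive error \<open>2 * L * scale k\<close>.\<close>
  have ends: "\<bar>v (\<gamma> (t i)) - v (y i)\<bar> \<le> L * ?d" if "i \<le> m" for i
  proof -
    have "dist (v (\<gamma> (t i))) (v (y i)) \<le> L * dist (\<gamma> (t i)) (y i)"
      using inX[of "t i"] t[OF that] y(1)[OF that] net(1) by (intro lipschitz_onD[OF v]) auto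
    also have "\<dots> \<le> L * ?d" using y(2)[OF that] L0 by (intro mult_left_mono) auto
    finally show ?thesis by (simp add: dist_real_def)
  qed
  have "\<bar>v (y 0) - v (y m)\<bar> = \<bar>\<Sum>j<m. v (y j) - v (y (Suc j))\<bar>"
    using sum_lessThan_telescope'[of "\<lambda>j. v (y j)" m] by simp
  also have "\<dots> \<le> (\<Sum>j<m. \<bar>v (y j) - v (y (Suc j))\<bar>)" by (rule sum_abs)
  finally have "\<bar>v (\<gamma> a) - v (\<gamma> b)\<bar> \<le> (\<Sum>j<m. \<bar>v (y j) - v (y (Suc j))\<bar>) + 2 * L * ?d"
    using ends[of 0] ends[of m] tm by (simp add: abs_le_iff)
  then have "ennreal \<bar>v (\<gamma> a) - v (\<gamma> b)\<bar> \<le> ennreal ((\<Sum>j<m. \<bar>v (y j) - v (y (Suc j))\<bar>) + 2 * L * ?d)"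
    by (rule ennreal_leI)
  also have "\<dots> = (\<Sum>j<m. ennreal \<bar>v (y j) - v (y (Suc j))\<bar>) + ennreal (2 * L * ?d)"
    using L0 scale_pos[of k] by (subst ennreal_plus) (auto intro!: sum_nonneg simp: sum_ennreal)
  also have "\<dots> \<le> path_int ?f a b \<gamma> + ennreal (2 * L * ?d)"
    using sum[of m] tm by (intro add_right_mono) auto
  finally show ?thesis .
qed

end

text \<open>The terms are eventually below 1, so consecutive differences are at most
  \<open>2 * (1/2) ^ i\<close> and hence summable.\<close>

lemma square_summable_imp_convergent:
  fixes z :: "nat \<Rightarrow> real"
  assumes "summable (\<lambda>i. 4 ^ i * ((z i - z (Suc i)) / 2)\<^sup>2)"
  shows "convergent z"
proof -
  have "(\<lambda>i. 4 ^ i * ((z i - z (Suc i)) / 2)\<^sup>2) \<longlonglongrightarrow> 0" by (rule summable_LIMSEQ_zero[OF assms])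
  then have "\<forall>\<^sub>F i in sequentially. 4 ^ i * ((z i - z (Suc i)) / 2)\<^sup>2 < 1"
    by (rule order_tendstoD(2)) simp
  then have ev: "\<forall>\<^sub>F i in sequentially. norm (z (Suc i) - z i) \<le> 2 * (1/2) ^ i"
  proof (rule eventually_mono)
    fix i assume "4 ^ i * ((z i - z (Suc i)) / 2)\<^sup>2 < 1"
    moreover have "(4::real) ^ i = (2 ^ i)\<^sup>2" by (simp add: power2_eq_square flip: power_mult_distrib)
    ultimately have "(2 ^ i * ((z i - z (Suc i)) / 2))\<^sup>2 < 1" by (simp only: power_mult_distrib)
    then have "\<bar>2 ^ i * ((z i - z (Suc i)) / 2)\<bar> < 1" by (simp add: abs_square_less_1)
    then have "2 ^ i * \<bar>z i - z (Suc i)\<bar> < 2" by (simp add: abs_mult)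
    then have "\<bar>z i - z (Suc i)\<bar> \<le> 2 / 2 ^ i" by (simp add: field_simps)
    then show "norm (z (Suc i) - z i) \<le> 2 * (1/2) ^ i" by (simp add: power_divide abs_minus_commute)
  qed
  have "summable (\<lambda>i. 2 * (1/2::real) ^ i)" by (intro summable_mult summable_geometric) simp
  then have "summable (\<lambda>i. z (Suc i) - z i)" by (rule summable_comparison_test_ev[OF ev])
  then have "convergent (\<lambda>n. \<Sum>i<n. z (Suc i) - z i)" unfolding summable_iff_convergent .
  then have "convergent (\<lambda>n. z n - z 0)" unfolding sum_lessThan_telescope .
  from convergent_add[OF this convergent_const[of "z 0"]] show ?thesis by (simp only: diff_add_cancel)
qed

section \<open>Upper gradients and Cauchy sequences from discrete energies\<close>

context closed_doubling begin

context
  fixes \<nu> :: "'a measure"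
  assumes fin: "finite_measure \<nu>" and sets_\<nu>: "sets \<nu> = sets M" and \<nu>X: "AE x in \<nu>. x \<in> X"
begin

lemma measurable_\<nu>: "f \<in> borel_measurable borel \<Longrightarrow> f \<in> borel_measurable \<nu>"
  unfolding measurable_cong_sets[OF sets_\<nu> refl] by (rule borel_measurable_M[OF refl])

lemma integrable_bounded:
  assumes "f \<in> borel_measurable borel" "\<And>x. x \<in> X \<Longrightarrow> \<bar>f x\<bar> \<le> B"
  shows "integrable \<nu> (f :: 'a \<Rightarrow> real)"
  by (rule finite_measure.integrable_const_bound[OF fin, of _ B])
    (use \<nu>X assms measurable_\<nu> in \<open>auto elim!: eventually_mono\<close>)

text \<open>The square roots of the discrete energies at different scales are bounded in \<open>L\<^sup>2(\<nu>)\<close>; the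
  upper limit of suitable midpoint combinations is an upper gradient, by the reverse Fatou lemma
  along each path, and its norm is controlled since the combinations converge a.e.\<close>
theorem upper_gradient_from_energy:
  assumes w: "L-lipschitz_on X w" and freq: "\<exists>\<^sub>F k in sequentially. (\<integral>x. En k w x \<partial>\<nu>) \<le> B"
  shows "\<exists>e. e \<in> borel_measurable borel \<and>
    (\<forall>a b \<gamma>. (a, b, \<gamma>) \<in> paths_in X \<longrightarrow> ennreal \<bar>w (\<gamma> a) - w (\<gamma> b)\<bar> \<le> path_int e a b \<gamma>) \<and>
    (\<integral>\<^sup>+x. (e x)\<^sup>2 \<partial>\<nu>) \<le> ennreal (4 * B) \<and>
    (\<forall>x\<in>X. \<forall>G. alip_le X w x G \<longrightarrow> G < \<infinity> \<longrightarrow> e x \<le> ennreal (12 * real Kd) * G)"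
proof -
  have L0: "0 \<le> L" using w by (rule lipschitz_on_nonneg)
  define B0 where "B0 = 12 * real Kd * L"
  have B00: "0 \<le> B0" using L0 by (simp add: B0_def)
  define F where "F k x = 2 * sqrt (En k w x)" for k x
  have Fm: "F k \<in> borel_measurable borel" for k unfolding F_def[abs_def] by measurable
  have F0: "0 \<le> F k x" for k x using En_nonneg by (simp add: F_def)
  have Fle: "F k x \<le> 2 * c" if "En k w x \<le> c\<^sup>2" "0 \<le> c" for k x c
    using real_sqrt_le_mono[OF that(1)] that(2) by (simp add: F_def)
  have FB: "F k x \<le> B0" for k x
    using Fle[OF En_le[OF w], of k x] L0 by (simp add: B0_def mult.assoc)
  have "infinite {k. (\<integral>x. En k w x \<partial>\<nu>) \<le> B}"
    using freq by (simp add: frequently_sequentially infinite_nat_iff_unbounded_le)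
  from infinite_enumerate[OF this] obtain \<kappa> :: "nat \<Rightarrow> nat"
    where \<kappa>0: "strict_mono \<kappa>" "\<forall>i. \<kappa> i \<in> {k. (\<integral>x. En k w x \<partial>\<nu>) \<le> B}"
    by (elim exE conjE)
  have \<kappa>: "strict_mono \<kappa>" "\<And>i. (\<integral>x. En (\<kappa> i) w x \<partial>\<nu>) \<le> B"
    using \<kappa>0(1) \<kappa>0(2)[rule_format] by simp_all
  \<comment> \<open>Only the tail from \<open>n\<close> on is combined, so that the scales in play
    tend to 0.\<close>
  define S where "S n = mhull ((\<lambda>i. F (\<kappa> i)) ` {n..})" for n
  define q where "q f = (\<integral>x. (f x)\<^sup>2 \<partial>\<nu>)" for f :: "'a \<Rightarrow> real"
  have Sdec: "S n \<subseteq> S m" if "m \<le> n" for m n unfolding S_def using that by (intro mhull_mono image_mono) auto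
  have Sm: "f \<in> borel_measurable borel" if "f \<in> S n" for f n
    using that unfolding S_def by (rule mhull_measurable) (auto simp: Fm)
  have S0: "0 \<le> f x" if "f \<in> S n" for f n x
    using that unfolding S_def by (rule mhull_ge) (auto simp: F0)
  have SB: "f x \<le> B0" if "f \<in> S n" for f n x
    using that unfolding S_def by (rule mhull_le) (auto simp: FB)
  have sqI: "integrable \<nu> (\<lambda>x. (f x)\<^sup>2)" if "f \<in> borel_measurable borel" "\<And>x. \<bar>f x\<bar> \<le> B0" for f
  proof (rule integrable_bounded[of _ "B0\<^sup>2"])
    show "(\<lambda>x. (f x)\<^sup>2) \<in> borel_measurable borel" using that(1) by measurable
    show "\<bar>(f x)\<^sup>2\<bar> \<le> B0\<^sup>2" for x using that(2)[of x] B00 by (simp add: power2_le_iff_abs_le)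
  qed
  have Sabs: "\<bar>f x\<bar> \<le> B0" if "f \<in> S n" for f n x using S0[OF that] SB[OF that] by simp
  have par: "q (\<lambda>x. (f x + g x) / 2) + q (\<lambda>x. (f x - g x) / 2) = (q f + q g) / 2"
    if f: "f \<in> S 0" and g: "g \<in> S 0" for f g
  proof -
    note [measurable] = Sm[OF f] Sm[OF g]
    have b: "\<bar>(f x + g x) / 2\<bar> \<le> B0" "\<bar>(f x - g x) / 2\<bar> \<le> B0" for x
      using S0[OF f, of x] SB[OF f, of x] S0[OF g, of x] SB[OF g, of x] by (simp_all add: abs_le_iff)
    have "q (\<lambda>x. (f x + g x) / 2) + q (\<lambda>x. (f x - g x) / 2)
      = (\<integral>x. ((f x + g x) / 2)\<^sup>2 + ((f x - g x) / 2)\<^sup>2 \<partial>\<nu>)"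
      unfolding q_def using b by (intro Bochner_Integration.integral_add[symmetric] sqI) auto
    also have "(\<lambda>x. ((f x + g x) / 2)\<^sup>2 + ((f x - g x) / 2)\<^sup>2) = (\<lambda>x. ((f x)\<^sup>2 + (g x)\<^sup>2) / 2)"
      by (auto simp: fun_eq_iff power_divide power2_eq_square field_simps)
    also have "(\<integral>x. ((f x)\<^sup>2 + (g x)\<^sup>2) / 2 \<partial>\<nu>) = (q f + q g) / 2"
      unfolding q_def using Sabs[OF f] Sabs[OF g] Sm[OF f] Sm[OF g]
      by (subst Bochner_Integration.integral_add[symmetric]) (auto intro: sqI)
    finally show ?thesis .
  qed
  have q_nonneg: "0 \<le> q f" for f by (simp add: q_def)
  have qF: "q (F (\<kappa> i)) \<le> 4 * B" for i
  proof -
    have "q (F (\<kappa> i)) = 4 * (\<integral>x. En (\<kappa> i) w x \<partial>\<nu>)"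
      unfolding q_def F_def using En_nonneg by (simp add: power_mult_distrib)
    then show ?thesis using \<kappa>(2)[of i] by simp
  qed
  have qS: "q f \<le> 4 * B" if "f \<in> S 0" for f
    using that unfolding S_def
  proof induction
    case (base f)
    then show ?case using qF by auto
  next
    case (mid f g)
    have aux: "r \<le> k" if "r + s = (t + u) / 2" "0 \<le> s" "t \<le> k" "u \<le> k" for r s t u k :: real
      using that by simp
    show ?case by (rule aux[OF par[OF mid.hyps[folded S_def]] q_nonneg mid.IH])
  qed
  have FS: "F (\<kappa> n) \<in> S n" for n unfolding S_def by (rule mhull.base) simp
  have "\<exists>y. (\<forall>n. y n \<in> S n) \<and> (\<forall>e>0. \<exists>N. \<forall>n\<ge>N. \<forall>m\<ge>n. q (\<lambda>x. (y n x - y m x) / 2) < e)"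
  proof (rule min_energy_Cauchy[of S q "4 * B"])
    show "S n \<noteq> {}" for n using FS[of n] by auto
    show "\<exists>f\<in>S n. q f \<le> 4 * B" for n
      using qF FS by blast
    show "(\<lambda>x. (f x + g x) / 2) \<in> S n" if "f \<in> S n" "g \<in> S n" for n f g
      using that unfolding S_def by (rule mhull.mid)
    show "S n \<subseteq> S m" if "m \<le> n" for m n using that by (rule Sdec)
    show "0 \<le> q f" for f by (rule q_nonneg)
  qed (rule par, assumption+)
  then obtain y where y: "\<And>n. y n \<in> S n"
    "\<And>e. 0 < e \<Longrightarrow> \<exists>N. \<forall>n\<ge>N. \<forall>m\<ge>n. q (\<lambda>x. (y n x - y m x) / 2) < e" by blast
  \<comment> \<open>The rate \<open>(1/8) ^ i\<close> beats the weight \<open>4 ^ i\<close> of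
    \<open>square_summable_imp_convergent\<close> and leaves the summable
    \<open>(1/2) ^ i\<close>.\<close>
  have "\<exists>N. \<forall>n\<ge>N. \<forall>m\<ge>n. q (\<lambda>x. (y n x - y m x) / 2) < (1/8) ^ i" for i by (rule y(2)) simp
  then obtain N where N: "\<And>i n m. N i \<le> n \<Longrightarrow> n \<le> m \<Longrightarrow> q (\<lambda>x. (y n x - y m x) / 2) < (1/8) ^ i" by metis
  define s where "s i = i + (\<Sum>j\<le>i. N j)" for i
  have s: "i \<le> s i" "N i \<le> s i" "s i \<le> s (Suc i)" for i
    using member_le_sum[of i "{..i}" N] by (auto simp: s_def)
  define z where "z i = y (s i)" for i
  have zS: "z i \<in> S i" for i using y(1)[of "s i"] Sdec[OF s(1)] by (auto simp: z_def)
  have zS0: "z i \<in> S 0" for i using zS Sdec[of 0 i] by auto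
  note [measurable] = Sm[OF zS]
  have zq: "q (\<lambda>x. (z i x - z (Suc i) x) / 2) < (1/8) ^ i" for i
    unfolding z_def by (rule N) (use s in auto)
  have AEc: "AE x in \<nu>. convergent (\<lambda>i. z i x)"
  proof -
    let ?t = "\<lambda>i x. ennreal (4 ^ i * ((z i x - z (Suc i) x) / 2)\<^sup>2)"
    have tm: "?t i \<in> borel_measurable \<nu>" for i by (rule measurable_\<nu>) measurable
    have "(\<integral>\<^sup>+x. ?t i x \<partial>\<nu>) \<le> ennreal ((1/2) ^ i)" for i
    proof -
      have b: "\<bar>(z i x - z (Suc i) x) / 2\<bar> \<le> B0" for x
        using S0[OF zS, of i x] SB[OF zS, of i x] S0[OF zS, of "Suc i" x] SB[OF zS, of "Suc i" x] by (simp add: abs_le_iff)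
      have "(\<integral>\<^sup>+x. ?t i x \<partial>\<nu>) = ennreal (\<integral>x. 4 ^ i * ((z i x - z (Suc i) x) / 2)\<^sup>2 \<partial>\<nu>)"
        using b by (intro nn_integral_eq_integral integrable_mult_right sqI) auto
      also have "\<dots> = ennreal (4 ^ i * q (\<lambda>x. (z i x - z (Suc i) x) / 2))" by (simp add: q_def)
      also have "\<dots> \<le> ennreal (4 ^ i * (1/8) ^ i)" using zq[of i] by (intro ennreal_leI mult_left_mono) auto
      also have "(4::real) ^ i * (1/8) ^ i = (1/2) ^ i" by (simp flip: power_mult_distrib)
      finally show ?thesis .
    qed
    then have "(\<Sum>i. \<integral>\<^sup>+x. ?t i x \<partial>\<nu>) \<le> (\<Sum>i. ennreal ((1/2) ^ i))" by (intro suminf_le) auto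
    also have "\<dots> = ennreal (\<Sum>i. (1/2) ^ i)" by (intro suminf_ennreal2 summable_geometric) auto
    finally have "(\<integral>\<^sup>+x. (\<Sum>i. ?t i x) \<partial>\<nu>) \<noteq> \<infinity>" using tm by (subst nn_integral_suminf) (auto simp: top_unique)
    then have "AE x in \<nu>. (\<Sum>i. ?t i x) \<noteq> \<infinity>"
      by (intro nn_integral_noteq_infinite borel_measurable_suminf_order tm)
    then show ?thesis
    proof (rule eventually_mono)
      fix x assume "(\<Sum>i. ?t i x) \<noteq> \<infinity>"
      then have "summable (\<lambda>i. 4 ^ i * ((z i x - z (Suc i) x) / 2)\<^sup>2)" by (intro summable_suminf_not_top) auto
      then show "convergent (\<lambda>i. z i x)" by (rule square_summable_imp_convergent)
    qed
  qed
  \<comment> \<open>A limsup is defined at every point: the gradient inequality is claimed along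
    every path, including those inside the null set where the \<open>z i\<close> may
    diverge.\<close>
  define e where "e x = limsup (\<lambda>i. ennreal (z i x))" for x
  have em: "e \<in> borel_measurable borel" unfolding e_def[abs_def] by measurable
  have e2: "(\<integral>\<^sup>+x. (e x)\<^sup>2 \<partial>\<nu>) \<le> ennreal (4 * B)"
  proof -
    have "(\<integral>\<^sup>+x. (e x)\<^sup>2 \<partial>\<nu>) = (\<integral>\<^sup>+x. liminf (\<lambda>i. ennreal ((z i x)\<^sup>2)) \<partial>\<nu>)"
    proof (rule nn_integral_cong_AE, rule eventually_mono[OF AEc])
      fix x assume "convergent (\<lambda>i. z i x)"
      then obtain l where l: "(\<lambda>i. z i x) \<longlonglongrightarrow> l" by (auto simp: convergent_def)
      have l0: "0 \<le> l" by (rule LIMSEQ_le_const[OF l]) (use S0[OF zS] in auto)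
      have "e x = ennreal l" unfolding e_def by (intro lim_imp_Limsup tendsto_ennrealI l) simp
      moreover have "liminf (\<lambda>i. ennreal ((z i x)\<^sup>2)) = ennreal (l\<^sup>2)"
        by (intro lim_imp_Liminf tendsto_ennrealI tendsto_power l) simp
      ultimately show "(e x)\<^sup>2 = liminf (\<lambda>i. ennreal ((z i x)\<^sup>2))" using l0 by (simp add: ennreal_power)
    qed
    also have "\<dots> \<le> liminf (\<lambda>i. \<integral>\<^sup>+x. ennreal ((z i x)\<^sup>2) \<partial>\<nu>)"
      by (intro nn_integral_liminf measurable_\<nu>) measurable
    also have "\<dots> \<le> liminf (\<lambda>i. ennreal (4 * B))"
    proof (intro Liminf_mono always_eventually allI)
      fix i
      have "(\<integral>\<^sup>+x. ennreal ((z i x)\<^sup>2) \<partial>\<nu>) = ennreal (q (z i))"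
        unfolding q_def using Sabs[OF zS] by (intro nn_integral_eq_integral sqI) auto
      then show "(\<integral>\<^sup>+x. ennreal ((z i x)\<^sup>2) \<partial>\<nu>) \<le> ennreal (4 * B)" using qS[OF zS0] by (simp add: ennreal_leI)
    qed
    also have "\<dots> = ennreal (4 * B)" by (rule Liminf_const) simp
    finally show ?thesis .
  qed
  have ebound: "e x \<le> ennreal (12 * real Kd) * G" if x: "x \<in> X" "alip_le X w x G" "G < \<infinity>" for x G
  proof -
    obtain g where g: "G = ennreal g" "0 \<le> g" using x(3) by (cases G) auto
    have *: "e x \<le> ennreal (12 * real Kd * c)" if c: "g < c" for c
    proof -
      have "G < ennreal c" using g c by (simp add: ennreal_less_iff)
      from En_eventually_le[OF x(2) this] obtain k0 where k0: "\<And>k. k0 \<le> k \<Longrightarrow> En k w x \<le> (6 * real Kd * c)\<^sup>2"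
        by (auto simp: eventually_sequentially)
      have "z i x \<le> 12 * real Kd * c" if "k0 \<le> i" for i
        using zS[of i] unfolding S_def
      proof (rule mhull_le)
        fix f assume "f \<in> (\<lambda>i. F (\<kappa> i)) ` {i..}"
        then obtain j where j: "f = F (\<kappa> j)" "i \<le> j" by auto
        have "k0 \<le> \<kappa> j" using seq_suble[OF \<kappa>(1), of j] j(2) that by linarith
        from Fle[OF k0[OF this]] show "f x \<le> 12 * real Kd * c" using j(1) g(2) c by simp
      qed
      then show ?thesis unfolding e_def
        by (intro Limsup_bounded) (auto simp: eventually_sequentially intro!: exI[of _ k0] ennreal_leI)
    qed
    have "e x \<le> ennreal (12 * real Kd * g) + ennreal d" if "0 < d" for d
    proof -
      let ?c = "g + d / (12 * real Kd + 1)"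
      have "0 < d / (12 * real Kd + 1)" using that by (intro divide_pos_pos) auto
      then have "e x \<le> ennreal (12 * real Kd * ?c)" by (intro *) simp
      also have "\<dots> \<le> ennreal (12 * real Kd * g + d)"
      proof (rule ennreal_leI)
        have "12 * real Kd * (d / (12 * real Kd + 1)) \<le> (12 * real Kd + 1) * (d / (12 * real Kd + 1))"
          using that by (intro mult_right_mono) auto
        also have "\<dots> = d" by (simp add: add_nonneg_eq_0_iff)
        finally show "12 * real Kd * ?c \<le> 12 * real Kd * g + d" by (simp only: distrib_left)
      qed
      also have "\<dots> = ennreal (12 * real Kd * g) + ennreal d" using g(2) that by (intro ennreal_plus) auto
      finally show ?thesis .
    qed
    then have "e x \<le> ennreal (12 * real Kd * g)" by (rule_tac ennreal_le_epsilon) simp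
    then show ?thesis using g by (simp add: ennreal_mult)
  qed
  have ug: "ennreal \<bar>w (\<gamma> a) - w (\<gamma> b)\<bar> \<le> path_int e a b \<gamma>" if path: "(a, b, \<gamma>) \<in> paths_in X" for a b \<gamma>
  proof (cases "rectifiable a b \<gamma>")
    case False
    then show ?thesis by (simp add: path_int_def)
  next
    case True
    then interpret rectifiable_path a b \<gamma> using path by (rule paths_in_rectifiable[rotated])
    let ?D = "ennreal \<bar>w (\<gamma> a) - w (\<gamma> b)\<bar>"
    show ?thesis
    proof (cases "len a b = 0")
      case True
      then have "\<gamma> a = \<gamma> b" using dist_le_len[of a b] le by simp
      then show ?thesis by simp
    next
      case False
      then have pos: "0 < len a b" using len_nonneg[of a b] by linarith
      have bmS: "bm (\<lambda>x. ennreal (f x))" if "f \<in> S 0" for f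
        using Sm[OF that] by (intro measurable_restrict_space1) measurable
      \<comment> \<open>The inequality is stable under midpoints, since the path integral is
        additive and the error term does not depend on \<open>f\<close>.\<close>
      have step: "?D \<le> path_int (\<lambda>x. ennreal (f x)) a b \<gamma> + ennreal (2 * L * scale (\<kappa> i))"
        if f: "f \<in> S i" and i: "scale (\<kappa> i) \<le> len a b" for f i
        using f unfolding S_def
      proof induction
        case (base f)
        then obtain j where j: "f = F (\<kappa> j)" "i \<le> j" by auto
        have "\<kappa> i \<le> \<kappa> j" using \<kappa>(1) j(2) by (simp add: strict_mono_less_eq)
        then have sc: "scale (\<kappa> j) \<le> scale (\<kappa> i)" by (rule scale_antimono)
        have "?D \<le> path_int (\<lambda>x. ennreal (f x)) a b \<gamma> + ennreal (2 * L * scale (\<kappa> j))"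
          unfolding j(1) F_def
          by (rule discrete_upper_gradient[OF w path]) (use sc i rectifiable_path_axioms in auto)
        also have "\<dots> \<le> path_int (\<lambda>x. ennreal (f x)) a b \<gamma> + ennreal (2 * L * scale (\<kappa> i))"
          using sc L0 by (intro add_left_mono ennreal_leI mult_left_mono) auto
        finally show ?case .
      next
        case (mid f g)
        let ?P = "\<lambda>f. path_int (\<lambda>x. ennreal (f x)) a b \<gamma>" and ?c = "ennreal (2 * L * scale (\<kappa> i))"
        have fg: "f \<in> S 0" "g \<in> S 0" using mid.hyps Sdec[of 0 i] by (auto simp: S_def)
        have "ennreal ((f x + g x) / 2) = ennreal (1/2) * (ennreal (f x) + ennreal (g x))" for x
        proof -
          have fx: "0 \<le> f x" and gx: "0 \<le> g x" using S0[OF fg(1), of x] S0[OF fg(2), of x] by simp_all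
          have "ennreal (1/2) * (ennreal (f x) + ennreal (g x)) = ennreal (1/2) * ennreal (f x + g x)"
            by (simp only: ennreal_plus[OF fx gx])
          also have "\<dots> = ennreal (1/2 * (f x + g x))"
            by (rule ennreal_mult[symmetric]) (use fx gx in simp_all)
          finally have "ennreal (1/2) * (ennreal (f x) + ennreal (g x)) = ennreal (1/2 * (f x + g x))" .
          then show ?thesis by (simp only: mult_1_left times_divide_eq_left)
        qed
        then have eq: "(\<lambda>x. ennreal ((f x + g x) / 2)) = (\<lambda>x. ennreal (1/2) * (ennreal (f x) + ennreal (g x)))"
          by (intro ext)
        have "bm (\<lambda>x. ennreal (f x) + ennreal (g x))" using bmS[OF fg(1)] bmS[OF fg(2)] by measurable
        then have "path_int (\<lambda>x. ennreal (1/2) * (ennreal (f x) + ennreal (g x))) a b \<gamma>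
          = ennreal (1/2) * path_int (\<lambda>x. ennreal (f x) + ennreal (g x)) a b \<gamma>"
          by (rule path_int_cmult[OF path]) simp
        then have "?P (\<lambda>x. (f x + g x) / 2) = ennreal (1/2) * path_int (\<lambda>x. ennreal (f x) + ennreal (g x)) a b \<gamma>"
          by (simp only: eq)
        also have "\<dots> = ennreal (1/2) * (?P f + ?P g)" by (simp only: path_int_add[OF path bmS[OF fg(1)] bmS[OF fg(2)]])
        finally have P: "?P (\<lambda>x. (f x + g x) / 2) = ennreal (1/2) * (?P f + ?P g)" .
        have half: "ennreal (1/2) * (x + x) = x" for x
        proof -
          have "ennreal (1/2) * (x + x) = (ennreal (1/2) + ennreal (1/2)) * x" by (simp only: distrib_left distrib_right)
          also have "ennreal (1/2) + ennreal (1/2) = 1" by (subst ennreal_plus[symmetric]) auto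
          finally show ?thesis by simp
        qed
        have "?D = ennreal (1/2) * (?D + ?D)" by (rule half[symmetric])
        also have "\<dots> \<le> ennreal (1/2) * ((?P f + ?c) + (?P g + ?c))" by (intro mult_left_mono add_mono mid.IH) auto
        also have "\<dots> = ennreal (1/2) * (?P f + ?P g) + ennreal (1/2) * (?c + ?c)" by (simp only: distrib_left ac_simps)
        also have "\<dots> = ?P (\<lambda>x. (f x + g x) / 2) + ?c" by (simp only: P half)
        finally show ?case .
      qed
      show ?thesis
      proof (rule ennreal_le_epsilon)
        fix d :: real assume "0 < d"
        let ?u = "\<lambda>i t. ennreal (z i (\<gamma> t)) * indicator {a..b} t"
        have "(\<lambda>i. 2 * L * scale (\<kappa> i)) \<longlonglongrightarrow> 2 * L * 0"
          using LIMSEQ_subseq_LIMSEQ[OF scale_tendsto \<kappa>(1)] by (intro tendsto_intros) (simp add: comp_def)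
        then have "\<forall>\<^sub>F i in sequentially. 2 * L * scale (\<kappa> i) < d" using \<open>0 < d\<close> by (intro order_tendstoD(2)) auto
        moreover have "\<forall>\<^sub>F i in sequentially. scale (\<kappa> i) < len a b"
          using LIMSEQ_subseq_LIMSEQ[OF scale_tendsto \<kappa>(1)] pos by (intro order_tendstoD(2)) (auto simp: comp_def)
        ultimately have "\<forall>\<^sub>F i in sequentially. ?D - ennreal d \<le> (\<integral>\<^sup>+t. ?u i t \<partial>lm)"
        proof eventually_elim
          case (elim i)
          have "?D \<le> path_int (\<lambda>x. ennreal (z i x)) a b \<gamma> + ennreal (2 * L * scale (\<kappa> i))"
            using elim by (intro step zS) auto
          also have "\<dots> \<le> path_int (\<lambda>x. ennreal (z i x)) a b \<gamma> + ennreal d"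
            using elim by (intro add_left_mono ennreal_leI) auto
          finally show ?case by (simp add: path_int_eq ennreal_minus_le_iff add.commute)
        qed
        then have "?D - ennreal d \<le> liminf (\<lambda>i. \<integral>\<^sup>+t. ?u i t \<partial>lm)" by (rule Liminf_bounded)
        also have "\<dots> \<le> limsup (\<lambda>i. \<integral>\<^sup>+t. ?u i t \<partial>lm)" by (rule Liminf_le_Limsup) simp
        \<comment> \<open>The constant \<open>B0\<close> is an integrable bound because the path has
          finite length.\<close>
        also have "\<dots> \<le> (\<integral>\<^sup>+t. limsup (\<lambda>i. ?u i t) \<partial>lm)"
        proof (rule nn_integral_limsup)
          show "?u i \<in> borel_measurable lm" for i using measurable_along_path[OF path bmS[OF zS0]] by simp
          show "(\<integral>\<^sup>+t. ennreal B0 \<partial>lm) < \<infinity>" by (simp add: emeasure_lm_UNIV ennreal_mult_less_top)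
          show "AE t in lm. ?u i t \<le> ennreal B0" for i
            using SB[OF zS] by (intro AE_I2) (auto split: split_indicator intro: ennreal_leI)
        qed simp
        also have "\<dots> = path_int e a b \<gamma>"
          unfolding path_int_eq e_def
        proof (rule nn_integral_cong)
          fix t show "limsup (\<lambda>i. ?u i t) = limsup (\<lambda>i. ennreal (z i (\<gamma> t))) * indicator {a..b} t"
            by (cases "t \<in> {a..b}") (simp_all add: Limsup_const)
        qed
        finally show "?D \<le> path_int e a b \<gamma> + ennreal d" by (simp add: ennreal_minus_le_iff add.commute)
      qed
    qed
  qed
  show ?thesis using em ug e2 ebound by blast
qed

end

text \<open>The weight makes \<open>(1 + G)\<^sup>2\<close> integrable. Along a refinement of the filter of scales the
  weighted discrete energies of all Lipschitz functions converge; the limit satisfies the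
  parallelogram identity, so its near minimizers over the midpoint hulls are Cauchy.\<close>
theorem energy_Cauchy:
  fixes v :: "nat \<Rightarrow> 'a \<Rightarrow> real" and G :: "'a \<Rightarrow> ennreal"
  assumes v: "\<And>j. lipschitz_fun X (v j)" and G: "Lp_integrable_borel p \<mu> X G"
    and alip: "\<And>j x. x \<in> X \<Longrightarrow> alip_le X (v j) x (G x)"
  obtains y where "\<And>n. y n \<in> mhull (v ` {n..})"
    "\<And>\<epsilon>. 0 < \<epsilon> \<Longrightarrow> \<exists>N. \<forall>n\<ge>N. \<forall>m\<ge>n. \<exists>e. Lwug (\<lambda>x. y n x - y m x) e \<and> pint e \<le> ennreal \<epsilon>"
proof -
  obtain h where h: "h \<in> borel_measurable M" "integral\<^sup>N M h \<noteq> \<infinity>" "\<And>x. 0 < h x" "\<And>x. h x < \<infinity>"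
    using sigma_finite_measure.Ex_finite_integrable_function[OF sigma_finite_M] by auto
  note [measurable] = h(1)
  define gr where "gr x = enn2real (G x * indicator X x)" for x
  have grm [measurable]: "gr \<in> borel_measurable M" unfolding gr_def using measurable_on_X[OF Lp_bm[OF G]] by measurable
  have gr0: "0 \<le> gr x" for x by (simp add: gr_def)
  have Xb [measurable]: "X \<in> sets M" by (rule X)
  \<comment> \<open>Positivity on \<open>X\<close> allows a.e. statements on \<open>X\<close> to
    return from \<open>\<nu>\<close> to \<open>M\<close>. The product of \<open>wt\<close> with
    \<open>(1 + gr x)\<^sup>2\<close> is at most the integrable \<open>h\<close>; as
    \<open>1 + gr x \<ge> 1\<close>, this also makes \<open>\<nu>\<close> finite.\<close>
  define wt where "wt x = h x * ennreal (1 / (1 + gr x)\<^sup>2) * indicator X x" for x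
  have wtm [measurable]: "wt \<in> borel_measurable M" unfolding wt_def by measurable
  have wt_h: "wt x * ennreal ((1 + gr x)\<^sup>2) \<le> h x" for x
  proof -
    have "ennreal (1 / (1 + gr x)\<^sup>2) * ennreal ((1 + gr x)\<^sup>2) = 1"
      using gr0[of x] by (subst ennreal_mult[symmetric]) auto
    then show ?thesis by (auto simp: wt_def mult.assoc split: split_indicator)
  qed
  have wt_pos: "0 < wt x" if "x \<in> X" for x
  proof -
    have "0 < 1 / (1 + gr x)\<^sup>2" using gr0[of x] by (intro divide_pos_pos zero_less_power) auto
    then show ?thesis using that h(3)[of x] by (simp add: wt_def ennreal_zero_less_mult_iff)
  qed
  define \<nu> where "\<nu> = density M wt"
  have sets_\<nu>: "sets \<nu> = sets M" by (simp add: \<nu>_def)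
  have AE\<nu>: "(AE x in \<nu>. P x) \<longleftrightarrow> (AE x in M. 0 < wt x \<longrightarrow> P x)" for P
    unfolding \<nu>_def by (rule AE_density) simp
  have \<nu>X: "AE x in \<nu>. x \<in> X" unfolding AE\<nu> by (rule AE_I2) (auto simp: wt_def split: split_indicator_asm)
  have int2: "(\<integral>\<^sup>+x. ennreal ((1 + gr x)\<^sup>2) \<partial>\<nu>) \<le> integral\<^sup>N M h"
  proof -
    have "(\<integral>\<^sup>+x. ennreal ((1 + gr x)\<^sup>2) \<partial>\<nu>) = (\<integral>\<^sup>+x. wt x * ennreal ((1 + gr x)\<^sup>2) \<partial>M)"
      unfolding \<nu>_def by (intro nn_integral_density) auto
    also have "\<dots> \<le> integral\<^sup>N M h" by (intro nn_integral_mono wt_h)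
    finally show ?thesis .
  qed
  have fin: "finite_measure \<nu>"
  proof
    have "emeasure \<nu> (space \<nu>) = (\<integral>\<^sup>+x. 1 \<partial>\<nu>)" by simp
    also have "\<dots> \<le> (\<integral>\<^sup>+x. ennreal ((1 + gr x)\<^sup>2) \<partial>\<nu>)"
    proof (rule nn_integral_mono)
      fix x
      have "1 \<le> (1 + gr x)\<^sup>2" using gr0[of x] by simp
      from ennreal_leI[OF this] show "1 \<le> ennreal ((1 + gr x)\<^sup>2)" by simp
    qed
    finally show "emeasure \<nu> (space \<nu>) \<noteq> \<infinity>" using int2 h(2) by (auto simp: top_unique)
  qed
  have Gfin: "AE x in M. x \<in> X \<longrightarrow> G x = ennreal (gr x)"
    using Lp_AE_finite[OF G] by eventually_elim (auto simp: gr_def)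
  have Gfin\<nu>: "AE x in \<nu>. G x = ennreal (gr x)"
    unfolding AE\<nu> using Gfin by eventually_elim (auto simp: wt_def split: split_indicator_asm)
  define \<Phi> where "\<Phi> k w = (\<integral>x. En k w x \<partial>\<nu>)" for k w
  have Eint: "integrable \<nu> (En k w)" if "lipschitz_fun X w" for k w
  proof -
    obtain L where "L-lipschitz_on X w" using \<open>lipschitz_fun X w\<close> by (auto simp: lipschitz_fun_def)
    from En_le[OF this] show ?thesis
      using En_nonneg by (intro integrable_bounded[OF fin sets_\<nu> \<nu>X, of _ "(6 * real Kd * L)\<^sup>2"]) auto
  qed
  have "\<exists>b. \<forall>k. lipschitz_fun X w \<longrightarrow> \<Phi> k w \<le> b" for w
  proof (cases "lipschitz_fun X w")
    case True
    then obtain L where L: "L-lipschitz_on X w" by (auto simp: lipschitz_fun_def)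
    have "\<Phi> k w \<le> (\<integral>x. (6 * real Kd * L)\<^sup>2 \<partial>\<nu>)" for k
      unfolding \<Phi>_def using Eint[OF True] En_le[OF L] finite_measure.integrable_const[OF fin]
      by (intro integral_mono) auto
    then show ?thesis by blast
  qed auto
  then obtain b where b: "\<And>k w. lipschitz_fun X w \<Longrightarrow> \<Phi> k w \<le> b w" by metis
  have \<Phi>0: "0 \<le> \<Phi> k w" for k w unfolding \<Phi>_def using En_nonneg by (intro integral_nonneg_AE) auto
  \<comment> \<open>The default 0 keeps the values at each \<open>w\<close> in a compact interval,
    as \<open>cluster_point_product\<close> requires; the index set consists of all functions
    \<open>w\<close>.\<close>
  define f where "f k w = (if lipschitz_fun X w then \<Phi> k w else 0)" for k w
  have "\<exists>F' Q. F' \<le> sequentially \<and> F' \<noteq> bot \<and> (\<forall>w. Q w \<in> {0..max 0 (b w)}) \<and> (\<forall>w. ((\<lambda>k. f k w) \<longlongrightarrow> Q w) F')"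
    by (rule cluster_point_product) (use b \<Phi>0 in \<open>auto simp: f_def le_max_iff_disj\<close>)
  then obtain F' Q where F0: "F' \<le> sequentially" "F' \<noteq> bot" "\<forall>w. Q w \<in> {0..max 0 (b w)}"
      "\<forall>w. ((\<lambda>k. f k w) \<longlongrightarrow> Q w) F'"
    by (elim exE conjE)
  have F': "F' \<le> sequentially" "F' \<noteq> bot" "\<And>w. 0 \<le> Q w" "\<And>w. ((\<lambda>k. f k w) \<longlongrightarrow> Q w) F'"
    using F0(1,2) F0(3)[rule_format] F0(4)[rule_format] by simp_all
  have Qlim: "((\<lambda>k. \<Phi> k w) \<longlongrightarrow> Q w) F'" if "lipschitz_fun X w" for w
    using F'(4)[of w] that by (simp add: f_def)
  define S where "S n = mhull (v ` {n..})" for n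
  have SL: "lipschitz_fun X w" if "w \<in> S n" for w n
    using that unfolding S_def by (rule mhull_lipschitz_fun) (auto simp: v)
  have Sal: "alip_le X w x (G x)" if "w \<in> S n" "x \<in> X" for w n x
    using that(1) unfolding S_def by (rule mhull_alip_le) (use alip that(2) in auto)
  \<comment> \<open>Almost everywhere \<open>En\<close> is eventually at most
    \<open>(6 * real Kd * (1 + gr x))\<^sup>2\<close>, whose \<open>\<nu>\<close>-integral is at
    most \<open>T\<close>; \<open>T + 1\<close> leaves room for a strict inequality.\<close>
  define T where "T = (6 * real Kd)\<^sup>2 * enn2real (integral\<^sup>N M h)"
  have QT: "Q (v j) \<le> T + 1" for j
  proof -
    have lim: "AE x in \<nu>. limsup (\<lambda>k. ennreal (En k (v j) x)) \<le> ennreal ((6 * real Kd)\<^sup>2) * ennreal ((1 + gr x)\<^sup>2)"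
      using Gfin\<nu> \<nu>X
    proof eventually_elim
      case (elim x)
      have "G x < ennreal (1 + gr x)" using elim(1) gr0[of x] by (simp add: ennreal_less_iff)
      from En_eventually_le[OF alip[OF elim(2)] this]
      have "limsup (\<lambda>k. ennreal (En k (v j) x)) \<le> ennreal ((6 * real Kd * (1 + gr x))\<^sup>2)"
        by (intro Limsup_bounded) (auto elim!: eventually_mono intro: ennreal_leI)
      then show ?case by (simp add: power_mult_distrib ennreal_mult)
    qed
    obtain L where L: "L-lipschitz_on X (v j)" using v[of j] by (auto simp: lipschitz_fun_def)
    have "limsup (\<lambda>k. \<integral>\<^sup>+x. ennreal (En k (v j) x) \<partial>\<nu>) \<le> (\<integral>\<^sup>+x. limsup (\<lambda>k. ennreal (En k (v j) x)) \<partial>\<nu>)"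
    proof (rule nn_integral_limsup)
      show "(\<lambda>x. ennreal (En k (v j) x)) \<in> borel_measurable \<nu>" for k
        by (rule measurable_\<nu>[OF fin sets_\<nu> \<nu>X]) measurable
      show "AE x in \<nu>. ennreal (En k (v j) x) \<le> ennreal ((6 * real Kd * L)\<^sup>2)" for k
        by (intro AE_I2 ennreal_leI En_le[OF L])
      show "(\<integral>\<^sup>+x. ennreal ((6 * real Kd * L)\<^sup>2) \<partial>\<nu>) < \<infinity>"
        using finite_measure.emeasure_finite[OF fin, of "space \<nu>"] by (simp add: ennreal_mult_less_top less_top)
    qed simp
    also have "\<dots> \<le> (\<integral>\<^sup>+x. ennreal ((6 * real Kd)\<^sup>2) * ennreal ((1 + gr x)\<^sup>2) \<partial>\<nu>)" by (rule nn_integral_mono_AE[OF lim])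
    also have "\<dots> = ennreal ((6 * real Kd)\<^sup>2) * (\<integral>\<^sup>+x. ennreal ((1 + gr x)\<^sup>2) \<partial>\<nu>)"
      by (rule nn_integral_cmult) (simp add: \<nu>_def)
    also have "\<dots> \<le> ennreal ((6 * real Kd)\<^sup>2) * integral\<^sup>N M h" using int2 by (rule mult_left_mono) simp
    also have "\<dots> = ennreal T" using h(2) by (simp add: T_def ennreal_mult less_top[symmetric])
    also have "\<dots> < ennreal (T + 1)" by (simp add: T_def ennreal_less_iff)
    finally have "\<forall>\<^sub>F k in sequentially. (\<integral>\<^sup>+x. ennreal (En k (v j) x) \<partial>\<nu>) < ennreal (T + 1)" by (rule Limsup_lessD)
    then have "\<forall>\<^sub>F k in sequentially. \<Phi> k (v j) \<le> T + 1"
    proof (rule eventually_mono)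
      fix k assume *: "(\<integral>\<^sup>+x. ennreal (En k (v j) x) \<partial>\<nu>) < ennreal (T + 1)"
      have "(\<integral>\<^sup>+x. ennreal (En k (v j) x) \<partial>\<nu>) = ennreal (\<Phi> k (v j))"
        unfolding \<Phi>_def by (intro nn_integral_eq_integral Eint v) (simp add: En_nonneg)
      then show "\<Phi> k (v j) \<le> T + 1" using * \<Phi>0[of k "v j"] by (simp add: ennreal_less_iff)
    qed
    then have "\<forall>\<^sub>F k in F'. \<Phi> k (v j) \<le> T + 1" by (rule filter_leD[OF F'(1)])
    then show ?thesis by (rule tendsto_upperbound[OF Qlim[OF v] _ F'(2)])
  qed
  have par: "Q (\<lambda>x. (f x + g x) / 2) + Q (\<lambda>x. (f x - g x) / 2) = (Q f + Q g) / 2" if "f \<in> S 0" "g \<in> S 0" for f g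
  proof (rule tendsto_unique[OF F'(2)])
    note L = SL[OF that(1)] SL[OF that(2)]
    note H = lipschitz_fun_half[OF L]
    show "((\<lambda>k. \<Phi> k (\<lambda>x. (f x + g x) / 2) + \<Phi> k (\<lambda>x. (f x - g x) / 2)) \<longlongrightarrow>
        Q (\<lambda>x. (f x + g x) / 2) + Q (\<lambda>x. (f x - g x) / 2)) F'"
      by (intro tendsto_add Qlim H)
    have eq: "\<Phi> k (\<lambda>x. (f x + g x) / 2) + \<Phi> k (\<lambda>x. (f x - g x) / 2) = (\<Phi> k f + \<Phi> k g) / 2" for k
    proof -
      have "\<Phi> k (\<lambda>x. (f x + g x) / 2) + \<Phi> k (\<lambda>x. (f x - g x) / 2)
        = (\<integral>x. En k (\<lambda>x. (f x + g x) / 2) x + En k (\<lambda>x. (f x - g x) / 2) x \<partial>\<nu>)"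
        unfolding \<Phi>_def by (intro Bochner_Integration.integral_add[symmetric] Eint H)
      also have "\<dots> = (\<Phi> k f + \<Phi> k g) / 2"
        unfolding \<Phi>_def En_parallelogram by (simp add: Bochner_Integration.integral_add Eint L)
      finally show ?thesis .
    qed
    show "((\<lambda>k. \<Phi> k (\<lambda>x. (f x + g x) / 2) + \<Phi> k (\<lambda>x. (f x - g x) / 2)) \<longlongrightarrow> (Q f + Q g) / 2) F'"
      unfolding eq
      by (rule tendsto_divide[OF tendsto_add[OF Qlim[OF L(1)] Qlim[OF L(2)]] tendsto_const]) simp
  qed
  have vS: "v n \<in> S n" for n unfolding S_def by (rule mhull.base) simp
  have "\<exists>y. (\<forall>n. y n \<in> S n) \<and> (\<forall>e>0. \<exists>N. \<forall>n\<ge>N. \<forall>m\<ge>n. Q (\<lambda>x. (y n x - y m x) / 2) < e)"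
  proof (rule min_energy_Cauchy[of S Q "T + 1"])
    show "S n \<noteq> {}" for n using vS[of n] by auto
    show "S n \<subseteq> S m" if "m \<le> n" for m n unfolding S_def using that by (intro mhull_mono image_mono) auto
    show "\<exists>f\<in>S n. Q f \<le> T + 1" for n
      using QT vS by blast
    show "(\<lambda>x. (f x + g x) / 2) \<in> S n" if "f \<in> S n" "g \<in> S n" for n f g
      using that unfolding S_def by (rule mhull.mid)
    show "0 \<le> Q f" for f by (rule F'(3))
  qed (rule par, assumption+)
  then obtain y where y: "\<And>n. y n \<in> S n"
    "\<And>e. 0 < e \<Longrightarrow> \<exists>N. \<forall>n\<ge>N. \<forall>m\<ge>n. Q (\<lambda>x. (y n x - y m x) / 2) < e" by blast
  define c where "c = 12 * real Kd"
  have LcG: "Lp_integrable_borel p \<mu> X (\<lambda>x. ennreal d * G x)" if "0 \<le> d" for d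
    using G pint_cmult[OF Lp_bm[OF G] that] Lp_bm[OF G] by (auto simp: Lp_iff ennreal_mult_less_top)
  have c0: "0 \<le> c" by (simp add: c_def)
  \<comment> \<open>By contradiction: functions whose squares have \<open>\<nu>\<close>-integrals at
    most \<open>(1/2) ^ i\<close> tend to 0 a.e. on \<open>X\<close>, and the bound
    \<open>c * G\<close> gives dominated convergence of the p-integrals. The factor 2 undoes the
    halving of the difference to which this is applied.\<close>
  have small: "\<exists>\<eta>>0. \<forall>e. e \<in> borel_measurable borel \<longrightarrow> (AE x\<in>X in M. e x \<le> ennreal c * G x) \<longrightarrow>
      (\<integral>\<^sup>+x. (e x)\<^sup>2 \<partial>\<nu>) \<le> ennreal (4 * \<eta>) \<longrightarrow> pint (\<lambda>x. ennreal 2 * e x) \<le> ennreal \<epsilon>" if "0 < \<epsilon>" for \<epsilon>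
  proof (rule ccontr)
    assume "\<not> ?thesis"
    then have neg: "\<forall>\<eta>>0. \<exists>e. e \<in> borel_measurable borel \<and> (AE x\<in>X in M. e x \<le> ennreal c * G x) \<and>
      (\<integral>\<^sup>+x. (e x)\<^sup>2 \<partial>\<nu>) \<le> ennreal (4 * \<eta>) \<and> ennreal \<epsilon> < pint (\<lambda>x. ennreal 2 * e x)"
      unfolding not_ex not_all not_imp not_le de_Morgan_conj by blast
    have "\<exists>e. e \<in> borel_measurable borel \<and> (AE x\<in>X in M. e x \<le> ennreal c * G x) \<and>
      (\<integral>\<^sup>+x. (e x)\<^sup>2 \<partial>\<nu>) \<le> ennreal ((1/2) ^ i) \<and> ennreal \<epsilon> < pint (\<lambda>x. ennreal 2 * e x)" for i :: nat
    proof -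
      have "0 < (1/2::real) ^ i / 4" by simp
      from neg[rule_format, OF this] show ?thesis by simp
    qed
    then have "\<exists>e. \<forall>i::nat. e i \<in> borel_measurable borel \<and> (AE x\<in>X in M. e i x \<le> ennreal c * G x) \<and>
      (\<integral>\<^sup>+x. (e i x)\<^sup>2 \<partial>\<nu>) \<le> ennreal ((1/2) ^ i) \<and> ennreal \<epsilon> < pint (\<lambda>x. ennreal 2 * e i x)"
      by (intro choice allI)
    then obtain e where e0: "\<forall>i::nat. e i \<in> borel_measurable borel \<and> (AE x\<in>X in M. e i x \<le> ennreal c * G x) \<and>
      (\<integral>\<^sup>+x. (e i x)\<^sup>2 \<partial>\<nu>) \<le> ennreal ((1/2) ^ i) \<and> ennreal \<epsilon> < pint (\<lambda>x. ennreal 2 * e i x)"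
      by (elim exE)
    have e: "e i \<in> borel_measurable borel" "AE x\<in>X in M. e i x \<le> ennreal c * G x"
      "(\<integral>\<^sup>+x. (e i x)\<^sup>2 \<partial>\<nu>) \<le> ennreal ((1/2) ^ i)" "ennreal \<epsilon> < pint (\<lambda>x. ennreal 2 * e i x)" for i
      using spec[OF e0, of i] by - (elim conjE, assumption)+
    note [measurable] = e(1)
    have "(\<Sum>i. \<integral>\<^sup>+x. (e i x)\<^sup>2 \<partial>\<nu>) \<le> (\<Sum>i. ennreal ((1/2) ^ i))" using e(3) by (intro suminf_le) auto
    also have "\<dots> = ennreal (\<Sum>i. (1/2) ^ i)" by (intro suminf_ennreal2 summable_geometric) auto
    finally have fin2: "(\<Sum>i. \<integral>\<^sup>+x. (e i x)\<^sup>2 \<partial>\<nu>) \<noteq> \<infinity>" by (auto simp: top_unique)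
    have e2m: "(\<lambda>x. (e i x)\<^sup>2) \<in> borel_measurable \<nu>" for i by (rule measurable_\<nu>[OF fin sets_\<nu> \<nu>X]) measurable
    have "AE x in \<nu>. (\<Sum>i. (e i x)\<^sup>2) \<noteq> \<infinity>"
      using fin2 by (intro nn_integral_noteq_infinite borel_measurable_suminf_order e2m) (simp add: nn_integral_suminf e2m)
    then have "AE x in M. x \<in> X \<longrightarrow> (\<Sum>i. (e i x)\<^sup>2) \<noteq> \<infinity>"
      unfolding AE\<nu> by eventually_elim (use wt_pos in auto)
    then have conv: "AE x in M. x \<in> X \<longrightarrow> (\<lambda>i. e i x) \<longlonglongrightarrow> 0"
    proof (rule eventually_mono, intro impI)
      fix x assume "x \<in> X \<longrightarrow> (\<Sum>i. (e i x)\<^sup>2) \<noteq> \<infinity>" "x \<in> X"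
      then have ne: "(\<Sum>i. (e i x)\<^sup>2) \<noteq> \<infinity>" by simp
      have "(e i x)\<^sup>2 \<noteq> \<infinity>" for i using sum_le_suminf[of "\<lambda>i. (e i x)\<^sup>2" "{i}"] ne by (auto simp: top_unique)
      then have fi: "e i x = ennreal (enn2real (e i x))" for i
        by (metis ennreal_enn2real infinity_ennreal_def less_top ennreal_top_mult power2_eq_square ennreal_mult_eq_top_iff top_neq_ennreal zero_neq_one)
      have "(e i x)\<^sup>2 = ennreal ((enn2real (e i x))\<^sup>2)" for i by (subst fi) (simp add: ennreal_power)
      then have "(\<Sum>i. ennreal ((enn2real (e i x))\<^sup>2)) \<noteq> top" using ne by simp
      then have "summable (\<lambda>i. (enn2real (e i x))\<^sup>2)" by (intro summable_suminf_not_top) auto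
      then have "(\<lambda>i. (enn2real (e i x))\<^sup>2) \<longlonglongrightarrow> 0" by (rule summable_LIMSEQ_zero)
      then have "(\<lambda>i. sqrt ((enn2real (e i x))\<^sup>2)) \<longlonglongrightarrow> sqrt 0" by (rule tendsto_real_sqrt)
      then have "(\<lambda>i. ennreal (enn2real (e i x))) \<longlonglongrightarrow> ennreal 0" by (intro tendsto_ennrealI) simp
      then show "(\<lambda>i. e i x) \<longlonglongrightarrow> 0" by (simp add: fi[symmetric])
    qed
    let ?u = "\<lambda>i x. epowr (ennreal 2 * e i x) p * indicator X x"
    have bme: "bm (\<lambda>x. ennreal 2 * e i x)" for i by (intro measurable_restrict_space1) measurable
    have "(\<lambda>i. \<integral>\<^sup>+x. ?u i x \<partial>M) \<longlonglongrightarrow> (\<integral>\<^sup>+x. 0 \<partial>M)"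
    proof (rule nn_integral_dominated_convergence)
      let ?w = "\<lambda>x. epowr (ennreal (2 * c) * G x) p * indicator X x"
      show "?u i \<in> borel_measurable M" for i by (intro measurable_on_X bm_epowr bme)
      show "?w \<in> borel_measurable M" using LcG[of "2 * c"] c0 by (intro measurable_on_X bm_epowr Lp_bm) auto
      show "integral\<^sup>N M ?w < \<infinity>" using LcG[of "2 * c"] c0 by (simp add: Lp_iff pint_def)
      show "AE x in M. ?u i x \<le> ?w x" for i
        using e(2)[of i]
      proof eventually_elim
        case (elim x)
        show ?case
        proof (cases "x \<in> X")
          case True
          then have "ennreal 2 * e i x \<le> ennreal 2 * (ennreal c * G x)" using elim by (intro mult_left_mono) auto
          then have "ennreal 2 * e i x \<le> ennreal (2 * c) * G x" using c0 by (simp only: ennreal_mult mult.assoc) 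
          then show ?thesis using True by (simp add: epowr_mono p_pos del: ennreal_numeral)
        qed simp
      qed
      show "AE x in M. (\<lambda>i. ?u i x) \<longlonglongrightarrow> 0"
        using conv
      proof eventually_elim
        case (elim x)
        show ?case
        proof (cases "x \<in> X")
          case True
          then have "(\<lambda>i. ennreal 2 * e i x) \<longlonglongrightarrow> ennreal 2 * 0" using elim by (intro ennreal_tendsto_cmult) auto
          then have "(\<lambda>i. epowr (ennreal 2 * e i x) p) \<longlonglongrightarrow> 0" by (intro epowr_tendsto_0 p_pos) simp
          then show ?thesis using True by simp
        qed simp
      qed
    qed simp
    then have "(\<lambda>i. pint (\<lambda>x. ennreal 2 * e i x)) \<longlonglongrightarrow> 0" by (simp add: pint_def)
    then have "\<forall>\<^sub>F i in sequentially. pint (\<lambda>x. ennreal 2 * e i x) < ennreal \<epsilon>"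
      using \<open>0 < \<epsilon>\<close> by (intro order_tendstoD(2)) auto
    then have "\<exists>i. pint (\<lambda>x. ennreal 2 * e i x) < ennreal \<epsilon>" by (auto simp: eventually_sequentially)
    then show False using e(4) by (meson less_asym)
  qed
  show ?thesis
  proof (rule that[of y])
    show "y n \<in> mhull (v ` {n..})" for n using y(1) by (simp add: S_def)
    fix \<epsilon> :: real assume "0 < \<epsilon>"
    from small[OF this] obtain \<eta> where \<eta>: "0 < \<eta>"
      "\<And>e. e \<in> borel_measurable borel \<Longrightarrow> (AE x\<in>X in M. e x \<le> ennreal c * G x) \<Longrightarrow>
        (\<integral>\<^sup>+x. (e x)\<^sup>2 \<partial>\<nu>) \<le> ennreal (4 * \<eta>) \<Longrightarrow> pint (\<lambda>x. ennreal 2 * e x) \<le> ennreal \<epsilon>" by blast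
    obtain N where N: "\<And>n m. N \<le> n \<Longrightarrow> n \<le> m \<Longrightarrow> Q (\<lambda>x. (y n x - y m x) / 2) < \<eta>" using y(2)[OF \<eta>(1)] by blast
    have "\<exists>e. Lwug (\<lambda>x. y n x - y m x) e \<and> pint e \<le> ennreal \<epsilon>" if nm: "N \<le> n" "n \<le> m" for n m
    proof -
      let ?w = "\<lambda>x. (y n x - y m x) / 2"
      have lw: "lipschitz_fun X ?w" by (intro lipschitz_fun_half SL[OF y(1)])
      then obtain L where L: "L-lipschitz_on X ?w" by (auto simp: lipschitz_fun_def)
      have "\<forall>\<^sub>F k in F'. \<Phi> k ?w < \<eta>" by (rule order_tendstoD(2)[OF Qlim[OF lw] N[OF nm]])
      \<comment> \<open>\<open>F'\<close> is a proper refinement of \<open>sequentially\<close>, so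
        what holds eventually along \<open>F'\<close> holds at infinitely many scales.\<close>
      have fr: "\<exists>\<^sub>F k in sequentially. \<Phi> k ?w \<le> \<eta>"
      proof (rule ccontr)
        assume "\<not> ?thesis"
        then have "\<forall>\<^sub>F k in sequentially. \<not> \<Phi> k ?w \<le> \<eta>" by (simp add: not_frequently)
        then have "\<forall>\<^sub>F k in F'. \<not> \<Phi> k ?w \<le> \<eta>" by (rule filter_leD[OF F'(1)])
        with \<open>\<forall>\<^sub>F k in F'. \<Phi> k ?w < \<eta>\<close> have "\<forall>\<^sub>F k in F'. False" by eventually_elim simp
        then show False using F'(2) by (simp add: eventually_False)
      qed
      obtain e where e: "e \<in> borel_measurable borel"
        "\<And>a b \<gamma>. (a, b, \<gamma>) \<in> paths_in X \<Longrightarrow> ennreal \<bar>?w (\<gamma> a) - ?w (\<gamma> b)\<bar> \<le> path_int e a b \<gamma>"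
        "(\<integral>\<^sup>+x. (e x)\<^sup>2 \<partial>\<nu>) \<le> ennreal (4 * \<eta>)"
        "\<And>x G. x \<in> X \<Longrightarrow> alip_le X ?w x G \<Longrightarrow> G < \<infinity> \<Longrightarrow> e x \<le> ennreal c * G"
        using upper_gradient_from_energy[OF fin sets_\<nu> \<nu>X L fr[unfolded \<Phi>_def]] unfolding c_def by blast
      have alw: "alip_le X ?w x (G x)" if "x \<in> X" for x
      proof (rule alip_le_combine[OF Sal[OF y(1) that] Sal[OF y(1) that]])
        fix s t
        have eq: "(y n s - y m s) / 2 - (y n t - y m t) / 2 = ((y n s - y n t) - (y m s - y m t)) / 2"
          unfolding diff_divide_distrib by (simp only: algebra_simps)
        show "\<bar>(y n s - y m s) / 2 - (y n t - y m t) / 2\<bar> \<le> (\<bar>y n s - y n t\<bar> + \<bar>y m s - y m t\<bar>) / 2"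
          unfolding eq using abs_triangle_ineq4[of "y n s - y n t" "y m s - y m t"] by simp
      qed
      have eG: "AE x\<in>X in M. e x \<le> ennreal c * G x"
        using Lp_AE_finite[OF G] by eventually_elim (use e(4) alw in auto)
      have bme: "bm e" using e(1) by (rule measurable_restrict_space1)
      have bm2e: "bm (\<lambda>x. ennreal 2 * e x)" using bme by measurable
      have sm: "pint (\<lambda>x. ennreal 2 * e x) \<le> ennreal \<epsilon>" by (rule \<eta>(2)[OF e(1) eG e(3)])
      then have Lp: "Lp_integrable_borel p \<mu> X (\<lambda>x. ennreal 2 * e x)" using bm2e by (auto simp: Lp_iff intro: le_less_trans)
      have "Lwug (\<lambda>x. y n x - y m x) (\<lambda>x. ennreal 2 * e x)"
      proof (rule LwugI[OF Lp])
        show "AE_path (\<lambda>a b \<gamma>. ennreal \<bar>(y n (\<gamma> a) - y m (\<gamma> a)) - (y n (\<gamma> b) - y m (\<gamma> b))\<bar> \<le> path_int (\<lambda>x. ennreal 2 * e x) a b \<gamma>)"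
          using AE_path_finite[OF Lp]
        proof (rule AE_path_mono)
          fix a b \<gamma> assume path: "(a, b, \<gamma>) \<in> paths_in X"
          have "\<bar>(y n (\<gamma> a) - y m (\<gamma> a)) - (y n (\<gamma> b) - y m (\<gamma> b))\<bar> = 2 * \<bar>?w (\<gamma> a) - ?w (\<gamma> b)\<bar>"
            by (simp flip: diff_divide_distrib)
          then have "ennreal \<bar>(y n (\<gamma> a) - y m (\<gamma> a)) - (y n (\<gamma> b) - y m (\<gamma> b))\<bar> = ennreal 2 * ennreal \<bar>?w (\<gamma> a) - ?w (\<gamma> b)\<bar>"
            by (simp only: ennreal_mult abs_ge_zero zero_le_numeral)
          also have "\<dots> \<le> ennreal 2 * path_int e a b \<gamma>" by (intro mult_left_mono e(2)[OF path]) simp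
          also have "\<dots> = path_int (\<lambda>x. ennreal 2 * e x) a b \<gamma>" by (rule path_int_cmult[OF path bme, symmetric]) simp
          finally show "ennreal \<bar>(y n (\<gamma> a) - y m (\<gamma> a)) - (y n (\<gamma> b) - y m (\<gamma> b))\<bar> \<le> path_int (\<lambda>x. ennreal 2 * e x) a b \<gamma>" .
        qed
      qed
      then show ?thesis using sm by blast
    qed
    then show "\<exists>N. \<forall>n\<ge>N. \<forall>m\<ge>n. \<exists>e. Lwug (\<lambda>x. y n x - y m x) e \<and> pint e \<le> ennreal \<epsilon>" by blast
  qed
qed

end

section \<open>Lipschitz approximation in \<open>L\<^sup>p\<close>\<close>

lemma powr_superadditive:
  fixes a b p :: real
  assumes "0 \<le> a" "0 \<le> b" "1 \<le> p"
  shows "a powr p + b powr p \<le> (a + b) powr p"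
proof -
  have "c powr p \<le> c * (a + b) powr (p - 1)" if "0 \<le> c" "c \<le> a + b" for c
    using powr_mult_base[of c "p - 1"] mult_left_mono[OF powr_mono2[of "p - 1" c "a + b"], of c] that assms by simp
  from add_mono[OF this[of a] this[of b]] have "a powr p + b powr p \<le> (a + b) * (a + b) powr (p - 1)"
    using assms by (simp add: distrib_right)
  then show ?thesis using powr_mult_base[of "a + b" "p - 1"] assms by simp
qed

lemma powr_add_le:
  fixes a b p :: real
  assumes "0 \<le> a" "0 \<le> b" "0 \<le> p"
  shows "(a + b) powr p \<le> 2 powr p * (a powr p + b powr p)"
proof -
  have "(a + b) powr p \<le> (2 * max a b) powr p" using assms by (intro powr_mono2) auto
  also have "\<dots> = 2 powr p * (max a b) powr p" using assms by (simp add: powr_mult)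
  also have "\<dots> \<le> 2 powr p * (a powr p + b powr p)" by (intro mult_left_mono) (auto simp: max_def)
  finally show ?thesis .
qed

lemma powr_midpoint_le:
  fixes a b p :: real
  assumes "0 \<le> a" "0 \<le> b" "1 \<le> p"
  shows "((a + b) / 2) powr p \<le> (a powr p + b powr p) / 2"
proof -
  have half: "(c / 2) powr p \<le> c powr p / 2" if "0 \<le> c" for c :: real
  proof -
    have "(1/2::real) powr p \<le> (1/2) powr 1" using assms by (intro powr_mono') auto
    then have "c powr p * (1/2) powr p \<le> c powr p * (1/2)" by (intro mult_left_mono) auto
    then show ?thesis using powr_mult[of c "1/2" p] that by simp
  qed
  show ?thesis
  proof (cases "a = 0 \<or> b = 0")
    case True
    then show ?thesis using half assms by auto
  next
    case False
    then have "0 < a" "0 < b" using assms by auto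
    then show ?thesis using convex_onD[OF powr_convex[OF assms(3)], of "1/2" a b] by (simp add: field_simps)
  qed
qed

lemma cutoff_product_diff:
  fixes c c' e e' d :: real
  assumes "0 \<le> e" "e \<le> 1" "\<bar>e - e'\<bar> \<le> d" "0 \<le> c'"
  shows "\<bar>c * e - c' * e'\<bar> \<le> \<bar>c - c'\<bar> + c' * d"
proof -
  have "c * e - c' * e' = (c - c') * e + c' * (e - e')" by (simp add: algebra_simps)
  also have "\<bar>\<dots>\<bar> \<le> \<bar>c - c'\<bar> * e + c' * \<bar>e - e'\<bar>"
    using assms by (intro order_trans[OF abs_triangle_ineq]) (simp add: abs_mult)
  also have "\<dots> \<le> \<bar>c - c'\<bar> * 1 + c' * d" using assms by (intro add_mono mult_left_mono) auto
  finally show ?thesis by simp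
qed

text \<open>Where \<open>c * e\<close> exceeds \<open>u\<close>, superadditivity bounds the power of
  the difference by \<open>W - u powr p\<close>, which is small in the mean when \<open>W\<close> is
  a nearly optimal majorant of \<open>u powr p\<close>. Elsewhere the deficit splits into that of
  \<open>c\<close> and that of the cut-off \<open>e\<close>.\<close>

lemma cutoff_powr_diff:
  fixes c u e p :: real
  assumes p: "1 \<le> p" and "0 \<le> c" "0 \<le> u" "0 \<le> e" "e \<le> 1" and W: "ennreal ((c * e) powr p) \<le> W"
  shows "ennreal (\<bar>c * e - u\<bar> powr p) \<le>
    (W - ennreal (u powr p)) + ennreal (2 powr p) * (ennreal (max 0 (u - c) powr p) + ennreal ((u * (1 - e)) powr p))"
proof (cases "u \<le> c * e")
  case True
  have "(c * e - u) powr p + u powr p \<le> (c * e) powr p"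
    using powr_superadditive[of "c * e - u" u p] True assms by simp
  then have "ennreal (\<bar>c * e - u\<bar> powr p) \<le> ennreal ((c * e) powr p - u powr p)"
    using True by (intro ennreal_leI) simp
  also have "\<dots> = ennreal ((c * e) powr p) - ennreal (u powr p)" by (simp add: ennreal_minus)
  also have "\<dots> \<le> W - ennreal (u powr p)" by (rule ennreal_minus_mono[OF W order_refl])
  finally show ?thesis by (rule add_increasing2[rotated]) simp
next
  case False
  have "e * (u - c) \<le> max 0 (u - c)"
    using assms mult_right_mono[of e 1 "u - c"] by (cases "0 \<le> u - c") (auto simp: mult_nonneg_nonpos max_def)
  then have "\<bar>c * e - u\<bar> \<le> max 0 (u - c) + u * (1 - e)" using False by (simp add: algebra_simps)
  then have "\<bar>c * e - u\<bar> powr p \<le> (max 0 (u - c) + u * (1 - e)) powr p" using p by (intro powr_mono2) auto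
  also have "\<dots> \<le> 2 powr p * (max 0 (u - c) powr p + (u * (1 - e)) powr p)" using assms by (intro powr_add_le) auto
  finally have "ennreal (\<bar>c * e - u\<bar> powr p) \<le> ennreal (2 powr p * (max 0 (u - c) powr p + (u * (1 - e)) powr p))"
    by (rule ennreal_leI)
  also have "\<dots> = ennreal (2 powr p) * (ennreal (max 0 (u - c) powr p) + ennreal ((u * (1 - e)) powr p))"
    by (simp add: ennreal_mult)
  finally show ?thesis by (rule add_increasing[rotated]) simp
qed

text \<open>Product rule: near \<open>x\<close> the first factor has slope about
  \<open>lip_reg g n x + \<delta>\<close>, at most \<open>g x + \<delta>\<close>, and the slope 1 of
  the cut-off is multiplied by a value of about \<open>chain_inf\<close>, at most
  \<open>w x\<close>. Off \<open>ball x0 (R + 1)\<close> the product vanishes near \<open>x\<close>,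
  hence the indicator at \<open>\<delta>\<close>.\<close>

lemma chain_cutoff_alip:
  fixes X :: "'a::metric_space set" and R :: real
  assumes \<delta>: "0 < \<delta>" and x: "x \<in> X"
  shows "alip_le X (\<lambda>y. chain_inf X g w \<delta> n y * max 0 (min 1 (R - dist x0 y))) x
    (g x + w x + ennreal \<delta> * indicator (ball x0 (R + 1)) x)"
  unfolding alip_le_def
proof (intro allI impI)
  fix c assume c: "g x + w x + ennreal \<delta> * indicator (ball x0 (R + 1)) x < ennreal c"
  let ?c = "chain_inf X g w \<delta> n" and ?e = "\<lambda>y. max 0 (min 1 (R - dist x0 y))"
  let ?d = "\<lambda>y z. \<bar>?c y * ?e y - ?c z * ?e z\<bar>"
  have c0: "0 < c"
  proof (rule ccontr)
    assume "\<not> 0 < c"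
    then have "ennreal c = 0" by (simp add: ennreal_neg)
    with c show False by simp
  qed
  show "\<exists>r>0. \<forall>y\<in>X \<inter> ball x r. \<forall>z\<in>X \<inter> ball x r. ?d y z \<le> c * dist y z"
  proof (cases "x \<in> ball x0 (R + 1)")
    case False
    have "?e y = 0" if "y \<in> ball x (1/2)" for y
      using that False dist_triangle[of x0 x y] by (auto simp: dist_commute)
    then show ?thesis using c0 by (intro exI[of _ "1/2"]) auto
  next
    case True
    define L where "L = real n + \<delta> + real n * real (Suc n)"
    have L: "L-lipschitz_on X ?c" unfolding L_def by (rule chain_inf_lipschitz[OF \<delta>])
    have "g x < \<infinity>" "w x < \<infinity>" using c by (auto simp: less_top[symmetric] top_unique)
    then obtain a b where ab: "g x = ennreal a" "w x = ennreal b" "0 \<le> a" "0 \<le> b"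
      by (cases "g x"; cases "w x") auto
    have eq: "ennreal (a + b + \<delta>) = ennreal a + ennreal b + ennreal \<delta>" using ab \<delta> by simp
    have "ennreal (a + b + \<delta>) < ennreal c" unfolding eq using c True ab by simp
    then have abc: "a + b + \<delta> < c" by (rule iffD1[OF ennreal_less_iff, rotated]) (use ab \<delta> in simp)
    define K where "K = real n + L + 1"
    have K: "0 < K" using lipschitz_on_nonneg[OF L] by (simp add: K_def)
    \<comment> \<open>The first term absorbs the variation of \<open>lip_reg\<close> and of
      \<open>?c\<close> near \<open>x\<close> into the slack of \<open>c\<close>; the second keeps
      \<open>y\<close> and \<open>z\<close> within one admissible chain step.\<close>
    define r where "r = min ((c - (a + b + \<delta>)) / K) (1 / (2 * real (Suc n)))"
    have r0: "0 < r" using abc K by (simp add: r_def)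
    have "r \<le> (c - (a + b + \<delta>)) / K" by (simp add: r_def)
    then have rK: "r * K \<le> c - (a + b + \<delta>)" using K by (simp add: pos_le_divide_eq)
    have lr: "lip_reg g n x \<le> a" using lip_reg_le_self[of g n x] ab by simp
    have cx: "?c x \<le> b" using chain_inf_le[OF \<delta> x, of g w n] ab by simp
    have step: "?c z - ?c y \<le> (a + real n * r + \<delta>) * dist y z"
      if y: "y \<in> X" "dist x y < r" and z: "z \<in> X" "dist x z < r" for y z
    proof -
      have "dist y z \<le> 2 * r" using dist_triangle[of y z x] y z by (simp add: dist_commute)
      also have "\<dots> \<le> 2 * (1 / (2 * real (Suc n)))" unfolding r_def by (intro mult_left_mono min.cobounded2) simp
      also have "\<dots> = 1 / real (Suc n)" by (simp del: of_nat_Suc)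
      finally have "?c z \<le> ?c y + (lip_reg g n y + \<delta>) * dist y z" by (rule chain_inf_step[OF \<delta> y(1) z(1)])
      moreover have "real n * dist y x \<le> real n * r" using y by (intro mult_left_mono) (auto simp: dist_commute)
      then have "lip_reg g n y \<le> a + real n * r" using lip_reg_lipschitz[of g n y x] lr by linarith
      then have "(lip_reg g n y + \<delta>) * dist y z \<le> (a + real n * r + \<delta>) * dist y z" by (intro mult_right_mono) auto
      ultimately show ?thesis by linarith
    qed
    have "?d y z \<le> c * dist y z" if y: "y \<in> X" "dist x y < r" and z: "z \<in> X" "dist x z < r" for y z
    proof -
      have "\<bar>?c y - ?c z\<bar> \<le> (a + real n * r + \<delta>) * dist y z"
        using step[OF y z] step[OF z y] by (auto simp: abs_le_iff dist_commute)
      moreover have "\<bar>?c z - ?c x\<bar> \<le> L * dist z x" using lipschitz_onD[OF L z(1) x] by (simp add: dist_real_def)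
      moreover have "L * dist z x \<le> L * r" using z lipschitz_on_nonneg[OF L] by (intro mult_left_mono) (auto simp: dist_commute)
      ultimately have cz: "?c z \<le> b + L * r" "\<bar>?c y - ?c z\<bar> \<le> (a + real n * r + \<delta>) * dist y z" using cx by linarith+
      have "?d y z \<le> \<bar>?c y - ?c z\<bar> + ?c z * dist y z"
      proof (rule cutoff_product_diff)
        show "\<bar>?e y - ?e z\<bar> \<le> dist y z"
          using dist_triangle[of x0 y z] dist_triangle[of x0 z y] by (auto simp: max_def min_def dist_commute)
        show "0 \<le> ?c z" by (rule chain_inf_nonneg[OF \<delta>])
      qed auto
      also have "\<dots> \<le> (a + real n * r + \<delta>) * dist y z + (b + L * r) * dist y z"
        using cz by (intro add_mono mult_right_mono) auto
      also have "\<dots> = (a + b + \<delta> + r * (real n + L)) * dist y z" by (simp add: algebra_simps)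
      also have "\<dots> \<le> c * dist y z"
      proof (rule mult_right_mono)
        have "r * (real n + L) \<le> r * K" using r0 by (intro mult_left_mono) (auto simp: K_def)
        then show "a + b + \<delta> + r * (real n + L) \<le> c" using rK by linarith
      qed simp
      finally show ?thesis .
    qed
    then show ?thesis using r0 by (intro exI[of _ r]) (auto simp: dist_commute)
  qed
qed

lemma chain_cutoff_lipschitz:
  fixes X :: "'a::metric_space set" and R :: real
  assumes \<delta>: "0 < \<delta>"
  shows "lipschitz_fun X (\<lambda>y. chain_inf X g w \<delta> n y * max 0 (min 1 (R - dist x0 y)))"
proof -
  let ?c = "chain_inf X g w \<delta> n" and ?e = "\<lambda>y. max 0 (min 1 (R - dist x0 y))"
  define L where "L = real n + \<delta> + real n * real (Suc n)"
  have L: "L-lipschitz_on X ?c" unfolding L_def by (rule chain_inf_lipschitz[OF \<delta>])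
  have "(L + real n)-lipschitz_on X (\<lambda>y. ?c y * ?e y)"
  proof (rule lipschitz_onI)
    fix y z assume yz: "y \<in> X" "z \<in> X"
    have "\<bar>?c y * ?e y - ?c z * ?e z\<bar> \<le> \<bar>?c y - ?c z\<bar> + ?c z * dist y z"
    proof (rule cutoff_product_diff)
      show "\<bar>?e y - ?e z\<bar> \<le> dist y z"
        using dist_triangle[of x0 y z] dist_triangle[of x0 z y] by (auto simp: max_def min_def dist_commute)
      show "0 \<le> ?c z" by (rule chain_inf_nonneg[OF \<delta>])
    qed auto
    also have "\<dots> \<le> L * dist y z + real n * dist y z"
      using lipschitz_onD[OF L yz] chain_inf_le_n[OF \<delta>]
      by (intro add_mono mult_right_mono) (auto simp: dist_real_def)
    finally show "dist (?c y * ?e y) (?c z * ?e z) \<le> (L + real n) * dist y z"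
      by (simp add: dist_real_def algebra_simps)
  qed (use lipschitz_on_nonneg[OF L] in simp)
  then show ?thesis unfolding lipschitz_fun_def by blast
qed

context mm_space begin

lemma measurable_AE_eq:
  fixes f g :: "'a \<Rightarrow> real"
  assumes f: "f \<in> borel_measurable M" and ae: "AE x in M. f x = g x"
  shows "g \<in> borel_measurable M"
proof (rule borel_measurableI_greater)
  fix c
  obtain N where N: "N \<in> sets borel" "N \<in> null_sets M" "\<And>x. x \<notin> N \<Longrightarrow> f x = g x"
    using AE_borel_hull[OF ae] by metis
  have 1: "{x. c < f x} \<in> sets M" using borel_measurable_iff_greater[of f M] f by simp
  have "{x. c < g x} \<inter> N \<in> null_sets M" by (rule complete_measure.complete2[OF complete_M _ N(2)]) simp
  then have 2: "{x. c < g x} \<inter> N \<in> sets M" by auto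
  have 3: "({x. c < f x} - N) \<union> ({x. c < g x} \<inter> N) \<in> sets M"
    by (intro sets.Un sets.Diff 1 2 null_setsD2[OF N(2)])
  have "{x. c < g x} = ({x. c < f x} - N) \<union> ({x. c < g x} \<inter> N)"
  proof (rule set_eqI)
    fix x show "x \<in> {x. c < g x} \<longleftrightarrow> x \<in> ({x. c < f x} - N) \<union> ({x. c < g x} \<inter> N)"
      using N(3)[of x] by (cases "x \<in> N") auto
  qed
  then show "{x \<in> space M. c < g x} \<in> sets M" using 3 by (simp only: space_M UNIV_I simp_thms)
qed

end

section \<open>Gradients without exceptional paths and approximation in L^p\<close>

context closed_doubling begin

lemma lsc_root:
  assumes "lsc W" "(\<integral>\<^sup>+x. W x \<partial>M) < \<infinity>"
  shows "lsc (\<lambda>x. epowr (W x) (1 / p))" "Lp_integrable_borel p \<mu> X (\<lambda>x. epowr (W x) (1 / p))"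
proof -
  show l: "lsc (\<lambda>x. epowr (W x) (1 / p))" using p_pos by (intro lsc_epowr assms) simp
  have "pint (\<lambda>x. epowr (W x) (1 / p)) \<le> (\<integral>\<^sup>+x. W x \<partial>M)"
    unfolding pint_def using p_pos
    by (intro nn_integral_mono) (auto simp: epowr_epowr split: split_indicator)
  then show "Lp_integrable_borel p \<mu> X (\<lambda>x. epowr (W x) (1 / p))"
    unfolding Lp_iff using measurable_restrict_space1[OF lsc_borel_measurable[OF l]] assms(2)
    by (auto intro: le_less_trans)
qed

text \<open>The summand \<open>\<sigma>\<close> removes the exceptional family: its paths get an
  infinite integral, so the inequality holds along every path. \<open>Vitali_Caratheodory\<close>
  for the p-th power then provides a lower semicontinuous majorant whose root is
  p-integrable.\<close>

lemma lsc_upper_gradient: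
  assumes "Lwug u \<rho>"
  obtains g where "lsc g" "Lp_integrable_borel p \<mu> X g"
    "\<And>a b \<gamma>. (a, b, \<gamma>) \<in> paths_in X \<Longrightarrow> ennreal \<bar>u (\<gamma> a) - u (\<gamma> b)\<bar> \<le> path_int g a b \<gamma>"
proof -
  have "AE_path (\<lambda>a b \<gamma>. ennreal \<bar>u (\<gamma> a) - u (\<gamma> b)\<bar> \<le> path_int \<rho> a b \<gamma>)"
    using assms by (simp add: Lp_weak_upper_gradient_def weak_upper_gradient_iff)
  then obtain \<sigma> where \<sigma>: "Lp_integrable_borel p \<mu> X \<sigma>"
    "\<And>a b \<gamma>. (a, b, \<gamma>) \<in> paths_in X \<Longrightarrow> path_int \<sigma> a b \<gamma> < \<infinity> \<Longrightarrow>
       ennreal \<bar>u (\<gamma> a) - u (\<gamma> b)\<bar> \<le> path_int \<rho> a b \<gamma>"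
    unfolding AE_path_def by blast
  define g0 where "g0 x = \<rho> x + \<sigma> x" for x
  have L0: "Lp_integrable_borel p \<mu> X g0" unfolding g0_def by (rule Lp_add[OF Lwug_Lp[OF assms] \<sigma>(1)])
  have "(\<lambda>x. epowr (g0 x) p * indicator X x) \<in> borel_measurable M" by (rule measurable_on_X[OF bm_epowr[OF Lp_bm[OF L0]]])
  from Vitali_Caratheodory[OF this zero_less_one] obtain W where W: "lsc W"
    "\<And>x. epowr (g0 x) p * indicator X x \<le> W x" "integral\<^sup>N M W \<le> pint g0 + ennreal 1"
    unfolding pint_def by blast
  have fin: "integral\<^sup>N M W < \<infinity>"
    using W(3) L0 unfolding Lp_iff by (auto intro: le_less_trans)
  let ?g = "\<lambda>x. epowr (W x) (1 / p)"
  have ge: "g0 x \<le> ?g x" if "x \<in> X" for x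
  proof -
    have "epowr (epowr (g0 x) p) (1 / p) \<le> ?g x" using W(2)[of x] that p_pos by (intro epowr_mono) auto
    then show ?thesis using p_pos by (simp add: epowr_epowr)
  qed
  show ?thesis
  proof (rule that[OF lsc_root[OF W(1) fin]])
    fix a b \<gamma> assume path: "(a, b, \<gamma>) \<in> paths_in X"
    have ge': "g0 (\<gamma> t) \<le> ?g (\<gamma> t)" if "t \<in> {a..b}" for t by (rule ge[OF paths_in_mem[OF path that]])
    have 1: "path_int \<rho> a b \<gamma> \<le> path_int ?g a b \<gamma>"
      by (intro path_int_mono order_trans[OF _ ge']) (auto simp: g0_def)
    have 2: "path_int \<sigma> a b \<gamma> \<le> path_int ?g a b \<gamma>"
      by (intro path_int_mono order_trans[OF _ ge']) (auto simp: g0_def)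
    show "ennreal \<bar>u (\<gamma> a) - u (\<gamma> b)\<bar> \<le> path_int ?g a b \<gamma>"
    proof (cases "path_int ?g a b \<gamma> < \<infinity>")
      case True
      then have "path_int \<sigma> a b \<gamma> < \<infinity>" by (rule le_less_trans[OF 2])
      from \<sigma>(2)[OF path this] show ?thesis using 1 by (rule order_trans)
    next
      case False
      then show ?thesis by (simp add: less_top[symmetric])
    qed
  qed
qed

text \<open>The majorants \<open>w j\<close> converge to \<open>u\<close> in \<open>L\<^sup>p\<close> and stay below \<open>w 0\<close>, which bounds the slope
  caused by the cutoff; \<open>D\<close> absorbs the constants \<open>\<delta> j\<close>, each of which matters on a ball only.\<close>
lemma lipschitz_approx_nonneg:
  fixes u :: "'a \<Rightarrow> real"
  assumes um [measurable]: "u \<in> borel_measurable M" and u0: "\<And>x. 0 \<le> u x"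
    and fin: "(\<integral>\<^sup>+x\<in>X. ennreal (u x powr p) \<partial>M) < \<infinity>"
    and g: "lsc g" "Lp_integrable_borel p \<mu> X g"
    and ug: "\<And>a b \<gamma>. (a, b, \<gamma>) \<in> paths_in X \<Longrightarrow> ennreal \<bar>u (\<gamma> a) - u (\<gamma> b)\<bar> \<le> path_int g a b \<gamma>"
  shows "\<exists>v G. (\<forall>j::nat. lipschitz_fun X (v j) \<and> bounded {x\<in>X. v j x \<noteq> 0}) \<and> Lp_integrable_borel p \<mu> X G \<and>
    (\<forall>j. \<forall>x\<in>X. alip_le X (v j) x (G x)) \<and> (\<lambda>j. \<integral>\<^sup>+x\<in>X. ennreal (\<bar>v j x - u x\<bar> powr p) \<partial>M) \<longlonglongrightarrow> 0"
proof -
  have [measurable]: "X \<in> sets M" by (rule X)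
  define F where "F x = ennreal (u x powr p) * indicator X x" for x
  have Fm [measurable]: "F \<in> borel_measurable M" unfolding F_def[abs_def] by measurable
  have finF: "integral\<^sup>N M F < \<infinity>" using fin by (simp add: F_def[abs_def])
  have "\<exists>W. lsc W \<and> (\<forall>x. F x \<le> W x) \<and> integral\<^sup>N M W \<le> integral\<^sup>N M F + ennreal ((1/2) ^ j)" for j :: nat
    by (rule Vitali_Caratheodory[OF Fm]) simp
  then obtain V where V: "\<And>j. lsc (V j)" "\<And>j x. F x \<le> V j x"
      "\<And>j::nat. integral\<^sup>N M (V j) \<le> integral\<^sup>N M F + ennreal ((1/2) ^ j)" by metis
  define W where "W j x = min (V j x) (V 0 x)" for j x
  have W: "lsc (W j)" "F x \<le> W j x" for j x using V by (auto simp: W_def[abs_def] intro: lsc_min)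
  have Wm [measurable]: "W j \<in> borel_measurable M" for j by (rule borel_measurable_M[OF refl lsc_borel_measurable[OF W(1)]])
  have W_int: "integral\<^sup>N M (W j) \<le> integral\<^sup>N M F + ennreal ((1/2) ^ j)" for j
    by (rule order_trans[OF nn_integral_mono V(3)]) (simp add: W_def)
  have W_fin: "integral\<^sup>N M (W j) < \<infinity>" for j
    by (rule le_less_trans[OF W_int]) (use finF in auto)
  define w where "w j x = epowr (W j x) (1 / p)" for j x
  have w: "lsc (w j)" "Lp_integrable_borel p \<mu> X (w j)" for j
    unfolding w_def[abs_def] using lsc_root[OF W(1) W_fin] by auto
  have uw: "ennreal (u x) \<le> w j x" if "x \<in> X" for j x
  proof -
    have "epowr (F x) (1 / p) \<le> w j x" unfolding w_def using W(2) p_pos by (intro epowr_mono) auto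
    then show ?thesis using that u0[of x] p_pos by (simp add: F_def powr_powr)
  qed
  have ww0: "w j x \<le> w 0 x" for j x unfolding w_def using p_pos by (intro epowr_mono) (auto simp: W_def)
  define x0 :: 'a where "x0 = undefined"
  define \<eta> where "\<eta> j x = max 0 (min 1 (real (Suc j) - dist x0 x))" for j x
  have \<eta>01: "0 \<le> \<eta> j x" "\<eta> j x \<le> 1" for j x by (auto simp: \<eta>_def)
  have \<eta>m [measurable]: "\<eta> j \<in> borel_measurable M" for j
    unfolding \<eta>_def[abs_def]
    by (rule borel_measurable_M[OF refl borel_measurable_continuous_onI]) (intro continuous_intros)
  \<comment> \<open>Makes \<open>\<delta> j\<close> times the measure of the ball at most
    \<open>(1/2) ^ j\<close>, so that the supremum \<open>D\<close> is p-integrable.\<close>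
  define \<delta> where "\<delta> j = (1/2) ^ j / (1 + measure M (ball x0 (real (Suc j) + 1)))" for j
  have \<delta>: "0 < \<delta> j" for j unfolding \<delta>_def by (intro divide_pos_pos add_pos_nonneg) auto
  define c where "c j n = chain_inf X g (w j) (\<delta> j) n" for j n
  have cm [measurable]: "(\<lambda>x. indicator X x * c j n x) \<in> borel_measurable M" for j n
  proof -
    have "continuous_on X (c j n)" unfolding c_def by (rule lipschitz_on_continuous_on[OF chain_inf_lipschitz[OF \<delta>]])
    then have "c j n \<in> borel_measurable (restrict_space M X)"
      by (intro measurable_restrict_M borel_measurable_continuous_on_restrict)
    then show ?thesis by (simp add: borel_measurable_restrict_space_iff X)
  qed
  have c0: "0 \<le> c j n x" for j n x unfolding c_def by (rule chain_inf_nonneg[OF \<delta>])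
  \<comment> \<open>The p-th power of the deficit of the chain minimum below \<open>u\<close>: it
    tends to 0 pointwise by \<open>chain_inf_eventually_gt\<close> and is dominated by
    \<open>F\<close>.\<close>
  let ?T = "\<lambda>j n x. ennreal (max 0 (u x - indicator X x * c j n x) powr p) * indicator X x"
  have Tlim: "(\<lambda>n. \<integral>\<^sup>+x. ?T j n x \<partial>M) \<longlonglongrightarrow> (\<integral>\<^sup>+x. 0 \<partial>M)" for j
  proof (rule nn_integral_dominated_convergence[where w = F])
    show "AE x in M. ?T j n x \<le> F x" for n
      using c0[of j n] u0 p_pos by (intro AE_I2) (auto simp: F_def intro!: ennreal_leI powr_mono2 split: split_indicator)
    show "AE x in M. (\<lambda>n. ?T j n x) \<longlonglongrightarrow> 0"
    proof (rule AE_I2)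
      fix x
      show "(\<lambda>n. ?T j n x) \<longlonglongrightarrow> 0"
      proof (cases "x \<in> X")
        case True
        have "(\<lambda>n. max 0 (u x - c j n x)) \<longlonglongrightarrow> 0"
        proof (rule order_tendstoI)
          fix e :: real assume "0 < e"
          then have "\<forall>\<^sub>F n in sequentially. u x - e < c j n x"
            unfolding c_def by (intro chain_inf_eventually_gt[OF \<delta> compact_cball closed_X g(1) w(1) uw ug True]) auto
          then show "\<forall>\<^sub>F n in sequentially. max 0 (u x - c j n x) < e" using \<open>0 < e\<close> by (auto elim!: eventually_mono)
        qed (auto intro!: always_eventually)
        then have "(\<lambda>n. max 0 (u x - c j n x) powr p) \<longlonglongrightarrow> 0" using p_pos by (intro tendsto_zero_powrI[OF _ tendsto_const]) auto
        from tendsto_ennrealI[OF this] show ?thesis using True by simp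
      qed simp
    qed
  qed (use finF in auto)
  have "\<exists>n. (\<integral>\<^sup>+x. ?T j n x \<partial>M) < ennreal ((1/2) ^ j)" for j
    using order_tendstoD(2)[OF Tlim[of j], of "ennreal ((1/2) ^ j)"] by (auto simp: eventually_sequentially)
  then obtain n where n: "\<And>j. (\<integral>\<^sup>+x. ?T j (n j) x \<partial>M) < ennreal ((1/2) ^ j)" by metis
  define v where "v j x = c j (n j) x * \<eta> j x" for j x
  define D where "D x = (SUP j. ennreal (\<delta> j) * indicator (ball x0 (real (Suc j) + 1)) x)" for x
  have LD: "Lp_integrable_borel p \<mu> X D"
    unfolding D_def
  proof (rule Lp_SUP)
    have [measurable]: "ball x0 r \<in> sets borel" for r by simp
    show "bm (\<lambda>x. ennreal (\<delta> j) * indicator (ball x0 (real (Suc j) + 1)) x)" for j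
      by (intro measurable_restrict_space1) measurable
    have "(\<integral>\<^sup>+x\<in>X. epowr (ennreal (\<delta> j) * indicator (ball x0 (real (Suc j) + 1)) x) p \<partial>M) \<le> ennreal ((1/2) ^ j)" for j
    proof -
      let ?B = "ball x0 (real (Suc j) + 1)"
      have Bm: "?B \<in> sets M" by (rule borel_sets_M) simp
      have "\<delta> j \<le> 1"
      proof -
        have "(1/2::real) ^ j \<le> 1" by (rule power_le_one) auto
        then show ?thesis unfolding \<delta>_def by (subst divide_le_eq_1_pos) (auto intro: add_pos_nonneg add_increasing2)
      qed
      then have "\<delta> j powr p \<le> \<delta> j powr 1" using \<delta>[of j] p by (intro powr_mono') auto
      then have dp: "\<delta> j powr p \<le> \<delta> j" using \<delta>[of j] by simp
      have "(\<integral>\<^sup>+x\<in>X. epowr (ennreal (\<delta> j) * indicator ?B x) p \<partial>M) \<le> (\<integral>\<^sup>+x. ennreal (\<delta> j) * indicator ?B x \<partial>M)"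
        using \<delta>[of j] dp by (intro nn_integral_mono) (auto intro: ennreal_leI less_imp_le split: split_indicator)
      also have "\<dots> = ennreal (\<delta> j) * emeasure M ?B" by (rule nn_integral_cmult_indicator[OF Bm])
      also have "emeasure M ?B = ennreal (measure M ?B)"
        using emeasure_ball_finite[of x0 "real (Suc j) + 1"] by (intro emeasure_eq_ennreal_measure) auto
      also have "ennreal (\<delta> j) * ennreal (measure M ?B) = ennreal (\<delta> j * measure M ?B)"
        using \<delta>[of j] by (intro ennreal_mult[symmetric]) auto
      also have "\<dots> \<le> ennreal ((1/2) ^ j)"
      proof (rule ennreal_leI)
        have "\<delta> j * measure M ?B \<le> \<delta> j * (1 + measure M ?B)" using \<delta>[of j] by (intro mult_left_mono) auto
        also have "\<dots> = (1/2) ^ j" unfolding \<delta>_def by (simp add: add_nonneg_eq_0_iff)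
        finally show "\<delta> j * measure M ?B \<le> (1/2) ^ j" .
      qed
      finally show ?thesis .
    qed
    then have "(\<Sum>j. \<integral>\<^sup>+x\<in>X. epowr (ennreal (\<delta> j) * indicator (ball x0 (real (Suc j) + 1)) x) p \<partial>M) \<le> (\<Sum>j. ennreal ((1/2) ^ j))"
      by (intro suminf_le) auto
    also have "\<dots> = ennreal (\<Sum>j. (1/2) ^ j)" by (intro suminf_ennreal2 summable_geometric) auto
    also have "\<dots> < \<infinity>" by simp
    finally show "(\<Sum>j. \<integral>\<^sup>+x\<in>X. epowr (ennreal (\<delta> j) * indicator (ball x0 (real (Suc j) + 1)) x) p \<partial>M) < \<infinity>" .
  qed
  define G where "G x = (g x + w 0 x) + D x" for x
  have LG: "Lp_integrable_borel p \<mu> X G" unfolding G_def by (intro Lp_add g(2) w(2) LD)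
  have lip: "lipschitz_fun X (v j)" for j
    unfolding v_def[abs_def] c_def \<eta>_def by (rule chain_cutoff_lipschitz[OF \<delta>])
  have supp: "bounded {x\<in>X. v j x \<noteq> 0}" for j
  proof (rule bounded_subset[OF bounded_ball])
    show "{x\<in>X. v j x \<noteq> 0} \<subseteq> ball x0 (real (Suc j))" by (auto simp: v_def \<eta>_def max_def split: if_splits)
  qed
  have alip: "alip_le X (v j) x (G x)" if "x \<in> X" for j x
  proof -
    have a: "alip_le X (v j) x (g x + w j x + ennreal (\<delta> j) * indicator (ball x0 (real (Suc j) + 1)) x)"
      unfolding v_def[abs_def] c_def \<eta>_def by (rule chain_cutoff_alip[OF \<delta> that])
    have "ennreal (\<delta> j) * indicator (ball x0 (real (Suc j) + 1)) x \<le> D x" unfolding D_def by (rule SUP_upper) simp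
    then have "g x + w j x + ennreal (\<delta> j) * indicator (ball x0 (real (Suc j) + 1)) x \<le> G x"
      unfolding G_def by (intro add_mono ww0 order_refl)
    then show ?thesis using a unfolding alip_le_def by (meson le_less_trans)
  qed
  let ?A = "\<lambda>j x. ennreal ((u x * (1 - \<eta> j x)) powr p) * indicator X x"
  have Alim: "(\<lambda>j. \<integral>\<^sup>+x. ?A j x \<partial>M) \<longlonglongrightarrow> (\<integral>\<^sup>+x. 0 \<partial>M)"
  proof (rule nn_integral_dominated_convergence[where w = F])
    show "AE x in M. ?A j x \<le> F x" for j
      using \<eta>01[of j] u0 p_pos
      by (intro AE_I2) (auto simp: F_def intro!: ennreal_leI powr_mono2 mult_left_le split: split_indicator)
    show "AE x in M. (\<lambda>j. ?A j x) \<longlonglongrightarrow> 0"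
    proof (rule AE_I2)
      fix x
      obtain N :: nat where N: "dist x0 x < real N" using reals_Archimedean2 by blast
      have "\<eta> j x = 1" if "N \<le> j" for j using N that by (auto simp: \<eta>_def)
      then show "(\<lambda>j. ?A j x) \<longlonglongrightarrow> 0" by (intro tendsto_eventually) (auto simp: eventually_sequentially)
    qed
  qed (use finF in auto)
  \<comment> \<open>Three errors: the excess of \<open>W j\<close> over \<open>F\<close>, the
    deficit of the chain minimum, and the cut-off.\<close>
  let ?b = "\<lambda>j. ennreal ((1/2) ^ j) + ennreal (2 powr p) * (ennreal ((1/2) ^ j) + (\<integral>\<^sup>+x. ?A j x \<partial>M))"
  have le: "(\<integral>\<^sup>+x\<in>X. ennreal (\<bar>v j x - u x\<bar> powr p) \<partial>M) \<le> ?b j" for j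
  proof -
    have "(\<integral>\<^sup>+x\<in>X. ennreal (\<bar>v j x - u x\<bar> powr p) \<partial>M)
      \<le> (\<integral>\<^sup>+x. (W j x - F x) + ennreal (2 powr p) * (?T j (n j) x + ?A j x) \<partial>M)"
    proof (rule nn_integral_mono)
      fix x
      show "ennreal (\<bar>v j x - u x\<bar> powr p) * indicator X x \<le> (W j x - F x) + ennreal (2 powr p) * (?T j (n j) x + ?A j x)"
      proof (cases "x \<in> X")
        case True
        have "ennreal (v j x) \<le> w j x"
        proof (rule order_trans[OF ennreal_leI])
          show "v j x \<le> c j (n j) x" unfolding v_def using c0 \<eta>01 by (intro mult_left_le)
          show "ennreal (c j (n j) x) \<le> w j x" unfolding c_def by (rule chain_inf_le[OF \<delta> True])
        qed
        then have "epowr (ennreal (v j x)) p \<le> epowr (w j x) p" by (rule epowr_mono[OF _ p_pos])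
        then have "ennreal (v j x powr p) \<le> W j x"
          using p_pos c0 \<eta>01 by (simp add: w_def epowr_epowr v_def)
        then have "ennreal ((c j (n j) x * \<eta> j x) powr p) \<le> W j x" by (simp add: v_def)
        from cutoff_powr_diff[OF p c0 u0 \<eta>01 this] show ?thesis using True by (simp add: v_def F_def)
      qed simp
    qed
    also have "\<dots> = (\<integral>\<^sup>+x. (W j x - F x) \<partial>M) + ennreal (2 powr p) * ((\<integral>\<^sup>+x. ?T j (n j) x \<partial>M) + (\<integral>\<^sup>+x. ?A j x \<partial>M))"
      by (simp add: nn_integral_add nn_integral_cmult)
    also have "\<dots> \<le> ?b j"
    proof (intro add_mono mult_left_mono order_refl)
      have "(\<integral>\<^sup>+x. (W j x - F x) \<partial>M) = integral\<^sup>N M (W j) - integral\<^sup>N M F"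
        using finF W(2) by (intro nn_integral_diff) auto
      also have "\<dots> \<le> ennreal ((1/2) ^ j)" using W_int[of j] finF by (auto simp: ennreal_minus_le_iff)
      finally show "(\<integral>\<^sup>+x. (W j x - F x) \<partial>M) \<le> ennreal ((1/2) ^ j)" .
    qed (use n[of j] in \<open>auto intro: less_imp_le\<close>)
    finally show ?thesis .
  qed
  have h: "(\<lambda>j. ennreal ((1/2) ^ j)) \<longlonglongrightarrow> ennreal 0" by (intro tendsto_ennrealI LIMSEQ_power_zero) simp
  have "?b \<longlonglongrightarrow> ennreal 0 + ennreal (2 powr p) * (ennreal 0 + (\<integral>\<^sup>+x. 0 \<partial>M))"
    by (intro tendsto_add ennreal_tendsto_cmult h Alim) simp
  then have b: "?b \<longlonglongrightarrow> 0" by simp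
  have "(\<lambda>j. \<integral>\<^sup>+x\<in>X. ennreal (\<bar>v j x - u x\<bar> powr p) \<partial>M) \<longlonglongrightarrow> 0"
    by (rule tendsto_sandwich[OF _ _ tendsto_const b]) (auto intro!: always_eventually le)
  then show ?thesis using lip supp LG alip by blast
qed

end

lemma alip_le_diff:
  assumes f: "alip_le X f x G" and g: "alip_le X g x H"
  shows "alip_le X (\<lambda>y. f y - g y) x (G + H)"
  unfolding alip_le_def
proof (intro allI impI)
  fix c assume c: "G + H < ennreal c"
  then have "G < \<infinity>" "H < \<infinity>" by (auto simp: less_top[symmetric] top_unique)
  then obtain a b where ab: "G = ennreal a" "H = ennreal b" "0 \<le> a" "0 \<le> b" by (cases G; cases H) auto
  have eq: "ennreal (a + b) = G + H" using ab by simp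
  have "a + b < c" by (rule iffD1[OF ennreal_less_iff, rotated]) (use ab c eq in simp_all)
  define e where "e = (c - (a + b)) / 2"
  have e: "0 < e" "c = (a + e) + (b + e)" using \<open>a + b < c\<close> by (simp_all add: e_def field_simps)
  have "G < ennreal (a + e)" "H < ennreal (b + e)" using ab e(1) by (auto simp: ennreal_less_iff)
  with f g obtain r s where r: "0 < r" "\<And>y z. y \<in> X \<inter> ball x r \<Longrightarrow> z \<in> X \<inter> ball x r \<Longrightarrow> \<bar>f y - f z\<bar> \<le> (a + e) * dist y z"
    and s: "0 < s" "\<And>y z. y \<in> X \<inter> ball x s \<Longrightarrow> z \<in> X \<inter> ball x s \<Longrightarrow> \<bar>g y - g z\<bar> \<le> (b + e) * dist y z"
    unfolding alip_le_def by meson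
  have "\<bar>f y - g y - (f z - g z)\<bar> \<le> c * dist y z"
    if "y \<in> X \<inter> ball x (min r s)" "z \<in> X \<inter> ball x (min r s)" for y z
  proof -
    have "\<bar>f y - f z\<bar> \<le> (a + e) * dist y z" "\<bar>g y - g z\<bar> \<le> (b + e) * dist y z" using that by (auto intro!: r s)
    then show ?thesis unfolding e(2) distrib_right by linarith
  qed
  then show "\<exists>r>0. \<forall>y\<in>X \<inter> ball x r. \<forall>z\<in>X \<inter> ball x r. \<bar>f y - g y - (f z - g z)\<bar> \<le> c * dist y z"
    using r(1) s(1) by (intro exI[of _ "min r s"]) auto
qed

section \<open>Linear operations on weak upper gradients\<close>

context mm_subspace begin

lemma Lp_cmult:
  assumes "Lp_integrable_borel p \<mu> X \<rho>" "0 \<le> c"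
  shows "Lp_integrable_borel p \<mu> X (\<lambda>x. ennreal c * \<rho> x)"
proof -
  have [measurable]: "bm \<rho>" by (rule Lp_bm[OF assms(1)])
  have "bm (\<lambda>x. ennreal c * \<rho> x)" by measurable
  moreover have "pint (\<lambda>x. ennreal c * \<rho> x) < \<infinity>"
    unfolding pint_cmult[OF Lp_bm[OF assms(1)] assms(2)] using assms(1) by (simp add: Lp_iff ennreal_mult_less_top)
  ultimately show ?thesis by (simp add: Lp_iff)
qed

lemma Lwug_add:
  assumes u: "Lwug u \<rho>" and v: "Lwug v \<rho>'"
  shows "Lwug (\<lambda>x. u x + v x) (\<lambda>x. \<rho> x + \<rho>' x)"
proof (rule LwugI[OF Lp_add[OF Lwug_Lp[OF u] Lwug_Lp[OF v]]])
  have "AE_path (\<lambda>a b \<gamma>. ennreal \<bar>u (\<gamma> a) - u (\<gamma> b)\<bar> \<le> path_int \<rho> a b \<gamma>)"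
    "AE_path (\<lambda>a b \<gamma>. ennreal \<bar>v (\<gamma> a) - v (\<gamma> b)\<bar> \<le> path_int \<rho>' a b \<gamma>)"
    using u v by (simp_all add: Lp_weak_upper_gradient_def weak_upper_gradient_iff)
  from AE_path_conj[OF this]
  show "AE_path (\<lambda>a b \<gamma>. ennreal \<bar>u (\<gamma> a) + v (\<gamma> a) - (u (\<gamma> b) + v (\<gamma> b))\<bar> \<le> path_int (\<lambda>x. \<rho> x + \<rho>' x) a b \<gamma>)"
  proof (rule AE_path_mono)
    fix a b \<gamma>
    assume path: "(a, b, \<gamma>) \<in> paths_in X"
      and *: "ennreal \<bar>u (\<gamma> a) - u (\<gamma> b)\<bar> \<le> path_int \<rho> a b \<gamma> \<and> ennreal \<bar>v (\<gamma> a) - v (\<gamma> b)\<bar> \<le> path_int \<rho>' a b \<gamma>"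
    have "ennreal \<bar>u (\<gamma> a) + v (\<gamma> a) - (u (\<gamma> b) + v (\<gamma> b))\<bar> \<le> ennreal (\<bar>u (\<gamma> a) - u (\<gamma> b)\<bar> + \<bar>v (\<gamma> a) - v (\<gamma> b)\<bar>)"
      by (intro ennreal_leI) linarith
    also have "\<dots> = ennreal \<bar>u (\<gamma> a) - u (\<gamma> b)\<bar> + ennreal \<bar>v (\<gamma> a) - v (\<gamma> b)\<bar>" by (rule ennreal_plus) auto
    also have "\<dots> \<le> path_int \<rho> a b \<gamma> + path_int \<rho>' a b \<gamma>" using * by (intro add_mono) auto
    also have "\<dots> = path_int (\<lambda>x. \<rho> x + \<rho>' x) a b \<gamma>"
      by (rule path_int_add[OF path Lwug_bm[OF u] Lwug_bm[OF v], symmetric])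
    finally show "ennreal \<bar>u (\<gamma> a) + v (\<gamma> a) - (u (\<gamma> b) + v (\<gamma> b))\<bar> \<le> path_int (\<lambda>x. \<rho> x + \<rho>' x) a b \<gamma>" .
  qed
qed

lemma Lwug_uminus: "Lwug u \<rho> \<Longrightarrow> Lwug (\<lambda>x. - u x) \<rho>"
  by (simp add: Lp_weak_upper_gradient_def weak_upper_gradient_def abs_minus_commute)

lemma Lwug_const:
  assumes "Lp_integrable_borel p \<mu> X \<rho>"
  shows "Lwug (\<lambda>_. c) \<rho>"
  by (rule LwugI[OF assms AE_path_mono[OF AE_path_finite[OF assms]]]) simp

end

section \<open>Norm density of Lipschitz functions on a closed set\<close>

context closed_doubling begin

lemma lipschitz_fun_power_diff_measurable:
  assumes f: "lipschitz_fun X f" and [measurable]: "w \<in> borel_measurable M"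
  shows "(\<lambda>x. ennreal (\<bar>f x - w x\<bar> powr p) * indicator X x) \<in> borel_measurable M"
proof -
  have [measurable]: "X \<in> sets M" by (rule X)
  have "continuous_on X f" using f unfolding lipschitz_fun_def by (blast intro: lipschitz_on_continuous_on)
  then have "f \<in> borel_measurable (restrict_space M X)"
    by (intro measurable_restrict_M borel_measurable_continuous_on_restrict)
  then have [measurable]: "(\<lambda>x. indicator X x * f x) \<in> borel_measurable M"
    by (simp add: borel_measurable_restrict_space_iff X)
  have eq: "(\<lambda>x. ennreal (\<bar>f x - w x\<bar> powr p) * indicator X x) = (\<lambda>x. ennreal (\<bar>indicator X x * f x - w x\<bar> powr p) * indicator X x)"
    by (auto split: split_indicator)
  show ?thesis unfolding eq by measurable
qed

text \<open>Positive and negative parts, obtained with \<open>s = 1\<close> and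
  \<open>s = -1\<close>, inherit the upper gradient \<open>g\<close>; their approximants are
  subtracted and the bounds added.\<close>

lemma lipschitz_approx:
  fixes u :: "'a \<Rightarrow> real"
  assumes um: "u \<in> borel_measurable M" and fin: "(\<integral>\<^sup>+x\<in>X. ennreal (\<bar>u x\<bar> powr p) \<partial>M) < \<infinity>"
    and wug: "Lwug u \<rho>"
  shows "\<exists>v G. (\<forall>j::nat. lipschitz_fun X (v j) \<and> bounded {x\<in>X. v j x \<noteq> 0}) \<and> Lp_integrable_borel p \<mu> X G \<and>
    (\<forall>j. \<forall>x\<in>X. alip_le X (v j) x (G x)) \<and> (\<lambda>j. \<integral>\<^sup>+x\<in>X. ennreal (\<bar>v j x - u x\<bar> powr p) \<partial>M) \<longlonglongrightarrow> 0"
proof -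
  note [measurable] = um
  obtain g where g: "lsc g" "Lp_integrable_borel p \<mu> X g"
    "\<And>a b \<gamma>. (a, b, \<gamma>) \<in> paths_in X \<Longrightarrow> ennreal \<bar>u (\<gamma> a) - u (\<gamma> b)\<bar> \<le> path_int g a b \<gamma>"
    by (rule lsc_upper_gradient[OF wug]) blast
  have *: "\<exists>v G. (\<forall>j::nat. lipschitz_fun X (v j) \<and> bounded {x\<in>X. v j x \<noteq> 0}) \<and> Lp_integrable_borel p \<mu> X G \<and>
    (\<forall>j. \<forall>x\<in>X. alip_le X (v j) x (G x)) \<and> (\<lambda>j. \<integral>\<^sup>+x\<in>X. ennreal (\<bar>v j x - max 0 (s * u x)\<bar> powr p) \<partial>M) \<longlonglongrightarrow> 0"
    if s: "s = 1 \<or> s = -1" for s :: real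
  proof (rule lipschitz_approx_nonneg[OF _ _ _ g(1,2)])
    show "(\<lambda>x. max 0 (s * u x)) \<in> borel_measurable M" by measurable
    have "(\<integral>\<^sup>+x\<in>X. ennreal (max 0 (s * u x) powr p) \<partial>M) \<le> (\<integral>\<^sup>+x\<in>X. ennreal (\<bar>u x\<bar> powr p) \<partial>M)"
      using s p_pos by (intro nn_integral_mono mult_right_mono ennreal_leI powr_mono2) auto
    then show "(\<integral>\<^sup>+x\<in>X. ennreal (max 0 (s * u x) powr p) \<partial>M) < \<infinity>" using fin by (rule le_less_trans)
    show "ennreal \<bar>max 0 (s * u (\<gamma> a)) - max 0 (s * u (\<gamma> b))\<bar> \<le> path_int g a b \<gamma>" if "(a, b, \<gamma>) \<in> paths_in X" for a b \<gamma>
      by (rule order_trans[OF ennreal_leI g(3)[OF that]]) (use s in \<open>auto simp: max_def\<close>)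
  qed simp
  obtain v1 G1 where v1: "\<And>j::nat. lipschitz_fun X (v1 j)" "\<And>j. bounded {x\<in>X. v1 j x \<noteq> 0}" "Lp_integrable_borel p \<mu> X G1"
    "\<And>j x. x \<in> X \<Longrightarrow> alip_le X (v1 j) x (G1 x)" "(\<lambda>j. \<integral>\<^sup>+x\<in>X. ennreal (\<bar>v1 j x - max 0 (1 * u x)\<bar> powr p) \<partial>M) \<longlonglongrightarrow> 0"
    using *[of 1] by blast
  obtain v2 G2 where v2: "\<And>j::nat. lipschitz_fun X (v2 j)" "\<And>j. bounded {x\<in>X. v2 j x \<noteq> 0}" "Lp_integrable_borel p \<mu> X G2"
    "\<And>j x. x \<in> X \<Longrightarrow> alip_le X (v2 j) x (G2 x)" "(\<lambda>j. \<integral>\<^sup>+x\<in>X. ennreal (\<bar>v2 j x - max 0 (-1 * u x)\<bar> powr p) \<partial>M) \<longlonglongrightarrow> 0"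
    using *[of "-1"] by blast
  let ?v = "\<lambda>j x. v1 j x - v2 j x"
  have lip: "lipschitz_fun X (?v j)" for j
    using v1(1)[of j] v2(1)[of j] unfolding lipschitz_fun_def by (blast intro: lipschitz_on_diff)
  have supp: "bounded {x\<in>X. ?v j x \<noteq> 0}" for j
    by (rule bounded_subset[of "{x\<in>X. v1 j x \<noteq> 0} \<union> {x\<in>X. v2 j x \<noteq> 0}"]) (use v1(2) v2(2) in auto)
  have m12 [measurable]: "(\<lambda>x. ennreal (\<bar>v1 j x - max 0 (1 * u x)\<bar> powr p) * indicator X x) \<in> borel_measurable M"
    "(\<lambda>x. ennreal (\<bar>v2 j x - max 0 (-1 * u x)\<bar> powr p) * indicator X x) \<in> borel_measurable M" for j
    by (intro lipschitz_fun_power_diff_measurable v1(1) v2(1); measurable)+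
  let ?I = "\<lambda>j. \<integral>\<^sup>+x\<in>X. ennreal (\<bar>v1 j x - max 0 (1 * u x)\<bar> powr p) \<partial>M"
  let ?J = "\<lambda>j. \<integral>\<^sup>+x\<in>X. ennreal (\<bar>v2 j x - max 0 (-1 * u x)\<bar> powr p) \<partial>M"
  have le: "(\<integral>\<^sup>+x\<in>X. ennreal (\<bar>?v j x - u x\<bar> powr p) \<partial>M) \<le> ennreal (2 powr p) * (?I j + ?J j)" for j
  proof -
    have pt: "ennreal (\<bar>?v j x - u x\<bar> powr p) \<le>
      ennreal (2 powr p) * (ennreal (\<bar>v1 j x - max 0 (1 * u x)\<bar> powr p) + ennreal (\<bar>v2 j x - max 0 (-1 * u x)\<bar> powr p))" for x
    proof -
      let ?a = "\<bar>v1 j x - max 0 (1 * u x)\<bar>" and ?b = "\<bar>v2 j x - max 0 (-1 * u x)\<bar>"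
      have "\<bar>?v j x - u x\<bar> \<le> ?a + ?b" by (auto simp: max_def)
      then have "\<bar>?v j x - u x\<bar> powr p \<le> (?a + ?b) powr p" using p_pos by (intro powr_mono2) auto
      also have "\<dots> \<le> 2 powr p * (?a powr p + ?b powr p)" using p_pos by (intro powr_add_le) auto
      finally have "ennreal (\<bar>?v j x - u x\<bar> powr p) \<le> ennreal (2 powr p * (?a powr p + ?b powr p))" by (rule ennreal_leI)
      also have "\<dots> = ennreal (2 powr p) * (ennreal (?a powr p) + ennreal (?b powr p))" by (simp add: ennreal_mult)
      finally show ?thesis .
    qed
    have "(\<integral>\<^sup>+x\<in>X. ennreal (\<bar>?v j x - u x\<bar> powr p) \<partial>M) \<le> (\<integral>\<^sup>+x. ennreal (2 powr p) *
      (ennreal (\<bar>v1 j x - max 0 (1 * u x)\<bar> powr p) * indicator X x + ennreal (\<bar>v2 j x - max 0 (-1 * u x)\<bar> powr p) * indicator X x) \<partial>M)"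
    proof (rule nn_integral_mono)
      fix x
      show "ennreal (\<bar>?v j x - u x\<bar> powr p) * indicator X x \<le> ennreal (2 powr p) *
        (ennreal (\<bar>v1 j x - max 0 (1 * u x)\<bar> powr p) * indicator X x + ennreal (\<bar>v2 j x - max 0 (-1 * u x)\<bar> powr p) * indicator X x)"
        using pt[of x] by (cases "x \<in> X") simp_all
    qed
    also have "\<dots> = ennreal (2 powr p) * (\<integral>\<^sup>+x. (ennreal (\<bar>v1 j x - max 0 (1 * u x)\<bar> powr p) * indicator X x
        + ennreal (\<bar>v2 j x - max 0 (-1 * u x)\<bar> powr p) * indicator X x) \<partial>M)"
      by (rule nn_integral_cmult) measurable
    also have "\<dots> = ennreal (2 powr p) * (?I j + ?J j)" by (subst nn_integral_add[OF m12(1) m12(2)]) (rule refl)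
    finally show ?thesis .
  qed
  have "(\<lambda>j. ennreal (2 powr p) * (?I j + ?J j)) \<longlonglongrightarrow> ennreal (2 powr p) * (0 + 0)"
    by (intro ennreal_tendsto_cmult tendsto_add v1(5) v2(5)) simp
  then have b: "(\<lambda>j. ennreal (2 powr p) * (?I j + ?J j)) \<longlonglongrightarrow> 0" by simp
  have conv: "(\<lambda>j. \<integral>\<^sup>+x\<in>X. ennreal (\<bar>?v j x - u x\<bar> powr p) \<partial>M) \<longlonglongrightarrow> 0"
    by (rule tendsto_sandwich[OF _ _ tendsto_const b]) (intro always_eventually allI le zero_le)+
  have alip: "\<forall>x\<in>X. alip_le X (?v j) x (G1 x + G2 x)" for j by (intro ballI alip_le_diff v1(4) v2(4))
  show ?thesis
    using lip supp Lp_add[OF v1(3) v2(3)] alip conv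
    by (intro exI[of _ ?v] exI[of _ "\<lambda>x. G1 x + G2 x"] conjI allI)
qed

text \<open>By convexity of the p-th power, balls about \<open>u\<close> in L^p are stable under
  midpoints; passing to midpoint combinations of tails therefore preserves L^p convergence.\<close>

lemma mhull_power_integral_le:
  assumes f: "f \<in> mhull S" and lip: "\<And>g. g \<in> S \<Longrightarrow> lipschitz_fun X g" and u: "u \<in> borel_measurable M"
    and le: "\<And>g. g \<in> S \<Longrightarrow> (\<integral>\<^sup>+x\<in>X. ennreal (\<bar>g x - u x\<bar> powr p) \<partial>M) \<le> c"
  shows "(\<integral>\<^sup>+x\<in>X. ennreal (\<bar>f x - u x\<bar> powr p) \<partial>M) \<le> c"
  using f
proof induction
  case (base f)
  then show ?case by (rule le)
next
  case (mid f g)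
  note [measurable] = lipschitz_fun_power_diff_measurable[OF mhull_lipschitz_fun[OF mid.hyps(1) lip] u]
    lipschitz_fun_power_diff_measurable[OF mhull_lipschitz_fun[OF mid.hyps(2) lip] u]
  have half: "ennreal (1/2) * (k + k) = k" for k
  proof -
    have "ennreal (1/2) * (k + k) = (ennreal (1/2) + ennreal (1/2)) * k" by (simp only: distrib_left distrib_right)
    also have "ennreal (1/2) + ennreal (1/2) = 1" by (subst ennreal_plus[symmetric]) auto
    finally show ?thesis by simp
  qed
  have pt: "ennreal (\<bar>(f x + g x) / 2 - u x\<bar> powr p) \<le> ennreal (1/2) * (ennreal (\<bar>f x - u x\<bar> powr p) + ennreal (\<bar>g x - u x\<bar> powr p))" for x
  proof -
    have "\<bar>(f x + g x) / 2 - u x\<bar> \<le> (\<bar>f x - u x\<bar> + \<bar>g x - u x\<bar>) / 2" by (simp add: field_simps)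
    then have "\<bar>(f x + g x) / 2 - u x\<bar> powr p \<le> ((\<bar>f x - u x\<bar> + \<bar>g x - u x\<bar>) / 2) powr p" using p_pos by (intro powr_mono2) auto
    also have "\<dots> \<le> (\<bar>f x - u x\<bar> powr p + \<bar>g x - u x\<bar> powr p) / 2" using p by (intro powr_midpoint_le) auto
    finally have "ennreal (\<bar>(f x + g x) / 2 - u x\<bar> powr p) \<le> ennreal (1/2 * (\<bar>f x - u x\<bar> powr p + \<bar>g x - u x\<bar> powr p))"
      by (intro ennreal_leI) simp
    also have "\<dots> = ennreal (1/2) * ennreal (\<bar>f x - u x\<bar> powr p + \<bar>g x - u x\<bar> powr p)" by (rule ennreal_mult) auto
    also have "\<dots> = ennreal (1/2) * (ennreal (\<bar>f x - u x\<bar> powr p) + ennreal (\<bar>g x - u x\<bar> powr p))"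
      by (rule arg_cong[where f = "\<lambda>k. ennreal (1/2) * k"], rule ennreal_plus) auto
    finally show ?thesis .
  qed
  have "(\<integral>\<^sup>+x\<in>X. ennreal (\<bar>(f x + g x) / 2 - u x\<bar> powr p) \<partial>M) \<le> (\<integral>\<^sup>+x. ennreal (1/2) *
    (ennreal (\<bar>f x - u x\<bar> powr p) * indicator X x + ennreal (\<bar>g x - u x\<bar> powr p) * indicator X x) \<partial>M)"
  proof (rule nn_integral_mono)
    fix x
    show "ennreal (\<bar>(f x + g x) / 2 - u x\<bar> powr p) * indicator X x \<le> ennreal (1/2) *
      (ennreal (\<bar>f x - u x\<bar> powr p) * indicator X x + ennreal (\<bar>g x - u x\<bar> powr p) * indicator X x)"
      proof (cases "x \<in> X")
      case True
      then show ?thesis using pt[of x] by (simp only: indicator_simps mult_1_right)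
    qed simp
  qed
  also have "\<dots> = ennreal (1/2) * (\<integral>\<^sup>+x. (ennreal (\<bar>f x - u x\<bar> powr p) * indicator X x + ennreal (\<bar>g x - u x\<bar> powr p) * indicator X x) \<partial>M)"
    by (rule nn_integral_cmult) measurable
  also have "\<dots> = ennreal (1/2) * ((\<integral>\<^sup>+x\<in>X. ennreal (\<bar>f x - u x\<bar> powr p) \<partial>M) + (\<integral>\<^sup>+x\<in>X. ennreal (\<bar>g x - u x\<bar> powr p) \<partial>M))"
    by (rule arg_cong[where f = "\<lambda>k. ennreal (1/2) * k"], rule nn_integral_add) measurable
  also have "\<dots> \<le> ennreal (1/2) * (c + c)" by (intro mult_left_mono add_mono mid.IH) auto
  also have "\<dots> = c" by (rule half)
  finally show ?case .
qed

lemma mhull_bounded_support: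
  assumes "f \<in> mhull S" "\<And>g. g \<in> S \<Longrightarrow> bounded {x\<in>X. g x \<noteq> 0}"
  shows "bounded {x\<in>X. f x \<noteq> (0::real)}"
  using assms(1)
proof induction
  case (mid f g)
  show ?case
    by (rule bounded_subset[of "{x\<in>X. f x \<noteq> 0} \<union> {x\<in>X. g x \<noteq> 0}"]) (use mid.IH in auto)
qed (rule assms(2))

text \<open>Apply the limit theorem to \<open>f i - f l\<close> as \<open>l \<rightarrow> \<infinity>\<close>, with upper gradients bounded by telescoping.\<close>
theorem lipschitz_density_closed:
  fixes u :: "'a \<Rightarrow> real"
  assumes um: "u \<in> borel_measurable M" and fin: "(\<integral>\<^sup>+x\<in>X. ennreal (\<bar>u x\<bar> powr p) \<partial>M) < \<infinity>"
    and wug: "Lwug u \<rho>" and "0 < \<epsilon>"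
  shows "\<exists>w v r. w \<in> lipschitz_bounded_support X \<and> representative \<mu> X (\<lambda>x. u x - w x) v \<and> Lwug v r \<and>
    pint r \<le> ennreal \<epsilon> \<and> (\<integral>\<^sup>+x\<in>X. ennreal (\<bar>u x - w x\<bar> powr p) \<partial>M) \<le> ennreal \<epsilon>"
proof -
  from lipschitz_approx[OF um fin wug] obtain v G where v0:
    "\<forall>j::nat. lipschitz_fun X (v j) \<and> bounded {x\<in>X. v j x \<noteq> 0}" "Lp_integrable_borel p \<mu> X G"
    "\<forall>j. \<forall>x\<in>X. alip_le X (v j) x (G x)" "(\<lambda>j. \<integral>\<^sup>+x\<in>X. ennreal (\<bar>v j x - u x\<bar> powr p) \<partial>M) \<longlonglongrightarrow> 0"
    by (elim exE conjE)
  have vlip: "lipschitz_fun X (v j)" and vsupp: "bounded {x\<in>X. v j x \<noteq> 0}" for j using v0(1) by auto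
  have valip: "alip_le X (v j) x (G x)" if "x \<in> X" for j x using v0(3) that by blast
  obtain y where y: "\<And>n. y n \<in> mhull (v ` {n..})"
    "\<And>\<epsilon>. 0 < \<epsilon> \<Longrightarrow> \<exists>N. \<forall>n\<ge>N. \<forall>m\<ge>n. \<exists>e. Lwug (\<lambda>x. y n x - y m x) e \<and> pint e \<le> ennreal \<epsilon>"
  proof (rule energy_Cauchy[where v = v and G = G, OF vlip v0(2) valip])
    fix y
    assume 1: "\<And>n. y n \<in> mhull (v ` {n..})"
      and 2: "\<And>\<epsilon>. 0 < \<epsilon> \<Longrightarrow> \<exists>N. \<forall>n\<ge>N. \<forall>m\<ge>n. \<exists>e. Lwug (\<lambda>x. y n x - y m x) e \<and> pint e \<le> ennreal \<epsilon>"
    show thesis by (rule that[OF 1 2])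
  qed
  have ylip: "lipschitz_fun X (y n)" for n by (rule mhull_lipschitz_fun[OF y(1)]) (use vlip in auto)
  have ysupp: "bounded {x\<in>X. y n x \<noteq> 0}" for n by (rule mhull_bounded_support[OF y(1)]) (use vsupp in auto)
  let ?I = "\<lambda>f. \<integral>\<^sup>+x\<in>X. ennreal (\<bar>f x - u x\<bar> powr p) \<partial>M"
  have yconv: "(\<lambda>n. ?I (y n)) \<longlonglongrightarrow> 0"
  proof (rule order_tendstoI)
    fix a :: ennreal assume "0 < a"
    then obtain b where b: "0 < b" "b < a" using dense by blast
    from order_tendstoD(2)[OF v0(4) b(1)] obtain N where N: "\<And>j. N \<le> j \<Longrightarrow> ?I (v j) < b"
      by (auto simp: eventually_sequentially)
    have "?I (y n) \<le> b" if "N \<le> n" for n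
      by (rule mhull_power_integral_le[OF y(1) _ um]) (use vlip N that in \<open>auto intro: less_imp_le\<close>)
    then show "\<forall>\<^sub>F n in sequentially. ?I (y n) < a" using b(2) unfolding eventually_sequentially
      by (intro exI[of _ N] allI impI) (rule le_less_trans)
  qed simp
  let ?e = "\<lambda>k. (1/2) ^ k / (2 ^ k) powr p"
  have "\<exists>N. \<forall>n\<ge>N. \<forall>m\<ge>n. \<exists>e. Lwug (\<lambda>x. y n x - y m x) e \<and> pint e \<le> ennreal (?e k)" for k :: nat
    by (rule y(2)) simp
  then obtain N where N: "\<And>k n m. N k \<le> n \<Longrightarrow> n \<le> m \<Longrightarrow> \<exists>e. Lwug (\<lambda>x. y n x - y m x) e \<and> pint e \<le> ennreal (?e k)"
    by metis
  define s where "s k = k + (\<Sum>j\<le>k. N j)" for k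
  have s: "N k \<le> s k" "s k < s (Suc k)" for k using member_le_sum[of k "{..k}" N] by (auto simp: s_def)
  have smono: "strict_mono s" using s(2) by (simp add: strict_mono_Suc_iff)
  define f where "f k = y (s k)" for k
  have "\<exists>e. Lwug (\<lambda>x. f k x - f (Suc k) x) e \<and> pint e \<le> ennreal (?e k)" for k
    unfolding f_def by (rule N) (use s less_imp_le in auto)
  then obtain e where e: "\<And>k. Lwug (\<lambda>x. f k x - f (Suc k) x) (e k)" "\<And>k. pint (e k) \<le> ennreal (?e k)" by metis
  obtain \<sigma> where \<sigma>: "Lp_integrable_borel p \<mu> X \<sigma>" "\<And>k x. e k x \<le> ennreal ((1/2) ^ k) * \<sigma> x"
    by (rule AE_path_fast_decay[OF Lwug_bm[OF e(1)] e(2)]) blast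
  have fconv: "(\<lambda>k. ?I (f k)) \<longlonglongrightarrow> 0"
    using LIMSEQ_subseq_LIMSEQ[OF yconv smono] by (simp add: f_def comp_def)
  define r where "r i x = ennreal (2 * (1/2) ^ i) * \<sigma> x" for i :: nat and x
  have Lr: "Lp_integrable_borel p \<mu> X (r i)" for i unfolding r_def by (rule Lp_cmult[OF \<sigma>(1)]) simp
  \<comment> \<open>The sum of \<open>(1/2) ^ j\<close> over \<open>i \<le> j < i + l\<close>, which
    accumulates the bounds on consecutive differences.\<close>
  define c where "c i l = 2 * (1/2) ^ i * (1 - (1/2::real) ^ l)" for i l :: nat
  have c0: "0 \<le> c i l" for i l
  proof -
    have "(1/2::real) ^ l \<le> 1" by (rule power_le_one) auto
    then show ?thesis by (simp add: c_def)
  qed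
  have tele: "Lwug (\<lambda>x. f i x - f (l + i) x) (\<lambda>x. ennreal (c i l) * \<sigma> x)" for i l
  proof (induction l)
    case 0
    show ?case using Lwug_const[OF Lp_cmult[OF \<sigma>(1) c0[of i 0]], of 0] by simp
  next
    case (Suc l)
    have "Lwug (\<lambda>x. (f i x - f (l + i) x) + (f (l + i) x - f (Suc (l + i)) x)) (\<lambda>x. ennreal (c i l) * \<sigma> x + e (l + i) x)"
      by (rule Lwug_add[OF Suc.IH e(1)])
    then have w: "Lwug (\<lambda>x. f i x - f (Suc l + i) x) (\<lambda>x. ennreal (c i l) * \<sigma> x + e (l + i) x)" by simp
    show ?case
    proof (rule Lwug_mono_AE[OF w Lp_cmult[OF \<sigma>(1) c0]], rule AE_I2, rule impI)
      fix x
      have "c i l + (1/2) ^ (l + i) = c i (Suc l)" by (simp add: c_def power_add field_simps)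
      then have eq: "ennreal (c i (Suc l)) = ennreal (c i l) + ennreal ((1/2) ^ (l + i))"
        using c0[of i l] ennreal_plus[of "c i l" "(1/2) ^ (l + i)"] by simp
      have "ennreal (c i l) * \<sigma> x + e (l + i) x \<le> ennreal (c i l) * \<sigma> x + ennreal ((1/2) ^ (l + i)) * \<sigma> x"
        by (intro add_left_mono \<sigma>(2))
      also have "\<dots> = ennreal (c i (Suc l)) * \<sigma> x" unfolding eq by (simp only: distrib_right)
      finally show "ennreal (c i l) * \<sigma> x + e (l + i) x \<le> ennreal (c i (Suc l)) * \<sigma> x" .
    qed
  qed
  have fm: "f k \<in> borel_measurable (restrict_space M X)" for k
  proof -
    have "continuous_on X (f k)" using ylip[of "s k"] unfolding lipschitz_fun_def f_def by (blast intro: lipschitz_on_continuous_on)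
    then show ?thesis by (intro measurable_restrict_M borel_measurable_continuous_on_restrict)
  qed
  have lim: "\<exists>v. representative \<mu> X (\<lambda>x. f i x - u x) v \<and> Lwug v (r i)" for i
  proof (rule Lwug_limit[OF _ _ _ tele Lr, where d = "\<lambda>_ _. 0"])
    note [measurable] = fm measurable_restrict_space1[OF um, of X]
    show "(\<lambda>x. f i x - f (l + i) x) \<in> borel_measurable (restrict_space M X)" for l by measurable
    show "(\<lambda>x. f i x - u x) \<in> borel_measurable (restrict_space M X)" by measurable
    have "(\<integral>\<^sup>+x\<in>X. ennreal (\<bar>f i x - f (l + i) x - (f i x - u x)\<bar> powr p) \<partial>M) = ?I (f (l + i))" for l
      by (simp add: abs_minus_commute)
    then show "(\<lambda>l. \<integral>\<^sup>+x\<in>X. ennreal (\<bar>f i x - f (l + i) x - (f i x - u x)\<bar> powr p) \<partial>M) \<longlonglongrightarrow> 0"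
      using LIMSEQ_ignore_initial_segment[OF fconv, of i] by simp
    show "AE x\<in>X in M. ennreal (c i l) * \<sigma> x \<le> r i x + 0" for l
      unfolding r_def by (intro AE_I2 impI) (auto simp: c_def intro!: mult_right_mono ennreal_leI)
  qed (auto simp: pint_def)
  have "(\<lambda>i. (2 * (1/2::real) ^ i) powr p) \<longlonglongrightarrow> 0"
  proof (rule tendsto_zero_powrI[OF _ tendsto_const])
    show "(\<lambda>i. 2 * (1/2::real) ^ i) \<longlonglongrightarrow> 0" by (intro tendsto_mult_right_zero LIMSEQ_power_zero) simp
  qed (use p_pos in auto)
  from tendsto_ennrealI[OF this] have "(\<lambda>i. pint \<sigma> * ennreal ((2 * (1/2) ^ i) powr p)) \<longlonglongrightarrow> pint \<sigma> * ennreal 0"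
    using \<sigma>(1) by (intro ennreal_tendsto_cmult) (auto simp: Lp_iff)
  moreover have "pint (r i) = pint \<sigma> * ennreal ((2 * (1/2) ^ i) powr p)" for i
    unfolding r_def by (subst pint_cmult[OF Lp_bm[OF \<sigma>(1)]]) (simp_all add: mult.commute)
  ultimately have rlim: "(\<lambda>i. pint (r i)) \<longlonglongrightarrow> 0" by simp
  have "\<forall>\<^sub>F i in sequentially. pint (r i) < ennreal \<epsilon> \<and> ?I (f i) < ennreal \<epsilon>"
    using \<open>0 < \<epsilon>\<close> by (intro eventually_conj order_tendstoD(2)[OF rlim] order_tendstoD(2)[OF fconv]) auto
  then obtain i where i: "pint (r i) < ennreal \<epsilon>" "?I (f i) < ennreal \<epsilon>" by (auto simp: eventually_sequentially)
  from lim[of i] obtain v' where v': "representative \<mu> X (\<lambda>x. f i x - u x) v'" "Lwug v' (r i)" by (elim exE conjE)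
  have rep: "representative \<mu> X (\<lambda>x. u x - f i x) (\<lambda>x. - v' x)"
    using v'(1) unfolding representative_def by eventually_elim auto
  have fi: "f i \<in> lipschitz_bounded_support X"
    using ylip[of "s i"] ysupp[of "s i"] by (simp add: lipschitz_bounded_support_def lipschitz_fun_def f_def)
  have I: "(\<integral>\<^sup>+x\<in>X. ennreal (\<bar>u x - f i x\<bar> powr p) \<partial>M) \<le> ennreal \<epsilon>"
    using i(2) by (simp add: abs_minus_commute)
  show ?thesis using fi rep Lwug_uminus[OF v'(2)] less_imp_le[OF i(1)] I by (intro exI conjI)
qed

end

text \<open>An extension of \<open>u\<close> is approximated on the closure. The approximants and
  the weak upper gradients of the differences are then restricted to \<open>\<Omega>\<close>, which
  does not increase the integrals.\<close>

theorem lipschitz_norm_dense_of_extension: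
  fixes \<mu> :: "'a::polish_space set \<Rightarrow> ennreal"
  assumes p: "1 \<le> p" and mms: "metric_measure_space \<mu>" and dbl: "doubling \<mu>"
    and \<Omega>: "\<Omega> \<in> sets (induced_measure \<mu>)"
    and ext: "\<And>u. u \<in> sobolev p \<mu> \<Omega> \<Longrightarrow> \<exists>h\<in>sobolev p \<mu> (closure \<Omega>). is_restriction \<mu> \<Omega> u h"
  shows "lipschitz_norm_dense p \<mu> \<Omega>"
  unfolding lipschitz_norm_dense_def
proof
  fix u assume u: "u \<in> sobolev p \<mu> \<Omega>"
  interpret closed_doubling p \<mu> "closure \<Omega>" by unfold_locales (use p mms dbl in auto)
  interpret O: mm_subspace p \<mu> \<Omega> by (rule mm_subspaceI[OF \<Omega>])
  let ?X = "closure \<Omega>"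
  have \<Omega>X: "\<Omega> \<subseteq> ?X" by (rule closure_subset)
  from ext[OF u] obtain h where h: "h \<in> sobolev p \<mu> ?X" "is_restriction \<mu> \<Omega> u h" by blast
  then obtain h' \<rho> where h': "representative \<mu> ?X h h'" "Lwug h' \<rho>" by (auto simp: sobolev_def)
  \<comment> \<open>The representative that has a weak upper gradient, set to 0 off the closure;
    completeness of \<open>M\<close> makes it measurable on the whole space.\<close>
  define k where "k x = indicator ?X x * h' x" for x
  have AEk: "AE x in M. indicator ?X x * h x = k x"
    using h'(1) unfolding representative_def by eventually_elim (auto simp: k_def split: split_indicator)
  have km: "k \<in> borel_measurable M"
  proof (rule measurable_AE_eq[OF _ AEk])
    show "(\<lambda>x. indicator ?X x * h x) \<in> borel_measurable M"
      using h(1) X by (simp add: sobolev_def Lp_space_def borel_measurable_restrict_space_iff)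
  qed
  have kw: "Lwug k \<rho>" by (rule Lwug_cong[OF h'(2)]) (simp add: k_def)
  have "(\<integral>\<^sup>+x\<in>?X. ennreal (\<bar>k x\<bar> powr p) \<partial>M) = (\<integral>\<^sup>+x\<in>?X. ennreal (\<bar>h x\<bar> powr p) \<partial>M)"
    by (rule nn_integral_cong_AE, use AEk in eventually_elim) (auto split: split_indicator_asm)
  also have "\<dots> < \<infinity>" using h(1) by (simp add: sobolev_def Lp_space_def Lp_norm_def)
  finally have kfin: "(\<integral>\<^sup>+x\<in>?X. ennreal (\<bar>k x\<bar> powr p) \<partial>M) < \<infinity>" .
  have AEu: "AE x in M. x \<in> \<Omega> \<longrightarrow> u x = k x"
    using AEk h(2)[unfolded is_restriction_def]
  proof eventually_elim
    case (elim x)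
    then show ?case using \<Omega>X by auto
  qed
  let ?q = "\<lambda>i. epowr (ennreal ((1/2) ^ i)) (1 / p)"
  have "\<exists>w. w \<in> lipschitz_bounded_support \<Omega> \<and> sobolev_norm p \<mu> \<Omega> (\<lambda>x. u x - w x) \<le> ?q i + ?q i" for i :: nat
  proof -
    have "0 < (1/2::real) ^ i" by simp
    from lipschitz_density_closed[OF km kfin kw this] obtain w v r where w:
      "w \<in> lipschitz_bounded_support ?X" "representative \<mu> ?X (\<lambda>x. k x - w x) v" "Lwug v r"
      "pint r \<le> ennreal ((1/2) ^ i)" "(\<integral>\<^sup>+x\<in>?X. ennreal (\<bar>k x - w x\<bar> powr p) \<partial>M) \<le> ennreal ((1/2) ^ i)"
      by (elim exE conjE)
    have wO: "w \<in> lipschitz_bounded_support \<Omega>"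
    proof -
      obtain L where "L-lipschitz_on ?X w" "bounded {x\<in>?X. w x \<noteq> 0}" using w(1) by (auto simp: lipschitz_bounded_support_def)
      then show ?thesis using \<Omega>X lipschitz_on_subset[of L ?X w \<Omega>] bounded_subset[of "{x\<in>?X. w x \<noteq> 0}" "{x\<in>\<Omega>. w x \<noteq> 0}"]
        by (auto simp: lipschitz_bounded_support_def)
    qed
    have rep: "representative \<mu> \<Omega> (\<lambda>x. u x - w x) v"
      using w(2) AEu unfolding representative_def
    proof eventually_elim
      case (elim x)
      then show ?case using \<Omega>X by auto
    qed
    have vO: "O.Lwug v r" by (rule Lwug_subset[OF w(3) \<Omega>X X \<Omega>])
    obtain g where g: "min_weak_upper_gradient p \<mu> \<Omega> (\<lambda>x. u x - w x) = (\<lambda>x. enn2real (g x))"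
      "\<And>v \<rho>'. representative \<mu> \<Omega> (\<lambda>x. u x - w x) v \<Longrightarrow> O.Lwug v \<rho>' \<Longrightarrow> O.Lwug v g \<and> (AE x\<in>\<Omega> in M. g x \<le> \<rho>' x)"
      by (rule O.min_wug_char[OF rep vO]) blast
    have gr: "AE x\<in>\<Omega> in M. g x \<le> r x" using g(2)[OF rep vO] by blast
    have n1: "Lp_norm p \<mu> \<Omega> (\<lambda>x. u x - w x) \<le> ?q i"
      unfolding Lp_norm_def
    proof (rule epowr_mono)
      have "(\<integral>\<^sup>+x\<in>\<Omega>. ennreal (\<bar>u x - w x\<bar> powr p) \<partial>M) \<le> (\<integral>\<^sup>+x\<in>?X. ennreal (\<bar>k x - w x\<bar> powr p) \<partial>M)"
      proof (rule nn_integral_mono_AE, use AEu in eventually_elim)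
        case (elim x)
        then show ?case using \<Omega>X by (auto split: split_indicator)
      qed
      then show "(\<integral>\<^sup>+x\<in>\<Omega>. ennreal (\<bar>u x - w x\<bar> powr p) \<partial>M) \<le> ennreal ((1/2) ^ i)" using w(5) by (rule order_trans)
    qed (use p in simp)
    have n2: "Lp_norm p \<mu> \<Omega> (\<lambda>x. enn2real (g x)) \<le> ?q i"
      unfolding Lp_norm_def
    proof (rule epowr_mono)
      have "(\<integral>\<^sup>+x\<in>\<Omega>. ennreal (\<bar>enn2real (g x)\<bar> powr p) \<partial>M) \<le> pint r"
        unfolding pint_def
      proof (rule nn_integral_mono_AE, use gr in eventually_elim)
        case (elim x)
        show ?case
        proof (cases "x \<in> \<Omega>")
          case True
          have "ennreal (\<bar>enn2real (g x)\<bar> powr p) \<le> epowr (g x) p" by (simp add: epowr_def)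
          also have "\<dots> \<le> epowr (r x) p" using elim True p by (intro epowr_mono) auto
          finally show ?thesis using True \<Omega>X by (auto split: split_indicator)
        qed simp
      qed
      then show "(\<integral>\<^sup>+x\<in>\<Omega>. ennreal (\<bar>enn2real (g x)\<bar> powr p) \<partial>M) \<le> ennreal ((1/2) ^ i)" using w(4) by (rule order_trans)
    qed (use p in simp)
    have "sobolev_norm p \<mu> \<Omega> (\<lambda>x. u x - w x) \<le> ?q i + ?q i"
      unfolding sobolev_norm_def g(1) by (rule add_mono[OF n1 n2])
    with wO show ?thesis by blast
  qed
  then obtain w where w: "\<And>i::nat. w i \<in> lipschitz_bounded_support \<Omega>"
    "\<And>i. sobolev_norm p \<mu> \<Omega> (\<lambda>x. u x - w i x) \<le> ?q i + ?q i" by metis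
  have "(\<lambda>i. ennreal ((1/2) ^ i)) \<longlonglongrightarrow> ennreal 0" by (intro tendsto_ennrealI LIMSEQ_power_zero) simp
  then have "?q \<longlonglongrightarrow> 0" using p by (intro epowr_tendsto_0) auto
  from tendsto_add[OF this this] have q: "(\<lambda>i. ?q i + ?q i) \<longlonglongrightarrow> 0" by simp
  have "(\<lambda>i. sobolev_norm p \<mu> \<Omega> (\<lambda>x. u x - w i x)) \<longlonglongrightarrow> 0"
    by (rule tendsto_sandwich[OF _ _ tendsto_const q]) (intro always_eventually allI w(2) zero_le)+
  then show "\<exists>v. (\<forall>n. v n \<in> lipschitz_bounded_support \<Omega>) \<and> (\<lambda>n. sobolev_norm p \<mu> \<Omega> (\<lambda>x. u x - v n x)) \<longlonglongrightarrow> 0"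
    using w(1) by blast
qed

theorem proposition1p9:
  fixes p :: real
    and \<mu> :: "'a::polish_space set \<Rightarrow> ennreal"
    and \<Omega> :: "'a set"
  assumes "1 \<le> p"
    and "PI_space p \<mu>"
    and "\<Omega> \<in> sets (induced_measure \<mu>)"
    and "\<mu> (closure \<Omega> - \<Omega>) = 0"
  shows "((\<forall>u\<in>sobolev p \<mu> \<Omega>. \<exists>h\<in>sobolev p \<mu> (closure \<Omega>). is_restriction \<mu> \<Omega> u h)
            \<longrightarrow> lipschitz_norm_dense p \<mu> \<Omega>)
       \<and> (path_almost_open p \<mu> \<Omega> (closure \<Omega>) \<and> lipschitz_energy_dense p \<mu> \<Omega>
            \<longrightarrow> (\<forall>u\<in>sobolev p \<mu> \<Omega>. \<exists>h\<in>sobolev p \<mu> (closure \<Omega>).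
                  is_restriction \<mu> \<Omega> u h \<and>
                  sobolev_norm p \<mu> (closure \<Omega>) h = sobolev_norm p \<mu> \<Omega> u))"
proof (intro conjI impI ballI)
  have mms: "metric_measure_space \<mu>" and dbl: "doubling \<mu>" using assms(2) by (simp_all add: PI_space_def)
  show "lipschitz_norm_dense p \<mu> \<Omega>"
    if "\<forall>u\<in>sobolev p \<mu> \<Omega>. \<exists>h\<in>sobolev p \<mu> (closure \<Omega>). is_restriction \<mu> \<Omega> u h"
    by (rule lipschitz_norm_dense_of_extension[OF assms(1) mms dbl assms(3)]) (use that in blast)
  interpret mm_closure p \<mu> \<Omega> by unfold_locales (use assms mms in auto)
  fix u assume "path_almost_open p \<mu> \<Omega> (closure \<Omega>) \<and> lipschitz_energy_dense p \<mu> \<Omega>" "u \<in> sobolev p \<mu> \<Omega>"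
  then show "\<exists>h\<in>sobolev p \<mu> (closure \<Omega>). is_restriction \<mu> \<Omega> u h \<and>
      sobolev_norm p \<mu> (closure \<Omega>) h = sobolev_norm p \<mu> \<Omega> u"
    by (intro extension_of_energy_density) auto
qed

end
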